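(* Let $n,J\ge 1$, let $\delta>0$, and let $g(z,c)=(g_j(z,c))_{j=1}^J$ be a $J$-vector of holomorphic functions on a polydisk $B^{(n)}\times B^{(1)}\subset\mathbb{C}^n\times\mathbb{C}$ centered at the origin. Assume that $$\int_{B^{(n)}} |g(z,0)|^{-\delta}\, dV_1\cdots dV_n<\infty .$$ Then there exists a smaller polydisk $B'^{(n)}\times B'^{(1)}$ centered at the origin such that the function $$c\longmapsto \int_{B'^{(n)}} |g(z,c)|^{-\delta}\, dV_1\cdots dV_n$$ is finite and continuous for $c\in B'^{(1)}$.
   Context: For a $J$-vector $g=(g_j)_{j=1}^J$ of complex numbers or functions, $|g|^2=\sum_{j=1}^J|g_j|^2$. $dV_k$ denotes Lebesgue (area) measure in the $k$-th complex coordinate $z_k$, so $dV_1\cdots dV_n$ is Lebesgue measure on $\mathbb{C}^n$. $B^{(n)}$ denotes an open polydisk in $\mathbb{C}^n$. *)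

theory Defs
  imports "HOL-Analysis.Analysis"
begin

definition polydisk :: "('n::finite \<Rightarrow> real) \<Rightarrow> (complex^'n) set" where
  "polydisk r = {z. \<forall>i. norm (z $ i) < r i}"

definition cmul :: "complex \<Rightarrow> (complex^'n::finite) \<times> complex \<Rightarrow> (complex^'n) \<times> complex" where
  "cmul a p = ((\<chi> i. a * fst p $ i), a * snd p)"

definition holomorphic_several ::
  "((complex^'n::finite) \<times> complex \<Rightarrow> complex) \<Rightarrow> ((complex^'n) \<times> complex) set \<Rightarrow> bool" where
  "holomorphic_several F S \<longleftrightarrow> open S \<and>
     (\<forall>p\<in>S. \<exists>L. (F has_derivative L) (at p) \<and> (\<forall>a v. L (cmul a v) = a * L v))"

definition negpow :: "real \<Rightarrow> real \<Rightarrow> ennreal" where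
  "negpow \<delta> t = (if t = 0 then \<infinity> else ennreal (t powr (-\<delta>)))"

end

theory Submission
 imports Defs "HOL-Complex_Analysis.Cauchy_Integral_Formula"
begin

text \<open>The integral of \<open>|p|\<^sup>-\<^sup>\<delta>\<close> is shown to be stable, with a slightly larger exponent, under uniform perturbation of a
 vector \<open>g\<close> by polynomial vectors \<open>p\<close>, by induction on the number of variables on which they depend (Hiep's argument).
 By Fubini there are slices \<open>z\<^sub>k = w\<close> arbitrarily near the origin on which the integral is at most \<open>\<kappa> / |w|\<^sup>2\<close>, because
 \<open>1 / |w|\<^sup>2\<close> is not integrable in the plane. The induction hypothesis transfers this bound to nearby \<open>p\<close>, and an
 Ohsawa--Takegoshi extension \<open>F\<close> of the constant \<open>1\<close> from that slice has \<open>L\<^sup>2\<close> norm of order \<open>\<surd>\<kappa> / |w|\<close> with respect to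
 the weight \<open>|p|\<^sup>-\<^sup>\<delta>\<close>; by Cauchy's estimate \<open>|F| \<ge> 1/2\<close> near the origin, so \<open>|p|\<^sup>-\<^sup>\<delta>\<close> is integrable there with a uniform
 bound. Approximating \<open>g(\<cdot>, c)\<close> by polynomials and using Fatou's lemma bounds the integrals for all small \<open>c\<close> with an
 exponent larger than \<open>\<delta>\<close>, hence they are uniform limits of integrals of truncated, continuous integrands.\<close>

unbundle no fps_syntax

lemma nn_integral_lborel_shift:
 fixes f :: "'a::euclidean_space \<Rightarrow> ennreal"
 assumes [measurable]: "f \<in> borel_measurable borel"
 shows "(\<integral>\<^sup>+x. f (a + x) \<partial>lborel) = (\<integral>\<^sup>+x. f x \<partial>lborel)"
 by (subst (2) lborel_distr_plus[of a, symmetric]) (simp add: nn_integral_distr)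

lemma lborel_distr_uminus_euclidean:
 "distr lborel borel uminus = (lborel :: 'a::euclidean_space measure)"
 by (subst lborel_affine[of "-1" 0]) (auto simp: density_1 one_ennreal_def[symmetric])

lemma nn_integral_lborel_reflect:
 fixes f :: "'a::euclidean_space \<Rightarrow> ennreal"
 assumes [measurable]: "f \<in> borel_measurable borel"
 shows "(\<integral>\<^sup>+x. f (a - x) \<partial>lborel) = (\<integral>\<^sup>+x. f x \<partial>lborel)"
proof -
 have "(\<integral>\<^sup>+x. f (a - x) \<partial>lborel) = (\<integral>\<^sup>+x. f (a + x) \<partial>lborel)"
  by (subst (2) lborel_distr_uminus_euclidean[symmetric]) (simp add: nn_integral_distr)
 then show ?thesis by (simp add: nn_integral_lborel_shift)
qed

lemma integral_lborel_shift:
 fixes f :: "'a::euclidean_space \<Rightarrow> 'b::{banach,second_countable_topology}"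
 assumes [measurable]: "f \<in> borel_measurable borel"
 shows "(\<integral>x. f (a + x) \<partial>lborel) = (\<integral>x. f x \<partial>lborel)"
 by (subst (2) lborel_distr_plus[of a, symmetric]) (simp add: integral_distr)

lemma integrable_lborel_shift:
 fixes f :: "'a::euclidean_space \<Rightarrow> 'b::{banach,second_countable_topology}"
 shows "integrable lborel f \<Longrightarrow> integrable lborel (\<lambda>x. f (a + x))"
 using integrable_distr[of "(+) a" lborel borel f] by (simp add: lborel_distr_plus)

lemma integral_lborel_reflect:
 fixes f :: "'a::euclidean_space \<Rightarrow> 'b::{banach,second_countable_topology}"
 assumes [measurable]: "f \<in> borel_measurable borel"
 shows "(\<integral>x. f (a - x) \<partial>lborel) = (\<integral>x. f x \<partial>lborel)"
proof -
 have "(\<integral>x. f (a - x) \<partial>lborel) = (\<integral>x. f (a + x) \<partial>lborel)"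
  by (subst (2) lborel_distr_uminus_euclidean[symmetric]) (simp add: integral_distr)
 then show ?thesis by (simp add: integral_lborel_shift)
qed

text \<open>Uniqueness of translation-invariant measures, tested against the unit ball, which an
 isometry maps to itself.\<close>

lemma nn_integral_lborel_isometry:
 fixes T :: "'a::euclidean_space \<Rightarrow> 'a" and f :: "'a \<Rightarrow> ennreal"
 assumes "linear T" and iso: "\<And>x. norm (T x) = norm x"
  and [measurable]: "f \<in> borel_measurable borel"
 shows "(\<integral>\<^sup>+x. f (T x) \<partial>lborel) = (\<integral>\<^sup>+x. f x \<partial>lborel)"
proof -
 interpret T: linear T by fact
 have [measurable]: "T \<in> borel_measurable borel"
  by (intro borel_measurable_continuous_onI linear_continuous_on) (simp add: assms(1) linear_linear)
 have "inj T" by (metis iso T.inj_iff_eq_0 norm_eq_zero)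
 then have "surj T" using assms(1) linear_injective_imp_surjective by blast
 let ?B = "ball 0 1 :: 'a set"
 let ?b = "\<lambda>x. indicator ?B x :: ennreal"
 have [measurable]: "?B \<in> sets borel" by simp
 have "(\<integral>\<^sup>+y. f (T y) \<partial>lborel) * emeasure lborel ?B = (\<integral>\<^sup>+y. f (T y) * (\<integral>\<^sup>+x. ?b x \<partial>lborel) \<partial>lborel)"
  by (simp add: nn_integral_multc)
 also have "\<dots> = (\<integral>\<^sup>+y. \<integral>\<^sup>+x. f (T y) * ?b (T y + x) \<partial>lborel \<partial>lborel)"
  by (simp add: nn_integral_cmult nn_integral_lborel_shift[of ?b])
 also have "\<dots> = (\<integral>\<^sup>+x. \<integral>\<^sup>+y. f (T y) * ?b (T y + x) \<partial>lborel \<partial>lborel)"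
  by (subst lborel_pair.Fubini') auto
 also have "\<dots> = (\<integral>\<^sup>+x. \<integral>\<^sup>+y. f (T y - x) * ?b (T y) \<partial>lborel \<partial>lborel)"
 proof (rule nn_integral_cong)
  fix x
  obtain a where T_a: "T a = x" using \<open>surj T\<close> by (metis surjD)
  have "(\<integral>\<^sup>+y. f (T y) * ?b (T y + x) \<partial>lborel) = (\<integral>\<^sup>+y. f (T (-a + y)) * ?b (T (-a + y) + x) \<partial>lborel)"
   by (rule nn_integral_lborel_shift[symmetric]) auto
  then show "(\<integral>\<^sup>+y. f (T y) * ?b (T y + x) \<partial>lborel) = (\<integral>\<^sup>+y. f (T y - x) * ?b (T y) \<partial>lborel)"
   by (simp add: T.diff T_a)
 qed
 also have "\<dots> = (\<integral>\<^sup>+y. \<integral>\<^sup>+x. f (T y - x) * ?b (T y) \<partial>lborel \<partial>lborel)"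
  by (subst lborel_pair.Fubini') auto
 also have "\<dots> = (\<integral>\<^sup>+x. f x \<partial>lborel) * emeasure lborel ?B"
  by (simp add: nn_integral_multc nn_integral_lborel_reflect nn_integral_cmult indicator_def iso flip: nn_integral_indicator)
 finally have "(\<integral>\<^sup>+y. f (T y) \<partial>lborel) * emeasure lborel ?B = (\<integral>\<^sup>+x. f x \<partial>lborel) * emeasure lborel ?B" .
 moreover have "emeasure lborel ?B \<noteq> 0" "emeasure lborel ?B \<noteq> \<infinity>"
  using emeasure_lborel_ball_finite[of "0::'a" 1] content_ball_pos[of 1 "0::'a"] by (auto simp: measure_def)
 ultimately show ?thesis by (metis ennreal_mult_divide_eq infinity_ennreal_def)
qed

definition vec_upd :: "complex^'n \<Rightarrow> 'n \<Rightarrow> complex \<Rightarrow> complex^'n" where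
 "vec_upd z k w = (\<chi> i. if i = k then w else z $ i)"

lemma vec_upd_nth [simp]: "vec_upd z k w $ i = (if i = k then w else z $ i)"
 by (simp add: vec_upd_def)

lemma vec_upd_vec_upd [simp]: "vec_upd (vec_upd z k v) k w = vec_upd z k w"
 by (simp add: vec_eq_iff)

lemma vec_upd_same [simp]: "vec_upd z k (z $ k) = z"
 by (simp add: vec_eq_iff)

lemma norm_sq_vec: "(norm (z::complex^'n))\<^sup>2 = (\<Sum>i\<in>UNIV. (norm (z $ i))\<^sup>2)"
 by (simp add: norm_vec_def L2_set_def sum_nonneg)

lemma norm_sq_vec_upd:
 fixes z :: "complex^'n::finite"
 shows "(norm (vec_upd z k w))\<^sup>2 = (norm z)\<^sup>2 - (norm (z $ k))\<^sup>2 + (norm w)\<^sup>2"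
proof -
 have split: "(norm y)\<^sup>2 = (norm (y $ k))\<^sup>2 + (\<Sum>i\<in>UNIV - {k}. (norm (y $ i))\<^sup>2)" for y :: "complex^'n"
  unfolding norm_sq_vec by (subst sum.remove[of _ k]) auto
 show ?thesis using split[of z] split[of "vec_upd z k w"] by simp
qed

lemma continuous_on_vec_upd [continuous_intros]:
 fixes f :: "'a::topological_space \<Rightarrow> complex^'n::finite"
 assumes "continuous_on S f" "continuous_on S h"
 shows "continuous_on S (\<lambda>x. vec_upd (f x) k (h x))"
 unfolding vec_upd_def
proof (rule continuous_on_vec_lambda)
 show "continuous_on S (\<lambda>x. if i = k then h x else f x $ i)" for i
  by (cases "i = k") (auto intro!: continuous_intros assms)
qed

lemma borel_measurable_vec_upd [measurable (raw)]:
 fixes f :: "'a \<Rightarrow> complex^'n::finite"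
 assumes "f \<in> borel_measurable M" "h \<in> borel_measurable M"
 shows "(\<lambda>x. vec_upd (f x) k (h x)) \<in> borel_measurable M"
 by (rule borel_measurable_continuous_Pair[OF assms]) (intro continuous_intros)

lemma borel_measurable_vec_nth_complex [measurable]:
 "(\<lambda>z. z $ k) \<in> borel_measurable (borel :: (complex^'n::finite) measure)"
 by (intro borel_measurable_continuous_onI continuous_intros)

lemma nn_integral_vec_upd:
 fixes f :: "complex^'n::finite \<Rightarrow> ennreal" and b :: "complex \<Rightarrow> ennreal"
 assumes [measurable]: "f \<in> borel_measurable borel" "b \<in> borel_measurable borel"
 shows "(\<integral>\<^sup>+z. f z \<partial>lborel) * (\<integral>\<^sup>+w. b w \<partial>lborel)
   = (\<integral>\<^sup>+z. \<integral>\<^sup>+w. f (vec_upd z k w) * b (z $ k) \<partial>lborel \<partial>lborel)"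
proof -
 define T :: "(complex^'n) \<times> complex \<Rightarrow> (complex^'n) \<times> complex"
  where "T = (\<lambda>(z, w). (vec_upd z k w, z $ k))"
 have lin: "linear T"
  by (rule linearI) (auto simp: T_def vec_eq_iff split: prod.splits)
 have "(norm (T p))\<^sup>2 = (norm p)\<^sup>2" for p
  by (simp add: T_def split_beta norm_Pair norm_sq_vec_upd) (simp add: norm_prod_def)
 then have iso: "norm (T p) = norm p" for p
  by (simp add: power2_eq_iff_nonneg)
 let ?f = "\<lambda>p::(complex^'n) \<times> complex. f (fst p) * b (snd p)"
 have f_meas: "?f \<in> borel_measurable borel"
  by (simp add: borel_prod[symmetric])
 have "(\<integral>\<^sup>+z. f z \<partial>lborel) * (\<integral>\<^sup>+w. b w \<partial>lborel) = (\<integral>\<^sup>+z. \<integral>\<^sup>+w. f z * b w \<partial>lborel \<partial>lborel)"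
  by (simp add: nn_integral_cmult nn_integral_multc)
 also have "\<dots> = (\<integral>\<^sup>+p. ?f p \<partial>(lborel \<Otimes>\<^sub>M lborel))"
  by (subst lborel.nn_integral_fst[symmetric]) auto
 also have "\<dots> = (\<integral>\<^sup>+p. ?f (T p) \<partial>(lborel \<Otimes>\<^sub>M lborel))"
  unfolding lborel_prod by (rule nn_integral_lborel_isometry[OF lin iso f_meas, symmetric])
 also have "\<dots> = (\<integral>\<^sup>+z. \<integral>\<^sup>+w. f (vec_upd z k w) * b (z $ k) \<partial>lborel \<partial>lborel)"
  by (subst lborel.nn_integral_fst[symmetric]) (auto simp: T_def split_beta')
 finally show ?thesis .
qed

definition has_partial :: "('a::euclidean_space \<Rightarrow> complex) \<Rightarrow> 'a \<Rightarrow> ('a \<Rightarrow> complex) \<Rightarrow> bool" where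
 "has_partial f e f' \<longleftrightarrow> (\<forall>x. ((\<lambda>t. f (x + t *\<^sub>R e)) has_vector_derivative f' x) (at 0))"

definition partial :: "'a::euclidean_space \<Rightarrow> ('a \<Rightarrow> complex) \<Rightarrow> 'a \<Rightarrow> complex" where
 "partial e f x = vector_derivative (\<lambda>t. f (x + t *\<^sub>R e)) (at 0)"

lemma partial_eq: "has_partial f e f' \<Longrightarrow> partial e f = f'"
 by (auto simp: has_partial_def partial_def fun_eq_iff intro: vector_derivative_at)

lemma has_partial_at:
 assumes "has_partial f e f'"
 shows "((\<lambda>t. f (x + t *\<^sub>R e)) has_vector_derivative f' (x + s *\<^sub>R e)) (at s)"
proof -
 have "((\<lambda>t. f ((x + s *\<^sub>R e) + t *\<^sub>R e)) has_vector_derivative f' (x + s *\<^sub>R e)) (at (s - s))"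
  using assms by (simp add: has_partial_def)
 moreover have "((\<lambda>t. t - s) has_vector_derivative 1) (at s)"
  by (auto intro!: derivative_eq_intros)
 ultimately have "((\<lambda>t. f ((x + s *\<^sub>R e) + t *\<^sub>R e)) \<circ> (\<lambda>t. t - s) has_vector_derivative 1 *\<^sub>R f' (x + s *\<^sub>R e)) (at s)"
  by (rule vector_diff_chain_at[rotated])
 then show ?thesis by (simp add: o_def algebra_simps)
qed

lemma has_partial_const: "has_partial (\<lambda>_. c) e (\<lambda>_. 0)"
 by (simp add: has_partial_def)

lemma has_partial_add: "has_partial f e f' \<Longrightarrow> has_partial g e g' \<Longrightarrow> has_partial (\<lambda>x. f x + g x) e (\<lambda>x. f' x + g' x)"
 by (auto simp: has_partial_def intro!: derivative_eq_intros)

lemma has_partial_minus: "has_partial f e f' \<Longrightarrow> has_partial (\<lambda>x. - f x) e (\<lambda>x. - f' x)"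
 by (auto simp: has_partial_def intro!: derivative_eq_intros)

lemma has_partial_mult: "has_partial f e f' \<Longrightarrow> has_partial g e g' \<Longrightarrow> has_partial (\<lambda>x. f x * g x) e (\<lambda>x. f' x * g x + f x * g' x)"
 unfolding has_partial_def
proof (intro allI)
 fix x
 assume deriv: "\<forall>x. ((\<lambda>t. f (x + t *\<^sub>R e)) has_vector_derivative f' x) (at 0)"
  "\<forall>x. ((\<lambda>t. g (x + t *\<^sub>R e)) has_vector_derivative g' x) (at 0)"
 show "((\<lambda>t. f (x + t *\<^sub>R e) * g (x + t *\<^sub>R e)) has_vector_derivative f' x * g x + f x * g' x) (at 0)"
  using has_vector_derivative_mult[OF deriv(1)[rule_format, of x] deriv(2)[rule_format, of x]]
  by (simp add: add.commute)
qed

lemma has_partial_cnj: "has_partial f e f' \<Longrightarrow> has_partial (\<lambda>x. cnj (f x)) e (\<lambda>x. cnj (f' x))"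
 unfolding has_partial_def using bounded_linear.has_vector_derivative[OF bounded_linear_cnj] by blast

lemma has_partial_inverse:
 assumes "has_partial f e f'" "\<And>x. f x \<noteq> 0"
 shows "has_partial (\<lambda>x. inverse (f x)) e (\<lambda>x. - f' x * (inverse (f x) * inverse (f x)))"
 unfolding has_partial_def
proof
 fix x
 have "((\<lambda>t. f (x + t *\<^sub>R e)) has_vector_derivative f' x) (at 0)"
  using assms by (simp add: has_partial_def)
 moreover have "(inverse has_field_derivative - (inverse (f x) * inverse (f x))) (at (f (x + 0 *\<^sub>R e)))"
  using assms(2)[of x] DERIV_inverse[of "f x" UNIV] by (simp add: power2_eq_square)
 ultimately have "(inverse \<circ> (\<lambda>t. f (x + t *\<^sub>R e)) has_vector_derivative f' x * - (inverse (f x) * inverse (f x))) (at 0)"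
  by (rule field_vector_diff_chain_at)
 then show "((\<lambda>t. inverse (f (x + t *\<^sub>R e))) has_vector_derivative - f' x * (inverse (f x) * inverse (f x))) (at 0)"
  by (simp add: o_def)
qed

lemma has_partial_reflect:
 assumes "has_partial f e f'"
 shows "has_partial (\<lambda>x. f (a - x)) e (\<lambda>x. - f' (a - x))"
 unfolding has_partial_def
proof
 fix x
 have "((\<lambda>t. f ((a - x) + t *\<^sub>R e)) has_vector_derivative f' (a - x)) (at (- 0))"
  using assms by (simp add: has_partial_def)
 moreover have "((\<lambda>t::real. - t) has_vector_derivative - 1) (at 0)"
  by (auto intro!: derivative_eq_intros)
 ultimately have "((\<lambda>t. f ((a - x) + t *\<^sub>R e)) \<circ> (\<lambda>t. - t) has_vector_derivative (-1) *\<^sub>R f' (a - x)) (at 0)"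
  by (rule vector_diff_chain_at[rotated])
 then show "((\<lambda>t. f (a - (x + t *\<^sub>R e))) has_vector_derivative - f' (a - x)) (at 0)"
  by (simp add: o_def algebra_simps)
qed

primrec Ck :: "nat \<Rightarrow> ('a::euclidean_space \<Rightarrow> complex) \<Rightarrow> bool" where
 "Ck 0 f = continuous_on UNIV f"
| "Ck (Suc n) f = (continuous_on UNIV f \<and> (\<forall>e\<in>Basis. has_partial f e (partial e f) \<and> Ck n (partial e f)))"

lemma Ck_cont: "Ck n f \<Longrightarrow> continuous_on UNIV f"
 by (cases n) auto

lemma Ck_SucI:
 assumes "continuous_on UNIV f" "\<And>e. e \<in> Basis \<Longrightarrow> has_partial f e (f' e)" "\<And>e. e \<in> Basis \<Longrightarrow> Ck n (f' e)"
 shows "Ck (Suc n) f"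
 using assms partial_eq[OF assms(2)] by simp

lemma Ck_has_partial: "Ck (Suc n) f \<Longrightarrow> e \<in> Basis \<Longrightarrow> has_partial f e (partial e f)"
 and Ck_partial: "Ck (Suc n) f \<Longrightarrow> e \<in> Basis \<Longrightarrow> Ck n (partial e f)"
 by auto

lemma Ck_Suc_imp: "Ck (Suc n) f \<Longrightarrow> Ck n f"
proof (induction n arbitrary: f)
 case 0
 then show ?case by simp
next
 case (Suc n)
 then show ?case
  by (intro Ck_SucI[where f' = "\<lambda>e. partial e f"]) (auto simp: Ck_cont)
qed

lemma Ck_le: "Ck n f \<Longrightarrow> m \<le> n \<Longrightarrow> Ck m f"
proof (induction n)
 case (Suc n)
 show ?case
 proof (cases "m = Suc n")
  case False
  with Suc show ?thesis by (meson Ck_Suc_imp le_SucE)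
 qed (use Suc in simp)
qed simp

lemma Ck_const: "Ck n (\<lambda>_. c)"
proof (induction n arbitrary: c)
 case (Suc n)
 show ?case by (rule Ck_SucI[OF _ has_partial_const]) (auto intro: Suc)
qed auto

lemma Ck_add: "Ck n f \<Longrightarrow> Ck n g \<Longrightarrow> Ck n (\<lambda>x. f x + g x)"
proof (induction n arbitrary: f g)
 case 0
 then show ?case by (auto intro: continuous_intros)
next
 case (Suc n)
 show ?case
  by (rule Ck_SucI[OF _ has_partial_add[OF Ck_has_partial Ck_has_partial]])
   (use Suc in \<open>auto intro!: continuous_intros simp: Ck_cont\<close>)
qed

lemma Ck_minus: "Ck n f \<Longrightarrow> Ck n (\<lambda>x. - f x)"
proof (induction n arbitrary: f)
 case 0
 then show ?case by (auto intro: continuous_intros)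
next
 case (Suc n)
 show ?case
  by (rule Ck_SucI[OF _ has_partial_minus[OF Ck_has_partial]])
   (use Suc in \<open>auto intro!: continuous_intros simp: Ck_cont\<close>)
qed

lemma Ck_diff: "Ck n f \<Longrightarrow> Ck n g \<Longrightarrow> Ck n (\<lambda>x. f x - g x)"
 using Ck_add[OF _ Ck_minus, of n f g] by simp

lemma Ck_cnj: "Ck n f \<Longrightarrow> Ck n (\<lambda>x. cnj (f x))"
proof (induction n arbitrary: f)
 case 0
 then show ?case by (auto intro: continuous_intros)
next
 case (Suc n)
 show ?case
  by (rule Ck_SucI[OF _ has_partial_cnj[OF Ck_has_partial]])
   (use Suc in \<open>auto intro!: continuous_intros simp: Ck_cont\<close>)
qed

lemma Ck_mult: "Ck n f \<Longrightarrow> Ck n g \<Longrightarrow> Ck n (\<lambda>x. f x * g x)"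
proof (induction n arbitrary: f g)
 case 0
 then show ?case by (auto intro: continuous_intros)
next
 case (Suc n)
 have "Ck n (\<lambda>x. partial e f x * g x + f x * partial e g x)" if "e \<in> Basis" for e
  by (intro Ck_add Suc.IH Ck_partial[OF Suc.prems(1) that] Ck_partial[OF Suc.prems(2) that]
    Ck_Suc_imp[OF Suc.prems(1)] Ck_Suc_imp[OF Suc.prems(2)])
 moreover have "continuous_on UNIV (\<lambda>x. f x * g x)"
  using Suc.prems by (intro continuous_on_mult Ck_cont)
 moreover have "has_partial (\<lambda>x. f x * g x) e (\<lambda>x. partial e f x * g x + f x * partial e g x)" if "e \<in> Basis" for e
  using Suc.prems that by (intro has_partial_mult Ck_has_partial)
 ultimately show ?case by (intro Ck_SucI)
qed

lemma Ck_inverse: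
 assumes f_nonzero: "\<And>x. f x \<noteq> 0"
 shows "Ck n f \<Longrightarrow> Ck n (\<lambda>x. inverse (f x))"
proof (induction n)
 case 0
 then show ?case using f_nonzero by (auto intro!: continuous_intros)
next
 case (Suc n)
 have "Ck n (\<lambda>x. - partial e f x * (inverse (f x) * inverse (f x)))" if "e \<in> Basis" for e
  using Suc.IH[OF Ck_Suc_imp[OF Suc.prems]] Ck_partial[OF Suc.prems that] by (intro Ck_minus Ck_mult)
 moreover have "continuous_on UNIV (\<lambda>x. inverse (f x))"
  using Ck_cont[OF Suc.prems] f_nonzero by (intro continuous_on_inverse) auto
 moreover have "has_partial (\<lambda>x. inverse (f x)) e (\<lambda>x. - partial e f x * (inverse (f x) * inverse (f x)))" if "e \<in> Basis" for e
  using Suc.prems that f_nonzero by (intro has_partial_inverse Ck_has_partial)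
 ultimately show ?case by (intro Ck_SucI)
qed

lemma Ck_divide: "Ck n f \<Longrightarrow> Ck n g \<Longrightarrow> (\<And>x. g x \<noteq> 0) \<Longrightarrow> Ck n (\<lambda>x. f x / g x)"
 unfolding divide_inverse by (intro Ck_mult Ck_inverse)

lemma Ck_sum: "(\<And>i. i \<in> A \<Longrightarrow> Ck n (f i)) \<Longrightarrow> Ck n (\<lambda>x. \<Sum>i\<in>A. f i x)"
 by (induction A rule: infinite_finite_induct) (auto intro: Ck_const Ck_add)

lemma Ck_reflect: "Ck n f \<Longrightarrow> Ck n (\<lambda>x. f (a - x))"
proof (induction n arbitrary: f)
 case 0
 then have "continuous_on UNIV f" by simp
 then have "continuous_on UNIV (\<lambda>x. f (a - x))"
  by (rule continuous_on_compose2) (auto intro: continuous_intros)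
 then show ?case by simp
next
 case (Suc n)
 then have "continuous_on UNIV f" by (rule_tac Ck_cont)
 have "Ck n (\<lambda>x. - partial e f (a - x))" if "e \<in> Basis" for e
  by (intro Ck_minus Suc.IH Ck_partial[OF Suc.prems that])
 moreover have "continuous_on UNIV (\<lambda>x. f (a - x))"
  by (rule continuous_on_compose2[OF \<open>continuous_on UNIV f\<close>]) (auto intro: continuous_intros)
 moreover have "has_partial (\<lambda>x. f (a - x)) e (\<lambda>x. - partial e f (a - x))" if "e \<in> Basis" for e
  using Suc.prems that by (intro has_partial_reflect Ck_has_partial)
 ultimately show ?case by (intro Ck_SucI)
qed

lemma second_difference_eq:
 assumes f_partial: "has_partial f a (partial a f)" and partial_f: "has_partial (partial a f) b (partial b (partial a f))"
  and r_linear: "bounded_linear (r :: complex \<Rightarrow> real)" and t_pos: "t > 0"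
 obtains s u where "s \<in> {0<..<t}" "u \<in> {0<..<t}"
  "r (f (x + t *\<^sub>R a + t *\<^sub>R b)) - r (f (x + t *\<^sub>R a)) - r (f (x + t *\<^sub>R b)) + r (f x)
    = t * t * r (partial b (partial a f) (x + s *\<^sub>R a + u *\<^sub>R b))"
proof -
 interpret r: bounded_linear r by fact
 have deriv: "((\<lambda>s. r (g (y + s *\<^sub>R c))) has_field_derivative r (partial c g (y + s *\<^sub>R c))) (at s)"
  if "has_partial g c (partial c g)" for g c y s
  using r.has_vector_derivative[OF has_partial_at[OF that]]
  by (simp add: has_real_derivative_iff_has_vector_derivative)
 let ?h = "\<lambda>s. r (f ((x + t *\<^sub>R b) + s *\<^sub>R a)) - r (f (x + s *\<^sub>R a))"
 let ?h' = "\<lambda>s. r (partial a f ((x + t *\<^sub>R b) + s *\<^sub>R a)) - r (partial a f (x + s *\<^sub>R a))"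
 have "\<exists>s>0. s < t \<and> ?h t - ?h 0 = (t - 0) * ?h' s"
  by (rule MVT2[OF t_pos]) (intro DERIV_diff deriv f_partial)
 then obtain s where s_mvt: "0 < s" "s < t" "?h t - ?h 0 = (t - 0) * ?h' s" by blast
 let ?g = "\<lambda>u. r (partial a f ((x + s *\<^sub>R a) + u *\<^sub>R b))"
 let ?g' = "\<lambda>u. r (partial b (partial a f) ((x + s *\<^sub>R a) + u *\<^sub>R b))"
 have "\<exists>u>0. u < t \<and> ?g t - ?g 0 = (t - 0) * ?g' u"
  by (rule MVT2[OF t_pos]) (intro deriv partial_f)
 then obtain u where u_mvt: "0 < u" "u < t" "?g t - ?g 0 = (t - 0) * ?g' u" by blast
 show thesis
 proof (rule that)
  show "r (f (x + t *\<^sub>R a + t *\<^sub>R b)) - r (f (x + t *\<^sub>R a)) - r (f (x + t *\<^sub>R b)) + r (f x)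
    = t * t * r (partial b (partial a f) (x + s *\<^sub>R a + u *\<^sub>R b))"
   using s_mvt(3) u_mvt(3) by (simp add: algebra_simps)
 qed (use s_mvt u_mvt in auto)
qed

lemma second_difference_tendsto:
 assumes f_Ck: "Ck 2 f" and basis: "a \<in> Basis" "b \<in> Basis" and r_linear: "bounded_linear (r :: complex \<Rightarrow> real)"
 shows "(\<lambda>m. (r (f (x + inverse (Suc m) *\<^sub>R a + inverse (Suc m) *\<^sub>R b)) - r (f (x + inverse (Suc m) *\<^sub>R a))
    - r (f (x + inverse (Suc m) *\<^sub>R b)) + r (f x)) * (real (Suc m))\<^sup>2)
  \<longlonglongrightarrow> r (partial b (partial a f) x)"
proof -
 define \<tau> where "\<tau> m = inverse (real (Suc m))" for m
 let ?\<Delta> = "\<lambda>m. r (f (x + \<tau> m *\<^sub>R a + \<tau> m *\<^sub>R b)) - r (f (x + \<tau> m *\<^sub>R a)) - r (f (x + \<tau> m *\<^sub>R b)) + r (f x)"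
 let ?ba = "partial b (partial a f)"
 have f_Ck_Suc: "Ck (Suc (Suc 0)) f" using f_Ck by (simp add: numeral_2_eq_2)
 note h = Ck_has_partial[OF f_Ck_Suc basis(1)] Ck_has_partial[OF Ck_partial[OF f_Ck_Suc basis(1)] basis(2)]
 have "\<exists>s u. s \<in> {0<..<\<tau> m} \<and> u \<in> {0<..<\<tau> m} \<and> ?\<Delta> m = \<tau> m * \<tau> m * r (?ba (x + s *\<^sub>R a + u *\<^sub>R b))" for m
  by (rule second_difference_eq[OF h r_linear, of "\<tau> m" x]) (auto simp: \<tau>_def)
 then obtain s u where s_u_in: "\<And>m. s m \<in> {0<..<\<tau> m}" "\<And>m. u m \<in> {0<..<\<tau> m}"
  and \<Delta>: "\<And>m. ?\<Delta> m = \<tau> m * \<tau> m * r (?ba (x + s m *\<^sub>R a + u m *\<^sub>R b))" by metis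
 have \<tau>_lim: "\<tau> \<longlonglongrightarrow> 0" unfolding \<tau>_def[abs_def] by (rule LIMSEQ_inverse_real_of_nat)
 have squeeze: "v \<longlonglongrightarrow> 0" if "\<And>m. v m \<in> {0<..<\<tau> m}" for v
  by (rule tendsto_sandwich[OF _ _ tendsto_const \<tau>_lim]) (use that in \<open>auto intro!: always_eventually less_imp_le\<close>)
 have "(\<lambda>m. x + s m *\<^sub>R a + u m *\<^sub>R b) \<longlonglongrightarrow> x + 0 *\<^sub>R a + 0 *\<^sub>R b"
  by (intro tendsto_intros squeeze s_u_in)
 moreover have "isCont ?ba x"
  using Ck_cont[OF Ck_partial[OF Ck_partial[OF f_Ck_Suc basis(1)] basis(2)]] by (simp add: continuous_on_eq_continuous_at)
 ultimately have "(\<lambda>m. ?ba (x + s m *\<^sub>R a + u m *\<^sub>R b)) \<longlonglongrightarrow> ?ba x"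
  using isCont_tendsto_compose by fastforce
 then have "(\<lambda>m. r (?ba (x + s m *\<^sub>R a + u m *\<^sub>R b))) \<longlonglongrightarrow> r (?ba x)"
  by (rule bounded_linear.tendsto[OF r_linear])
 moreover have "?\<Delta> m * (real (Suc m))\<^sup>2 = r (?ba (x + s m *\<^sub>R a + u m *\<^sub>R b))" for m
 proof -
  have "\<tau> m * real (Suc m) = 1" by (simp add: \<tau>_def)
  then have "(\<tau> m * real (Suc m))\<^sup>2 * y = y" for y by simp
  then show ?thesis unfolding \<Delta> by (simp add: power2_eq_square mult_ac)
 qed
 ultimately show ?thesis unfolding \<tau>_def by simp
qed

lemma partial_commute:
 assumes f_Ck: "Ck 2 f" and basis: "e \<in> Basis" "d \<in> Basis"
 shows "partial e (partial d f) x = partial d (partial e f) x"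
proof -
 have "r (partial e (partial d f) x) = r (partial d (partial e f) x)" if r_linear: "bounded_linear r" for r :: "complex \<Rightarrow> real"
  using LIMSEQ_unique[OF second_difference_tendsto[OF f_Ck basis r_linear, of x]] second_difference_tendsto[OF f_Ck basis(2,1) r_linear, of x]
  by (simp add: algebra_simps)
 from this[OF bounded_linear_Re] this[OF bounded_linear_Im] show ?thesis by (simp add: complex_eq_iff)
qed

definition compact_supp :: "('a::euclidean_space \<Rightarrow> 'b::zero) \<Rightarrow> bool" where
 "compact_supp f \<longleftrightarrow> (\<exists>R. \<forall>x. R < norm x \<longrightarrow> f x = 0)"

lemma compact_supp_mult1: "compact_supp f \<Longrightarrow> compact_supp (\<lambda>x. f x * (g x :: 'b::mult_zero))"
 and compact_supp_mult2: "compact_supp g \<Longrightarrow> compact_supp (\<lambda>x. (f x :: 'b::mult_zero) * g x)"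
 by (force simp: compact_supp_def)+

lemma compact_supp_add: "compact_supp f \<Longrightarrow> compact_supp g \<Longrightarrow> compact_supp (\<lambda>x. f x + (g x :: 'b::monoid_add))"
proof -
 assume "compact_supp f" "compact_supp g"
 then obtain R S where "\<forall>x. R < norm x \<longrightarrow> f x = 0" "\<forall>x. S < norm x \<longrightarrow> g x = 0"
  by (auto simp: compact_supp_def)
 then have "\<forall>x. max R S < norm x \<longrightarrow> f x + g x = 0" by auto
 then show ?thesis unfolding compact_supp_def by blast
qed

lemma compact_supp_comp: "compact_supp f \<Longrightarrow> h 0 = 0 \<Longrightarrow> compact_supp (\<lambda>x. h (f x))"
 unfolding compact_supp_def by metis

lemma compact_supp_sum: "(\<And>i. i \<in> A \<Longrightarrow> compact_supp (f i)) \<Longrightarrow> compact_supp (\<lambda>x. \<Sum>i\<in>A. (f i x :: 'b::comm_monoid_add))"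
proof (induction A rule: infinite_finite_induct)
 case (insert a A)
 then show ?case by (simp add: compact_supp_add)
qed (auto simp: compact_supp_def)

lemma compact_supp_reflect:
 assumes "compact_supp f" shows "compact_supp (\<lambda>x. f (a - x))"
proof -
 obtain R where "\<forall>x. R < norm x \<longrightarrow> f x = 0" using assms by (auto simp: compact_supp_def)
 moreover have "norm x \<le> norm (a - x) + norm a" for x
  using norm_triangle_ineq[of "x - a" a] by (simp add: norm_minus_commute)
 ultimately have "\<forall>x. R + norm a < norm x \<longrightarrow> f (a - x) = 0"
  by (smt (verit))
 then show ?thesis unfolding compact_supp_def by blast
qed

lemma compact_supp_partial:
 assumes "compact_supp f" shows "compact_supp (partial e f)"
proof -
 obtain R where R_vanish: "\<forall>x. R < norm x \<longrightarrow> f x = 0" using assms by (auto simp: compact_supp_def)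
 have "partial e f x = 0" if "R < norm x" for x
 proof -
  have "((\<lambda>t. norm (x + t *\<^sub>R e)) \<longlongrightarrow> norm (x + 0 *\<^sub>R e)) (at (0::real))"
   by (intro tendsto_intros)
  then have "\<forall>\<^sub>F t in at (0::real). R < norm (x + t *\<^sub>R e)"
   using that by (intro order_tendstoD(1)) auto
  then have "\<forall>\<^sub>F t in nhds (0::real). f (x + t *\<^sub>R e) = 0"
   using R_vanish that by (auto simp: eventually_nhds_conv_at elim: eventually_mono)
  then have "((\<lambda>t. f (x + t *\<^sub>R e)) has_vector_derivative 0) (at 0)"
   by (subst has_vector_derivative_cong_ev[where g = "\<lambda>_. 0"]) (use R_vanish that in \<open>auto elim: eventually_mono\<close>)
  then show ?thesis by (simp add: partial_def vector_derivative_at)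
 qed
 then show ?thesis by (auto simp: compact_supp_def)
qed

lemma integrable_compact_supp:
 fixes f :: "'a::euclidean_space \<Rightarrow> 'b::{banach,second_countable_topology}"
 assumes "continuous_on UNIV f" "compact_supp f"
 shows "integrable lborel f"
proof -
 obtain R where R_vanish: "\<And>x. R < norm x \<Longrightarrow> f x = 0" using assms by (auto simp: compact_supp_def)
 have "integrable lborel (\<lambda>x. indicator (cball 0 R) x *\<^sub>R f x)"
  by (intro borel_integrable_compact) (use assms continuous_on_subset in auto)
 moreover have "(\<lambda>x. indicator (cball 0 R) x *\<^sub>R f x) = f"
  using R_vanish by (auto simp: fun_eq_iff indicator_def not_le)
 ultimately show ?thesis by simp
qed

lemma bounded_compact_supp:
 fixes f :: "'a::euclidean_space \<Rightarrow> 'b::real_normed_vector"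
 assumes "continuous_on UNIV f" "compact_supp f"
 obtains M where "M \<ge> 0" "\<And>x. norm (f x) \<le> M"
proof -
 obtain R where R_vanish: "\<And>x. R < norm x \<Longrightarrow> f x = 0" using assms by (auto simp: compact_supp_def)
 have "compact (f ` cball 0 R)"
  by (intro compact_continuous_image) (use assms continuous_on_subset in auto)
 then obtain M where "\<And>x. x \<in> cball 0 R \<Longrightarrow> norm (f x) \<le> M"
  using compact_imp_bounded bounded_iff by (metis imageI)
 then have "norm (f x) \<le> max M 0" for x
  using R_vanish[of x] by (cases "R < norm x") (auto simp: max.coboundedI1)
 then show ?thesis by (intro that[of "max M 0"]) auto
qed

lemma integrable_indicator_translate:
 fixes g :: "'a::euclidean_space \<Rightarrow> complex"
 assumes g_props: "continuous_on UNIV g" "compact_supp g"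
 shows "integrable (lborel \<Otimes>\<^sub>M lborel) (\<lambda>(s, x). indicator {0..1::real} s *\<^sub>R g (x + s *\<^sub>R e))"
proof -
 obtain R where R_vanish: "\<And>x. R < norm x \<Longrightarrow> g x = 0" using g_props(2) by (auto simp: compact_supp_def)
 define K where "K = {0..1::real} \<times> cball (0::'a) (R + norm e)"
 have "g (x + s *\<^sub>R e) = 0" if s_in: "s \<in> {0..1}" and x_outside: "x \<notin> cball 0 (R + norm e)" for s x
 proof (rule R_vanish)
  have "norm x \<le> norm (x + s *\<^sub>R e) + norm (s *\<^sub>R e)" by (metis add_diff_cancel_right' norm_triangle_ineq4)
  moreover have "norm (s *\<^sub>R e) \<le> norm e" using s_in by (simp add: mult_left_le_one_le)
  ultimately show "R < norm (x + s *\<^sub>R e)" using x_outside by simp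
 qed
 then have "(\<lambda>(s, x). indicator {0..1} s *\<^sub>R g (x + s *\<^sub>R e)) = (\<lambda>p. indicator K p *\<^sub>R g (snd p + fst p *\<^sub>R e))"
  by (auto simp: K_def fun_eq_iff indicator_def)
 moreover have "compact K" unfolding K_def by (intro compact_Times compact_Icc compact_cball)
 then have "integrable lborel (\<lambda>p. indicator K p *\<^sub>R g (snd p + fst p *\<^sub>R e))"
  by (rule borel_integrable_compact) (intro continuous_on_compose2[OF g_props(1)] continuous_intros; simp)
 ultimately show ?thesis by (simp add: lborel_prod)
qed

lemma integral_partial_eq_0:
 fixes f :: "'a::euclidean_space \<Rightarrow> complex"
 assumes f_test: "Ck 1 f" "compact_supp f" and e_in: "e \<in> Basis"
 shows "(\<integral>x. partial e f x \<partial>lborel) = 0"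
proof -
 let ?f' = "partial e f"
 have deriv: "has_partial f e ?f'" and cont: "continuous_on UNIV f" "continuous_on UNIV ?f'" using f_test e_in by auto
 have [measurable]: "f \<in> borel_measurable borel" "?f' \<in> borel_measurable borel"
  using cont by (auto intro: borel_measurable_continuous_onI)
 note integrable = integrable_indicator_translate[OF cont(2) compact_supp_partial[OF f_test(2)], of e]
 have shift: "(\<integral>x. g (x + v) \<partial>lborel) = (\<integral>x. g x \<partial>lborel)" if "g \<in> borel_measurable borel" for g :: "'a \<Rightarrow> complex" and v
  using integral_lborel_shift[OF that, of v] by (simp add: add.commute)
 have "(\<integral>x. ?f' x \<partial>lborel) = (\<integral>s. indicator {0..1::real} s *\<^sub>R (\<integral>x. ?f' x \<partial>lborel) \<partial>lborel)" by simp
 also have "\<dots> = (\<integral>s. \<integral>x. indicator {0..1::real} s *\<^sub>R ?f' (x + s *\<^sub>R e) \<partial>lborel \<partial>lborel)" by (simp add: shift)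
 also have "\<dots> = (\<integral>x. \<integral>s. indicator {0..1::real} s *\<^sub>R ?f' (x + s *\<^sub>R e) \<partial>lborel \<partial>lborel)"
  using lborel_pair.Fubini_integral[OF integrable] by simp
 also have "\<dots> = (\<integral>x. f (x + 1 *\<^sub>R e) - f (x + 0 *\<^sub>R e) \<partial>lborel)"
  by (intro Bochner_Integration.integral_cong refl integral_FTC_Icc has_vector_derivative_at_within[OF has_partial_at[OF deriv]]
    continuous_on_compose2[OF cont(2)] continuous_intros) auto
 also have "\<dots> = 0"
 proof -
  have f_int: "integrable lborel f" by (rule integrable_compact_supp[OF cont(1) f_test(2)])
  have "integrable lborel (\<lambda>x. f (x + e))"
   using integrable_lborel_shift[OF f_int, of e] by (simp add: add.commute)
  with f_int show ?thesis by (simp add: shift)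
 qed
 finally show ?thesis .
qed

definition dz :: "'n::finite \<Rightarrow> (complex^'n \<Rightarrow> complex) \<Rightarrow> complex^'n \<Rightarrow> complex" where
 "dz k f x = (partial (axis k 1) f x - \<i> * partial (axis k \<i>) f x) / 2"

definition dzbar :: "'n::finite \<Rightarrow> (complex^'n \<Rightarrow> complex) \<Rightarrow> complex^'n \<Rightarrow> complex" where
 "dzbar k f x = (partial (axis k 1) f x + \<i> * partial (axis k \<i>) f x) / 2"

lemma axis_Basis [simp]: "axis k 1 \<in> (Basis :: (complex^'n::finite) set)" "axis k \<i> \<in> (Basis :: (complex^'n) set)"
 by (simp_all add: axis_in_Basis_iff Basis_complex_def)

lemma Ck_dz: "Ck (Suc n) f \<Longrightarrow> Ck n (dz k f)"
 unfolding dz_def[abs_def] by (intro Ck_divide Ck_diff Ck_mult Ck_const Ck_partial) auto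

lemma Ck_dzbar: "Ck (Suc n) f \<Longrightarrow> Ck n (dzbar k f)"
 unfolding dzbar_def[abs_def] by (intro Ck_divide Ck_add Ck_mult Ck_const Ck_partial) auto

lemma compact_supp_dz: assumes "compact_supp f" shows "compact_supp (dz k f)"
proof -
 have "compact_supp (\<lambda>x. partial (axis k 1) f x + (- \<i>) * partial (axis k \<i>) f x)"
  by (intro compact_supp_add compact_supp_mult2 compact_supp_partial assms)
 from compact_supp_comp[OF this, of "\<lambda>x. x / 2"] show ?thesis by (simp add: dz_def[abs_def])
qed

lemma compact_supp_dzbar: assumes "compact_supp f" shows "compact_supp (dzbar k f)"
proof -
 have "compact_supp (\<lambda>x. partial (axis k 1) f x + \<i> * partial (axis k \<i>) f x)"
  by (intro compact_supp_add compact_supp_mult2 compact_supp_partial assms)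
 from compact_supp_comp[OF this, of "\<lambda>x. x / 2"] show ?thesis by (simp add: dzbar_def[abs_def])
qed

lemma Ck1_has_partial: "Ck 1 f \<Longrightarrow> e \<in> Basis \<Longrightarrow> has_partial f e (partial e f)"
 by simp

lemma partial_add: "Ck 1 f \<Longrightarrow> Ck 1 g \<Longrightarrow> e \<in> Basis \<Longrightarrow> partial e (\<lambda>x. f x + g x) x = partial e f x + partial e g x"
 using partial_eq[OF has_partial_add[OF Ck1_has_partial Ck1_has_partial]] by metis

lemma partial_minus: "Ck 1 f \<Longrightarrow> e \<in> Basis \<Longrightarrow> partial e (\<lambda>x. - f x) x = - partial e f x"
 using partial_eq[OF has_partial_minus[OF Ck1_has_partial]] by metis

lemma partial_mult: "Ck 1 f \<Longrightarrow> Ck 1 g \<Longrightarrow> e \<in> Basis \<Longrightarrow> partial e (\<lambda>x. f x * g x) x = partial e f x * g x + f x * partial e g x"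
 using partial_eq[OF has_partial_mult[OF Ck1_has_partial Ck1_has_partial]] by metis

lemma partial_cnj: "Ck 1 f \<Longrightarrow> e \<in> Basis \<Longrightarrow> partial e (\<lambda>x. cnj (f x)) x = cnj (partial e f x)"
 using partial_eq[OF has_partial_cnj[OF Ck1_has_partial]] by metis

lemma partial_const [simp]: "partial e (\<lambda>_. c) x = 0"
 by (simp add: partial_eq[OF has_partial_const])

lemma partial_cmult: "Ck 1 f \<Longrightarrow> e \<in> Basis \<Longrightarrow> partial e (\<lambda>x. c * f x) x = c * partial e f x"
 using partial_mult[OF Ck_const, of f e c x] by (simp del: Ck.simps One_nat_def)

lemma partial_cdivide: "Ck 1 f \<Longrightarrow> e \<in> Basis \<Longrightarrow> partial e (\<lambda>x. f x / c) x = partial e f x / c"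
 using partial_cmult[of f e "inverse c" x] by (simp add: divide_inverse mult.commute)

lemma partial_reflect: "Ck 1 f \<Longrightarrow> e \<in> Basis \<Longrightarrow> partial e (\<lambda>x. f (a - x)) x = - partial e f (a - x)"
 using partial_eq[OF has_partial_reflect[OF Ck1_has_partial]] by metis

lemma partial_diff: "Ck 1 f \<Longrightarrow> Ck 1 g \<Longrightarrow> e \<in> Basis \<Longrightarrow> partial e (\<lambda>x. f x - g x) x = partial e f x - partial e g x"
 using partial_add[OF _ Ck_minus, of f g e x] by (simp add: partial_minus)

lemma dz_add: "Ck 1 f \<Longrightarrow> Ck 1 g \<Longrightarrow> dz k (\<lambda>x. f x + g x) x = dz k f x + dz k g x"
 and dzbar_add: "Ck 1 f \<Longrightarrow> Ck 1 g \<Longrightarrow> dzbar k (\<lambda>x. f x + g x) x = dzbar k f x + dzbar k g x"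
 by (simp_all add: dz_def dzbar_def partial_add del: Ck.simps One_nat_def) (simp_all add: field_simps)

lemma dz_diff: "Ck 1 f \<Longrightarrow> Ck 1 g \<Longrightarrow> dz k (\<lambda>x. f x - g x) x = dz k f x - dz k g x"
 and dzbar_diff: "Ck 1 f \<Longrightarrow> Ck 1 g \<Longrightarrow> dzbar k (\<lambda>x. f x - g x) x = dzbar k f x - dzbar k g x"
 by (simp_all add: dz_def dzbar_def partial_diff del: Ck.simps One_nat_def) (simp_all add: field_simps)

lemma dz_mult: "Ck 1 f \<Longrightarrow> Ck 1 g \<Longrightarrow> dz k (\<lambda>x. f x * g x) x = dz k f x * g x + f x * dz k g x"
 and dzbar_mult: "Ck 1 f \<Longrightarrow> Ck 1 g \<Longrightarrow> dzbar k (\<lambda>x. f x * g x) x = dzbar k f x * g x + f x * dzbar k g x"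
 by (simp_all add: dz_def dzbar_def partial_mult del: Ck.simps One_nat_def) (simp_all add: field_simps)

lemma dz_const [simp]: "dz k (\<lambda>_. c) x = 0" and dzbar_const [simp]: "dzbar k (\<lambda>_. c) x = 0"
 by (simp_all add: dz_def dzbar_def)

lemma dz_cnj: "Ck 1 f \<Longrightarrow> dz k (\<lambda>x. cnj (f x)) x = cnj (dzbar k f x)"
 and dzbar_cnj: "Ck 1 f \<Longrightarrow> dzbar k (\<lambda>x. cnj (f x)) x = cnj (dz k f x)"
 by (simp_all add: dz_def dzbar_def partial_cnj del: Ck.simps One_nat_def)

lemma dz_sum: "(\<And>i. i \<in> A \<Longrightarrow> Ck 1 (f i)) \<Longrightarrow> dz k (\<lambda>x. \<Sum>i\<in>A. f i x) x = (\<Sum>i\<in>A. dz k (f i) x)"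
 and dzbar_sum: "(\<And>i. i \<in> A \<Longrightarrow> Ck 1 (f i)) \<Longrightarrow> dzbar k (\<lambda>x. \<Sum>i\<in>A. f i x) x = (\<Sum>i\<in>A. dzbar k (f i) x)"
 by (induction A rule: infinite_finite_induct)
  (simp_all add: dz_add dzbar_add Ck_sum del: Ck.simps One_nat_def)

lemma dz_reflect: "Ck 1 f \<Longrightarrow> dz k (\<lambda>x. f (a - x)) x = - dz k f (a - x)"
 and dzbar_reflect: "Ck 1 f \<Longrightarrow> dzbar k (\<lambda>x. f (a - x)) x = - dzbar k f (a - x)"
 by (simp_all add: dz_def dzbar_def partial_reflect del: Ck.simps One_nat_def) (simp_all add: field_simps)

lemma dz_inverse:
 assumes "Ck 1 f" "\<And>x. f x \<noteq> 0"
 shows "dz k (\<lambda>x. inverse (f x)) x = - dz k f x * (inverse (f x) * inverse (f x))"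
  and "dzbar k (\<lambda>x. inverse (f x)) x = - dzbar k f x * (inverse (f x) * inverse (f x))"
proof -
 have "partial e (\<lambda>x. inverse (f x)) x = - partial e f x * (inverse (f x) * inverse (f x))" if "e \<in> Basis" for e
  using partial_eq[OF has_partial_inverse[OF Ck1_has_partial[OF assms(1) that] assms(2)]] by metis
 then show "dz k (\<lambda>x. inverse (f x)) x = - dz k f x * (inverse (f x) * inverse (f x))"
  "dzbar k (\<lambda>x. inverse (f x)) x = - dzbar k f x * (inverse (f x) * inverse (f x))"
  using assms(2)[of x] by (simp_all add: dz_def dzbar_def) (simp_all add: field_simps)
qed

lemma dzbar_dz_commute: "Ck 2 f \<Longrightarrow> dzbar j (dz k f) x = dz k (dzbar j f) x"
 and dzbar_dzbar_commute: "Ck 2 f \<Longrightarrow> dzbar j (dzbar k f) x = dzbar k (dzbar j f) x"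
proof -
 assume f_Ck: "Ck 2 f"
 then have partial_Ck1: "Ck 1 (partial e f)" if "e \<in> Basis" for e
  using that Ck_partial[of 1 f e] by (simp add: numeral_2_eq_2)
 have partial_dz: "partial e (dz k f) x = (partial e (partial (axis k 1) f) x - \<i> * partial e (partial (axis k \<i>) f) x) / 2"
  "partial e (dzbar k f) x = (partial e (partial (axis k 1) f) x + \<i> * partial e (partial (axis k \<i>) f) x) / 2" if "e \<in> Basis" for e k
 proof -
  have "dz k f = (\<lambda>x. (1/2) * (partial (axis k 1) f x - \<i> * partial (axis k \<i>) f x))"
   "dzbar k f = (\<lambda>x. (1/2) * (partial (axis k 1) f x + \<i> * partial (axis k \<i>) f x))"
   by (simp_all add: dz_def dzbar_def fun_eq_iff)
  then show "partial e (dz k f) x = (partial e (partial (axis k 1) f) x - \<i> * partial e (partial (axis k \<i>) f) x) / 2"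
   "partial e (dzbar k f) x = (partial e (partial (axis k 1) f) x + \<i> * partial e (partial (axis k \<i>) f) x) / 2"
   by (simp_all only:) (simp_all add: partial_cmult partial_cdivide partial_add partial_diff that partial_Ck1 Ck_add Ck_diff Ck_mult Ck_const del: Ck.simps One_nat_def)
 qed
 note comm = partial_commute[OF f_Ck axis_Basis(1) axis_Basis(1)] partial_commute[OF f_Ck axis_Basis(1) axis_Basis(2)]
  partial_commute[OF f_Ck axis_Basis(2) axis_Basis(1)] partial_commute[OF f_Ck axis_Basis(2) axis_Basis(2)]
 show "dzbar j (dz k f) x = dz k (dzbar j f) x"
  unfolding dz_def[of k "dzbar j f"] dzbar_def[of j "dz k f"] partial_dz[OF axis_Basis(1)] partial_dz[OF axis_Basis(2)]
  using comm(1)[of j k x] comm(2)[of j k x] comm(3)[of j k x] comm(4)[of j k x] by (simp add: field_simps)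
 show "dzbar j (dzbar k f) x = dzbar k (dzbar j f) x"
  unfolding dzbar_def[of k "dzbar j f"] dzbar_def[of j "dzbar k f"] partial_dz[OF axis_Basis(1)] partial_dz[OF axis_Basis(2)]
  using comm(1)[of j k x] comm(2)[of j k x] comm(3)[of j k x] comm(4)[of j k x] by (simp add: field_simps)
qed

lemma integral_dz_eq_0:
 assumes "Ck 1 f" "compact_supp f"
 shows "(\<integral>x. dz k f x \<partial>lborel) = 0" "(\<integral>x. dzbar k f x \<partial>lborel) = 0"
proof -
 have partial_integrable: "integrable lborel (partial e f)" if "e \<in> Basis" for e
  using assms that by (intro integrable_compact_supp compact_supp_partial) auto
 show "(\<integral>x. dz k f x \<partial>lborel) = 0" "(\<integral>x. dzbar k f x \<partial>lborel) = 0"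
  unfolding dz_def dzbar_def using partial_integrable[OF axis_Basis(1)] partial_integrable[OF axis_Basis(2)]
  by (simp_all add: integral_partial_eq_0 assms del: Ck.simps One_nat_def)
qed

locale psh_weight =
 fixes E :: "complex^'n::finite \<Rightarrow> real" and ph :: "'n \<Rightarrow> complex^'n \<Rightarrow> complex"
 assumes E_pos: "E x > 0"
  and E_Ck: "Ck 1 (\<lambda>x. complex_of_real (E x))"
  and dz_E: "dz k (\<lambda>x. complex_of_real (E x)) x = - ph k x * E x"
  and ph_Ck: "Ck 1 (ph k)"
  and psh: "Re (\<Sum>j\<in>UNIV. \<Sum>k\<in>UNIV. a j * cnj (dzbar j (ph k) x * a k)) \<ge> 2 * (norm (a m))\<^sup>2"
  and E_int: "integrable lborel E"
begin

definition D :: "'n \<Rightarrow> (complex^'n \<Rightarrow> complex) \<Rightarrow> complex^'n \<Rightarrow> complex" where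
 "D k a x = dz k a x - ph k x * a x"

definition Box :: "(complex^'n \<Rightarrow> complex) \<Rightarrow> complex^'n \<Rightarrow> complex" where
 "Box v x = - (\<Sum>j\<in>UNIV. D j (dzbar j v) x)"

lemma Ck_D: "Ck 2 a \<Longrightarrow> Ck 1 (D k a)"
 unfolding D_def[abs_def]
 using Ck_le[of 2 a 1] Ck_dz[of 1 a k] ph_Ck[of k]
 by (intro Ck_diff Ck_mult) (simp_all add: numeral_2_eq_2 del: Ck.simps)

lemma compact_supp_D: "compact_supp a \<Longrightarrow> compact_supp (D k a)"
 using compact_supp_add[OF compact_supp_dz[of a k] compact_supp_mult2[of a "\<lambda>x. - ph k x"]]
 by (simp add: D_def[abs_def])

lemma dz_mult_E:
 assumes "Ck 1 a"
 shows "dz k (\<lambda>x. a x * E x) x = D k a x * E x"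
 using dz_mult[OF assms E_Ck, of k x] by (simp add: dz_E D_def algebra_simps)

lemma dzbar_mult_E:
 assumes "Ck 1 a"
 shows "dzbar k (\<lambda>x. cnj (a x) * E x) x = cnj (D k a x) * E x"
proof -
 have "dzbar k (\<lambda>x. cnj (a x * E x)) x = cnj (dz k (\<lambda>x. a x * E x) x)"
  by (rule dzbar_cnj) (intro Ck_mult assms E_Ck)
 then show ?thesis by (simp add: dz_mult_E assms del: Ck.simps One_nat_def)
qed

lemma dzbar_D:
 assumes "Ck 2 a"
 shows "dzbar j (D k a) x = D k (dzbar j a) x - dzbar j (ph k) x * a x"
proof -
 have a_Ck: "Ck 1 a" and dz_Ck: "Ck 1 (dz k a)"
  using assms Ck_dz[of 1 a k] Ck_le[of 2 a 1] by (simp_all add: numeral_2_eq_2 del: Ck.simps)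
 have "dzbar j (D k a) x = dzbar j (dz k a) x - (dzbar j (ph k) x * a x + ph k x * dzbar j a x)"
  unfolding D_def[abs_def] using a_Ck dz_Ck
  by (simp add: dzbar_diff dzbar_mult Ck_mult ph_Ck del: Ck.simps One_nat_def)
 then show ?thesis
  by (simp add: D_def dzbar_dz_commute[OF assms])
qed

lemma continuous_on_Box: "Ck 3 v \<Longrightarrow> continuous_on UNIV (Box v)"
 unfolding Box_def[abs_def] using Ck_dzbar[of 2 v] Ck_cont[OF Ck_D[of "dzbar _ v"]]
 by (intro continuous_intros) (simp add: numeral_3_eq_3 numeral_2_eq_2 del: Ck.simps)

lemma compact_supp_Box: "compact_supp v \<Longrightarrow> compact_supp (Box v)"
 unfolding Box_def[abs_def] by (intro compact_supp_comp[of _ uminus] compact_supp_sum compact_supp_D compact_supp_dzbar) auto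

end

text \<open>Twisted Bochner inequality for \<open>\<alpha> = dzbar v\<close>: integrate \<open>\<eta> |\<Sum>\<^sub>j D\<^sub>j \<alpha>\<^sub>j|\<^sup>2 E\<close> by parts twice. The twist \<open>\<eta>\<close> depends
 only on the \<open>m\<close>-th coordinate.\<close>

locale twisted_bochner = psh_weight E ph
 for E :: "complex^'n::finite \<Rightarrow> real" and ph :: "'n \<Rightarrow> complex^'n \<Rightarrow> complex" +
 fixes v :: "complex^'n \<Rightarrow> complex" and \<eta> :: "complex^'n \<Rightarrow> real" and m :: 'n
 assumes Ck_v: "Ck 3 v" and compact_supp_v: "compact_supp v"
  and Ck2_\<eta>: "Ck 2 (\<lambda>x. complex_of_real (\<eta> x))" and \<eta>_nonneg: "\<eta> x \<ge> 0"
  and dz_\<eta>_eq_0: "j \<noteq> m \<Longrightarrow> dz j (\<lambda>x. complex_of_real (\<eta> x)) x = 0"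
begin

declare Ck.simps [simp del] One_nat_def [simp del]

abbreviation \<eta>\<^sub>c :: "complex^'n \<Rightarrow> complex" where "\<eta>\<^sub>c x \<equiv> complex_of_real (\<eta> x)"

definition \<alpha> :: "'n \<Rightarrow> complex^'n \<Rightarrow> complex" where "\<alpha> j = dzbar j v"

lemma Ck_\<alpha>: "Ck 2 (\<alpha> j)" "Ck 1 (\<alpha> j)"
 using Ck_v Ck_dzbar[of 2 v j] Ck_le[of 2 "\<alpha> j" 1] by (simp_all add: \<alpha>_def eval_nat_numeral One_nat_def)

lemma Ck_dzbar_\<alpha>: "Ck 1 (dzbar j (\<alpha> k))"
 using Ck_\<alpha>(1) Ck_dzbar[of 1 "\<alpha> k" j] by (simp add: numeral_2_eq_2 One_nat_def)

lemma Ck_\<eta>: "Ck 1 \<eta>\<^sub>c"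
 using Ck2_\<eta> Ck_le[of 2 \<eta>\<^sub>c 1] by simp

lemma Ck_dzbar_\<eta>: "Ck 1 (dzbar k \<eta>\<^sub>c)"
 using Ck2_\<eta> Ck_dzbar[of 1 \<eta>\<^sub>c k] by (simp add: numeral_2_eq_2 One_nat_def)

lemma compact_supp_\<alpha>: "compact_supp (\<alpha> j)"
 unfolding \<alpha>_def by (intro compact_supp_dzbar compact_supp_v)

lemma dzbar_\<eta>: "dzbar j \<eta>\<^sub>c x = cnj (dz j \<eta>\<^sub>c x)"
 using dzbar_cnj[OF Ck_\<eta>, of j x] by simp

lemma dzbar_\<alpha>_commute: "dzbar k (\<alpha> j) x = dzbar j (\<alpha> k) x"
 unfolding \<alpha>_def by (rule dzbar_dzbar_commute) (use Ck_v Ck_le[of 3 v 2] in simp)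

lemma dz_dzbar_\<eta>_eq_0:
 assumes "\<not> (j = m \<and> k = m)" shows "dz j (dzbar k \<eta>\<^sub>c) x = 0"
proof (cases "k = m")
 case True
 have "dz j (dzbar k \<eta>\<^sub>c) x = dzbar k (dz j \<eta>\<^sub>c) x" using dzbar_dz_commute[OF Ck2_\<eta>] by simp
 also have "dz j \<eta>\<^sub>c = (\<lambda>_. 0)" using dz_\<eta>_eq_0 assms True by auto
 finally show ?thesis by simp
next
 case False
 then have "dzbar k \<eta>\<^sub>c = (\<lambda>_. 0)" using dz_\<eta>_eq_0 by (auto simp: dzbar_\<eta>)
 then show ?thesis by simp
qed

definition bochner_term :: "'n \<Rightarrow> 'n \<Rightarrow> complex^'n \<Rightarrow> complex" where
 "bochner_term j k x = \<eta>\<^sub>c x * (D j (\<alpha> j) x * cnj (D k (\<alpha> k) x)) + dz j \<eta>\<^sub>c x * \<alpha> j x * cnj (D k (\<alpha> k) x)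
   - \<eta>\<^sub>c x * (\<alpha> j x * cnj (dzbar j (ph k) x * \<alpha> k x)) - \<eta>\<^sub>c x * (dzbar k (\<alpha> j) x * cnj (dzbar j (\<alpha> k) x))
   + dzbar k \<eta>\<^sub>c x * D j (\<alpha> j) x * cnj (\<alpha> k x) + dz j (dzbar k \<eta>\<^sub>c) x * \<alpha> j x * cnj (\<alpha> k x)"

lemma dz_\<alpha>_cnj_D_\<alpha>:
 "dz j (\<lambda>x. (\<alpha> j x * E x) * (\<eta>\<^sub>c x * cnj (D k (\<alpha> k) x))) x
  = D j (\<alpha> j) x * E x * (\<eta>\<^sub>c x * cnj (D k (\<alpha> k) x))
    + \<alpha> j x * E x * (dz j \<eta>\<^sub>c x * cnj (D k (\<alpha> k) x) + \<eta>\<^sub>c x * cnj (D k (dzbar j (\<alpha> k)) x - dzbar j (ph k) x * \<alpha> k x))"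
 by (subst dz_mult) (auto intro!: Ck_mult Ck_cnj Ck_\<alpha> E_Ck Ck_\<eta> Ck_D
   simp: dz_mult_E[OF Ck_\<alpha>(2)] dz_mult[OF Ck_\<eta> Ck_cnj[OF Ck_D[OF Ck_\<alpha>(1)]]] dz_cnj[OF Ck_D[OF Ck_\<alpha>(1)]] dzbar_D[OF Ck_\<alpha>(1)])

lemma dzbar_\<alpha>_cnj_dzbar_\<alpha>:
 "dzbar k (\<lambda>x. (\<eta>\<^sub>c x * \<alpha> j x) * (cnj (dzbar j (\<alpha> k) x) * E x)) x
  = (dzbar k \<eta>\<^sub>c x * \<alpha> j x + \<eta>\<^sub>c x * dzbar k (\<alpha> j) x) * (cnj (dzbar j (\<alpha> k) x) * E x)
    + (\<eta>\<^sub>c x * \<alpha> j x) * (cnj (D k (dzbar j (\<alpha> k)) x) * E x)"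
 by (subst dzbar_mult) (auto intro!: Ck_mult Ck_cnj Ck_\<alpha> E_Ck Ck_\<eta> Ck_dzbar_\<alpha>
   simp: dzbar_mult_E[OF Ck_dzbar_\<alpha>] dzbar_mult[OF Ck_\<eta> Ck_\<alpha>(2)])

lemma dz_\<alpha>_dzbar_\<eta>_cnj_\<alpha>:
 "dz j (\<lambda>x. (\<alpha> j x * E x) * (dzbar k \<eta>\<^sub>c x * cnj (\<alpha> k x))) x
  = D j (\<alpha> j) x * E x * (dzbar k \<eta>\<^sub>c x * cnj (\<alpha> k x))
    + \<alpha> j x * E x * (dz j (dzbar k \<eta>\<^sub>c) x * cnj (\<alpha> k x) + dzbar k \<eta>\<^sub>c x * cnj (dzbar j (\<alpha> k) x))"
 by (subst dz_mult) (auto intro!: Ck_mult Ck_cnj Ck_\<alpha> E_Ck Ck_dzbar_\<eta>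
   simp: dz_mult_E[OF Ck_\<alpha>(2)] dz_mult[OF Ck_dzbar_\<eta> Ck_cnj[OF Ck_\<alpha>(2)]] dz_cnj[OF Ck_\<alpha>(2)])

lemma integral_bochner_term:
 "integrable lborel (\<lambda>x. bochner_term j k x * E x)" "(\<integral>x. bochner_term j k x * E x \<partial>lborel) = 0"
proof -
 let ?F = "\<lambda>x. (\<alpha> j x * E x) * (\<eta>\<^sub>c x * cnj (D k (\<alpha> k) x))"
 let ?G = "\<lambda>x. (\<eta>\<^sub>c x * \<alpha> j x) * (cnj (dzbar j (\<alpha> k) x) * E x)"
 let ?H = "\<lambda>x. (\<alpha> j x * E x) * (dzbar k \<eta>\<^sub>c x * cnj (\<alpha> k x))"
 have products_Ck: "Ck 1 ?F" "Ck 1 ?G" "Ck 1 ?H"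
  by (intro Ck_mult Ck_cnj Ck_\<alpha> E_Ck Ck_\<eta> Ck_D Ck_dzbar_\<eta> Ck_dzbar_\<alpha>)+
 have supp: "compact_supp ?F" "compact_supp ?G" "compact_supp ?H"
  using compact_supp_\<alpha>[of j] by (intro compact_supp_mult1 compact_supp_mult2; simp)+
 have int: "integrable lborel (dz j ?F)" "integrable lborel (dzbar k ?G)" "integrable lborel (dz j ?H)"
  using products_Ck supp Ck_dz[of 0] Ck_dzbar[of 0]
  by (auto intro!: integrable_compact_supp compact_supp_dz compact_supp_dzbar simp: Ck.simps(1) One_nat_def)
 have divergence: "bochner_term j k x * E x = dz j ?F x - dzbar k ?G x + dz j ?H x" for x
  unfolding dz_\<alpha>_cnj_D_\<alpha> dzbar_\<alpha>_cnj_dzbar_\<alpha> dz_\<alpha>_dzbar_\<eta>_cnj_\<alpha> bochner_term_def by (simp add: algebra_simps)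
 show "integrable lborel (\<lambda>x. bochner_term j k x * E x)" "(\<integral>x. bochner_term j k x * E x \<partial>lborel) = 0"
  unfolding divergence using int integral_dz_eq_0[OF products_Ck(1) supp(1)] integral_dz_eq_0[OF products_Ck(2) supp(2)] integral_dz_eq_0[OF products_Ck(3) supp(3)]
  by simp_all
qed

definition bochner_sum :: "complex^'n \<Rightarrow> complex" where
 "bochner_sum x = (\<Sum>j\<in>UNIV. \<Sum>k\<in>UNIV. bochner_term j k x)"

lemma integral_bochner_sum:
 "integrable lborel (\<lambda>x. Re (bochner_sum x) * E x)" "(\<integral>x. Re (bochner_sum x) * E x \<partial>lborel) = 0"
proof -
 have "(\<lambda>x. bochner_sum x * complex_of_real (E x)) = (\<lambda>x. \<Sum>j\<in>UNIV. \<Sum>k\<in>UNIV. bochner_term j k x * E x)"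
  by (simp add: bochner_sum_def sum_distrib_right)
 then have int: "integrable lborel (\<lambda>x. bochner_sum x * complex_of_real (E x))" and "(\<integral>x. bochner_sum x * complex_of_real (E x) \<partial>lborel) = 0"
  using integral_bochner_term by (simp_all add: integral_sum integrable_sum)
 then show "integrable lborel (\<lambda>x. Re (bochner_sum x) * E x)" "(\<integral>x. Re (bochner_sum x) * E x \<partial>lborel) = 0"
  using integrable_Re[OF int] integral_Re[OF int] by simp_all
qed

lemma bochner_sum_eq:
 "bochner_sum x = \<eta>\<^sub>c x * (Box v x * cnj (Box v x)) - dz m \<eta>\<^sub>c x * \<alpha> m x * cnj (Box v x)
   - \<eta>\<^sub>c x * (\<Sum>j\<in>UNIV. \<Sum>k\<in>UNIV. \<alpha> j x * cnj (dzbar j (ph k) x * \<alpha> k x))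
   - \<eta>\<^sub>c x * (\<Sum>j\<in>UNIV. \<Sum>k\<in>UNIV. dzbar k (\<alpha> j) x * cnj (dzbar j (\<alpha> k) x))
   - cnj (dz m \<eta>\<^sub>c x * \<alpha> m x * cnj (Box v x)) + dz m (dzbar m \<eta>\<^sub>c) x * (\<alpha> m x * cnj (\<alpha> m x))"
proof -
 let ?\<Sigma> = "\<lambda>f :: 'n \<Rightarrow> 'n \<Rightarrow> complex. \<Sum>j\<in>UNIV. \<Sum>k\<in>UNIV. f j k"
 have Box: "Box v x = - (\<Sum>j\<in>UNIV. D j (\<alpha> j) x)" by (simp add: Box_def \<alpha>_def)
 have "?\<Sigma> (\<lambda>j k. D j (\<alpha> j) x * cnj (D k (\<alpha> k) x)) = Box v x * cnj (Box v x)"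
  unfolding Box by (simp add: sum_product)
 moreover have "?\<Sigma> (\<lambda>j k. dz j \<eta>\<^sub>c x * \<alpha> j x * cnj (D k (\<alpha> k) x)) = - (dz m \<eta>\<^sub>c x * \<alpha> m x * cnj (Box v x))"
 proof -
  have "?\<Sigma> (\<lambda>j k. dz j \<eta>\<^sub>c x * \<alpha> j x * cnj (D k (\<alpha> k) x)) = (\<Sum>j\<in>UNIV. dz j \<eta>\<^sub>c x * \<alpha> j x * (- cnj (Box v x)))"
   unfolding Box by (simp add: sum_distrib_left)
  also have "\<dots> = (\<Sum>j\<in>UNIV. if j = m then dz m \<eta>\<^sub>c x * \<alpha> m x * (- cnj (Box v x)) else 0)"
   using dz_\<eta>_eq_0 by (intro sum.cong) auto
  finally show ?thesis by simp
 qed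
 moreover have "?\<Sigma> (\<lambda>j k. dzbar k \<eta>\<^sub>c x * D j (\<alpha> j) x * cnj (\<alpha> k x)) = - cnj (dz m \<eta>\<^sub>c x * \<alpha> m x * cnj (Box v x))"
 proof -
  have "?\<Sigma> (\<lambda>j k. dzbar k \<eta>\<^sub>c x * D j (\<alpha> j) x * cnj (\<alpha> k x)) = (\<Sum>k\<in>UNIV. cnj (dz k \<eta>\<^sub>c x) * (- Box v x) * cnj (\<alpha> k x))"
   unfolding Box dzbar_\<eta> by (subst sum.swap) (simp add: sum_distrib_left sum_distrib_right mult.assoc)
  also have "\<dots> = (\<Sum>k\<in>UNIV. if k = m then cnj (dz m \<eta>\<^sub>c x) * (- Box v x) * cnj (\<alpha> m x) else 0)"
   using dz_\<eta>_eq_0 by (intro sum.cong) auto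
  finally show ?thesis by (simp add: mult_ac)
 qed
 moreover have "?\<Sigma> (\<lambda>j k. dz j (dzbar k \<eta>\<^sub>c) x * \<alpha> j x * cnj (\<alpha> k x)) = dz m (dzbar m \<eta>\<^sub>c) x * (\<alpha> m x * cnj (\<alpha> m x))"
 proof -
  have "?\<Sigma> (\<lambda>j k. dz j (dzbar k \<eta>\<^sub>c) x * \<alpha> j x * cnj (\<alpha> k x))
    = ?\<Sigma> (\<lambda>j k. if k = m then (if j = m then dz m (dzbar m \<eta>\<^sub>c) x * (\<alpha> m x * cnj (\<alpha> m x)) else 0) else 0)"
   using dz_dzbar_\<eta>_eq_0 by (intro sum.cong refl) auto
  then show ?thesis by simp
 qed
 ultimately show ?thesis
  unfolding bochner_sum_def bochner_term_def sum.distrib sum_subtractf sum_distrib_left[symmetric] by simp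
qed

lemma Re_bochner_sum_le:
 "Re (bochner_sum x) \<le> (\<eta> x + (norm (dz m \<eta>\<^sub>c x))\<^sup>2) * (norm (Box v x))\<^sup>2
   - (2 * \<eta> x - Re (dz m (dzbar m \<eta>\<^sub>c) x) - 1) * (norm (\<alpha> m x))\<^sup>2"
proof -
 define c where "c = dz m \<eta>\<^sub>c x * \<alpha> m x * cnj (Box v x)"
 define curvature where "curvature = (\<Sum>j\<in>UNIV. \<Sum>k\<in>UNIV. \<alpha> j x * cnj (dzbar j (ph k) x * \<alpha> k x))"
 define gradient where "gradient = (\<Sum>j\<in>UNIV. \<Sum>k\<in>UNIV. dzbar k (\<alpha> j) x * cnj (dzbar j (\<alpha> k) x))"
 have "dzbar k (\<alpha> j) x * cnj (dzbar j (\<alpha> k) x) = complex_of_real ((norm (dzbar k (\<alpha> j) x))\<^sup>2)" for j k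
  unfolding dzbar_\<alpha>_commute[of j k] by (rule complex_norm_square[symmetric])
 then have "Re gradient \<ge> 0" by (simp add: gradient_def sum_nonneg)
 then have gradient: "\<eta> x * Re gradient \<ge> 0" using \<eta>_nonneg[of x] by simp
 have curvature: "\<eta> x * (2 * (norm (\<alpha> m x))\<^sup>2) \<le> \<eta> x * Re curvature"
  unfolding curvature_def by (intro mult_left_mono psh \<eta>_nonneg)
 have "- Re c \<le> norm (dz m \<eta>\<^sub>c x) * norm (Box v x) * norm (\<alpha> m x)"
  using abs_Re_le_cmod[of c] by (simp add: c_def norm_mult mult_ac)
 then have cross: "- 2 * Re c \<le> (norm (dz m \<eta>\<^sub>c x))\<^sup>2 * (norm (Box v x))\<^sup>2 + (norm (\<alpha> m x))\<^sup>2"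
  using sum_squares_bound[of "norm (dz m \<eta>\<^sub>c x) * norm (Box v x)" "norm (\<alpha> m x)"] by (simp add: power_mult_distrib)
 have "Re (bochner_sum x) = \<eta> x * (norm (Box v x))\<^sup>2 - 2 * Re c - \<eta> x * Re curvature - \<eta> x * Re gradient
   + Re (dz m (dzbar m \<eta>\<^sub>c) x) * (norm (\<alpha> m x))\<^sup>2"
  unfolding bochner_sum_eq c_def[symmetric] curvature_def[symmetric] gradient_def[symmetric] complex_norm_square[symmetric] by simp
 then show ?thesis using cross curvature gradient by (simp add: algebra_simps)
qed

theorem bochner_inequality:
 assumes \<kappa>: "continuous_on UNIV \<kappa>" "\<And>x. \<kappa> x \<le> 2 * \<eta> x - Re (dz m (dzbar m \<eta>\<^sub>c) x) - 1"
 shows "(\<integral>x. \<kappa> x * (norm (dzbar m v x))\<^sup>2 * E x \<partial>lborel)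
   \<le> (\<integral>x. (\<eta> x + (norm (dz m \<eta>\<^sub>c x))\<^sup>2) * (norm (Box v x))\<^sup>2 * E x \<partial>lborel)"
proof -
 have "continuous_on UNIV E" "continuous_on UNIV \<eta>"
  using continuous_on_Re[OF Ck_cont[OF E_Ck]] continuous_on_Re[OF Ck_cont[OF Ck_\<eta>]] by simp_all
 moreover have "continuous_on UNIV (dz m \<eta>\<^sub>c)" using Ck_dz[of 0 \<eta>\<^sub>c m] Ck_\<eta> by (simp add: Ck.simps(1) One_nat_def)
 moreover have "continuous_on UNIV (Box v)" by (rule continuous_on_Box[OF Ck_v])
 moreover have "compact_supp (\<lambda>x. f x * (norm (Box v x))\<^sup>2 * E x)" "compact_supp (\<lambda>x. f x * (norm (\<alpha> m x))\<^sup>2 * E x)" for f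
  by (rule compact_supp_mult1[OF compact_supp_mult2], rule compact_supp_comp[where h = "\<lambda>z. (norm z)\<^sup>2"],
    simp_all add: compact_supp_Box compact_supp_v compact_supp_\<alpha>)+
 ultimately have int: "integrable lborel (\<lambda>x. (\<eta> x + (norm (dz m \<eta>\<^sub>c x))\<^sup>2) * (norm (Box v x))\<^sup>2 * E x)"
   "integrable lborel (\<lambda>x. \<kappa> x * (norm (\<alpha> m x))\<^sup>2 * E x)"
  using \<kappa>(1) Ck_cont[OF Ck_\<alpha>(2)[of m]]
  by (auto intro!: integrable_compact_supp continuous_intros)
 have "Re (bochner_sum x) * E x \<le> (\<eta> x + (norm (dz m \<eta>\<^sub>c x))\<^sup>2) * (norm (Box v x))\<^sup>2 * E x - \<kappa> x * (norm (\<alpha> m x))\<^sup>2 * E x" for x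
 proof -
  have "Re (bochner_sum x) \<le> (\<eta> x + (norm (dz m \<eta>\<^sub>c x))\<^sup>2) * (norm (Box v x))\<^sup>2 - \<kappa> x * (norm (\<alpha> m x))\<^sup>2"
   using Re_bochner_sum_le[of x] mult_right_mono[OF \<kappa>(2)[of x], of "(norm (\<alpha> m x))\<^sup>2"] by simp
  then show ?thesis using E_pos[of x] by (simp add: left_diff_distrib[symmetric] mult_right_mono)
 qed
 from integral_mono[OF integral_bochner_sum(1) Bochner_Integration.integrable_diff[OF int] this] show ?thesis
  unfolding integral_bochner_sum(2) Bochner_Integration.integral_diff[OF int] by (simp add: \<alpha>_def)
qed

end

lemma borel_measurable_cnj [measurable (raw)]:
 "f \<in> borel_measurable M \<Longrightarrow> (\<lambda>x. cnj (f x)) \<in> borel_measurable M"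
 by (rule borel_measurable_continuous_on[of cnj]) (auto intro: continuous_intros)

lemma le_sqrt_mult: "x\<^sup>2 \<le> a * b \<Longrightarrow> x \<le> sqrt a * sqrt b"
 by (simp add: real_le_rsqrt real_sqrt_mult[symmetric])

lemma norm_add_sq_le: "(norm (a + b))\<^sup>2 \<le> 2 * (norm a)\<^sup>2 + 2 * (norm (b::'a::real_normed_vector))\<^sup>2"
proof -
 have "(norm (a + b))\<^sup>2 \<le> (norm a + norm b)\<^sup>2" by (intro power_mono norm_triangle_ineq) auto
 also have "\<dots> \<le> 2 * (norm a)\<^sup>2 + 2 * (norm b)\<^sup>2"
  using sum_squares_bound[of "norm a" "norm b"] by (simp add: power2_sum)
 finally show ?thesis .
qed

lemma L2_Cauchy_Schwarz:
 fixes f g :: "'a \<Rightarrow> complex"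
 assumes [measurable]: "f \<in> borel_measurable M" "g \<in> borel_measurable M"
  and f_int: "integrable M (\<lambda>x. (norm (f x))\<^sup>2)" and g_int: "integrable M (\<lambda>x. (norm (g x))\<^sup>2)"
 shows "integrable M (\<lambda>x. f x * g x)"
  and "norm (\<integral>x. f x * g x \<partial>M) \<le> sqrt (\<integral>x. (norm (f x))\<^sup>2 \<partial>M) * sqrt (\<integral>x. (norm (g x))\<^sup>2 \<partial>M)"
proof -
 show int: "integrable M (\<lambda>x. f x * g x)"
 proof (rule Bochner_Integration.integrable_bound[OF Bochner_Integration.integrable_add[OF f_int g_int]])
  have "norm (f x * g x) \<le> (norm (f x))\<^sup>2 + (norm (g x))\<^sup>2" for x
  proof -
   have "2 * (norm (f x) * norm (g x)) \<le> (norm (f x))\<^sup>2 + (norm (g x))\<^sup>2" "0 \<le> norm (f x) * norm (g x)"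
    using sum_squares_bound[of "norm (f x)" "norm (g x)"] by (simp_all add: mult.assoc)
   then show ?thesis unfolding norm_mult by linarith
  qed
  then show "AE x in M. norm (f x * g x) \<le> norm ((norm (f x))\<^sup>2 + (norm (g x))\<^sup>2)" by simp
 qed measurable
 have "(ennreal (norm (\<integral>x. f x * g x \<partial>M)))\<^sup>2 \<le> (\<integral>\<^sup>+x. ennreal (norm (f x)) * ennreal (norm (g x)) \<partial>M)\<^sup>2"
  using integral_norm_bound_ennreal[OF int] by (intro power_mono) (simp_all add: norm_mult ennreal_mult)
 also have "\<dots> \<le> (\<integral>\<^sup>+x. ennreal (norm (f x)) ^ 2 \<partial>M) * (\<integral>\<^sup>+x. ennreal (norm (g x)) ^ 2 \<partial>M)"
  by (rule Cauchy_Schwarz_nn_integral) auto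
 also have "\<dots> = ennreal ((\<integral>x. (norm (f x))\<^sup>2 \<partial>M) * (\<integral>x. (norm (g x))\<^sup>2 \<partial>M))"
  using f_int g_int by (simp add: ennreal_power nn_integral_eq_integral ennreal_mult)
 finally have "(norm (\<integral>x. f x * g x \<partial>M))\<^sup>2 \<le> (\<integral>x. (norm (f x))\<^sup>2 \<partial>M) * (\<integral>x. (norm (g x))\<^sup>2 \<partial>M)"
  by (simp add: ennreal_power ennreal_le_iff)
 then show "norm (\<integral>x. f x * g x \<partial>M) \<le> sqrt (\<integral>x. (norm (f x))\<^sup>2 \<partial>M) * sqrt (\<integral>x. (norm (g x))\<^sup>2 \<partial>M)"
  by (rule le_sqrt_mult)
qed

lemma convergent_of_weighted_square_sum:
 fixes z :: "nat \<Rightarrow> complex"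
 assumes "(\<Sum>j. ennreal (2 ^ j) * ennreal ((norm (z (Suc j) - z j))\<^sup>2)) \<noteq> \<infinity>"
 shows "convergent z"
proof -
 obtain B where sum_eq_B: "(\<Sum>j. ennreal (2 ^ j) * ennreal ((norm (z (Suc j) - z j))\<^sup>2)) = ennreal B" "B \<ge> 0"
  using assms by (cases "\<Sum>j. ennreal (2 ^ j) * ennreal ((norm (z (Suc j) - z j))\<^sup>2)" rule: ennreal_cases) auto
 have "norm (z (Suc j) - z j) \<le> sqrt B * (sqrt (1/2)) ^ j" for j
 proof -
  have "ennreal (2 ^ j) * ennreal ((norm (z (Suc j) - z j))\<^sup>2) \<le> ennreal B"
   unfolding sum_eq_B(1)[symmetric] using sum_le_suminf[of "\<lambda>j. ennreal (2 ^ j) * ennreal ((norm (z (Suc j) - z j))\<^sup>2)" "{j}"] by simp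
  then have "2 ^ j * (norm (z (Suc j) - z j))\<^sup>2 \<le> B" using sum_eq_B(2) by (simp add: ennreal_mult[symmetric] ennreal_le_iff)
  then have "(norm (z (Suc j) - z j))\<^sup>2 \<le> B * (1/2) ^ j" by (simp add: field_simps power_divide)
  then show ?thesis using real_le_rsqrt by (fastforce simp: real_sqrt_mult real_sqrt_power)
 qed
 moreover have "summable (\<lambda>j. sqrt B * (sqrt (1/2)) ^ j)"
  by (intro summable_mult summable_geometric) (simp add: real_sqrt_divide)
 ultimately have "summable (\<lambda>j. z (Suc j) - z j)"
  using summable_comparison_test'[of "\<lambda>j. sqrt B * (sqrt (1/2)) ^ j" 0 "\<lambda>j. z (Suc j) - z j"] by blast
 then have "(\<lambda>n. z n - z 0) \<longlonglongrightarrow> (\<Sum>j. z (Suc j) - z j)"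
  using summable_LIMSEQ by (fastforce simp: sum_lessThan_telescope)
 from tendsto_add[OF this tendsto_const[of "z 0"]] show ?thesis by (simp add: convergentI)
qed

lemma rapidly_Cauchy_L2_imp_AE_convergent:
 fixes f :: "nat \<Rightarrow> 'a \<Rightarrow> complex"
 assumes [measurable]: "\<And>j. f j \<in> borel_measurable M"
  and rapid: "\<And>j. (\<integral>\<^sup>+x. ennreal ((norm (f (Suc j) x - f j x))\<^sup>2) \<partial>M) \<le> ennreal ((1/4) ^ j)"
 obtains U where "U \<in> borel_measurable M" "AE x in M. (\<lambda>j. f j x) \<longlonglongrightarrow> U x"
proof -
 have "(\<integral>\<^sup>+x. (\<Sum>j. ennreal (2 ^ j) * ennreal ((norm (f (Suc j) x - f j x))\<^sup>2)) \<partial>M)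
   = (\<Sum>j. ennreal (2 ^ j) * (\<integral>\<^sup>+x. ennreal ((norm (f (Suc j) x - f j x))\<^sup>2) \<partial>M))"
  by (simp add: nn_integral_suminf nn_integral_cmult)
 also have "\<dots> \<le> (\<Sum>j. ennreal (2 ^ j) * ennreal ((1/4) ^ j))"
  by (intro suminf_le mult_left_mono rapid) auto
 also have "\<dots> = (\<Sum>j. ennreal ((1/2) ^ j))"
  by (simp add: ennreal_mult[symmetric] power_mult_distrib[symmetric])
 also have "\<dots> = ennreal (\<Sum>j. (1/2) ^ j)"
  by (intro suminf_ennreal2) (auto intro: summable_geometric)
 finally have finite: "(\<integral>\<^sup>+x. (\<Sum>j. ennreal (2 ^ j) * ennreal ((norm (f (Suc j) x - f j x))\<^sup>2)) \<partial>M) \<noteq> \<infinity>"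
  by (auto simp: top_unique)
 have "AE x in M. (\<Sum>j. ennreal (2 ^ j) * ennreal ((norm (f (Suc j) x - f j x))\<^sup>2)) \<noteq> \<infinity>"
  by (rule nn_integral_PInf_AE[OF _ finite]) measurable
 then have "AE x in M. (\<lambda>j. f j x) \<longlonglongrightarrow> lim (\<lambda>j. f j x)"
  by eventually_elim (use convergent_of_weighted_square_sum in \<open>auto simp: convergent_LIMSEQ_iff\<close>)
 moreover have "(\<lambda>x. lim (\<lambda>j. f j x)) \<in> borel_measurable M"
  by (rule borel_measurable_lim_metric) simp
 ultimately show ?thesis using that by blast
qed

lemma rapidly_Cauchy_L2_limit:
 fixes f :: "nat \<Rightarrow> 'a \<Rightarrow> complex"
 assumes f [measurable]: "\<And>j. f j \<in> borel_measurable M" and f_L2: "\<And>j. integrable M (\<lambda>x. (norm (f j x))\<^sup>2)"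
  and rapid: "\<And>i j. j \<le> i \<Longrightarrow> (\<integral>\<^sup>+x. ennreal ((norm (f i x - f j x))\<^sup>2) \<partial>M) \<le> ennreal ((1/4) ^ j)"
 obtains U where "U \<in> borel_measurable M" "integrable M (\<lambda>x. (norm (U x))\<^sup>2)"
  "\<And>j. integrable M (\<lambda>x. (norm (U x - f j x))\<^sup>2)" "\<And>j. (\<integral>x. (norm (U x - f j x))\<^sup>2 \<partial>M) \<le> (1/4) ^ j"
proof -
 have "(\<integral>\<^sup>+x. ennreal ((norm (f (Suc j) x - f j x))\<^sup>2) \<partial>M) \<le> ennreal ((1/4) ^ j)" for j by (rule rapid) simp
 from rapidly_Cauchy_L2_imp_AE_convergent[where f = f, OF f this]
 obtain U where U [measurable]: "U \<in> borel_measurable M" and lim: "AE x in M. (\<lambda>j. f j x) \<longlonglongrightarrow> U x" .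
 have dist: "(\<integral>\<^sup>+x. ennreal ((norm (U x - f j x))\<^sup>2) \<partial>M) \<le> ennreal ((1/4) ^ j)" for j
 proof -
  have "(\<integral>\<^sup>+x. ennreal ((norm (U x - f j x))\<^sup>2) \<partial>M) = (\<integral>\<^sup>+x. liminf (\<lambda>i. ennreal ((norm (f i x - f j x))\<^sup>2)) \<partial>M)"
  proof (rule nn_integral_cong_AE, rule AE_mp[OF lim], intro AE_I2 impI)
   fix x assume "(\<lambda>i. f i x) \<longlonglongrightarrow> U x"
   then have "(\<lambda>i. ennreal ((norm (f i x - f j x))\<^sup>2)) \<longlonglongrightarrow> ennreal ((norm (U x - f j x))\<^sup>2)"
    by (intro tendsto_ennrealI tendsto_intros)
   from lim_imp_Liminf[OF _ this]
   show "ennreal ((norm (U x - f j x))\<^sup>2) = liminf (\<lambda>i. ennreal ((norm (f i x - f j x))\<^sup>2))" by simp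
  qed
  also have "\<dots> \<le> liminf (\<lambda>i. \<integral>\<^sup>+x. ennreal ((norm (f i x - f j x))\<^sup>2) \<partial>M)"
   by (rule nn_integral_liminf) measurable
  also have "\<dots> \<le> liminf (\<lambda>i. ennreal ((1/4) ^ j))"
   by (rule Liminf_mono) (use rapid in \<open>auto simp: eventually_sequentially\<close>)
  finally show ?thesis by (simp add: Liminf_const)
 qed
 have int: "integrable M (\<lambda>x. (norm (U x - f j x))\<^sup>2)" for j
  using dist[of j] by (intro integrableI_nonneg) (auto intro: le_less_trans)
 have bound: "(\<integral>x. (norm (U x - f j x))\<^sup>2 \<partial>M) \<le> (1/4) ^ j" for j
  using dist[of j] nn_integral_eq_integral[OF int[of j]] by (simp add: ennreal_le_iff)
 have "integrable M (\<lambda>x. (norm (U x))\<^sup>2)"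
 proof (rule Bochner_Integration.integrable_bound)
  show "integrable M (\<lambda>x. 2 * (norm (U x - f 0 x))\<^sup>2 + 2 * (norm (f 0 x))\<^sup>2)" using int[of 0] f_L2[of 0] by simp
  show "AE x in M. norm ((norm (U x))\<^sup>2) \<le> norm (2 * (norm (U x - f 0 x))\<^sup>2 + 2 * (norm (f 0 x))\<^sup>2)"
   using norm_add_sq_le[of "U x - f 0 x" "f 0 x" for x] by simp
 qed measurable
 then show thesis using that[OF U] int bound by blast
qed

lemma le_product_of_quadratic_nonneg:
 fixes a n q :: real
 assumes quadratic: "\<And>t. 0 \<le> a + t\<^sup>2 * (n * q) - 2 * t * n" and "n \<ge> 0" "q \<ge> 0"
 shows "n \<le> a * q"
proof (cases "q = 0")
 case True
 have "n = 0"
 proof (rule ccontr)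
  assume "n \<noteq> 0"
  then show False using quadratic[of "(a + 1) / (2 * n)"] quadratic[of 0] True by simp
 qed
 then show ?thesis using True by simp
next
 case False
 then have "(1 / q)\<^sup>2 * (n * q) - 2 * (1 / q) * n = - (n / q)" by (simp add: power2_eq_square)
 then have "n / q \<le> a" using quadratic[of "1 / q"] by linarith
 then show ?thesis using False \<open>q \<ge> 0\<close> by (simp add: divide_le_eq)
qed

text \<open>Riesz representation without a completion: minimise \<open>\<parallel>T v\<parallel>\<^sup>2 - 2 Re (l v)\<close> over \<open>V\<close>.\<close>

locale L2_bounded_functional =
 fixes M :: "'a measure" and V :: "('b \<Rightarrow> complex) set" and T :: "('b \<Rightarrow> complex) \<Rightarrow> 'a \<Rightarrow> complex"
  and l :: "('b \<Rightarrow> complex) \<Rightarrow> complex" and A :: real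
 assumes V_nonempty: "V \<noteq> {}"
  and V_comb: "v \<in> V \<Longrightarrow> w \<in> V \<Longrightarrow> (\<lambda>y. v y + c * w y) \<in> V"
  and T_comb: "v \<in> V \<Longrightarrow> w \<in> V \<Longrightarrow> T (\<lambda>y. v y + c * w y) x = T v x + c * T w x"
  and l_comb: "v \<in> V \<Longrightarrow> w \<in> V \<Longrightarrow> l (\<lambda>y. v y + c * w y) = l v + cnj c * l w"
  and T_measurable: "v \<in> V \<Longrightarrow> T v \<in> borel_measurable M"
  and T_L2: "v \<in> V \<Longrightarrow> integrable M (\<lambda>x. (norm (T v x))\<^sup>2)"
  and A_nonneg: "A \<ge> 0"
  and l_bound: "v \<in> V \<Longrightarrow> (norm (l v))\<^sup>2 \<le> A * (\<integral>x. (norm (T v x))\<^sup>2 \<partial>M)"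
begin

definition Q :: "('b \<Rightarrow> complex) \<Rightarrow> real" where "Q v = (\<integral>x. (norm (T v x))\<^sup>2 \<partial>M)"
definition B :: "('b \<Rightarrow> complex) \<Rightarrow> ('b \<Rightarrow> complex) \<Rightarrow> complex" where "B v w = (\<integral>x. T v x * cnj (T w x) \<partial>M)"
definition J :: "('b \<Rightarrow> complex) \<Rightarrow> real" where "J v = Q v - 2 * Re (l v)"
definition J_inf :: real where "J_inf = Inf (J ` V)"

lemma Q_nonneg: "Q v \<ge> 0"
 unfolding Q_def by (intro integral_nonneg_AE) simp

lemma integrable_mult_cnj_T:
 assumes "U \<in> borel_measurable M" "integrable M (\<lambda>x. (norm (U x))\<^sup>2)" "w \<in> V"
 shows "integrable M (\<lambda>x. U x * cnj (T w x))"
  and "norm (\<integral>x. U x * cnj (T w x) \<partial>M) \<le> sqrt (\<integral>x. (norm (U x))\<^sup>2 \<partial>M) * sqrt (Q w)"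
 using L2_Cauchy_Schwarz[of U M "\<lambda>x. cnj (T w x)"] assms T_measurable[OF assms(3)] T_L2[OF assms(3)] by (simp_all add: Q_def)

lemma norm_add_mult_sq:
 "(norm (a + c * d))\<^sup>2 = (norm a)\<^sup>2 + 2 * Re (cnj c * (a * cnj d)) + (norm c)\<^sup>2 * (norm (d :: complex))\<^sup>2"
proof -
 have "complex_of_real ((norm (a + c * d))\<^sup>2) = (norm a)\<^sup>2 + (cnj c * (a * cnj d)) + cnj (cnj c * (a * cnj d)) + (norm c)\<^sup>2 * (norm d)\<^sup>2"
  unfolding of_real_power[symmetric] of_real_mult of_real_add complex_norm_square by (simp add: algebra_simps)
 from arg_cong[OF this, of Re] show ?thesis by (simp add: algebra_simps)
qed

lemma Q_comb:
 assumes v_in: "v \<in> V" and w_in: "w \<in> V"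
 shows "Q (\<lambda>y. v y + c * w y) = Q v + 2 * Re (cnj c * B v w) + (norm c)\<^sup>2 * Q w"
proof -
 define g where "g x = cnj c * (T v x * cnj (T w x))" for x
 have g_rep: "integrable M g" "(\<integral>x. g x \<partial>M) = cnj c * B v w"
  using integrable_mult_cnj_T(1)[OF T_measurable[OF v_in] T_L2[OF v_in] w_in] by (simp_all add: g_def[abs_def] B_def)
 then show ?thesis
  unfolding Q_def T_comb[OF v_in w_in] norm_add_mult_sq g_def[symmetric] using T_L2[OF v_in] T_L2[OF w_in] integrable_Re[OF g_rep(1)] integral_Re[OF g_rep(1)] by simp
qed

lemma J_comb:
 "v \<in> V \<Longrightarrow> w \<in> V \<Longrightarrow> J (\<lambda>y. v y + c * w y) = J v + (norm c)\<^sup>2 * Q w + 2 * Re (cnj c * (B v w - l w))"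
 unfolding J_def by (simp add: Q_comb l_comb algebra_simps)

lemma J_lower_bound:
 assumes "v \<in> V" shows "2 * Re (l v) \<le> A + Q v"
proof -
 have "norm (l v) \<le> sqrt A * sqrt (Q v)" using l_bound[OF assms] by (intro le_sqrt_mult) (simp add: Q_def)
 moreover have "2 * sqrt A * sqrt (Q v) \<le> (sqrt A)\<^sup>2 + (sqrt (Q v))\<^sup>2" by (rule sum_squares_bound)
 moreover have "(sqrt A)\<^sup>2 = A" "(sqrt (Q v))\<^sup>2 = Q v" using A_nonneg Q_nonneg by auto
 ultimately show ?thesis using complex_Re_le_cmod[of "l v"] by linarith
qed

lemma J_inf_le: "v \<in> V \<Longrightarrow> J_inf \<le> J v"
 unfolding J_inf_def using J_lower_bound by (intro cInf_lower bdd_belowI[of _ "- A"]) (fastforce simp: J_def)+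

lemma ex_near_minimiser: "\<epsilon> > 0 \<Longrightarrow> \<exists>v\<in>V. J v < J_inf + \<epsilon>"
 using cInf_lessD[of "J ` V" "J_inf + \<epsilon>"] V_nonempty by (auto simp: J_inf_def)

lemma defect_bound:
 assumes v_in: "v \<in> V" and w_in: "w \<in> V"
 shows "(norm (B v w - l w))\<^sup>2 \<le> (J v - J_inf) * Q w"
proof (rule le_product_of_quadratic_nonneg)
 fix t :: real
 define b c where "b = B v w - l w" and "c = - complex_of_real t * b"
 have "Re (cnj c * b) = - t * (norm b)\<^sup>2"
  by (simp add: c_def cmod_power2 algebra_simps) (simp add: power2_eq_square algebra_simps)
 moreover have "J_inf \<le> J v + (norm c)\<^sup>2 * Q w + 2 * Re (cnj c * b)"
  using J_inf_le[OF V_comb[OF v_in w_in]] unfolding J_comb[OF v_in w_in] b_def .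
 moreover have "(norm c)\<^sup>2 = t\<^sup>2 * (norm b)\<^sup>2" by (simp add: c_def norm_mult power_mult_distrib)
 ultimately show "0 \<le> (J v - J_inf) + t\<^sup>2 * ((norm (B v w - l w))\<^sup>2 * Q w) - 2 * t * (norm (B v w - l w))\<^sup>2"
  unfolding b_def[symmetric] by (simp add: mult.assoc)
qed (simp_all add: Q_nonneg)

lemma near_minimisers_close:
 assumes v_in: "v \<in> V" "v' \<in> V" and near: "J v \<le> J_inf + \<epsilon>" "J v' \<le> J_inf + \<epsilon>"
 shows "Q (\<lambda>y. v' y + (-1) * v y) \<le> 4 * \<epsilon>"
proof -
 define w where "w = (\<lambda>y. v' y + (-1) * v y)"
 have w_in: "w \<in> V" using V_comb[OF v_in(2,1)] by (simp only: w_def)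
 have "J v' = J v + Q w + 2 * Re (B v w - l w)" using J_comb[OF v_in(1) w_in, of 1] by (simp add: w_def)
 moreover have "J_inf \<le> J v + Q w / 4 + Re (B v w - l w)"
  using J_inf_le[OF V_comb[OF v_in(1) w_in, of "1/2"]] unfolding J_comb[OF v_in(1) w_in] by (simp add: power2_eq_square norm_divide diff_divide_distrib)
 ultimately show ?thesis using near unfolding w_def[symmetric] by linarith
qed

lemma minimising_limit:
 obtains U v where "U \<in> borel_measurable M" "integrable M (\<lambda>x. (norm (U x))\<^sup>2)"
  "\<And>j. v j \<in> V" "\<And>j. J (v j) \<le> J_inf + (1/4) ^ j"
  "\<And>j. integrable M (\<lambda>x. (norm (U x - T (v j) x))\<^sup>2)" "\<And>j. (\<integral>x. (norm (U x - T (v j) x))\<^sup>2 \<partial>M) \<le> (1/4) ^ j"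
proof -
 have "\<forall>j. \<exists>v\<in>V. J v < J_inf + (1/4) ^ j / 4" using ex_near_minimiser by simp
 then obtain v where v_in: "\<And>j. v j \<in> V" and near: "\<And>j. J (v j) < J_inf + (1/4) ^ j / 4" by metis
 have rapid: "(\<integral>\<^sup>+x. ennreal ((norm (T (v i) x - T (v j) x))\<^sup>2) \<partial>M) \<le> ennreal ((1/4) ^ j)" if "j \<le> i" for i j
 proof -
  let ?w = "\<lambda>y. v i y + (-1) * v j y"
  have "(1/4::real) ^ i \<le> (1/4) ^ j" using that by (intro power_decreasing) auto
  then have "Q ?w \<le> 4 * ((1/4) ^ j / 4)" using near[of i] near[of j] by (intro near_minimisers_close v_in) linarith+
  moreover have "T (v i) x - T (v j) x = T ?w x" for x unfolding T_comb[OF v_in v_in] by simp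
  then have "(\<integral>\<^sup>+x. ennreal ((norm (T (v i) x - T (v j) x))\<^sup>2) \<partial>M) = (\<integral>\<^sup>+x. ennreal ((norm (T ?w x))\<^sup>2) \<partial>M)"
   by (simp only:)
  moreover have "\<dots> = ennreal (Q ?w)" unfolding Q_def by (rule nn_integral_eq_integral[OF T_L2[OF V_comb[OF v_in v_in]]]) simp
  ultimately show ?thesis by (simp add: ennreal_leI)
 qed
 obtain U where U_props: "U \<in> borel_measurable M" "integrable M (\<lambda>x. (norm (U x))\<^sup>2)"
  "\<And>j. integrable M (\<lambda>x. (norm (U x - T (v j) x))\<^sup>2)" "\<And>j. (\<integral>x. (norm (U x - T (v j) x))\<^sup>2 \<partial>M) \<le> (1/4) ^ j"
  using rapidly_Cauchy_L2_limit[where f = "\<lambda>j. T (v j)", OF T_measurable[OF v_in] T_L2[OF v_in] rapid] by blast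
 have "J (v j) \<le> J_inf + (1/4) ^ j" for j
 proof -
  have "0 \<le> (1/4::real) ^ j" by simp
  then show ?thesis using near[of j] by linarith
 qed
 then show thesis using that[of U v] U_props v_in by blast
qed

lemma minimising_limit_represents:
 assumes U_L2: "U \<in> borel_measurable M" "integrable M (\<lambda>x. (norm (U x))\<^sup>2)"
  and v_minimising: "\<And>j. v j \<in> V" "\<And>j. J (v j) \<le> J_inf + (1/4) ^ j"
  and diff: "\<And>j. integrable M (\<lambda>x. (norm (U x - T (v j) x))\<^sup>2)" "\<And>j. (\<integral>x. (norm (U x - T (v j) x))\<^sup>2 \<partial>M) \<le> (1/4) ^ j"
  and w_in: "w \<in> V"
 shows "(\<integral>x. U x * cnj (T w x) \<partial>M) = l w"
proof -
 have bound: "norm ((\<integral>x. U x * cnj (T w x) \<partial>M) - l w) \<le> 2 * (sqrt ((1/4) ^ j) * sqrt (Q w))" for j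
 proof -
  have "(\<integral>x. (U x - T (v j) x) * cnj (T w x) \<partial>M) = (\<integral>x. U x * cnj (T w x) \<partial>M) - B (v j) w"
   unfolding B_def left_diff_distrib
   by (intro Bochner_Integration.integral_diff integrable_mult_cnj_T U_L2 w_in T_measurable T_L2 v_minimising)
  moreover have "norm (\<integral>x. (U x - T (v j) x) * cnj (T w x) \<partial>M) \<le> sqrt (\<integral>x. (norm (U x - T (v j) x))\<^sup>2 \<partial>M) * sqrt (Q w)"
   by (intro integrable_mult_cnj_T(2) borel_measurable_diff U_L2 T_measurable v_minimising diff w_in)
  moreover have "\<dots> \<le> sqrt ((1/4) ^ j) * sqrt (Q w)" using diff(2)[of j] Q_nonneg by (intro mult_right_mono) auto
  moreover have "norm (B (v j) w - l w) \<le> sqrt ((1/4) ^ j) * sqrt (Q w)"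
   using order_trans[OF defect_bound[OF v_minimising(1) w_in] mult_right_mono[OF _ Q_nonneg]] v_minimising(2)[of j] by (intro le_sqrt_mult) simp
  ultimately show ?thesis
   using norm_triangle_ineq[of "(\<integral>x. U x * cnj (T w x) \<partial>M) - B (v j) w" "B (v j) w - l w"] by simp
 qed
 have "(\<lambda>j. 2 * (sqrt ((1/4) ^ j) * sqrt (Q w))) \<longlonglongrightarrow> 2 * (sqrt 0 * sqrt (Q w))"
  by (intro tendsto_intros LIMSEQ_power_zero) simp
 then have "norm ((\<integral>x. U x * cnj (T w x) \<partial>M) - l w) \<le> 2 * (sqrt 0 * sqrt (Q w))"
  by (rule LIMSEQ_le_const) (use bound in blast)
 then show ?thesis by simp
qed

theorem representation:
 obtains U where "U \<in> borel_measurable M" "integrable M (\<lambda>x. (norm (U x))\<^sup>2)"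
  "(\<integral>x. (norm (U x))\<^sup>2 \<partial>M) \<le> A" "\<And>v. v \<in> V \<Longrightarrow> (\<integral>x. U x * cnj (T v x) \<partial>M) = l v"
proof -
 obtain U v where U [measurable]: "U \<in> borel_measurable M" and U_L2: "integrable M (\<lambda>x. (norm (U x))\<^sup>2)"
  and v_in: "\<And>j. v j \<in> V" and near: "\<And>j. J (v j) \<le> J_inf + (1/4) ^ j"
  and diff_L2: "\<And>j. integrable M (\<lambda>x. (norm (U x - T (v j) x))\<^sup>2)"
  and diff_le: "\<And>j. (\<integral>x. (norm (U x - T (v j) x))\<^sup>2 \<partial>M) \<le> (1/4) ^ j"
  using minimising_limit by blast
 note represents = minimising_limit_represents[OF U U_L2 v_in near diff_L2 diff_le]
 have "(\<integral>x. (norm (U x))\<^sup>2 \<partial>M) \<le> A + (1/4) ^ j" for j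
 proof -
  define g where "g x = U x * cnj (T (v j) x)" for x
  have g_rep: "integrable M g" "(\<integral>x. g x \<partial>M) = l (v j)"
   using integrable_mult_cnj_T(1)[OF U U_L2 v_in] represents[OF v_in] by (simp_all add: g_def[abs_def])
  have "(norm (U x - T (v j) x))\<^sup>2 = (norm (U x))\<^sup>2 - 2 * Re (g x) + (norm (T (v j) x))\<^sup>2" for x
   using norm_add_mult_sq[of "U x" "-1" "T (v j) x"] by (simp add: g_def)
  then have "(\<integral>x. (norm (U x - T (v j) x))\<^sup>2 \<partial>M) = (\<integral>x. (norm (U x))\<^sup>2 \<partial>M) - 2 * Re (l (v j)) + Q (v j)"
   using U_L2 T_L2[OF v_in] integrable_Re[OF g_rep(1)] integral_Re[OF g_rep(1)] g_rep(2) by (simp add: Q_def)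
  then show ?thesis using diff_le[of j] J_lower_bound[OF v_in, of j] by linarith
 qed
 then have "(\<integral>x. (norm (U x))\<^sup>2 \<partial>M) \<le> A + 0"
  by (intro LIMSEQ_le_const[OF tendsto_add[OF tendsto_const LIMSEQ_power_zero[of "1/4"]]]) auto
 then show thesis using that[OF U U_L2] represents by simp
qed

end

lemma DERIV_max0_power:
 "((\<lambda>s::real. (max 0 s) ^ Suc (Suc n)) has_real_derivative real (Suc (Suc n)) * (max 0 s) ^ Suc n) (at s)"
proof -
 consider (pos) "s > 0" | (neg) "s < 0" | (zero) "s = 0" by linarith
 then show ?thesis
 proof cases
  case pos
  have "((\<lambda>s::real. s ^ Suc (Suc n)) has_real_derivative real (Suc (Suc n)) * s ^ Suc n) (at s)"
   using DERIV_pow[of "Suc (Suc n)" s] by simp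
  then have "((\<lambda>s::real. (max 0 s) ^ Suc (Suc n)) has_real_derivative real (Suc (Suc n)) * s ^ Suc n) (at s)"
   by (rule has_field_derivative_transform_within_open[of _ _ _ "{0<..}"]) (use pos in auto)
  then show ?thesis using pos by (simp add: max_def)
 next
  case neg
  have "((\<lambda>s::real. (max 0 s) ^ Suc (Suc n)) has_real_derivative 0) (at s)"
   by (rule has_field_derivative_transform_within_open[of "\<lambda>_. 0" _ _ "{..<0}"]) (use neg in auto)
  then show ?thesis using neg by (simp add: max_def)
 next
  case zero
  have "((\<lambda>h::real. ((max 0 (0 + h)) ^ Suc (Suc n) - (max 0 0) ^ Suc (Suc n)) / h) \<longlongrightarrow> 0) (at 0)"
  proof (rule Lim_null_comparison)
   show "\<forall>\<^sub>F h in at (0::real). norm (((max 0 (0 + h)) ^ Suc (Suc n) - (max 0 0) ^ Suc (Suc n)) / h) \<le> \<bar>h\<bar> ^ Suc n"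
    by (rule always_eventually) (auto simp: max_def abs_mult power_abs mult_nonpos_nonneg)
   have "((\<lambda>h::real. \<bar>h\<bar> ^ Suc n) \<longlongrightarrow> \<bar>0\<bar> ^ Suc n) (at 0)"
    by (intro tendsto_intros)
   then show "((\<lambda>h::real. \<bar>h\<bar> ^ Suc n) \<longlongrightarrow> 0) (at 0)" by simp
  qed
  then show ?thesis using zero by (simp add: DERIV_def)
 qed
qed

lemma has_partial_inner: "has_partial (\<lambda>x. complex_of_real (x \<bullet> b)) e (\<lambda>_. complex_of_real (e \<bullet> b))"
 unfolding has_partial_def
proof
 fix x
 have "((\<lambda>t. (x + t *\<^sub>R e) \<bullet> b) has_real_derivative e \<bullet> b) (at 0)"
  by (auto intro!: derivative_eq_intros simp: inner_add_left)
 then show "((\<lambda>t. complex_of_real ((x + t *\<^sub>R e) \<bullet> b)) has_vector_derivative complex_of_real (e \<bullet> b)) (at 0)"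
  unfolding has_real_derivative_iff_has_vector_derivative
  by (rule bounded_linear.has_vector_derivative[OF bounded_linear_of_real])
qed

lemma Ck_inner: "Ck n (\<lambda>x. complex_of_real (x \<bullet> b))"
proof (cases n)
 case (Suc m)
 show ?thesis unfolding Suc
  by (rule Ck_SucI[OF _ has_partial_inner]) (auto intro!: continuous_intros Ck_const)
qed (auto intro!: continuous_intros)

definition bump :: "real \<Rightarrow> nat \<Rightarrow> 'a::euclidean_space \<Rightarrow> real" where
 "bump r n x = (max 0 (1 - (x \<bullet> x) / r\<^sup>2)) ^ n"

lemma continuous_on_bump: "continuous_on UNIV (bump r n)"
 unfolding bump_def[abs_def] divide_inverse by (intro continuous_intros)

lemma has_partial_bump:
 "has_partial (\<lambda>x. complex_of_real (bump r (Suc (Suc n)) x)) e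
   (\<lambda>x. of_nat (Suc (Suc n)) * complex_of_real (bump r (Suc n) x) * (complex_of_real (x \<bullet> e) * complex_of_real (- 2 / r\<^sup>2)))"
 unfolding has_partial_def
proof
 fix x
 have "((\<lambda>t. 1 - ((x + t *\<^sub>R e) \<bullet> (x + t *\<^sub>R e)) / r\<^sup>2) has_real_derivative - 2 * (x \<bullet> e) / r\<^sup>2) (at 0)"
 proof -
  have "(\<lambda>t. 1 - ((x + t *\<^sub>R e) \<bullet> (x + t *\<^sub>R e)) / r\<^sup>2) = (\<lambda>t. 1 - (x \<bullet> x + t * (2 * (x \<bullet> e)) + t\<^sup>2 * (e \<bullet> e)) / r\<^sup>2)"
   by (auto simp: fun_eq_iff inner_add_left inner_add_right inner_commute power2_eq_square)
  then show ?thesis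
   unfolding divide_inverse by (auto intro!: derivative_eq_intros)
 qed
 from DERIV_chain2[OF DERIV_max0_power this, of n]
 have "((\<lambda>t. bump r (Suc (Suc n)) (x + t *\<^sub>R e)) has_real_derivative
   real (Suc (Suc n)) * bump r (Suc n) x * ((x \<bullet> e) * (- 2 / r\<^sup>2))) (at 0)"
  by (simp add: bump_def algebra_simps del: power_Suc of_nat_Suc)
 then have "((\<lambda>t. complex_of_real (bump r (Suc (Suc n)) (x + t *\<^sub>R e))) has_vector_derivative
   complex_of_real (real (Suc (Suc n)) * bump r (Suc n) x * ((x \<bullet> e) * (- 2 / r\<^sup>2)))) (at 0)"
  unfolding has_real_derivative_iff_has_vector_derivative
  by (rule bounded_linear.has_vector_derivative[OF bounded_linear_of_real])
 moreover have "complex_of_real (real (Suc (Suc n)) * bump r (Suc n) x * ((x \<bullet> e) * (- 2 / r\<^sup>2)))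
  = of_nat (Suc (Suc n)) * complex_of_real (bump r (Suc n) x) * (complex_of_real (x \<bullet> e) * complex_of_real (- 2 / r\<^sup>2))"
  by (simp only: of_real_mult of_real_of_nat_eq)
 ultimately show "((\<lambda>t. complex_of_real (bump r (Suc (Suc n)) (x + t *\<^sub>R e))) has_vector_derivative
   of_nat (Suc (Suc n)) * complex_of_real (bump r (Suc n) x) * (complex_of_real (x \<bullet> e) * complex_of_real (- 2 / r\<^sup>2))) (at 0)"
  by (simp only:)
qed

lemma Ck_bump: "Ck n (\<lambda>x::'a::euclidean_space. complex_of_real (bump r (Suc n) x))"
proof (induction n)
 case 0
 then show ?case using continuous_on_bump by (auto intro!: continuous_intros)
next
 case (Suc n)
 show ?case
 proof (rule Ck_SucI[OF _ has_partial_bump])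
  show "continuous_on UNIV (\<lambda>x::'a. complex_of_real (bump r (Suc (Suc n)) x))"
   using continuous_on_bump by (auto intro!: continuous_intros)
  show "Ck n (\<lambda>x. of_nat (Suc (Suc n)) * complex_of_real (bump r (Suc n) x) * (complex_of_real (x \<bullet> e) * complex_of_real (- 2 / r\<^sup>2)))" for e :: 'a
   by (intro Ck_mult Ck_const Suc Ck_inner)
 qed
qed

lemma bump_nonneg: "bump r n x \<ge> 0"
 by (simp add: bump_def)

lemma bump_le_1: "bump r n x \<le> 1"
 unfolding bump_def by (intro power_le_one) auto

lemma bump_eq_0: "r > 0 \<Longrightarrow> norm x \<ge> r \<Longrightarrow> bump r (Suc n) x = 0"
proof -
 assume "r > 0" "norm x \<ge> r"
 then have "r\<^sup>2 \<le> x \<bullet> x" by (metis dot_square_norm less_imp_le power_mono)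
 then show ?thesis using \<open>r > 0\<close> by (simp add: bump_def max_def field_simps)
qed

lemma compact_supp_bump: "r > 0 \<Longrightarrow> compact_supp (bump r (Suc n))"
 unfolding compact_supp_def using bump_eq_0 by (metis less_imp_le)

lemma bump_lower_bound:
 assumes "r > 0" "norm x \<le> r / 2" shows "(3/4) ^ n \<le> bump r n x"
proof -
 have "(norm x)\<^sup>2 \<le> (r/2)\<^sup>2" using assms(2) by (intro power_mono) auto
 then have "3/4 \<le> 1 - (x \<bullet> x) / r\<^sup>2" using assms(1) by (simp add: dot_square_norm power_divide field_simps)
 then have "3/4 \<le> max 0 (1 - (x \<bullet> x) / r\<^sup>2)" by (rule order_trans[OF _ max.cobounded2])
 then show ?thesis unfolding bump_def by (rule power_mono) simp
qed

lemma integral_bump_pos: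
 assumes "r > 0" shows "(\<integral>x. bump r (Suc n) (x::'a::euclidean_space) \<partial>lborel) > 0"
proof -
 have int: "integrable lborel (bump r (Suc n) :: 'a \<Rightarrow> real)"
  by (rule integrable_compact_supp[OF continuous_on_bump compact_supp_bump[OF assms]])
 have "(\<integral>x. indicator (ball (0::'a) (r/2)) x * (3/4::real) ^ Suc n \<partial>lborel) \<le> (\<integral>x. bump r (Suc n) (x::'a) \<partial>lborel)"
 proof (rule integral_mono[OF _ int])
  show "integrable lborel (\<lambda>x. indicator (ball (0::'a) (r/2)) x * (3/4::real) ^ Suc n)"
   using emeasure_lborel_ball_finite[of "0::'a" "r/2"] by (intro integrable_mult_left integrable_real_indicator) auto
  show "indicator (ball (0::'a) (r/2)) x * (3/4::real) ^ Suc n \<le> bump r (Suc n) x" for x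
   using bump_lower_bound[OF assms, of x "Suc n"] bump_nonneg[of r "Suc n" x] by (simp add: indicator_def)
 qed
 moreover have "(\<integral>x. indicator (ball (0::'a) (r/2)) x * (3/4::real) ^ Suc n \<partial>lborel) > 0"
  using content_ball_pos[of "r/2" "0::'a"] assms by simp
 ultimately show ?thesis by linarith
qed

definition mollifier :: "real \<Rightarrow> 'a::euclidean_space \<Rightarrow> real" where
 "mollifier r x = bump r 4 x / (\<integral>y. bump r 4 (y::'a) \<partial>lborel)"

lemma
 fixes x :: "'a::euclidean_space"
 assumes "r > 0"
 shows mollifier_nonneg: "mollifier r x \<ge> 0"
  and mollifier_even: "mollifier r (- x) = mollifier r x"
  and mollifier_eq_0: "norm x \<ge> r \<Longrightarrow> mollifier r x = 0"
  and continuous_on_mollifier: "continuous_on UNIV (mollifier r :: 'a \<Rightarrow> real)"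
  and compact_supp_mollifier: "compact_supp (mollifier r :: 'a \<Rightarrow> real)"
  and Ck_mollifier: "Ck 3 (\<lambda>x::'a. complex_of_real (mollifier r x))"
  and integrable_mollifier: "integrable lborel (mollifier r :: 'a \<Rightarrow> real)"
  and integral_mollifier: "(\<integral>x. mollifier r (x::'a) \<partial>lborel) = 1"
proof -
 let ?I = "\<integral>y. bump r 4 (y::'a) \<partial>lborel"
 have I_pos: "?I > 0" using integral_bump_pos[OF assms, of 3] by (simp add: eval_nat_numeral)
 show "mollifier r x \<ge> 0" using bump_nonneg[of r 4 x] I_pos by (simp add: mollifier_def)
 show "mollifier r (- x) = mollifier r x" by (simp add: mollifier_def bump_def)
 show outside: "norm x \<ge> r \<Longrightarrow> mollifier r x = 0" for x :: 'a using bump_eq_0[OF assms, of x 3] by (simp add: mollifier_def eval_nat_numeral)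
 show cont: "continuous_on UNIV (mollifier r :: 'a \<Rightarrow> real)"
  unfolding mollifier_def[abs_def] using continuous_on_bump I_pos by (intro continuous_intros) auto
 show supp: "compact_supp (mollifier r :: 'a \<Rightarrow> real)" unfolding compact_supp_def using outside by (metis less_imp_le)
 have "(\<lambda>x. complex_of_real (mollifier r (x::'a))) = (\<lambda>x. complex_of_real (bump r (Suc 3) x) * complex_of_real (1 / ?I))"
  by (simp add: mollifier_def fun_eq_iff eval_nat_numeral)
 then show "Ck 3 (\<lambda>x. complex_of_real (mollifier r (x::'a)))"
  using Ck_mult[OF Ck_bump[of 3 r] Ck_const] by metis
 show "integrable lborel (mollifier r :: 'a \<Rightarrow> real)" by (rule integrable_compact_supp[OF cont supp])
 show "(\<integral>x. mollifier r (x::'a) \<partial>lborel) = 1" using I_pos by (simp add: mollifier_def)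
qed

lemma borel_measurable_mollifier: "r > 0 \<Longrightarrow> mollifier r \<in> borel_measurable (borel :: 'a::euclidean_space measure)"
 by (rule borel_measurable_continuous_onI[OF continuous_on_mollifier])

lemma continuous_on_reflect: "continuous_on UNIV k \<Longrightarrow> continuous_on UNIV (\<lambda>x. k (y - x :: 'a::real_normed_vector))"
 by (rule continuous_on_compose2) (auto intro: continuous_intros)

definition locally_integrable :: "('a::euclidean_space \<Rightarrow> complex) \<Rightarrow> bool" where
 "locally_integrable f \<longleftrightarrow> f \<in> borel_measurable borel \<and> (\<forall>R. integrable lborel (\<lambda>x. indicator (cball 0 R) x * norm (f x)))"

definition convolve :: "('a::euclidean_space \<Rightarrow> complex) \<Rightarrow> ('a \<Rightarrow> complex) \<Rightarrow> 'a \<Rightarrow> complex" where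
 "convolve f k y = (\<integral>x. f x * k (y - x) \<partial>lborel)"

lemma locally_integrable_integrable:
 assumes f_loc_int: "locally_integrable f" and g_dominated: "g \<in> borel_measurable borel" "\<And>x. norm (g x) \<le> M * indicator (cball 0 R) x"
 shows "integrable lborel (\<lambda>x. f x * g x)"
proof (rule Bochner_Integration.integrable_bound)
 show "integrable lborel (\<lambda>x. M * (indicator (cball 0 R) x * norm (f x)))"
  using f_loc_int by (simp add: locally_integrable_def)
 have [measurable]: "f \<in> borel_measurable borel" using f_loc_int by (simp add: locally_integrable_def)
 note g_dominated(1)[measurable]
 show "(\<lambda>x. f x * g x) \<in> borel_measurable lborel" by measurable
 have "norm (f x * g x) \<le> norm (M * (indicator (cball 0 R) x * norm (f x)))" for x
 proof -
  have "norm (f x * g x) = norm (f x) * norm (g x)" by (rule norm_mult)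
  also have "\<dots> \<le> norm (f x) * (M * indicator (cball 0 R) x)" by (intro mult_left_mono g_dominated) simp
  also have "\<dots> \<le> norm (M * (indicator (cball 0 R) x * norm (f x)))" by (simp add: ac_simps)
  finally show ?thesis .
 qed
 then show "AE x in lborel. norm (f x * g x) \<le> norm (M * (indicator (cball 0 R) x * norm (f x)))" by simp
qed

lemma locally_integrable_tendsto:
 assumes f_loc_int: "locally_integrable f" and g_dominated: "\<And>m. g m \<in> borel_measurable borel" "\<And>m x. norm (g m x) \<le> M * indicator (cball 0 R) x"
  "\<And>x. (\<lambda>m. g m x) \<longlonglongrightarrow> g' x" and g'_meas: "g' \<in> borel_measurable borel"
 shows "(\<lambda>m. \<integral>x. f x * g m x \<partial>lborel) \<longlonglongrightarrow> (\<integral>x. f x * g' x \<partial>lborel)"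
proof (rule integral_dominated_convergence)
 show "integrable lborel (\<lambda>x. M * (indicator (cball 0 R) x * norm (f x)))"
  using f_loc_int by (simp add: locally_integrable_def)
 have [measurable]: "f \<in> borel_measurable borel" using f_loc_int by (simp add: locally_integrable_def)
 note g_dominated(1)[measurable] g'_meas[measurable]
 show "(\<lambda>x. f x * g' x) \<in> borel_measurable lborel" "(\<lambda>x. f x * g m x) \<in> borel_measurable lborel" for m
  by measurable
 show "AE x in lborel. (\<lambda>m. f x * g m x) \<longlonglongrightarrow> f x * g' x"
  using g_dominated(3) by (intro AE_I2 tendsto_intros)
 have "norm (f x * g m x) \<le> M * (indicator (cball 0 R) x * norm (f x))" for x m
 proof -
  have "norm (f x * g m x) = norm (f x) * norm (g m x)" by (rule norm_mult)
  also have "\<dots> \<le> norm (f x) * (M * indicator (cball 0 R) x)" by (intro mult_left_mono g_dominated) simp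
  finally show ?thesis by (simp add: ac_simps)
 qed
 then show "AE x in lborel. norm (f x * g m x) \<le> M * (indicator (cball 0 R) x * norm (f x))" for m by simp
qed

lemma compact_supp_shift_bound:
 fixes k :: "'a::euclidean_space \<Rightarrow> complex"
 assumes "continuous_on UNIV k" "compact_supp k"
 obtains M S where "M \<ge> 0" "\<And>B x y. norm y \<le> B \<Longrightarrow> norm (k (y - x)) \<le> M * indicator (cball 0 (B + S)) x"
proof -
 obtain M where M_bound: "M \<ge> 0" "\<And>x. norm (k x) \<le> M" using bounded_compact_supp[OF assms] by blast
 obtain S where S_vanish: "\<And>x. S < norm x \<Longrightarrow> k x = 0" using assms by (auto simp: compact_supp_def)
 have "norm (k (y - x)) \<le> M * indicator (cball 0 (B + S)) x" if "norm y \<le> B" for B x y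
 proof (cases "norm x \<le> B + S")
  case False
  then have "S < norm (y - x)" using that norm_triangle_ineq3[of y x] by linarith
  then show ?thesis using S_vanish False by simp
 qed (use M_bound in simp)
 then show ?thesis using that M_bound(1) by blast
qed

lemma convolve_integrable:
 assumes "locally_integrable f" "continuous_on UNIV k" "compact_supp k"
 shows "integrable lborel (\<lambda>x. f x * k (y - x))"
proof -
 obtain M S where "M \<ge> 0" and M_bound: "\<And>B x y. norm y \<le> B \<Longrightarrow> norm (k (y - x)) \<le> M * indicator (cball 0 (B + S)) x"
  using compact_supp_shift_bound[OF assms(2,3)] by blast
 show ?thesis
  by (intro locally_integrable_integrable[OF assms(1) _ M_bound[OF order_refl]] borel_measurable_continuous_onI continuous_on_reflect assms)
qed

lemma continuous_on_convolve:
 assumes "locally_integrable f" "continuous_on UNIV k" "compact_supp k"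
 shows "continuous_on UNIV (convolve f k)"
 unfolding continuous_on_sequentially
proof (intro allI ballI impI, elim conjE)
 fix u :: "nat \<Rightarrow> 'a" and a assume u_lim: "u \<longlonglongrightarrow> a"
 obtain M S where "M \<ge> 0" and M_bound: "\<And>B x y. norm y \<le> B \<Longrightarrow> norm (k (y - x)) \<le> M * indicator (cball 0 (B + S)) x"
  using compact_supp_shift_bound[OF assms(2,3)] by blast
 obtain B where B_bound: "\<And>m. norm (u m) \<le> B"
  using convergent_imp_Bseq[OF convergentI[OF u_lim]] by (auto simp: Bseq_def)
 have "(\<lambda>m. \<integral>x. f x * k (u m - x) \<partial>lborel) \<longlonglongrightarrow> (\<integral>x. f x * k (a - x) \<partial>lborel)"
 proof (rule locally_integrable_tendsto[OF assms(1)])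
  show "(\<lambda>x. k (u m - x)) \<in> borel_measurable borel" "(\<lambda>x. k (a - x)) \<in> borel_measurable borel" for m
   by (intro borel_measurable_continuous_onI continuous_on_reflect assms)+
  show "norm (k (u m - x)) \<le> M * indicator (cball 0 (B + S)) x" for m x by (rule M_bound[OF B_bound])
  show "(\<lambda>m. k (u m - x)) \<longlonglongrightarrow> k (a - x)" for x
   by (rule continuous_on_tendsto_compose[OF assms(2)]) (auto intro!: tendsto_intros u_lim)
 qed
 then show "(convolve f k \<circ> u) \<longlonglongrightarrow> convolve f k a" by (simp add: convolve_def o_def)
qed

lemma has_vector_derivative_iff_tendsto_quotient:
 fixes f :: "real \<Rightarrow> 'b::real_normed_vector"
 shows "(f has_vector_derivative D) (at x) \<longleftrightarrow> ((\<lambda>h. (f (x + h) - f x) /\<^sub>R h) \<longlongrightarrow> D) (at 0)"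
proof -
 have quotient: "norm (f (x + h) - f x - h *\<^sub>R D) / norm h = norm ((f (x + h) - f x) /\<^sub>R h - D)" if "h \<noteq> 0" for h
 proof -
  have "(f (x + h) - f x) /\<^sub>R h - D = (f (x + h) - f x - h *\<^sub>R D) /\<^sub>R h" using that by (simp add: scaleR_diff_right)
  then show ?thesis by (simp add: divide_inverse mult.commute)
 qed
 have "(f has_vector_derivative D) (at x) \<longleftrightarrow> ((\<lambda>h. norm (f (x + h) - f x - h *\<^sub>R D) / norm h) \<longlongrightarrow> 0) (at 0)"
  by (simp add: has_vector_derivative_def has_derivative_at bounded_linear_scaleR_left)
 also have "\<dots> \<longleftrightarrow> ((\<lambda>h. norm ((f (x + h) - f x) /\<^sub>R h - D)) \<longlongrightarrow> 0) (at 0)"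
  using quotient by (intro tendsto_cong) (auto simp: eventually_at intro!: exI[of _ "1::real"])
 finally show ?thesis by (simp add: tendsto_norm_zero_iff LIM_zero_iff)
qed

lemma has_partial_increment_bound:
 assumes f_partial: "has_partial f e f'" and bound: "\<And>t. \<bar>t\<bar> \<le> \<bar>s\<bar> \<Longrightarrow> norm (f' (x + t *\<^sub>R e)) \<le> B"
 shows "norm (f (x + s *\<^sub>R e) - f x) \<le> B * \<bar>s\<bar>"
proof -
 have "norm (f (x + s *\<^sub>R e) - f (x + 0 *\<^sub>R e)) \<le> B * norm (s - 0)"
 proof (rule differentiable_bound)
  show "((\<lambda>t. f (x + t *\<^sub>R e)) has_derivative (\<lambda>h. h *\<^sub>R f' (x + t *\<^sub>R e))) (at t within closed_segment 0 s)" for t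
   using has_partial_at[OF f_partial] by (auto simp: has_vector_derivative_def intro: has_derivative_at_withinI)
  fix t assume "t \<in> closed_segment 0 s"
  then have "norm (f' (x + t *\<^sub>R e)) \<le> B" by (intro bound) (auto simp: closed_segment_eq_real_ivl split: if_splits)
  then show "onorm (\<lambda>h. h *\<^sub>R f' (x + t *\<^sub>R e)) \<le> B" by (intro onorm_le) (simp add: mult.commute[of B] mult_left_mono)
 qed auto
 then show ?thesis by simp
qed

lemma convolve_difference_quotient:
 assumes "locally_integrable f" "continuous_on UNIV k" "compact_supp k"
 shows "(\<integral>x. f x * ((k ((y - x) + v) - k (y - x)) /\<^sub>R t) \<partial>lborel) = (convolve f k (y + v) - convolve f k y) /\<^sub>R t"
proof -
 have integrand: "f x * ((k ((y - x) + v) - k (y - x)) /\<^sub>R t) = (f x * k ((y + v) - x) - f x * k (y - x)) /\<^sub>R t" for x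
  by (simp add: scaleR_conv_of_real algebra_simps)
 show ?thesis unfolding integrand convolve_def using convolve_integrable[OF assms] by simp
qed

lemma has_partial_convolve:
 assumes f_loc_int: "locally_integrable f" and k_test: "Ck 1 k" "compact_supp k" and e_in: "e \<in> Basis"
 shows "has_partial (convolve f k) e (convolve f (partial e k))"
 unfolding has_partial_def has_vector_derivative_iff_tendsto_quotient
proof (intro allI, simp only: add_0_left scaleR_zero_left add_0_right, rule LIMSEQ_SEQ_conv[THEN iffD1, rule_format], elim conjE)
 fix y and s :: "nat \<Rightarrow> real" assume s_nonzero: "\<forall>m. s m \<noteq> 0" and s_lim: "s \<longlonglongrightarrow> 0"
 have k_partial: "has_partial k e (partial e k)" and k_cont: "continuous_on UNIV k" and dk_cont: "continuous_on UNIV (partial e k)"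
  using k_test e_in by auto
 obtain M S where "M \<ge> 0" and M_bound: "\<And>B x y. norm y \<le> B \<Longrightarrow> norm (partial e k (y - x)) \<le> M * indicator (cball 0 (B + S)) x"
  using compact_supp_shift_bound[OF dk_cont compact_supp_partial[OF k_test(2)]] by blast
 obtain B where B_bound: "\<And>m. norm (s m) \<le> B" using convergent_imp_Bseq[OF convergentI[OF s_lim]] by (auto simp: Bseq_def)
 let ?q = "\<lambda>m x. (k ((y - x) + s m *\<^sub>R e) - k (y - x)) /\<^sub>R s m"
 have "(\<lambda>m. \<integral>x. f x * ?q m x \<partial>lborel) \<longlonglongrightarrow> (\<integral>x. f x * partial e k (y - x) \<partial>lborel)"
 proof (rule locally_integrable_tendsto[OF f_loc_int])
  show "?q m \<in> borel_measurable borel" for m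
   using continuous_on_reflect[OF k_cont, of y] continuous_on_reflect[OF k_cont, of "y + s m *\<^sub>R e"]
   by (intro borel_measurable_continuous_onI continuous_intros) (simp_all add: algebra_simps)
  show "(\<lambda>x. partial e k (y - x)) \<in> borel_measurable borel"
   by (rule borel_measurable_continuous_onI[OF continuous_on_reflect[OF dk_cont]])
  show "norm (?q m x) \<le> M * indicator (cball 0 (norm y + B + S)) x" for m x
  proof -
   have "norm (partial e k ((y - x) + t *\<^sub>R e)) \<le> M * indicator (cball 0 (norm y + B + S)) x" if "\<bar>t\<bar> \<le> \<bar>s m\<bar>" for t
   proof -
    have "norm (y + t *\<^sub>R e) \<le> norm y + B" using norm_triangle_ineq[of y "t *\<^sub>R e"] that B_bound[of m] e_in by simp
    from M_bound[OF this, of x] show ?thesis by (simp add: algebra_simps)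
   qed
   then have "norm (k ((y - x) + s m *\<^sub>R e) - k (y - x)) \<le> M * indicator (cball 0 (norm y + B + S)) x * \<bar>s m\<bar>"
    by (rule has_partial_increment_bound[OF k_partial])
   then show ?thesis using s_nonzero[rule_format, of m] by (simp add: pos_divide_le_eq divide_inverse_commute[symmetric])
  qed
  show "(\<lambda>m. ?q m x) \<longlonglongrightarrow> partial e k (y - x)" for x
  proof -
   have "((\<lambda>h. (k ((y - x) + h *\<^sub>R e) - k (y - x)) /\<^sub>R h) \<longlongrightarrow> partial e k (y - x)) (at 0)"
    using k_partial unfolding has_partial_def has_vector_derivative_iff_tendsto_quotient by simp
   then show ?thesis by (rule filterlim_compose[OF _ filterlim_atI[OF s_lim]]) (use s_nonzero in simp)
  qed
 qed
 then show "(\<lambda>m. (convolve f k (y + s m *\<^sub>R e) - convolve f k y) /\<^sub>R s m) \<longlonglongrightarrow> convolve f (partial e k) y"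
  unfolding convolve_difference_quotient[OF f_loc_int k_cont k_test(2)] convolve_def[of f "partial e k"] .
qed

lemma Ck_convolve: "locally_integrable f \<Longrightarrow> Ck n k \<Longrightarrow> compact_supp k \<Longrightarrow> Ck n (convolve f k)"
proof (induction n arbitrary: k)
 case 0
 then show ?case by (simp add: continuous_on_convolve)
next
 case (Suc n)
 have k_Ck: "Ck 1 k" using Ck_le[OF Suc.prems(2), of 1] by simp
 show ?case
 proof (rule Ck_SucI)
  show "continuous_on UNIV (convolve f k)"
   by (rule continuous_on_convolve[OF Suc.prems(1) Ck_cont[OF Suc.prems(2)] Suc.prems(3)])
  show "has_partial (convolve f k) e (convolve f (partial e k))" if "e \<in> Basis" for e
   by (rule has_partial_convolve[OF Suc.prems(1) k_Ck Suc.prems(3) that])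
  show "Ck n (convolve f (partial e k))" if "e \<in> Basis" for e
   by (rule Suc.IH[OF Suc.prems(1) Ck_partial[OF Suc.prems(2) that] compact_supp_partial[OF Suc.prems(3)]])
 qed
qed

lemma dz_convolve:
 assumes "locally_integrable f" "Ck 1 k" "compact_supp k"
 shows "dz j (convolve f k) = convolve f (dz j k)" "dzbar j (convolve f k) = convolve f (dzbar j k)"
proof -
 have int: "integrable lborel (\<lambda>x. f x * partial (axis j 1) k (y - x))"
   "integrable lborel (\<lambda>x. f x * partial (axis j \<i>) k (y - x))" for y
  using assms by (auto intro!: convolve_integrable compact_supp_partial)
 have partial: "partial e (convolve f k) = convolve f (partial e k)" if "e \<in> Basis" for e
  by (rule partial_eq[OF has_partial_convolve[OF assms that]])
 have integrand: "f x * dz j k z = (f x * partial (axis j 1) k z - \<i> * (f x * partial (axis j \<i>) k z)) / 2"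
  "f x * dzbar j k z = (f x * partial (axis j 1) k z + \<i> * (f x * partial (axis j \<i>) k z)) / 2" for x z
  by (simp_all add: dz_def dzbar_def field_simps)
 have "convolve f (dz j k) y = (convolve f (partial (axis j 1) k) y - \<i> * convolve f (partial (axis j \<i>) k) y) / 2"
  "convolve f (dzbar j k) y = (convolve f (partial (axis j 1) k) y + \<i> * convolve f (partial (axis j \<i>) k) y) / 2" for y
  unfolding convolve_def integrand using int by simp_all
 then show "dz j (convolve f k) = convolve f (dz j k)" "dzbar j (convolve f k) = convolve f (dzbar j k)"
  by (simp_all add: fun_eq_iff dz_def[of j "convolve f k"] dzbar_def[of j "convolve f k"] partial)
qed

lemma dz_minus: "Ck 1 f \<Longrightarrow> dz k (\<lambda>x. - f x) x = - dz k f x"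
 by (simp add: dz_def partial_minus del: Ck.simps One_nat_def) (simp add: field_simps)

lemma nn_integral_mollifier:
 assumes "r > 0" shows "(\<integral>\<^sup>+x. ennreal (mollifier r (y - x :: 'a::euclidean_space)) \<partial>lborel) = 1"
  and "(\<integral>\<^sup>+x. ennreal (mollifier r (x - y :: 'a)) \<partial>lborel) = 1"
proof -
 note [measurable] = borel_measurable_mollifier[OF assms]
 have "(\<integral>\<^sup>+x. ennreal (mollifier r (x :: 'a)) \<partial>lborel) = 1"
  by (simp add: nn_integral_eq_integral integrable_mollifier[OF assms] mollifier_nonneg[OF assms] integral_mollifier[OF assms])
 then show reflected: "(\<integral>\<^sup>+x. ennreal (mollifier r (y - x :: 'a)) \<partial>lborel) = 1"
  using nn_integral_lborel_reflect[of "\<lambda>x. ennreal (mollifier r x)" y] by simp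
 have "mollifier r (x - y) = mollifier r (y - x)" for x :: 'a
  using mollifier_even[OF assms, of "x - y"] by simp
 then show "(\<integral>\<^sup>+x. ennreal (mollifier r (x - y :: 'a)) \<partial>lborel) = 1" using reflected by simp
qed

lemma mollifier_Cauchy_Schwarz:
 fixes F :: "'a::euclidean_space \<Rightarrow> ennreal"
 assumes r_pos: "r > 0" and [measurable]: "F \<in> borel_measurable borel"
 shows "(\<integral>\<^sup>+x. F x * ennreal (mollifier r (y - x)) \<partial>lborel)\<^sup>2 \<le> (\<integral>\<^sup>+x. (F x)\<^sup>2 * ennreal (mollifier r (y - x)) \<partial>lborel)"
proof -
 note [measurable] = borel_measurable_mollifier[OF r_pos]
 have sqrt: "ennreal (sqrt (mollifier r z)) * ennreal (sqrt (mollifier r z)) = ennreal (mollifier r z)" for z :: 'a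
  using mollifier_nonneg[OF r_pos, of z] by (simp add: ennreal_mult[symmetric])
 have "(\<integral>\<^sup>+x. (F x * ennreal (sqrt (mollifier r (y - x)))) * ennreal (sqrt (mollifier r (y - x))) \<partial>lborel)\<^sup>2
  \<le> (\<integral>\<^sup>+x. (F x * ennreal (sqrt (mollifier r (y - x)))) ^ 2 \<partial>lborel) * (\<integral>\<^sup>+x. ennreal (sqrt (mollifier r (y - x))) ^ 2 \<partial>lborel)"
  by (rule Cauchy_Schwarz_nn_integral) auto
 moreover have "(F x * ennreal (sqrt (mollifier r (y - x)))) * ennreal (sqrt (mollifier r (y - x))) = F x * ennreal (mollifier r (y - x))"
  "ennreal (sqrt (mollifier r (y - x))) ^ 2 = ennreal (mollifier r (y - x))" for x
  by (simp_all add: mult.assoc sqrt power2_eq_square)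
 ultimately show ?thesis
  by (simp only: power_mult_distrib nn_integral_mollifier(1)[OF r_pos] mult_1_right)
qed

lemma mollifier_average_bound:
 fixes F g G :: "'a::euclidean_space \<Rightarrow> ennreal"
 assumes r_pos: "r > 0" and [measurable]: "F \<in> borel_measurable borel" "g \<in> borel_measurable borel" "G \<in> borel_measurable borel"
  and g_le_G: "\<And>x y. norm (y - x) < r \<Longrightarrow> g y \<le> G x"
 shows "(\<integral>\<^sup>+y. g y * (\<integral>\<^sup>+x. F x * ennreal (mollifier r (y - x)) \<partial>lborel)\<^sup>2 \<partial>lborel) \<le> (\<integral>\<^sup>+x. (F x)\<^sup>2 * G x \<partial>lborel)"
proof -
 note [measurable] = borel_measurable_mollifier[OF r_pos]
 have "(\<integral>\<^sup>+y. g y * (\<integral>\<^sup>+x. F x * ennreal (mollifier r (y - x)) \<partial>lborel)\<^sup>2 \<partial>lborel)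
   \<le> (\<integral>\<^sup>+y. g y * (\<integral>\<^sup>+x. (F x)\<^sup>2 * ennreal (mollifier r (y - x)) \<partial>lborel) \<partial>lborel)"
  by (intro nn_integral_mono mult_left_mono mollifier_Cauchy_Schwarz r_pos) simp_all
 also have "\<dots> = (\<integral>\<^sup>+y. \<integral>\<^sup>+x. g y * ((F x)\<^sup>2 * ennreal (mollifier r (y - x))) \<partial>lborel \<partial>lborel)"
  by (simp add: nn_integral_cmult)
 also have "\<dots> = (\<integral>\<^sup>+x. \<integral>\<^sup>+y. g y * ((F x)\<^sup>2 * ennreal (mollifier r (y - x))) \<partial>lborel \<partial>lborel)"
  by (subst lborel_pair.Fubini') auto
 also have "\<dots> \<le> (\<integral>\<^sup>+x. \<integral>\<^sup>+y. ((F x)\<^sup>2 * G x) * ennreal (mollifier r (y - x)) \<partial>lborel \<partial>lborel)"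
 proof (intro nn_integral_mono)
  fix x y :: 'a
  show "g y * ((F x)\<^sup>2 * ennreal (mollifier r (y - x))) \<le> ((F x)\<^sup>2 * G x) * ennreal (mollifier r (y - x))"
  proof (cases "norm (y - x) < r")
   case True
   then have "g y * ((F x)\<^sup>2 * ennreal (mollifier r (y - x))) \<le> G x * ((F x)\<^sup>2 * ennreal (mollifier r (y - x)))"
    by (intro mult_right_mono g_le_G) auto
   then show ?thesis by (simp add: ac_simps)
  qed (simp add: mollifier_eq_0[OF r_pos])
 qed
 also have "\<dots> = (\<integral>\<^sup>+x. (F x)\<^sup>2 * G x \<partial>lborel)"
  by (simp add: nn_integral_cmult nn_integral_mollifier(2)[OF r_pos])
 finally show ?thesis .
qed

lemma eventually_uniformly_close:
 fixes f :: "'a::euclidean_space \<Rightarrow> 'b::metric_space"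
 assumes f_cont: "continuous_on UNIV f" and "\<epsilon> > 0"
 shows "\<forall>\<^sub>F \<delta> in at_right 0. \<forall>x y. norm y \<le> R \<longrightarrow> norm (x - y) < \<delta> \<longrightarrow> dist (f x) (f y) < \<epsilon>"
proof -
 have "uniformly_continuous_on (cball 0 (R + 1)) f"
  by (intro compact_uniformly_continuous continuous_on_subset[OF f_cont]) auto
 then obtain d where "d > 0" and unif_cont: "\<And>x y. x \<in> cball 0 (R + 1) \<Longrightarrow> y \<in> cball 0 (R + 1) \<Longrightarrow> dist x y < d \<Longrightarrow> dist (f x) (f y) < \<epsilon>"
  using \<open>\<epsilon> > 0\<close> unfolding uniformly_continuous_on_def by (metis dist_commute)
 have "dist (f x) (f y) < \<epsilon>" if "\<delta> < min d 1" "norm y \<le> R" "norm (x - y) < \<delta>" for \<delta> x y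
 proof (rule unif_cont)
  have "norm x \<le> norm (x - y) + norm y" using norm_triangle_ineq[of "x - y" y] by simp
  then show "x \<in> cball 0 (R + 1)" "y \<in> cball 0 (R + 1)" using that by auto
  show "dist x y < d" using that by (simp add: dist_norm)
 qed
 moreover have "\<forall>\<^sub>F \<delta> in at_right (0::real). \<delta> < min d 1" using \<open>d > 0\<close> by (intro order_tendstoD(2)[OF tendsto_ident_at]) simp
 ultimately show ?thesis by (auto elim: eventually_mono)
qed

lemma locally_integrable_mult_cont:
 fixes f g :: "'a::euclidean_space \<Rightarrow> complex"
 assumes "locally_integrable f" "continuous_on UNIV g"
 shows "locally_integrable (\<lambda>x. g x * f x)"
 unfolding locally_integrable_def
proof (intro conjI allI)
 have [measurable]: "f \<in> borel_measurable borel" "g \<in> borel_measurable borel"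
  using assms by (auto simp: locally_integrable_def borel_measurable_continuous_onI)
 show "(\<lambda>x. g x * f x) \<in> borel_measurable borel" by measurable
 fix R :: real
 have [measurable]: "cball 0 R \<in> sets (borel :: 'a measure)" by simp
 have "compact (g ` cball 0 R)"
  by (intro compact_continuous_image continuous_on_subset[OF assms(2)]) auto
 then obtain M where M_bound: "\<And>x. x \<in> cball 0 R \<Longrightarrow> norm (g x) \<le> M"
  using compact_imp_bounded bounded_iff by (metis imageI)
 show "integrable lborel (\<lambda>x. indicator (cball 0 R) x * norm (g x * f x))"
 proof (rule Bochner_Integration.integrable_bound)
  show "integrable lborel (\<lambda>x. M * (indicator (cball 0 R) x * norm (f x)))"
   using assms(1) by (simp add: locally_integrable_def)
  have "norm (indicator (cball 0 R) x * norm (g x * f x)) \<le> norm (M * (indicator (cball 0 R) x * norm (f x)))" for x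
  proof (cases "x \<in> cball 0 R")
   case True
   have "norm (g x) * norm (f x) \<le> \<bar>M\<bar> * norm (f x)"
    using M_bound[OF True] by (intro mult_right_mono) auto
   then show ?thesis using True by (simp add: norm_mult abs_mult)
  qed simp
  then show "AE x in lborel. norm (indicator (cball 0 R) x * norm (g x * f x)) \<le> norm (M * (indicator (cball 0 R) x * norm (f x)))"
   by simp
 qed measurable
qed

lemma locally_integrable_integrableI: "integrable lborel f \<Longrightarrow> locally_integrable f"
 unfolding locally_integrable_def
proof (intro conjI allI)
 assume f_int: "integrable lborel f"
 then show "f \<in> borel_measurable borel" by simp
 fix R
 show "integrable lborel (\<lambda>x. indicator (cball 0 R) x * norm (f x))"
  using integrable_real_mult_indicator[OF _ integrable_norm[OF f_int], of "cball 0 R"] by (simp add: mult.commute)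
qed

lemma norm_integral_le_integral:
 fixes f :: "'a \<Rightarrow> 'b::{banach, second_countable_topology}"
 assumes "integrable M f" "integrable M g" "\<And>x. norm (f x) \<le> g x"
 shows "norm (\<integral>x. f x \<partial>M) \<le> (\<integral>x. g x \<partial>M)"
 using integral_norm_bound[of M f] integral_mono[OF integrable_norm[OF assms(1)] assms(2,3)] by linarith

lemma integrable_mult_bounded:
 fixes f g :: "'a \<Rightarrow> complex"
 assumes f_int: "integrable M f" and g_meas: "g \<in> borel_measurable M" and bound: "\<And>x. norm (g x) \<le> B"
 shows "integrable M (\<lambda>x. f x * g x)" "norm (\<integral>x. f x * g x \<partial>M) \<le> B * (\<integral>x. norm (f x) \<partial>M)"
proof -
 have norm_le: "norm (f x * g x) \<le> B * norm (f x)" for x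
  using mult_right_mono[OF bound norm_ge_zero] by (simp add: norm_mult mult.commute)
 show int: "integrable M (\<lambda>x. f x * g x)"
 proof (rule Bochner_Integration.integrable_bound)
  show "integrable M (\<lambda>x. B * norm (f x))" using f_int by simp
  show "(\<lambda>x. f x * g x) \<in> borel_measurable M" using f_int g_meas by measurable
  show "AE x in M. norm (f x * g x) \<le> norm (B * norm (f x))" using norm_le by (intro AE_I2) (simp add: order_trans[OF _ abs_ge_self])
 qed
 show "norm (\<integral>x. f x * g x \<partial>M) \<le> B * (\<integral>x. norm (f x) \<partial>M)"
  using norm_integral_le_integral[OF int _ norm_le] f_int by simp
qed

lemma mollifier_average_close:
 fixes q :: "'a::euclidean_space \<Rightarrow> complex"
 assumes r_pos: "r > 0" and q_bounded: "q \<in> borel_measurable borel" "\<And>x. norm (q x) \<le> M"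
  and close: "\<And>y. norm (y - x) < r \<Longrightarrow> norm (q y - q x) \<le> d"
 shows "norm ((\<integral>y. complex_of_real (mollifier r (y - x)) * q y \<partial>lborel) - q x) \<le> d"
proof -
 let ?m = "\<lambda>y. mollifier r (y - x)"
 have mollifier_props: "integrable lborel ?m" "(\<integral>y. ?m y \<partial>lborel) = 1"
  using integrable_lborel_shift[OF integrable_mollifier[OF r_pos], of "- x"] integral_lborel_shift[of "mollifier r" "- x"]
   integral_mollifier[OF r_pos, where 'a = 'a] borel_measurable_mollifier[OF r_pos] by simp_all
 have int: "integrable lborel (\<lambda>y. complex_of_real (?m y) * q y)" using mollifier_props(1) q_bounded by (intro integrable_mult_bounded) auto
 have "norm (\<integral>y. complex_of_real (?m y) * (q y - q x) \<partial>lborel) \<le> (\<integral>y. d * ?m y \<partial>lborel)"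
 proof (rule norm_integral_le_integral)
  show "integrable lborel (\<lambda>y. complex_of_real (?m y) * (q y - q x))" using int mollifier_props(1) by (simp add: right_diff_distrib)
  show "integrable lborel (\<lambda>y. d * ?m y)" using mollifier_props(1) by simp
  show "norm (complex_of_real (?m y) * (q y - q x)) \<le> d * ?m y" for y
  proof (cases "norm (y - x) < r")
   case True
   then show ?thesis using mult_right_mono[OF close mollifier_nonneg[OF r_pos], of y "y - x"] mollifier_nonneg[OF r_pos, of "y - x"]
    by (simp add: norm_mult mult.commute)
  qed (simp add: mollifier_eq_0[OF r_pos])
 qed
 moreover have "(\<integral>y. complex_of_real (?m y) * (q y - q x) \<partial>lborel) = (\<integral>y. complex_of_real (?m y) * q y \<partial>lborel) - q x"
  using int mollifier_props by (simp add: right_diff_distrib)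
 ultimately show ?thesis using mollifier_props(2) by simp
qed

lemma integrable_mollifier_pair:
 fixes W q :: "'a::euclidean_space \<Rightarrow> complex"
 assumes W_int: "integrable lborel W" and q_bounded: "q \<in> borel_measurable borel" "\<And>x. norm (q x) \<le> M" and r_pos: "r > 0"
 shows "integrable (lborel \<Otimes>\<^sub>M lborel) (\<lambda>(x, y). W x * complex_of_real (mollifier r (y - x)) * q y)"
proof (rule integrableI_bounded)
 let ?F = "\<lambda>x y. W x * complex_of_real (mollifier r (y - x)) * q y"
 note [measurable] = borel_measurable_mollifier[OF r_pos] q_bounded(1)
 have [measurable]: "W \<in> borel_measurable borel" using W_int by simp
 show "(\<lambda>(x, y). ?F x y) \<in> borel_measurable (lborel \<Otimes>\<^sub>M lborel)" by measurable
 have bound: "ennreal (norm (?F x y)) \<le> (ennreal M * ennreal (norm (W x))) * ennreal (mollifier r (y - x))" for x y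
 proof -
  have "norm (?F x y) \<le> M * norm (W x) * mollifier r (y - x)"
   using mult_left_mono[OF q_bounded(2)[of y], of "norm (W x) * mollifier r (y - x)"] mollifier_nonneg[OF r_pos, of "y - x"]
   by (simp add: norm_mult ac_simps)
  moreover have "0 \<le> M" using q_bounded(2) norm_ge_zero order_trans by blast
  ultimately show ?thesis
   using mollifier_nonneg[OF r_pos, of "y - x"] ennreal_leI[of "norm (?F x y)"] by (simp add: ennreal_mult[symmetric])
 qed
 have "(\<integral>\<^sup>+p. ennreal (norm (case p of (x, y) \<Rightarrow> ?F x y)) \<partial>(lborel \<Otimes>\<^sub>M lborel)) = (\<integral>\<^sup>+x. \<integral>\<^sup>+y. ennreal (norm (?F x y)) \<partial>lborel \<partial>lborel)"
  by (subst lborel.nn_integral_fst[symmetric]) auto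
 also have "\<dots> \<le> (\<integral>\<^sup>+x. \<integral>\<^sup>+y. (ennreal M * ennreal (norm (W x))) * ennreal (mollifier r (y - x)) \<partial>lborel \<partial>lborel)"
  by (intro nn_integral_mono bound)
 also have "\<dots> = ennreal M * (\<integral>\<^sup>+x. ennreal (norm (W x)) \<partial>lborel)"
  by (simp add: nn_integral_cmult nn_integral_mollifier(2)[OF r_pos])
 also have "\<dots> < \<infinity>" using W_int by (simp add: integrable_iff_bounded ennreal_mult_less_top)
 finally show "(\<integral>\<^sup>+p. ennreal (norm (case p of (x, y) \<Rightarrow> ?F x y)) \<partial>(lborel \<Otimes>\<^sub>M lborel)) < \<infinity>" .
qed

lemma integral_convolve_mollifier:
 fixes W q :: "'a::euclidean_space \<Rightarrow> complex"
 assumes W_int: "integrable lborel W" and q_props: "continuous_on UNIV q" "compact_supp q" and r_pos: "r > 0"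
  and close: "\<And>x y. norm (x - y) < r \<Longrightarrow> norm (q y - q x) \<le> d"
 shows "norm ((\<integral>y. convolve W (\<lambda>x. complex_of_real (mollifier r x)) y * q y \<partial>lborel) - (\<integral>x. W x * q x \<partial>lborel))
   \<le> d * (\<integral>x. norm (W x) \<partial>lborel)"
proof -
 note [measurable] = borel_measurable_mollifier[OF r_pos]
 have q_meas [measurable]: "q \<in> borel_measurable borel" using q_props(1) by (rule borel_measurable_continuous_onI)
 obtain M where M_bound: "\<And>x. norm (q x) \<le> M" using bounded_compact_supp[OF q_props] by blast
 define avg where "avg x = (\<integral>y. complex_of_real (mollifier r (y - x)) * q y \<partial>lborel)" for x
 have avg_meas: "avg \<in> borel_measurable borel"
  unfolding avg_def using lborel.borel_measurable_lebesgue_integral[of "\<lambda>x y. complex_of_real (mollifier r (y - x)) * q y" borel] by simp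
 have avg_close: "norm (avg x - q x) \<le> d" for x
  unfolding avg_def by (rule mollifier_average_close[OF r_pos q_meas M_bound close]) (simp add: norm_minus_commute)
 have "(\<integral>y. convolve W (\<lambda>x. complex_of_real (mollifier r x)) y * q y \<partial>lborel)
   = (\<integral>y. \<integral>x. W x * complex_of_real (mollifier r (y - x)) * q y \<partial>lborel \<partial>lborel)"
  by (simp add: convolve_def)
 also have "\<dots> = (\<integral>x. \<integral>y. W x * complex_of_real (mollifier r (y - x)) * q y \<partial>lborel \<partial>lborel)"
  by (rule lborel_pair.Fubini_integral[OF integrable_mollifier_pair[OF W_int q_meas M_bound r_pos]])
 also have "\<dots> = (\<integral>x. W x * avg x \<partial>lborel)"
  by (simp add: mult.assoc avg_def)
 also have "\<dots> - (\<integral>x. W x * q x \<partial>lborel) = (\<integral>x. W x * (avg x - q x) \<partial>lborel)"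
 proof -
  have "integrable lborel (\<lambda>x. W x * (avg x - q x))" "integrable lborel (\<lambda>x. W x * q x)"
   using avg_meas q_meas avg_close M_bound by (auto intro!: integrable_mult_bounded[OF W_int])
  from Bochner_Integration.integral_add[OF this] show ?thesis by (simp add: algebra_simps)
 qed
 finally show ?thesis
  using integrable_mult_bounded(2)[OF W_int _ avg_close] avg_meas by simp
qed

lemma norm_partial_bump_le:
 fixes x e :: "'a::euclidean_space"
 assumes R_pos: "R > 0" and e_in: "e \<in> Basis"
 shows "norm (partial e (\<lambda>x. complex_of_real (bump R 2 x)) x) \<le> 4 / R * indicator (cball 0 R) x"
proof -
 have partial: "partial e (\<lambda>x. complex_of_real (bump R 2 x)) x
   = 2 * complex_of_real (bump R 1 x) * (complex_of_real (x \<bullet> e) * complex_of_real (- 2 / R\<^sup>2))"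
  using partial_eq[OF has_partial_bump[of R 0 e]] by (simp add: numeral_2_eq_2 fun_eq_iff)
 show ?thesis
 proof (cases "norm x \<le> R")
  case True
  have "\<bar>x \<bullet> e\<bar> \<le> R" using Basis_le_norm[OF e_in, of x] True by linarith
  then have "bump R 1 x * \<bar>x \<bullet> e\<bar> \<le> 1 * R"
   using bump_nonneg[of R 1 x] bump_le_1[of R 1 x] by (intro mult_mono) auto
  moreover have "norm (partial e (\<lambda>x. complex_of_real (bump R 2 x)) x) = (bump R 1 x * \<bar>x \<bullet> e\<bar>) * (4 / R\<^sup>2)"
   unfolding partial using bump_nonneg[of R 1 x] by (simp add: norm_mult norm_divide norm_power abs_mult)
  ultimately have "norm (partial e (\<lambda>x. complex_of_real (bump R 2 x)) x) \<le> R * (4 / R\<^sup>2)"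
   by (simp add: mult_right_mono divide_right_mono)
  also have "\<dots> = 4 / R" using R_pos by (simp add: power2_eq_square)
  finally show ?thesis using True by simp
 next
  case False
  then have "bump R 1 x = 0" using bump_eq_0[OF R_pos, of x 0] by simp
  then show ?thesis unfolding partial using False by simp
 qed
qed

lemma norm_dzbar_bump_le:
 fixes x :: "complex^'n::finite"
 assumes "R > 0"
 shows "norm (dzbar j (\<lambda>x. complex_of_real (bump R 2 x)) x) \<le> 4 / R * indicator (cball 0 R) x"
proof -
 let ?p = "\<lambda>e. partial e (\<lambda>x. complex_of_real (bump R 2 x)) x"
 have "norm (dzbar j (\<lambda>x. complex_of_real (bump R 2 x)) x) = norm (?p (axis j 1) + \<i> * ?p (axis j \<i>)) / 2"
  by (simp add: dzbar_def norm_divide)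
 moreover have "norm (?p (axis j 1) + \<i> * ?p (axis j \<i>)) \<le> norm (?p (axis j 1)) + norm (?p (axis j \<i>))"
  using norm_triangle_ineq[of "?p (axis j 1)" "\<i> * ?p (axis j \<i>)"] by (simp add: norm_mult)
 ultimately show ?thesis
  using norm_partial_bump_le[OF assms axis_Basis(1), of j x] norm_partial_bump_le[OF assms axis_Basis(2), of j x] by linarith
qed

lemma eventually_uniformly_close_compact_supp:
 fixes f :: "'a::euclidean_space \<Rightarrow> 'b::{metric_space, zero}"
 assumes "continuous_on UNIV f" "compact_supp f" "\<epsilon> > 0"
 shows "\<forall>\<^sub>F \<delta> in at_right 0. \<forall>x y. norm (x - y) < \<delta> \<longrightarrow> dist (f x) (f y) < \<epsilon>"
proof -
 obtain S where S_vanish: "\<And>x. S < norm x \<Longrightarrow> f x = 0" using assms(2) by (auto simp: compact_supp_def)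
 have "\<forall>\<^sub>F \<delta> in at_right (0::real). \<delta> < 1" by (intro order_tendstoD(2)[OF tendsto_ident_at]) simp
 with eventually_uniformly_close[OF assms(1,3), of "S + 1"] show ?thesis
 proof eventually_elim
  case (elim \<delta>)
  show ?case
  proof (intro allI impI)
   fix x y :: 'a assume xy_close: "norm (x - y) < \<delta>"
   show "dist (f x) (f y) < \<epsilon>"
   proof (cases "norm y \<le> S + 1")
    case False
    moreover have "norm y \<le> norm x + norm (x - y)" using norm_triangle_ineq4[of x "x - y"] by simp
    ultimately have "S < norm x" "S < norm y" using xy_close elim(2) by linarith+
    then show ?thesis using S_vanish \<open>\<epsilon> > 0\<close> by simp
   qed (use elim(1) xy_close in blast)
  qed
 qed
qed

lemma eventually_comparable:
 fixes f :: "'a::euclidean_space \<Rightarrow> real"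
 assumes f_cont: "continuous_on UNIV f" and pos: "\<And>x. f x > 0"
 shows "\<forall>\<^sub>F \<delta> in at_right 0. \<forall>x y. norm y \<le> R \<longrightarrow> norm (x - y) < \<delta> \<longrightarrow> f x \<le> 2 * f y \<and> f y \<le> 2 * f x"
proof -
 have "continuous_on UNIV (\<lambda>x. ln (f x))" using pos by (intro continuous_intros f_cont) (metis less_irrefl)
 then have "\<forall>\<^sub>F \<delta> in at_right 0. \<forall>x y. norm y \<le> R \<longrightarrow> norm (x - y) < \<delta> \<longrightarrow> dist (ln (f x)) (ln (f y)) < ln 2"
  by (rule eventually_uniformly_close) simp
 then show ?thesis
 proof eventually_elim
  case (elim \<delta>)
  have "f x \<le> 2 * f y \<and> f y \<le> 2 * f x" if "norm y \<le> R" "norm (x - y) < \<delta>" for x y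
  proof -
   have "ln (f x) \<le> ln (2 * f y)" "ln (f y) \<le> ln (2 * f x)"
    using elim that pos[of x] pos[of y] by (fastforce simp: dist_real_def ln_mult)+
   then show ?thesis using pos[of x] pos[of y] by simp
  qed
  then show ?case by blast
 qed
qed

context psh_weight
begin

lemma E_cont: "continuous_on UNIV E"
 using continuous_on_Re[OF Ck_cont[OF E_Ck]] by simp

lemma E_nonzero: "E x \<noteq> 0"
 using E_pos[of x] by simp

lemma continuous_on_divide_E: "continuous_on UNIV f \<Longrightarrow> continuous_on UNIV (\<lambda>x. f x / E x)"
 using E_nonzero by (intro continuous_on_divide E_cont) simp_all

lemma integrable_norm_sq_div_E:
 assumes "Ck 1 \<psi>" "compact_supp \<psi>"
 shows "integrable lborel (\<lambda>x. (norm (\<psi> x))\<^sup>2 / E x)"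
 using compact_supp_comp[OF assms(2), of "\<lambda>t. (norm t)\<^sup>2"]
 by (intro integrable_compact_supp continuous_on_divide_E continuous_intros Ck_cont[OF assms(1)])
  (auto simp: divide_inverse intro: compact_supp_mult1)

lemma ph_cont: "continuous_on UNIV (ph k)"
 using Ck_cont[OF ph_Ck] .

lemma borel_measurable_E [measurable]: "E \<in> borel_measurable borel"
 by (rule borel_measurable_continuous_onI[OF E_cont])

lemma dzbar_E: "dzbar k (\<lambda>x. complex_of_real (E x)) x = - cnj (ph k x) * E x"
 using dzbar_cnj[OF E_Ck, of k x] by (simp add: dz_E)

definition inv_E :: "complex^'n \<Rightarrow> complex" where "inv_E x = inverse (complex_of_real (E x))"

lemma Ck_inv_E: "Ck 1 inv_E"
 unfolding inv_E_def[abs_def] by (intro Ck_inverse E_Ck) (simp add: E_nonzero)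

lemma dzbar_inv_E: "dzbar k inv_E x = cnj (ph k x) * inv_E x"
proof -
 have nonzero: "complex_of_real (E x) \<noteq> 0" for x by (simp add: E_nonzero)
 show ?thesis
  unfolding inv_E_def[abs_def] dz_inverse(2)[OF E_Ck nonzero] dzbar_E using nonzero[of x] by (simp add: field_simps)
qed

lemma locally_integrable_of_weighted_L2:
 assumes [measurable]: "h \<in> borel_measurable borel" and h_L2: "integrable lborel (\<lambda>x. (norm (h x))\<^sup>2 * E x)"
 shows "locally_integrable h"
 unfolding locally_integrable_def
proof (intro conjI allI)
 fix R :: real
 have int: "integrable lborel (\<lambda>x. indicator (cball 0 R) x *\<^sub>R (1 / E x))"
  using borel_integrable_compact[OF compact_cball continuous_on_subset[OF continuous_on_divide_E[OF continuous_on_const]], of 0 R 1]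
  by (simp add: set_integrable_def[symmetric])
 have [measurable]: "cball 0 R \<in> sets (borel :: (complex^'n) measure)" by simp
 show "integrable lborel (\<lambda>x. indicator (cball 0 R) x * norm (h x))"
 proof (rule Bochner_Integration.integrable_bound[OF Bochner_Integration.integrable_add[OF h_L2 int]], goal_cases)
  case 2
  show ?case
  proof (rule AE_I2)
   fix x
   have "2 * norm (h x) \<le> (norm (h x))\<^sup>2 * E x + 1 / E x"
    using E_pos[of x] zero_le_power2[of "norm (h x) * E x - 1"] by (simp add: field_simps power2_eq_square)
   then have "norm (h x) \<le> (norm (h x))\<^sup>2 * E x + 1 / E x" using norm_ge_zero[of "h x"] by linarith
   then show "norm (indicator (cball 0 R) x * norm (h x)) \<le> norm ((norm (h x))\<^sup>2 * E x + indicator (cball 0 R) x *\<^sub>R (1 / E x))"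
    using E_pos[of x] by (auto simp: indicator_def)
  qed
 qed simp
qed simp

end

text \<open>A weak \<open>L\<^sup>2\<close> solution is a weak solution of the Cauchy--Riemann equations: mollifying \<open>W = h E\<close> turns
 the equation into \<open>\<Sum>\<^sub>j \<partial>\<^sub>j \<beta>\<^sub>j = 0\<close>, where \<open>\<beta>\<^sub>j\<close> is \<open>E\<close> times the derivative of the mollified solution up to a
 commutator without derivatives; the energy (Caccioppoli) estimate with a cutoff of radius \<open>R\<close> then makes
 \<open>\<beta>\<^sub>j\<close> small.\<close>

locale weak_solution = psh_weight E ph
 for E :: "complex^'n::finite \<Rightarrow> real" and ph :: "'n \<Rightarrow> complex^'n \<Rightarrow> complex" +
 fixes h :: "complex^'n \<Rightarrow> complex"
 assumes h_meas [measurable]: "h \<in> borel_measurable borel"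
  and h_int: "integrable lborel (\<lambda>x. (norm (h x))\<^sup>2 * E x)"
  and weak: "\<And>v. Ck 3 v \<Longrightarrow> compact_supp v \<Longrightarrow> (\<integral>x. h x * cnj (Box v x) * E x \<partial>lborel) = 0"
begin

declare Ck.simps [simp del] One_nat_def [simp del]

definition energy :: real where "energy = (\<integral>x. (norm (h x))\<^sup>2 * E x \<partial>lborel)"

definition W :: "complex^'n \<Rightarrow> complex" where "W x = h x * complex_of_real (E x)"

lemma energy_nonneg: "energy \<ge> 0"
 unfolding energy_def using E_pos by (intro integral_nonneg_AE) (simp add: less_imp_le)

lemma borel_measurable_W [measurable]: "W \<in> borel_measurable borel"
 unfolding W_def[abs_def] by measurable

lemma norm_W_sq: "(norm (W x))\<^sup>2 / E x = (norm (h x))\<^sup>2 * E x"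
 using E_pos[of x] by (simp add: W_def norm_mult power_mult_distrib power2_eq_square)

lemma integrable_W: "integrable lborel W"
proof (rule Bochner_Integration.integrable_bound[OF Bochner_Integration.integrable_add[OF h_int E_int]])
 have "norm (W x) \<le> norm ((norm (h x))\<^sup>2 * E x + E x)" for x
 proof -
  have "2 * norm (h x) \<le> (norm (h x))\<^sup>2 + 1" using sum_squares_bound[of "norm (h x)" 1] by simp
  then have "norm (h x) \<le> (norm (h x))\<^sup>2 + 1" using norm_ge_zero[of "h x"] by linarith
  then have "norm (h x) * E x \<le> ((norm (h x))\<^sup>2 + 1) * E x" using E_pos[of x] by (intro mult_right_mono) auto
  then show ?thesis using E_pos[of x] by (simp add: W_def norm_mult algebra_simps)
 qed
 then show "AE x in lborel. norm (W x) \<le> norm ((norm (h x))\<^sup>2 * E x + E x)" by simp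
qed measurable

lemma locally_integrable_W: "locally_integrable W"
 by (rule locally_integrable_integrableI[OF integrable_W])

lemma locally_integrable_ph_W: "locally_integrable (\<lambda>x. cnj (ph j x) * W x)"
 by (rule locally_integrable_mult_cont[OF locally_integrable_W]) (intro continuous_intros ph_cont)

lemma nn_integral_W_sq:
 assumes "c \<ge> 0"
 shows "(\<integral>\<^sup>+x. (ennreal (norm (W x)))\<^sup>2 * ennreal (c / E x) \<partial>lborel) = ennreal (c * energy)"
proof -
 have "(ennreal (norm (W x)))\<^sup>2 * ennreal (c / E x) = ennreal (c * ((norm (h x))\<^sup>2 * E x))" for x
 proof -
  have "(ennreal (norm (W x)))\<^sup>2 * ennreal (c / E x) = ennreal ((norm (W x))\<^sup>2 * (c / E x))"
   using assms E_pos[of x] by (subst ennreal_mult) (auto simp: ennreal_power)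
  also have "(norm (W x))\<^sup>2 * (c / E x) = c * ((norm (W x))\<^sup>2 / E x)" by simp
  finally show ?thesis unfolding norm_W_sq .
 qed
 moreover have "integrable lborel (\<lambda>x. c * ((norm (h x))\<^sup>2 * E x))" by (rule integrable_mult_right[OF h_int])
 moreover have "AE x in lborel. 0 \<le> c * ((norm (h x))\<^sup>2 * E x)"
  using assms E_pos by (intro AE_I2 mult_nonneg_nonneg) (auto simp: less_imp_le)
 ultimately show ?thesis by (simp add: nn_integral_eq_integral energy_def)
qed

end

locale mollified_weak_solution = weak_solution E ph h
 for E :: "complex^'n::finite \<Rightarrow> real" and ph :: "'n \<Rightarrow> complex^'n \<Rightarrow> complex" and h :: "complex^'n \<Rightarrow> complex" +
 fixes \<epsilon> :: real
 assumes \<epsilon>_pos: "\<epsilon> > 0"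
begin

definition \<rho> :: "complex^'n \<Rightarrow> complex" where "\<rho> x = complex_of_real (mollifier \<epsilon> x)"

lemma Ck_\<rho>: "n \<le> 3 \<Longrightarrow> Ck n \<rho>"
 using Ck_le[OF Ck_mollifier[OF \<epsilon>_pos]] by (simp add: \<rho>_def[abs_def])

lemma Ck_d_\<rho>: "Ck 1 (dz j \<rho>)" "Ck 1 (dzbar j \<rho>)"
 using Ck_dz[of 1 \<rho> j] Ck_dzbar[of 1 \<rho> j] Ck_\<rho>[of 2] by (simp_all add: numeral_2_eq_2 One_nat_def)

lemma compact_supp_\<rho>: "compact_supp \<rho>"
 unfolding \<rho>_def[abs_def] using compact_supp_mollifier[OF \<epsilon>_pos] by (rule compact_supp_comp) simp

definition smooth_W :: "complex^'n \<Rightarrow> complex" where "smooth_W = convolve W \<rho>"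

definition smooth_h :: "complex^'n \<Rightarrow> complex" where "smooth_h y = smooth_W y * inv_E y"

definition \<beta> :: "'n \<Rightarrow> complex^'n \<Rightarrow> complex" where
 "\<beta> j y = convolve W (dzbar j \<rho>) y + convolve (\<lambda>x. cnj (ph j x) * W x) \<rho> y"

definition commutator :: "'n \<Rightarrow> complex^'n \<Rightarrow> complex" where
 "commutator j y = cnj (ph j y) * smooth_W y - convolve (\<lambda>x. cnj (ph j x) * W x) \<rho> y"

lemmas Ck_convolve_\<rho> = Ck_convolve[OF locally_integrable_W] Ck_convolve[OF locally_integrable_ph_W]

lemma Ck_smooth_W: "Ck 1 smooth_W"
 unfolding smooth_W_def by (intro Ck_convolve_\<rho> Ck_\<rho> compact_supp_\<rho>) simp

lemma Ck_smooth_h: "Ck 1 smooth_h"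
 unfolding smooth_h_def[abs_def] by (intro Ck_mult Ck_smooth_W Ck_inv_E)

lemma Ck_\<beta>: "Ck 1 (\<beta> j)"
 unfolding \<beta>_def[abs_def] by (intro Ck_add Ck_convolve_\<rho> Ck_d_\<rho> Ck_\<rho> compact_supp_dzbar compact_supp_\<rho>) simp

lemma continuous_on_commutator: "continuous_on UNIV (commutator j)"
 unfolding commutator_def[abs_def]
 by (intro continuous_intros ph_cont Ck_cont[OF Ck_smooth_W] continuous_on_convolve locally_integrable_ph_W
   Ck_cont[OF Ck_\<rho>[of 1]] compact_supp_\<rho>) simp

lemma dzbar_smooth_h: "dzbar j smooth_h y = (\<beta> j y + commutator j y) * inv_E y"
proof -
 have "dzbar j smooth_h y = dzbar j smooth_W y * inv_E y + smooth_W y * (cnj (ph j y) * inv_E y)"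
  unfolding smooth_h_def[abs_def] by (simp add: dzbar_mult Ck_smooth_W Ck_inv_E dzbar_inv_E)
 moreover have "dzbar j smooth_W y = convolve W (dzbar j \<rho>) y"
  unfolding smooth_W_def by (simp add: dz_convolve locally_integrable_W Ck_\<rho> compact_supp_\<rho>)
 ultimately show ?thesis by (simp add: \<beta>_def commutator_def algebra_simps)
qed

lemma cnj_Box_reflected_\<rho>:
 "cnj (Box (\<lambda>x. \<rho> (y - x)) x) = - (\<Sum>j\<in>UNIV. dz j (dzbar j \<rho>) (y - x) + cnj (ph j x) * dz j \<rho> (y - x))"
proof -
 have dzbar_reflected: "dzbar j (\<lambda>x. \<rho> (y - x)) = (\<lambda>x. - dzbar j \<rho> (y - x))" for j
  using dzbar_reflect[OF Ck_\<rho>[of 1]] by (simp add: fun_eq_iff)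
 have "dz j (\<lambda>x. - dzbar j \<rho> (y - x)) x = - dz j (\<lambda>x. dzbar j \<rho> (y - x)) x" for j
  by (rule dz_minus) (intro Ck_reflect Ck_d_\<rho>)
 then have dz_dzbar_reflected: "dz j (dzbar j (\<lambda>x. \<rho> (y - x))) x = dz j (dzbar j \<rho>) (y - x)" for j
  unfolding dzbar_reflected using dz_reflect[OF Ck_d_\<rho>(2), of j j y x] by simp
 have cnj_\<rho>: "(\<lambda>x. cnj (\<rho> x)) = \<rho>" by (simp add: \<rho>_def fun_eq_iff)
 have cnj_dzbar: "cnj (dzbar j \<rho> z) = dz j \<rho> z" for j z
  using dz_cnj[OF Ck_\<rho>[of 1], of j z] cnj_\<rho> by simp
 have cnj_dz_dzbar: "cnj (dz j (dzbar j \<rho>) z) = dz j (dzbar j \<rho>) z" for j z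
 proof -
  have "cnj (dz j (dzbar j \<rho>) z) = dzbar j (\<lambda>x. cnj (dzbar j \<rho> x)) z" using dzbar_cnj[OF Ck_d_\<rho>(2), of j j z] by simp
  also have "\<dots> = dzbar j (dz j \<rho>) z" by (simp add: cnj_dzbar)
  also have "\<dots> = dz j (dzbar j \<rho>) z" by (rule dzbar_dz_commute[OF Ck_\<rho>]) simp
  finally show ?thesis .
 qed
 show ?thesis
  by (simp add: Box_def D_def dz_dzbar_reflected) (simp add: dzbar_reflected cnj_dzbar cnj_dz_dzbar)
qed

lemma sum_dz_\<beta>: "(\<Sum>j\<in>UNIV. dz j (\<beta> j) y) = 0"
proof -
 have dz_\<beta>: "dz j (\<beta> j) y = convolve W (dz j (dzbar j \<rho>)) y + convolve (\<lambda>x. cnj (ph j x) * W x) (dz j \<rho>) y" for j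
  unfolding \<beta>_def[abs_def]
  by (subst dz_add) (simp_all add: Ck_convolve_\<rho> locally_integrable_W locally_integrable_ph_W Ck_d_\<rho> Ck_\<rho> compact_supp_dzbar
    compact_supp_\<rho> dz_convolve)
 have integrand: "h x * cnj (Box (\<lambda>x. \<rho> (y - x)) x) * E x
   = - (\<Sum>j\<in>UNIV. W x * dz j (dzbar j \<rho>) (y - x) + (cnj (ph j x) * W x) * dz j \<rho> (y - x))" for x
  unfolding cnj_Box_reflected_\<rho> by (simp add: W_def sum_distrib_left sum_distrib_right algebra_simps)
 have "continuous_on UNIV (dz j (dzbar j \<rho>))" for j
  using Ck_dz[of 0 "dzbar j \<rho>" j] Ck_d_\<rho>(2)[of j] by (auto simp: Ck.simps One_nat_def)
 then have int: "integrable lborel (\<lambda>x. W x * dz j (dzbar j \<rho>) (y - x))"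
  "integrable lborel (\<lambda>x. (cnj (ph j x) * W x) * dz j \<rho> (y - x))" for j
  by (intro convolve_integrable locally_integrable_W locally_integrable_ph_W compact_supp_dz compact_supp_dzbar compact_supp_\<rho>
    Ck_cont[OF Ck_d_\<rho>(1)]; assumption)+
 have "0 = (\<integral>x. h x * cnj (Box (\<lambda>x. \<rho> (y - x)) x) * E x \<partial>lborel)"
  by (rule weak[symmetric]) (simp_all add: Ck_reflect Ck_\<rho> compact_supp_reflect compact_supp_\<rho>)
 also have "\<dots> = - (\<Sum>j\<in>UNIV. convolve W (dz j (dzbar j \<rho>)) y + convolve (\<lambda>x. cnj (ph j x) * W x) (dz j \<rho>) y)"
  unfolding integrand convolve_def using int by (simp add: Bochner_Integration.integral_sum)
 finally show ?thesis by (simp add: dz_\<beta>)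
qed

definition average :: "complex^'n \<Rightarrow> ennreal" where
 "average y = (\<integral>\<^sup>+x. ennreal (norm (W x)) * ennreal (mollifier \<epsilon> (y - x)) \<partial>lborel)"

lemma norm_integral_W_\<rho>_le:
 assumes k_cont: "continuous_on UNIV k" and c_bound: "c \<ge> 0" "\<And>x. norm (y - x) < \<epsilon> \<Longrightarrow> norm (k x) \<le> c"
 shows "ennreal (norm (\<integral>x. W x * k x * \<rho> (y - x) \<partial>lborel)) \<le> ennreal c * average y"
proof -
 note [measurable] = borel_measurable_mollifier[OF \<epsilon>_pos]
 have "integrable lborel (\<lambda>x. W x * k x * \<rho> (y - x))"
  using convolve_integrable[OF locally_integrable_mult_cont[OF locally_integrable_W k_cont] Ck_cont[OF Ck_\<rho>[of 1]] compact_supp_\<rho>, of y]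
  by (simp add: mult.commute)
 then have "ennreal (norm (\<integral>x. W x * k x * \<rho> (y - x) \<partial>lborel)) \<le> (\<integral>\<^sup>+x. ennreal (norm (W x * k x * \<rho> (y - x))) \<partial>lborel)"
  by (rule integral_norm_bound_ennreal)
 also have "\<dots> \<le> (\<integral>\<^sup>+x. ennreal c * (ennreal (norm (W x)) * ennreal (mollifier \<epsilon> (y - x))) \<partial>lborel)"
 proof (rule nn_integral_mono)
  fix x
  have nonneg: "mollifier \<epsilon> (y - x) \<ge> 0" by (rule mollifier_nonneg[OF \<epsilon>_pos])
  have "norm (W x * k x * \<rho> (y - x)) \<le> c * (norm (W x) * mollifier \<epsilon> (y - x))"
  proof (cases "norm (y - x) < \<epsilon>")
   case True
   then have "norm (k x) * (norm (W x) * mollifier \<epsilon> (y - x)) \<le> c * (norm (W x) * mollifier \<epsilon> (y - x))"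
    using nonneg by (intro mult_right_mono c_bound(2)) auto
   then show ?thesis using nonneg by (simp add: \<rho>_def norm_mult mult_ac)
  qed (simp add: \<rho>_def mollifier_eq_0[OF \<epsilon>_pos])
  then show "ennreal (norm (W x * k x * \<rho> (y - x))) \<le> ennreal c * (ennreal (norm (W x)) * ennreal (mollifier \<epsilon> (y - x)))"
   using c_bound(1) nonneg by (simp add: ennreal_mult[symmetric] ennreal_leI)
 qed
 also have "\<dots> = ennreal c * average y"
  by (simp add: nn_integral_cmult average_def)
 finally show ?thesis .
qed

end
lemma Re_cutoff_form_ge:
 fixes b r p :: complex and \<zeta> :: real
 shows "\<zeta>\<^sup>2 * (norm b)\<^sup>2 / 2 - (\<zeta>\<^sup>2 * (norm r)\<^sup>2 + 4 * (norm p)\<^sup>2) \<le> Re (b * cnj (2 * \<zeta> * p + \<zeta> * \<zeta> * (b + r)))"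
proof -
 define u v where "u = \<zeta> * b" and "v = \<zeta> * r"
 have "b * cnj (2 * \<zeta> * p + \<zeta> * \<zeta> * (b + r)) = 2 * (u * cnj p) + u * cnj u + u * cnj v"
  by (simp add: u_def v_def algebra_simps)
 then have expand: "Re (b * cnj (2 * \<zeta> * p + \<zeta> * \<zeta> * (b + r))) = 2 * Re (u * cnj p) + (norm u)\<^sup>2 + Re (u * cnj v)"
  by (simp add: cmod_power2) (simp add: power2_eq_square)
 have lower: "- (norm u * norm z) \<le> Re (u * cnj z)" for z
  using abs_Re_le_cmod[of "u * cnj z"] by (simp add: norm_mult)
 have "2 * (norm u * norm p) \<le> (norm u)\<^sup>2 / 4 + 4 * (norm p)\<^sup>2"
  using zero_le_power2[of "norm u / 2 - 2 * norm p"] by (simp add: power2_eq_square algebra_simps)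
 moreover have "norm u * norm v \<le> (norm u)\<^sup>2 / 4 + (norm v)\<^sup>2"
  using zero_le_power2[of "norm u / 2 - norm v"] by (simp add: power2_eq_square algebra_simps)
 ultimately have "(norm u)\<^sup>2 / 2 - ((norm v)\<^sup>2 + 4 * (norm p)\<^sup>2) \<le> Re (b * cnj (2 * \<zeta> * p + \<zeta> * \<zeta> * (b + r)))"
  unfolding expand using lower[of p] lower[of v] by linarith
 then show ?thesis by (simp add: u_def v_def norm_mult power_mult_distrib)
qed

lemma product_le_cutoff_squares:
 fixes b r p R \<zeta> :: real
 assumes R_pos: "R > 0" and \<zeta>: "1 / 2 \<le> \<zeta>"
 shows "(b + r) * p \<le> 2 * R * (\<zeta>\<^sup>2 * b\<^sup>2 + \<zeta>\<^sup>2 * r\<^sup>2) + p\<^sup>2 / R"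
proof -
 have "a * p \<le> 2 * R * (\<zeta>\<^sup>2 * a\<^sup>2) + p\<^sup>2 / (2 * R)" for a
 proof -
  have "0 \<le> (R * a - p)\<^sup>2" by simp
  then have "a * p \<le> R / 2 * a\<^sup>2 + p\<^sup>2 / (2 * R)" using R_pos by (simp add: field_simps power2_eq_square)
  moreover have "1 / 4 \<le> \<zeta>\<^sup>2" using power_mono[OF \<zeta>, of 2] by (simp add: power_divide)
  then have "R / 2 * a\<^sup>2 \<le> 2 * R * (\<zeta>\<^sup>2 * a\<^sup>2)"
   using R_pos mult_right_mono[of "1 / 4" "\<zeta>\<^sup>2" "2 * R * a\<^sup>2"] by (simp add: ac_simps)
  ultimately show ?thesis by linarith
 qed
 from this[of b] this[of r] show ?thesis using R_pos by (simp add: field_simps)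
qed

locale cutoff_weak_solution = mollified_weak_solution E ph h \<epsilon>
 for E :: "complex^'n::finite \<Rightarrow> real" and ph :: "'n \<Rightarrow> complex^'n \<Rightarrow> complex" and h :: "complex^'n \<Rightarrow> complex" and \<epsilon> :: real +
 fixes R :: real
 assumes R_pos: "R > 0"
  and E_close: "\<And>x y. norm y \<le> R \<Longrightarrow> norm (x - y) < \<epsilon> \<Longrightarrow> E x \<le> 2 * E y"
  and ph_close: "\<And>j x y. norm y \<le> R \<Longrightarrow> norm (x - y) < \<epsilon> \<Longrightarrow> dist (ph j x) (ph j y) < 1 / R"
begin

abbreviation \<zeta> :: "complex^'n \<Rightarrow> real" where "\<zeta> \<equiv> bump R 2"

abbreviation cutoff :: "complex^'n \<Rightarrow> complex" where "cutoff x \<equiv> complex_of_real (\<zeta> x)"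

lemma Ck_cutoff: "Ck 1 cutoff"
 using Ck_bump[of 1 R] by (simp add: numeral_2_eq_2 One_nat_def)

lemma compact_supp_\<zeta>: "compact_supp \<zeta>"
 using compact_supp_bump[OF R_pos, of 1] by (simp add: numeral_2_eq_2 One_nat_def)

lemma \<zeta>_le_indicator: "(\<zeta> x)\<^sup>2 \<le> indicator (cball 0 R) x"
 using bump_eq_0[OF R_pos, of x 1] power_le_one[of "\<zeta> x" 2] bump_nonneg[of R 2 x] bump_le_1[of R 2 x] by (auto simp: indicator_def numeral_2_eq_2 One_nat_def)

lemma compact_supp_cutoff: "compact_supp cutoff"
 using compact_supp_\<zeta> by (rule compact_supp_comp) simp

definition flux_density :: "'n \<Rightarrow> complex^'n \<Rightarrow> real" where
 "flux_density j x = (\<zeta> x)\<^sup>2 * (norm (\<beta> j x))\<^sup>2 / E x"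

definition commutator_density :: "'n \<Rightarrow> complex^'n \<Rightarrow> real" where
 "commutator_density j x = (\<zeta> x)\<^sup>2 * (norm (commutator j x))\<^sup>2 / E x"

definition cutoff_density :: "'n \<Rightarrow> complex^'n \<Rightarrow> real" where
 "cutoff_density j x = (norm (dzbar j cutoff x * smooth_W x))\<^sup>2 / E x"

lemma density_nonneg: "flux_density j x \<ge> 0" "commutator_density j x \<ge> 0" "cutoff_density j x \<ge> 0"
 using less_imp_le[OF E_pos[of x]] by (simp_all add: flux_density_def commutator_density_def cutoff_density_def)

lemma integrable_density:
 "integrable lborel (flux_density j)" "integrable lborel (commutator_density j)" "integrable lborel (cutoff_density j)"
proof -
 have "continuous_on UNIV (dzbar j cutoff)"
  using Ck_dzbar[of 0 cutoff j] Ck_cutoff by (auto simp: Ck.simps One_nat_def)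
 then have "continuous_on UNIV (flux_density j)" "continuous_on UNIV (commutator_density j)" "continuous_on UNIV (cutoff_density j)"
  unfolding flux_density_def[abs_def] commutator_density_def[abs_def] cutoff_density_def[abs_def]
  by (intro continuous_on_divide_E continuous_intros continuous_on_bump continuous_on_commutator Ck_cont[OF Ck_\<beta>] Ck_cont[OF Ck_smooth_W]; assumption)+
 moreover have "compact_supp (flux_density j)" "compact_supp (commutator_density j)" "compact_supp (cutoff_density j)"
  unfolding flux_density_def[abs_def] commutator_density_def[abs_def] cutoff_density_def[abs_def] divide_inverse norm_mult power_mult_distrib
  using compact_supp_comp[OF compact_supp_\<zeta>, of "\<lambda>t. t\<^sup>2"]
   compact_supp_comp[OF compact_supp_dzbar[OF compact_supp_cutoff, of j], of "\<lambda>t. (norm t)\<^sup>2"]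
  by (intro compact_supp_mult1; simp)+
 ultimately show "integrable lborel (flux_density j)" "integrable lborel (commutator_density j)" "integrable lborel (cutoff_density j)"
  by (auto intro: integrable_compact_supp)
qed

lemma Re_\<beta>_test_ge:
 "flux_density j x / 2 - (commutator_density j x + 4 * cutoff_density j x)
  \<le> Re (\<beta> j x * cnj (dzbar j (\<lambda>x. cutoff x * cutoff x * smooth_h x) x))"
proof -
 let ?b = "\<beta> j x" and ?r = "commutator j x" and ?p = "dzbar j cutoff x * smooth_W x"
 have "dzbar j (\<lambda>x. cutoff x * cutoff x * smooth_h x) x = (2 * \<zeta> x * ?p + \<zeta> x * \<zeta> x * (?b + ?r)) * inv_E x"
  by (simp add: dzbar_mult Ck_mult Ck_cutoff Ck_smooth_h dzbar_smooth_h) (simp add: smooth_h_def algebra_simps)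
 then have "Re (?b * cnj (dzbar j (\<lambda>x. cutoff x * cutoff x * smooth_h x) x)) = Re (?b * cnj (2 * \<zeta> x * ?p + \<zeta> x * \<zeta> x * (?b + ?r))) / E x"
  by (simp add: inv_E_def divide_inverse mult.assoc[symmetric] flip: of_real_inverse)
 moreover have "((\<zeta> x)\<^sup>2 * (norm ?b)\<^sup>2 / 2 - ((\<zeta> x)\<^sup>2 * (norm ?r)\<^sup>2 + 4 * (norm ?p)\<^sup>2)) / E x
   = flux_density j x / 2 - (commutator_density j x + 4 * cutoff_density j x)"
  by (simp add: flux_density_def commutator_density_def cutoff_density_def diff_divide_distrib add_divide_distrib)
 ultimately show ?thesis
  using divide_right_mono[OF Re_cutoff_form_ge less_imp_le[OF E_pos[of x]], of "\<zeta> x" ?b ?r ?p] by simp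
qed

lemma Caccioppoli:
 "(\<integral>x. (\<Sum>j\<in>UNIV. flux_density j x) \<partial>lborel)
  \<le> 2 * (\<integral>x. (\<Sum>j\<in>UNIV. commutator_density j x + 4 * cutoff_density j x) \<partial>lborel)"
proof -
 define G where "G x = cutoff x * cutoff x * smooth_h x" for x
 have G_test: "Ck 1 G" "compact_supp G"
  unfolding G_def[abs_def] by (intro Ck_mult Ck_cutoff Ck_smooth_h compact_supp_mult1 compact_supp_cutoff)+
 let ?F = "\<lambda>j x. \<beta> j x * cnj (G x)"
 have F_test: "Ck 1 (?F j)" "compact_supp (?F j)" for j
  using compact_supp_comp[OF G_test(2), of cnj] by (auto intro!: Ck_mult Ck_cnj Ck_\<beta> G_test compact_supp_mult2)
 have "integrable lborel (dz j (?F j))" for j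
  using Ck_dz[of 0 "?F j" j] F_test(1)[of j] by (intro integrable_compact_supp compact_supp_dz F_test) (auto simp: Ck.simps One_nat_def)
 then have int: "integrable lborel (\<lambda>x. \<Sum>j\<in>UNIV. dz j (?F j) x)" and zero: "(\<integral>x. (\<Sum>j\<in>UNIV. dz j (?F j) x) \<partial>lborel) = 0"
  using integral_dz_eq_0(1)[OF F_test] by (simp_all add: Bochner_Integration.integral_sum)
 have "dz j (?F j) x = dz j (\<beta> j) x * cnj (G x) + \<beta> j x * cnj (dzbar j G x)" for j x
  by (simp add: dz_mult dz_cnj Ck_\<beta> G_test Ck_cnj)
 then have divergence: "(\<Sum>j\<in>UNIV. dz j (?F j) x) = (\<Sum>j\<in>UNIV. \<beta> j x * cnj (dzbar j G x))" for x
  by (simp add: sum.distrib sum_distrib_right[symmetric] sum_dz_\<beta>)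
 have "(\<integral>x. (\<Sum>j\<in>UNIV. flux_density j x / 2 - (commutator_density j x + 4 * cutoff_density j x)) \<partial>lborel)
   \<le> (\<integral>x. Re (\<Sum>j\<in>UNIV. dz j (?F j) x) \<partial>lborel)"
 proof (rule integral_mono[OF _ integrable_Re[OF int]])
  show "integrable lborel (\<lambda>x. \<Sum>j\<in>UNIV. flux_density j x / 2 - (commutator_density j x + 4 * cutoff_density j x))"
   using integrable_density by simp
  show "(\<Sum>j\<in>UNIV. flux_density j x / 2 - (commutator_density j x + 4 * cutoff_density j x)) \<le> Re (\<Sum>j\<in>UNIV. dz j (?F j) x)" for x
   unfolding divergence Re_sum by (intro sum_mono) (use Re_\<beta>_test_ge in \<open>simp add: G_def[abs_def]\<close>)
 qed
 also have "\<dots> = 0" using integral_Re[OF int] zero by simp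
 finally have "(\<integral>x. (\<Sum>j\<in>UNIV. flux_density j x) / 2 - (\<Sum>j\<in>UNIV. commutator_density j x + 4 * cutoff_density j x) \<partial>lborel) \<le> 0"
  by (simp add: sum_subtractf sum_divide_distrib)
 then show ?thesis using integrable_density by (simp add: Bochner_Integration.integral_diff)
qed

lemma nn_integral_average_sq_le:
 assumes c_nonneg: "c \<ge> 0"
 shows "(\<integral>\<^sup>+y. ennreal (c * indicator (cball 0 R) y / E y) * (average y)\<^sup>2 \<partial>lborel) \<le> ennreal (2 * c * energy)"
proof -
 have [measurable]: "cball 0 R \<in> sets (borel :: (complex^'n) measure)" by simp
 have "(\<integral>\<^sup>+y. ennreal (c * indicator (cball 0 R) y / E y) * (average y)\<^sup>2 \<partial>lborel)
   \<le> (\<integral>\<^sup>+x. (ennreal (norm (W x)))\<^sup>2 * ennreal (2 * c / E x) \<partial>lborel)"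
  unfolding average_def
 proof (rule mollifier_average_bound[OF \<epsilon>_pos])
  fix x y :: "complex^'n" assume xy_close: "norm (y - x) < \<epsilon>"
  have "c * indicator (cball 0 R) y / E y \<le> 2 * c / E x"
  proof (cases "norm y \<le> R")
   case True
   then have "c * E x \<le> c * (2 * E y)" using xy_close by (intro mult_left_mono E_close c_nonneg) (simp_all add: norm_minus_commute)
   then show ?thesis using True E_pos[of x] E_pos[of y] by (simp add: field_simps)
  next
   case False
   then show ?thesis using c_nonneg E_pos[of x] by simp
  qed
  then show "ennreal (c * indicator (cball 0 R) y / E y) \<le> ennreal (2 * c / E x)" by (rule ennreal_leI)
 qed measurable
 also have "\<dots> = ennreal (2 * c * energy)" using c_nonneg by (intro nn_integral_W_sq) simp
 finally show ?thesis .
qed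

lemma integral_le_energy:
 assumes f_props: "integrable lborel f" "\<And>x. f x \<ge> 0" and c_nonneg: "c \<ge> 0"
  and f_le: "\<And>y. f y \<le> indicator (cball 0 R) y * (norm (u y))\<^sup>2 / E y"
  and u_le: "\<And>y. norm y \<le> R \<Longrightarrow> ennreal (norm (u y :: complex)) \<le> ennreal c * average y"
 shows "(\<integral>x. f x \<partial>lborel) \<le> 2 * c\<^sup>2 * energy"
proof -
 have "ennreal (f y) \<le> ennreal (c\<^sup>2 * indicator (cball 0 R) y / E y) * (average y)\<^sup>2" for y
 proof (cases "norm y \<le> R")
  case True
  have "ennreal (f y) \<le> ennreal (1 / E y * (norm (u y))\<^sup>2)" using f_le[of y] True by (intro ennreal_leI) simp
  also have "\<dots> = ennreal (1 / E y) * (ennreal (norm (u y)))\<^sup>2"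
   using E_pos[of y] by (subst ennreal_mult) (auto simp: ennreal_power)
  also have "\<dots> \<le> ennreal (1 / E y) * (ennreal c * average y)\<^sup>2"
   using u_le[OF True] by (intro mult_left_mono power_mono) auto
  also have "\<dots> = ennreal (c\<^sup>2 / E y) * (average y)\<^sup>2"
   using c_nonneg E_pos[of y] by (simp add: power_mult_distrib ennreal_power mult.assoc[symmetric] ennreal_mult[symmetric])
  finally show ?thesis using True by simp
 next
  case False
  then have "f y \<le> 0" using f_le[of y] by simp
  then show ?thesis by (simp add: ennreal_neg)
 qed
 then have "(\<integral>\<^sup>+x. ennreal (f x) \<partial>lborel) \<le> ennreal (2 * c\<^sup>2 * energy)"
  by (intro order_trans[OF nn_integral_mono nn_integral_average_sq_le]) simp_all
 then show ?thesis using f_props energy_nonneg by (simp add: nn_integral_eq_integral)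
qed

lemma integral_commutator_density_le: "(\<integral>x. commutator_density j x \<partial>lborel) \<le> 2 / R\<^sup>2 * energy"
proof -
 have "(\<integral>x. commutator_density j x \<partial>lborel) \<le> 2 * (1 / R)\<^sup>2 * energy"
 proof (rule integral_le_energy[OF integrable_density(2) density_nonneg(2)])
  show "commutator_density j y \<le> indicator (cball 0 R) y * (norm (commutator j y))\<^sup>2 / E y" for y
   unfolding commutator_density_def using \<zeta>_le_indicator E_pos[of y] by (intro divide_right_mono mult_right_mono) auto
  fix y :: "complex^'n" assume y_in: "norm y \<le> R"
  have int: "integrable lborel (\<lambda>x. W x * \<rho> (y - x))" "integrable lborel (\<lambda>x. (cnj (ph j x) * W x) * \<rho> (y - x))"
   by (rule convolve_integrable[OF _ Ck_cont[OF Ck_\<rho>[of 1]] compact_supp_\<rho>]; simp add: locally_integrable_W locally_integrable_ph_W)+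
  have "commutator j y = (\<integral>x. cnj (ph j y) * (W x * \<rho> (y - x)) - (cnj (ph j x) * W x) * \<rho> (y - x) \<partial>lborel)"
   unfolding commutator_def smooth_W_def convolve_def using int by simp
  also have "\<dots> = (\<integral>x. W x * cnj (ph j y - ph j x) * \<rho> (y - x) \<partial>lborel)"
   by (intro Bochner_Integration.integral_cong) (auto simp: algebra_simps)
  also have "ennreal (norm \<dots>) \<le> ennreal (1 / R) * average y"
  proof (rule norm_integral_W_\<rho>_le)
   show "continuous_on UNIV (\<lambda>x. cnj (ph j y - ph j x))" by (intro continuous_intros ph_cont)
   show "norm (cnj (ph j y - ph j x)) \<le> 1 / R" if "norm (y - x) < \<epsilon>" for x
    using ph_close[OF y_in, of x j] that by (simp add: dist_norm norm_minus_commute del: complex_cnj_diff)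
  qed (use R_pos in simp)
  finally show "ennreal (norm (commutator j y)) \<le> ennreal (1 / R) * average y" .
 qed (use R_pos in simp)
 then show ?thesis by (simp add: power_divide)
qed

lemma integral_cutoff_density_le: "(\<integral>x. cutoff_density j x \<partial>lborel) \<le> 32 / R\<^sup>2 * energy"
proof -
 have "(\<integral>x. cutoff_density j x \<partial>lborel) \<le> 2 * (4 / R)\<^sup>2 * energy"
 proof (rule integral_le_energy[OF integrable_density(3) density_nonneg(3)])
  fix y :: "complex^'n"
  have "norm (dzbar j cutoff y * smooth_W y) \<le> (4 / R * indicator (cball 0 R) y) * norm (smooth_W y)"
   unfolding norm_mult by (intro mult_right_mono norm_dzbar_bump_le R_pos) simp
  then have "(norm (dzbar j cutoff y * smooth_W y))\<^sup>2 \<le> ((4 / R * indicator (cball 0 R) y) * norm (smooth_W y))\<^sup>2"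
   by (rule power_mono) simp
  also have "\<dots> = indicator (cball 0 R) y * (norm (complex_of_real (4 / R) * smooth_W y))\<^sup>2"
   using R_pos by (simp add: norm_mult norm_divide power_mult_distrib indicator_def)
  finally show "cutoff_density j y \<le> indicator (cball 0 R) y * (norm (complex_of_real (4 / R) * smooth_W y))\<^sup>2 / E y"
   unfolding cutoff_density_def using less_imp_le[OF E_pos[of y]] by (rule divide_right_mono)
  have "complex_of_real (4 / R) * smooth_W y = (\<integral>x. W x * complex_of_real (4 / R) * \<rho> (y - x) \<partial>lborel)"
   unfolding smooth_W_def convolve_def by (simp add: integral_mult_right_zero[symmetric] mult_ac del: integral_mult_right_zero)
  then show "ennreal (norm (complex_of_real (4 / R) * smooth_W y)) \<le> ennreal (4 / R) * average y"
   using norm_integral_W_\<rho>_le[of "\<lambda>_. complex_of_real (4 / R)" "4 / R" y] R_pos by (simp add: norm_divide)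
 qed (use R_pos in simp)
 then show ?thesis by (simp add: power_divide)
qed

lemma integral_flux_density_le: "(\<integral>x. flux_density j x \<partial>lborel) \<le> 260 * real CARD('n) / R\<^sup>2 * energy"
proof -
 have "(\<integral>x. flux_density j x \<partial>lborel) \<le> (\<integral>x. (\<Sum>j\<in>UNIV. flux_density j x) \<partial>lborel)"
 proof (rule integral_mono[OF integrable_density(1)])
  show "flux_density j x \<le> (\<Sum>j\<in>UNIV. flux_density j x)" for x by (intro member_le_sum density_nonneg) auto
 qed (use integrable_density in simp)
 also have "\<dots> \<le> 2 * (\<Sum>j\<in>UNIV. (\<integral>x. commutator_density j x \<partial>lborel) + 4 * (\<integral>x. cutoff_density j x \<partial>lborel))"
  using Caccioppoli integrable_density by (simp add: Bochner_Integration.integral_sum)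
 also have "\<dots> \<le> 2 * (\<Sum>j\<in>(UNIV :: 'n set). 2 / R\<^sup>2 * energy + 4 * (32 / R\<^sup>2 * energy))"
  by (intro mult_left_mono sum_mono add_mono integral_commutator_density_le integral_cutoff_density_le) simp_all
 also have "\<dots> = 260 * real CARD('n) / R\<^sup>2 * energy" by (simp add: field_simps)
 finally show ?thesis .
qed

lemma norm_integral_smooth_h_dzbar_le:
 assumes \<psi>: "Ck 1 \<psi>" "compact_supp \<psi>" and supp: "\<And>x. R / 2 < norm x \<Longrightarrow> \<psi> x = 0"
 shows "norm (\<integral>x. smooth_h x * dzbar j \<psi> x \<partial>lborel)
  \<le> 2 * R * ((\<integral>x. flux_density j x \<partial>lborel) + (\<integral>x. commutator_density j x \<partial>lborel)) + (\<integral>x. (norm (\<psi> x))\<^sup>2 / E x \<partial>lborel) / R"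
proof -
 let ?g = "\<lambda>x. (\<beta> j x + commutator j x) * inv_E x * \<psi> x"
 have g_int: "integrable lborel ?g"
  by (intro integrable_compact_supp compact_supp_mult2 \<psi> continuous_intros Ck_cont[OF Ck_\<beta>] continuous_on_commutator
    Ck_cont[OF Ck_inv_E] Ck_cont[OF \<psi>(1)])
 have "continuous_on UNIV (dzbar j \<psi>)" using Ck_dzbar[of 0 \<psi> j] \<psi>(1) by (auto simp: Ck.simps One_nat_def)
 then have int: "integrable lborel (\<lambda>x. smooth_h x * dzbar j \<psi> x)"
  by (intro integrable_compact_supp compact_supp_mult2 compact_supp_dzbar \<psi> continuous_intros Ck_cont[OF Ck_smooth_h])
 have "dzbar j (\<lambda>x. smooth_h x * \<psi> x) x = ?g x + smooth_h x * dzbar j \<psi> x" for x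
  by (simp add: dzbar_mult Ck_smooth_h \<psi>(1) dzbar_smooth_h)
 then have "(\<integral>x. ?g x \<partial>lborel) + (\<integral>x. smooth_h x * dzbar j \<psi> x \<partial>lborel) = 0"
  using integral_dz_eq_0(2)[OF Ck_mult[OF Ck_smooth_h \<psi>(1)] compact_supp_mult2[OF \<psi>(2)], of j]
   Bochner_Integration.integral_add[OF g_int int] by simp
 then have "norm (\<integral>x. smooth_h x * dzbar j \<psi> x \<partial>lborel) = norm (\<integral>x. ?g x \<partial>lborel)" by (simp add: add_eq_0_iff)
 also have "\<dots> \<le> (\<integral>x. 2 * R * (flux_density j x + commutator_density j x) + ((norm (\<psi> x))\<^sup>2 / E x) / R \<partial>lborel)"
 proof (rule norm_integral_le_integral[OF g_int])
  show "integrable lborel (\<lambda>x. 2 * R * (flux_density j x + commutator_density j x) + ((norm (\<psi> x))\<^sup>2 / E x) / R)"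
   using integrable_density integrable_norm_sq_div_E[OF \<psi>] by (simp del: divide_divide_eq_left)
  show "norm (?g x) \<le> 2 * R * (flux_density j x + commutator_density j x) + ((norm (\<psi> x))\<^sup>2 / E x) / R" for x
  proof (cases "norm x \<le> R / 2")
   case True
   have "norm (?g x) \<le> (norm (\<beta> j x) + norm (commutator j x)) * norm (\<psi> x) / E x"
    using E_pos[of x] norm_triangle_ineq[of "\<beta> j x" "commutator j x"]
    by (simp add: norm_mult inv_E_def norm_inverse divide_inverse mult_left_mono mult_ac)
   also have "\<dots> \<le> (2 * R * ((\<zeta> x)\<^sup>2 * (norm (\<beta> j x))\<^sup>2 + (\<zeta> x)\<^sup>2 * (norm (commutator j x))\<^sup>2) + (norm (\<psi> x))\<^sup>2 / R) / E x"
    using bump_lower_bound[OF R_pos True, of 2] less_imp_le[OF E_pos[of x]]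
    by (intro divide_right_mono product_le_cutoff_squares R_pos) (simp_all add: power2_eq_square)
   finally show ?thesis by (simp add: flux_density_def commutator_density_def add_divide_distrib ring_distribs mult.commute[of R "E x"])
  next
   case False
   then show ?thesis using supp[of x] density_nonneg[of j x] R_pos by simp
  qed
 qed
 also have "\<dots> = 2 * R * ((\<integral>x. flux_density j x \<partial>lborel) + (\<integral>x. commutator_density j x \<partial>lborel)) + (\<integral>x. (norm (\<psi> x))\<^sup>2 / E x \<partial>lborel) / R"
  using integrable_density integrable_norm_sq_div_E[OF \<psi>] by (simp del: divide_divide_eq_left)
 finally show ?thesis .
qed

end

context weak_solution
begin

lemma eventually_cutoff_weak_solution:
 assumes "R > 0"
 shows "\<forall>\<^sub>F \<epsilon> in at_right 0. cutoff_weak_solution E ph h \<epsilon> R"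
proof -
 have "\<forall>\<^sub>F \<epsilon> in at_right 0. \<forall>j. \<forall>x y. norm y \<le> R \<longrightarrow> norm (x - y) < \<epsilon> \<longrightarrow> dist (ph j x) (ph j y) < 1 / R"
  using assms by (intro eventually_all_finite eventually_uniformly_close ph_cont) simp
 with eventually_comparable[OF E_cont E_pos, of R] eventually_at_right_less[of 0] show ?thesis
  by eventually_elim (unfold_locales; use assms in blast)
qed

lemma norm_integral_dzbar_le:
 assumes \<psi>: "Ck 1 \<psi>" "compact_supp \<psi>" and supp: "\<And>x. R / 2 < norm x \<Longrightarrow> \<psi> x = 0" and R_pos: "R > 0"
 shows "norm (\<integral>x. h x * dzbar j \<psi> x \<partial>lborel)
  \<le> ((520 * real CARD('n) + 4) * energy + (\<integral>x. (norm (\<psi> x))\<^sup>2 / E x \<partial>lborel) + (\<integral>x. norm (W x) \<partial>lborel)) / R"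
proof -
 let ?q = "\<lambda>x. dzbar j \<psi> x * inv_E x"
 have "continuous_on UNIV (dzbar j \<psi>)" using Ck_dzbar[of 0 \<psi> j] \<psi>(1) by (auto simp: Ck.simps One_nat_def)
 then have q_props: "continuous_on UNIV ?q" "compact_supp ?q"
  using Ck_cont[OF Ck_inv_E] \<psi>(2) by (auto intro!: continuous_intros compact_supp_mult1 compact_supp_dzbar)
 have "1 / R > 0" using R_pos by simp
 from eventually_happens[OF eventually_conj[OF eventually_cutoff_weak_solution[OF R_pos] eventually_uniformly_close_compact_supp[OF q_props this]]]
 obtain \<epsilon> where "cutoff_weak_solution E ph h \<epsilon> R" and close: "\<And>x y. norm (x - y) < \<epsilon> \<Longrightarrow> dist (?q x) (?q y) < 1 / R"
  by auto
 then interpret cutoff_weak_solution E ph h \<epsilon> R by simp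
 have "(\<integral>x. smooth_h x * dzbar j \<psi> x \<partial>lborel) = (\<integral>y. convolve W \<rho> y * ?q y \<partial>lborel)"
  by (simp add: smooth_h_def smooth_W_def mult_ac)
 moreover have "(\<integral>x. h x * dzbar j \<psi> x \<partial>lborel) = (\<integral>x. W x * ?q x \<partial>lborel)"
  by (intro Bochner_Integration.integral_cong) (auto simp: W_def inv_E_def E_nonzero)
 moreover have "norm ((\<integral>y. convolve W \<rho> y * ?q y \<partial>lborel) - (\<integral>x. W x * ?q x \<partial>lborel)) \<le> 1 / R * (\<integral>x. norm (W x) \<partial>lborel)"
  unfolding \<rho>_def[abs_def] using close
  by (intro integral_convolve_mollifier integrable_W q_props \<epsilon>_pos) (simp add: dist_norm norm_minus_commute less_imp_le)
 ultimately have "norm ((\<integral>x. smooth_h x * dzbar j \<psi> x \<partial>lborel) - (\<integral>x. h x * dzbar j \<psi> x \<partial>lborel)) \<le> 1 / R * (\<integral>x. norm (W x) \<partial>lborel)"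
  by simp
 then have "norm (\<integral>x. h x * dzbar j \<psi> x \<partial>lborel) \<le> norm (\<integral>x. smooth_h x * dzbar j \<psi> x \<partial>lborel) + 1 / R * (\<integral>x. norm (W x) \<partial>lborel)"
  using norm_triangle_sub[of "\<integral>x. h x * dzbar j \<psi> x \<partial>lborel" "\<integral>x. smooth_h x * dzbar j \<psi> x \<partial>lborel"] by (simp add: norm_minus_commute)
 also have "\<dots> \<le> 2 * R * (260 * real CARD('n) / R\<^sup>2 * energy + 2 / R\<^sup>2 * energy) + (\<integral>x. (norm (\<psi> x))\<^sup>2 / E x \<partial>lborel) / R + 1 / R * (\<integral>x. norm (W x) \<partial>lborel)"
  using mult_left_mono[OF add_mono[OF integral_flux_density_le[of j] integral_commutator_density_le[of j]], of "2 * R"]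
   norm_integral_smooth_h_dzbar_le[OF \<psi> supp, of j] R_pos by linarith
 also have "\<dots> = ((520 * real CARD('n) + 4) * energy + (\<integral>x. (norm (\<psi> x))\<^sup>2 / E x \<partial>lborel) + (\<integral>x. norm (W x) \<partial>lborel)) / R"
  using R_pos by (simp add: power2_eq_square field_simps)
 finally show ?thesis .
qed

theorem integral_dzbar_eq_0:
 assumes \<psi>: "Ck 1 \<psi>" "compact_supp \<psi>"
 shows "(\<integral>x. h x * dzbar j \<psi> x \<partial>lborel) = 0"
proof -
 obtain R0 where R0_vanish: "\<And>x. R0 < norm x \<Longrightarrow> \<psi> x = 0" using \<psi>(2) by (auto simp: compact_supp_def)
 define K where "K = (520 * real CARD('n) + 4) * energy + (\<integral>x. (norm (\<psi> x))\<^sup>2 / E x \<partial>lborel) + (\<integral>x. norm (W x) \<partial>lborel)"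
 have "\<forall>\<^sub>F R in at_top. norm (\<integral>x. h x * dzbar j \<psi> x \<partial>lborel) \<le> K / R"
  using eventually_ge_at_top[of "2 * R0"] eventually_gt_at_top[of 0]
 proof eventually_elim
  case (elim R)
  show ?case unfolding K_def by (rule norm_integral_dzbar_le[OF \<psi> _ elim(2)]) (use elim(1) in \<open>auto intro: R0_vanish\<close>)
 qed
 moreover have "((\<lambda>R. K / R) \<longlongrightarrow> 0) at_top" by (intro tendsto_divide_0[OF tendsto_const] filterlim_at_top_imp_at_infinity filterlim_ident)
 ultimately have "norm (\<integral>x. h x * dzbar j \<psi> x \<partial>lborel) \<le> 0" by (intro tendsto_lowerbound) auto
 then show ?thesis by simp
qed

corollary dzbar_convolve_eq_0:
 assumes \<rho>: "Ck 1 \<rho>" "compact_supp \<rho>"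
 shows "dzbar j (convolve h \<rho>) y = 0"
proof -
 have "dzbar j (convolve h \<rho>) y = (\<integral>x. h x * dzbar j \<rho> (y - x) \<partial>lborel)"
  unfolding dz_convolve(2)[OF locally_integrable_of_weighted_L2[OF h_meas h_int] \<rho>] by (simp add: convolve_def)
 also have "\<dots> = - (\<integral>x. h x * dzbar j (\<lambda>x. \<rho> (y - x)) x \<partial>lborel)"
  unfolding dzbar_reflect[OF \<rho>(1)] by simp
 also have "\<dots> = 0" by (simp add: integral_dzbar_eq_0 Ck_reflect compact_supp_reflect \<rho>)
 finally show ?thesis .
qed

end

lemma has_partial_real_comp:
 fixes f :: "'a::euclidean_space \<Rightarrow> real"
 assumes f_partial: "has_partial (\<lambda>x. complex_of_real (f x)) e f'" and g_deriv: "\<And>x. (g has_real_derivative g' (f x)) (at (f x))"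
 shows "has_partial (\<lambda>x. complex_of_real (g (f x))) e (\<lambda>x. complex_of_real (g' (f x)) * f' x)"
 unfolding has_partial_def
proof
 fix x
 have deriv: "((\<lambda>t. complex_of_real (f (x + t *\<^sub>R e))) has_vector_derivative f' x) (at 0)"
  using f_partial by (simp add: has_partial_def)
 have real_deriv: "((\<lambda>t. f (x + t *\<^sub>R e)) has_vector_derivative Re (f' x)) (at 0)"
  using bounded_linear.has_vector_derivative[OF bounded_linear_Re deriv] by simp
 have "((\<lambda>t. complex_of_real (f (x + t *\<^sub>R e))) has_vector_derivative complex_of_real (Re (f' x))) (at 0)"
  by (rule bounded_linear.has_vector_derivative[OF bounded_linear_of_real real_deriv])
 then have real: "f' x = complex_of_real (Re (f' x))" using vector_derivative_unique_at[OF deriv] by blast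
 have "((\<lambda>t. g (f (x + t *\<^sub>R e))) has_real_derivative g' (f x) * Re (f' x)) (at 0)"
  using DERIV_chain2[of g "g' (f x)" "\<lambda>t. f (x + t *\<^sub>R e)" 0 "Re (f' x)" UNIV] g_deriv[of x] real_deriv
  by (simp add: has_real_derivative_iff_has_vector_derivative)
 then have "((\<lambda>t. complex_of_real (g (f (x + t *\<^sub>R e)))) has_vector_derivative complex_of_real (g' (f x) * Re (f' x))) (at 0)"
  unfolding has_real_derivative_iff_has_vector_derivative
  by (rule bounded_linear.has_vector_derivative[OF bounded_linear_of_real])
 moreover have "complex_of_real (g' (f x) * Re (f' x)) = complex_of_real (g' (f x)) * f' x"
  by (subst (2) real) simp
 ultimately show "((\<lambda>t. complex_of_real (g (f (x + t *\<^sub>R e)))) has_vector_derivative complex_of_real (g' (f x)) * f' x) (at 0)"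
  by (simp only:)
qed

lemma dz_real_comp:
 fixes f :: "complex^'n::finite \<Rightarrow> real"
 assumes f_Ck: "Ck 1 (\<lambda>x. complex_of_real (f x))" and g_deriv: "\<And>x. (g has_real_derivative g' (f x)) (at (f x))"
 shows "dz k (\<lambda>x. complex_of_real (g (f x))) x = complex_of_real (g' (f x)) * dz k (\<lambda>x. complex_of_real (f x)) x"
  and "dzbar k (\<lambda>x. complex_of_real (g (f x))) x = complex_of_real (g' (f x)) * dzbar k (\<lambda>x. complex_of_real (f x)) x"
proof -
 have "partial e (\<lambda>x. complex_of_real (g (f x))) x = complex_of_real (g' (f x)) * partial e (\<lambda>x. complex_of_real (f x)) x" if "e \<in> Basis" for e
  using partial_eq[OF has_partial_real_comp[where g' = g', OF Ck1_has_partial[OF f_Ck that] g_deriv]] by metis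
 then show "dz k (\<lambda>x. complex_of_real (g (f x))) x = complex_of_real (g' (f x)) * dz k (\<lambda>x. complex_of_real (f x)) x"
  "dzbar k (\<lambda>x. complex_of_real (g (f x))) x = complex_of_real (g' (f x)) * dzbar k (\<lambda>x. complex_of_real (f x)) x"
  by (simp_all add: dz_def dzbar_def) (simp_all add: field_simps)
qed

lemma Ck_real_comp:
 fixes f :: "'a::euclidean_space \<Rightarrow> real"
 assumes f_Ck: "Ck (Suc n) (\<lambda>x. complex_of_real (f x))" and g_deriv: "\<And>x. (g has_real_derivative g' (f x)) (at (f x))"
  and g'_Ck: "Ck n (\<lambda>x. complex_of_real (g' (f x)))"
 shows "Ck (Suc n) (\<lambda>x. complex_of_real (g (f x)))"
proof (rule Ck_SucI)
 have f_cont: "continuous_on UNIV f" using continuous_on_Re[OF Ck_cont[OF f_Ck]] by simp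
 have "continuous_on UNIV (\<lambda>x. g (f x))"
 proof (rule continuous_at_imp_continuous_on, rule ballI)
  fix x
  have "isCont f x" using f_cont by (simp add: continuous_on_eq_continuous_at)
  moreover have "isCont g (f x)" by (rule DERIV_isCont[OF g_deriv])
  ultimately show "isCont (\<lambda>x. g (f x)) x" by (rule isCont_o2)
 qed
 then show "continuous_on UNIV (\<lambda>x. complex_of_real (g (f x)))" by (intro continuous_intros)
 show "has_partial (\<lambda>x. complex_of_real (g (f x))) e (\<lambda>x. complex_of_real (g' (f x)) * partial e (\<lambda>x. complex_of_real (f x)) x)" if "e \<in> Basis" for e
  by (rule has_partial_real_comp[OF Ck_has_partial[OF f_Ck that] g_deriv])
 show "Ck n (\<lambda>x. complex_of_real (g' (f x)) * partial e (\<lambda>x. complex_of_real (f x)) x)" if "e \<in> Basis" for e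
  by (rule Ck_mult[OF g'_Ck Ck_partial[OF f_Ck that]])
qed

lemma has_partial_nth: "has_partial (\<lambda>x. x $ k) e (\<lambda>_. e $ k)"
 unfolding has_partial_def
proof
 fix x :: "complex^'a"
 have "((\<lambda>t. x $ k + of_real t * e $ k) has_vector_derivative e $ k) (at 0)"
  by (auto intro!: derivative_eq_intros)
 then show "((\<lambda>t. (x + t *\<^sub>R e) $ k) has_vector_derivative e $ k) (at 0)"
  by (simp add: scaleR_conv_of_real[of _ "e $ k"])
qed

lemma Ck_nth: "Ck n (\<lambda>x. x $ k)"
proof (cases n)
 case (Suc m)
 show ?thesis unfolding Suc
  by (rule Ck_SucI[OF _ has_partial_nth]) (auto intro!: continuous_intros Ck_const)
qed (auto intro!: continuous_intros)

lemma dz_nth: "dz j (\<lambda>x. x $ k) x = (if j = k then 1 else 0)" "dzbar j (\<lambda>x. x $ k) x = 0"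
 by (auto simp: dz_def dzbar_def partial_eq[OF has_partial_nth] axis_def)

text \<open>The twisting function of the Ohsawa--Takegoshi argument, a smoothing of \<open>1 - log (s / (1 + s))\<close> where
 \<open>s = |z\<^sub>m - w|\<^sup>2\<close>; its complex Hessian produces the kernel \<open>t / (s + t)\<^sup>2\<close>, an approximate delta function on the
 hyperplane \<open>z\<^sub>m = w\<close>.\<close>

locale twist =
 fixes m :: "'n::finite" and w :: complex and t :: real
 assumes t_bounds: "0 < t" "t \<le> 1"
begin

definition sq_dist :: "complex^'n \<Rightarrow> real" where "sq_dist x = (norm (x $ m - w))\<^sup>2"
definition \<eta> :: "complex^'n \<Rightarrow> real" where "\<eta> x = 1 + (ln (1 + sq_dist x) - ln (sq_dist x + t))"
definition \<eta>\<^sub>m :: "complex^'n \<Rightarrow> complex" where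
 "\<eta>\<^sub>m x = complex_of_real (1 / (1 + sq_dist x) - 1 / (sq_dist x + t)) * cnj (x $ m - w)"
definition delta_kernel :: "complex^'n \<Rightarrow> real" where "delta_kernel x = t / (sq_dist x + t)\<^sup>2"
definition approx_inverse :: "complex^'n \<Rightarrow> complex" where "approx_inverse x = cnj (x $ m - w) * inverse (complex_of_real (sq_dist x + t))"
definition \<Omega> :: "complex^'n \<Rightarrow> real" where "\<Omega> x = \<eta> x + (norm (\<eta>\<^sub>m x))\<^sup>2"

lemma sq_dist_nonneg: "sq_dist x \<ge> 0" by (simp add: sq_dist_def)

lemma sq_dist_add_pos: "c > 0 \<Longrightarrow> sq_dist x + c > 0"
 using sq_dist_nonneg[of x] by linarith

lemma of_real_sq_dist_add_nonzero: "c > 0 \<Longrightarrow> complex_of_real (sq_dist x + c) \<noteq> 0"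
 by (metis less_irrefl of_real_eq_0_iff sq_dist_add_pos)

lemma of_real_sq_dist: "complex_of_real (sq_dist x) = (x $ m - w) * cnj (x $ m - w)"
 unfolding sq_dist_def by (rule complex_norm_square)

lemma Ck_coordinate_diff: "Ck n (\<lambda>x. x $ m - w)"
 by (intro Ck_diff Ck_nth Ck_const)

lemma dz_coordinate_diff: "dz j (\<lambda>x. x $ m - w) x = (if j = m then 1 else 0)" "dzbar j (\<lambda>x. x $ m - w) x = 0"
 by (simp_all add: dz_diff dzbar_diff Ck_nth Ck_const dz_nth del: Ck.simps One_nat_def)

lemma Ck_sq_dist: "Ck n (\<lambda>x. complex_of_real (sq_dist x))"
 unfolding of_real_sq_dist by (intro Ck_mult Ck_cnj Ck_coordinate_diff)

lemma dz_sq_dist: "dz j (\<lambda>x. complex_of_real (sq_dist x)) x = (if j = m then cnj (x $ m - w) else 0)"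
 "dzbar j (\<lambda>x. complex_of_real (sq_dist x)) x = (if j = m then x $ m - w else 0)"
 unfolding of_real_sq_dist
 by (simp_all add: dz_mult dzbar_mult Ck_coordinate_diff Ck_cnj dz_coordinate_diff dz_cnj dzbar_cnj del: Ck.simps One_nat_def complex_cnj_diff)

lemma Ck_sq_dist_add: "Ck n (\<lambda>x. complex_of_real (sq_dist x + c))"
 unfolding of_real_add by (intro Ck_add Ck_sq_dist Ck_const)

lemma dz_sq_dist_add: "dz j (\<lambda>x. complex_of_real (sq_dist x + c)) x = dz j (\<lambda>x. complex_of_real (sq_dist x)) x"
 "dzbar j (\<lambda>x. complex_of_real (sq_dist x + c)) x = dzbar j (\<lambda>x. complex_of_real (sq_dist x)) x"
 unfolding of_real_add by (simp_all add: dz_add dzbar_add Ck_sq_dist Ck_const del: Ck.simps One_nat_def)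

lemma Ck_inverse_sq_dist: "c > 0 \<Longrightarrow> Ck n (\<lambda>x. complex_of_real (1 / (sq_dist x + c)))"
 using Ck_inverse[OF of_real_sq_dist_add_nonzero Ck_sq_dist_add] by (simp add: inverse_eq_divide)

lemma dz_inverse_sq_dist:
 assumes "c > 0"
 shows "dz m (\<lambda>x. complex_of_real (1 / (sq_dist x + c))) x = - cnj (x $ m - w) * complex_of_real (1 / (sq_dist x + c)\<^sup>2)"
proof -
 have "dz m (\<lambda>x. inverse (complex_of_real (sq_dist x + c))) x
  = - cnj (x $ m - w) * (inverse (complex_of_real (sq_dist x + c)) * inverse (complex_of_real (sq_dist x + c)))"
  unfolding dz_inverse(1)[OF Ck_sq_dist_add of_real_sq_dist_add_nonzero[OF assms]] dz_sq_dist_add dz_sq_dist by simp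
 then show ?thesis by (simp add: power2_eq_square divide_inverse)
qed

lemma Ck_ln_sq_dist: "c > 0 \<Longrightarrow> Ck (Suc n) (\<lambda>x. complex_of_real (ln (sq_dist x + c)))"
proof (rule Ck_real_comp[of n "\<lambda>x. sq_dist x + c" ln "\<lambda>y. 1 / y"])
 assume c_pos: "c > 0"
 show "Ck (Suc n) (\<lambda>x. complex_of_real (sq_dist x + c))" by (rule Ck_sq_dist_add)
 show "(ln has_real_derivative 1 / (sq_dist x + c)) (at (sq_dist x + c))" for x
  using sq_dist_add_pos[OF c_pos] by (auto intro!: derivative_eq_intros)
 show "Ck n (\<lambda>x. complex_of_real (1 / (sq_dist x + c)))" by (rule Ck_inverse_sq_dist[OF c_pos])
qed

lemma dz_ln_sq_dist:
 assumes c_pos: "c > 0"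
 shows "dz j (\<lambda>x. complex_of_real (ln (sq_dist x + c))) x = complex_of_real (1 / (sq_dist x + c)) * dz j (\<lambda>x. complex_of_real (sq_dist x)) x"
  "dzbar j (\<lambda>x. complex_of_real (ln (sq_dist x + c))) x = complex_of_real (1 / (sq_dist x + c)) * dzbar j (\<lambda>x. complex_of_real (sq_dist x)) x"
proof -
 have deriv: "(ln has_real_derivative 1 / (sq_dist x + c)) (at (sq_dist x + c))" for x
  using sq_dist_add_pos[OF c_pos] by (auto intro!: derivative_eq_intros)
 show "dz j (\<lambda>x. complex_of_real (ln (sq_dist x + c))) x = complex_of_real (1 / (sq_dist x + c)) * dz j (\<lambda>x. complex_of_real (sq_dist x)) x"
  "dzbar j (\<lambda>x. complex_of_real (ln (sq_dist x + c))) x = complex_of_real (1 / (sq_dist x + c)) * dzbar j (\<lambda>x. complex_of_real (sq_dist x)) x"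
  using dz_real_comp[of "\<lambda>x. sq_dist x + c" ln "\<lambda>y. 1 / y", OF Ck_sq_dist_add deriv] by (simp_all only: dz_sq_dist_add)
qed

lemma of_real_\<eta>: "complex_of_real (\<eta> x) = 1 + (complex_of_real (ln (sq_dist x + 1)) - complex_of_real (ln (sq_dist x + t)))"
 by (simp add: \<eta>_def add.commute)

lemma Ck_\<eta>: "Ck (Suc n) (\<lambda>x. complex_of_real (\<eta> x))"
 unfolding of_real_\<eta> using t_bounds by (intro Ck_add Ck_const Ck_diff Ck_ln_sq_dist) auto

lemma dz_\<eta>: "dz j (\<lambda>x. complex_of_real (\<eta> x)) x = (if j = m then \<eta>\<^sub>m x else 0)"
 and dzbar_\<eta>: "dzbar j (\<lambda>x. complex_of_real (\<eta> x)) x = (if j = m then cnj (\<eta>\<^sub>m x) else 0)"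
proof -
 have Ck_ln: "Ck 1 (\<lambda>x. complex_of_real (ln (sq_dist x + 1)))" "Ck 1 (\<lambda>x. complex_of_real (ln (sq_dist x + t)))"
  using Ck_ln_sq_dist[of 1 0] Ck_ln_sq_dist[of t 0] t_bounds by simp_all
 show "dz j (\<lambda>x. complex_of_real (\<eta> x)) x = (if j = m then \<eta>\<^sub>m x else 0)"
  unfolding of_real_\<eta> using t_bounds
  by (simp add: dz_add dz_diff Ck_ln Ck_diff Ck_const dz_ln_sq_dist dz_sq_dist \<eta>\<^sub>m_def del: Ck.simps One_nat_def)
   (simp add: algebra_simps)
 show "dzbar j (\<lambda>x. complex_of_real (\<eta> x)) x = (if j = m then cnj (\<eta>\<^sub>m x) else 0)"
  unfolding of_real_\<eta> using t_bounds
  by (simp add: dzbar_add dzbar_diff Ck_ln Ck_diff Ck_const dz_ln_sq_dist dz_sq_dist \<eta>\<^sub>m_def del: Ck.simps One_nat_def)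
   (simp add: algebra_simps)
qed

lemma dz_dzbar_\<eta>: "dz m (dzbar m (\<lambda>x. complex_of_real (\<eta> x))) x = complex_of_real (1 / (1 + sq_dist x)\<^sup>2 - delta_kernel x)"
proof -
 have dzbar: "dzbar m (\<lambda>x. complex_of_real (\<eta> x)) = (\<lambda>x. (complex_of_real (1 / (sq_dist x + 1)) - complex_of_real (1 / (sq_dist x + t))) * (x $ m - w))"
  unfolding dzbar_\<eta> by (simp add: \<eta>\<^sub>m_def fun_eq_iff add.commute)
 have "dz m (dzbar m (\<lambda>x. complex_of_real (\<eta> x))) x
   = (- cnj (x $ m - w) * complex_of_real (1 / (sq_dist x + 1)\<^sup>2) - (- cnj (x $ m - w) * complex_of_real (1 / (sq_dist x + t)\<^sup>2))) * (x $ m - w)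
    + (complex_of_real (1 / (sq_dist x + 1)) - complex_of_real (1 / (sq_dist x + t)))"
  unfolding dzbar using t_bounds dz_inverse_sq_dist[of 1] dz_inverse_sq_dist[of t]
  by (simp only: dz_mult[OF Ck_diff[OF Ck_inverse_sq_dist Ck_inverse_sq_dist] Ck_coordinate_diff] dz_diff[OF Ck_inverse_sq_dist Ck_inverse_sq_dist] dz_coordinate_diff zero_less_one) simp
 also have "\<dots> = - (complex_of_real (sq_dist x) * complex_of_real (1 / (sq_dist x + 1)\<^sup>2)) + complex_of_real (sq_dist x) * complex_of_real (1 / (sq_dist x + t)\<^sup>2)
   + complex_of_real (1 / (sq_dist x + 1)) - complex_of_real (1 / (sq_dist x + t))"
 proof -
  have expand: "(- b * P - (- b * Q)) * a + (p - q) = - (a * b * P) + a * b * Q + p - q" for a b P Q p q :: complex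
   by (simp add: algebra_simps)
  show ?thesis unfolding of_real_sq_dist[of x] by (rule expand)
 qed
 also have "\<dots> = complex_of_real (- (sq_dist x * (1 / (sq_dist x + 1)\<^sup>2)) + sq_dist x * (1 / (sq_dist x + t)\<^sup>2) + 1 / (sq_dist x + 1) - 1 / (sq_dist x + t))"
  by simp
 also have "- (sq_dist x * (1 / (sq_dist x + 1)\<^sup>2)) + sq_dist x * (1 / (sq_dist x + t)\<^sup>2) + 1 / (sq_dist x + 1) - 1 / (sq_dist x + t) = 1 / (1 + sq_dist x)\<^sup>2 - delta_kernel x"
 proof -
  have quotients: "1 / (sq_dist x + 1) = (sq_dist x + 1) / (sq_dist x + 1)\<^sup>2" "1 / (sq_dist x + t) = (sq_dist x + t) / (sq_dist x + t)\<^sup>2"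
   using sq_dist_add_pos[of 1 x] sq_dist_add_pos[OF t_bounds(1), of x] by (simp_all add: power2_eq_square)
  show ?thesis unfolding delta_kernel_def quotients by (simp add: add.commute[of 1] diff_divide_distrib add_divide_distrib)
 qed
 finally show ?thesis .
qed

lemma \<eta>_ge_1: "\<eta> x \<ge> 1"
 using sq_dist_nonneg[of x] t_bounds by (simp add: \<eta>_def)

lemma delta_kernel_pos: "delta_kernel x > 0"
 unfolding delta_kernel_def using sq_dist_nonneg[of x] t_bounds by (intro divide_pos_pos) auto

lemma delta_kernel_le: "delta_kernel x \<le> 1 / t"
proof -
 have "t * t \<le> (sq_dist x + t)\<^sup>2" using sq_dist_nonneg[of x] t_bounds by (simp add: power2_eq_square mult_mono)
 then show ?thesis unfolding delta_kernel_def using sq_dist_nonneg[of x] t_bounds by (simp add: divide_simps)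
qed

lemma delta_kernel_le_twist: "delta_kernel x \<le> 2 * \<eta> x - (1 / (1 + sq_dist x)\<^sup>2 - delta_kernel x) - 1"
proof -
 have "1 \<le> (1 + sq_dist x)\<^sup>2" using sq_dist_nonneg[of x] by (simp add: power2_eq_square algebra_simps)
 then have "1 / (1 + sq_dist x)\<^sup>2 \<le> 1" by (simp add: divide_le_eq_1)
 then show ?thesis using \<eta>_ge_1[of x] by linarith
qed

lemma continuous_on_sq_dist: "continuous_on UNIV sq_dist"
 using continuous_on_Re[OF Ck_cont[OF Ck_sq_dist]] by simp

lemma continuous_on_delta_kernel: "continuous_on UNIV delta_kernel"
 unfolding delta_kernel_def[abs_def]
proof (intro continuous_intros continuous_on_sq_dist ballI)
 fix x show "(sq_dist x + t)\<^sup>2 \<noteq> 0" using sq_dist_nonneg[of x] t_bounds by (simp add: add_nonneg_eq_0_iff)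
qed

lemma continuous_on_\<eta>\<^sub>m: "continuous_on UNIV \<eta>\<^sub>m"
 using Ck_dz[of 0 "\<lambda>x. complex_of_real (\<eta> x)" m] Ck_\<eta>[of 0] by (simp add: dz_\<eta>[abs_def] del: Ck.simps(2))

lemma continuous_on_\<Omega>: "continuous_on UNIV \<Omega>"
 unfolding \<Omega>_def[abs_def] using continuous_on_Re[OF Ck_cont[OF Ck_\<eta>[of 0]]]
 by (intro continuous_intros continuous_on_\<eta>\<^sub>m) simp

lemma \<Omega>_ge_1: "\<Omega> x \<ge> 1"
 using \<eta>_ge_1[of x] by (simp add: \<Omega>_def add_increasing2)

lemma norm_\<eta>\<^sub>m_sq_le: "(norm (\<eta>\<^sub>m x))\<^sup>2 \<le> sq_dist x / (sq_dist x + t)\<^sup>2"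
proof -
 have "0 \<le> 1 / (1 + sq_dist x)" "1 / (1 + sq_dist x) \<le> 1 / (sq_dist x + t)"
  using sq_dist_nonneg[of x] t_bounds by (auto intro: divide_left_mono)
 then have "\<bar>1 / (1 + sq_dist x) - 1 / (sq_dist x + t)\<bar> \<le> 1 / (sq_dist x + t)" by linarith
 then have "\<bar>1 / (1 + sq_dist x) - 1 / (sq_dist x + t)\<bar>\<^sup>2 \<le> (1 / (sq_dist x + t))\<^sup>2" by (intro power_mono) auto
 then have "(1 / (1 + sq_dist x) - 1 / (sq_dist x + t))\<^sup>2 * sq_dist x \<le> (1 / (sq_dist x + t))\<^sup>2 * sq_dist x"
  using sq_dist_nonneg[of x] by (intro mult_right_mono) auto
 moreover have "(norm (\<eta>\<^sub>m x))\<^sup>2 = (1 / (1 + sq_dist x) - 1 / (sq_dist x + t))\<^sup>2 * sq_dist x"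
  unfolding \<eta>\<^sub>m_def norm_mult norm_of_real power_mult_distrib complex_mod_cnj sq_dist_def[symmetric] by simp
 ultimately show ?thesis by (simp add: power_divide)
qed

lemma ln_quotient_le: "ln (1 + sq_dist x) - ln (sq_dist x + t) \<le> 1 / (sq_dist x + t)"
proof -
 have pos: "sq_dist x + t > 0" by (rule sq_dist_add_pos[OF t_bounds(1)])
 have "ln (1 + sq_dist x) - ln (sq_dist x + t) = ln ((1 + sq_dist x) / (sq_dist x + t))"
  using sq_dist_nonneg[of x] pos by (simp add: ln_div)
 also have "\<dots> \<le> (1 + sq_dist x) / (sq_dist x + t) - 1"
  using sq_dist_nonneg[of x] pos by (intro ln_le_minus_one) auto
 also have "\<dots> = (1 - t) / (sq_dist x + t)" using pos by (simp add: field_simps)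
 also have "\<dots> \<le> 1 / (sq_dist x + t)" using pos t_bounds by (intro divide_right_mono) auto
 finally show ?thesis .
qed

lemma \<Omega>_le: "\<Omega> x \<le> 1 + 2 / t" and sq_dist_\<Omega>_le: "sq_dist x * \<Omega> x \<le> sq_dist x + 2"
proof -
 have pos: "sq_dist x + t > 0" by (rule sq_dist_add_pos[OF t_bounds(1)])
 have inverse: "1 / (sq_dist x + t) \<le> 1 / t" using sq_dist_nonneg[of x] t_bounds by (intro divide_left_mono) auto
 have quotient: "sq_dist x / (sq_dist x + t)\<^sup>2 \<le> 1 / (sq_dist x + t)" using pos t_bounds by (simp add: divide_simps power2_eq_square)
 have "\<eta> x \<le> 1 + 1 / (sq_dist x + t)" using ln_quotient_le[of x] by (simp add: \<eta>_def)
 then have bound: "\<Omega> x \<le> 1 + 2 * (1 / (sq_dist x + t))" unfolding \<Omega>_def using norm_\<eta>\<^sub>m_sq_le[of x] quotient by linarith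
 show "\<Omega> x \<le> 1 + 2 / t" using bound inverse by simp
 have "sq_dist x * \<Omega> x \<le> sq_dist x * (1 + 2 * (1 / (sq_dist x + t)))" using bound sq_dist_nonneg[of x] by (rule mult_left_mono)
 also have "\<dots> = sq_dist x + 2 * (sq_dist x / (sq_dist x + t))" by (simp add: algebra_simps)
 also have "\<dots> \<le> sq_dist x + 2 * 1"
  using pos t_bounds sq_dist_nonneg[of x] by (intro add_left_mono mult_left_mono) (auto simp: divide_le_eq_1)
 finally show "sq_dist x * \<Omega> x \<le> sq_dist x + 2" by simp
qed

lemma Ck_approx_inverse: "Ck 1 approx_inverse"
 unfolding approx_inverse_def[abs_def]
 by (intro Ck_mult Ck_cnj Ck_coordinate_diff Ck_inverse[OF _ Ck_sq_dist_add] of_real_sq_dist_add_nonzero t_bounds)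

lemma dzbar_approx_inverse: "dzbar j approx_inverse x = (if j = m then complex_of_real (delta_kernel x) else 0)"
proof -
 define I where "I = inverse (complex_of_real (sq_dist x + t))"
 note nonzero = of_real_sq_dist_add_nonzero[OF t_bounds(1)]
 have "dzbar j (\<lambda>x. cnj (x $ m - w)) x = (if j = m then 1 else 0)"
  using dzbar_cnj[OF Ck_coordinate_diff, of j x] by (simp add: dz_coordinate_diff)
 then have product: "dzbar j approx_inverse x = (if j = m then 1 else 0) * I + cnj (x $ m - w) * (- dzbar j (\<lambda>x. complex_of_real (sq_dist x)) x * (I * I))"
  unfolding approx_inverse_def[abs_def] I_def
  by (subst dzbar_mult[OF Ck_cnj[OF Ck_coordinate_diff] Ck_inverse[OF nonzero Ck_sq_dist_add]])
   (simp only: dz_inverse(2)[OF Ck_sq_dist_add nonzero] dz_sq_dist_add)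
 have "I - complex_of_real (sq_dist x) * (I * I) = complex_of_real (delta_kernel x)"
 proof -
  have "inverse c - s * (inverse c * inverse c) = (c - s) / c\<^sup>2" if "c > 0" for c s :: real
   using that by (simp add: power2_eq_square divide_inverse) (simp add: field_simps)
  from this[OF sq_dist_add_pos[OF t_bounds(1)], of x "sq_dist x"]
  have "inverse (sq_dist x + t) - sq_dist x * (inverse (sq_dist x + t) * inverse (sq_dist x + t)) = delta_kernel x" by (simp add: delta_kernel_def)
  from arg_cong[OF this, of complex_of_real] show ?thesis by (simp add: I_def)
 qed
 then have "I - (x $ m - w) * cnj (x $ m - w) * (I * I) = complex_of_real (delta_kernel x)" by (simp only: of_real_sq_dist)
 then show ?thesis unfolding product dz_sq_dist by (simp add: mult_ac)
qed

lemma one_minus_approx_inverse: "1 - (x $ m - w) * approx_inverse x = complex_of_real (t / (sq_dist x + t))"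
proof -
 have "(x $ m - w) * approx_inverse x = complex_of_real (sq_dist x * inverse (sq_dist x + t))"
  unfolding approx_inverse_def of_real_mult of_real_sq_dist of_real_inverse by simp
 moreover have "1 - sq_dist x * inverse (sq_dist x + t) = t / (sq_dist x + t)"
  using sq_dist_add_pos[OF t_bounds(1), of x] by (simp add: field_simps)
 ultimately show ?thesis by (metis of_real_1 of_real_diff)
qed

lemma norm_approx_inverse_sq_le: "(norm (approx_inverse x))\<^sup>2 \<le> 1 / t"
proof -
 have pos: "sq_dist x + t > 0" by (rule sq_dist_add_pos[OF t_bounds(1)])
 have "(norm (approx_inverse x))\<^sup>2 = sq_dist x / (sq_dist x + t)\<^sup>2"
  unfolding approx_inverse_def norm_mult power_mult_distrib complex_mod_cnj sq_dist_def[symmetric] norm_inverse norm_of_real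
  using pos by (simp add: power_inverse divide_inverse)
 also have "\<dots> \<le> 1 / t"
 proof -
  have "sq_dist x * t \<le> (sq_dist x + t)\<^sup>2" using sq_dist_nonneg[of x] t_bounds by (simp add: power2_eq_square algebra_simps)
  then show ?thesis using pos t_bounds by (simp add: divide_simps)
 qed
 finally show ?thesis .
qed

end


context psh_weight
begin

lemma Box_linear:
 assumes v_Ck: "Ck 3 v" and u_Ck: "Ck 3 u"
 shows "Box (\<lambda>x. v x + c * u x) x = Box v x + c * Box u x"
proof -
 have Ck_uv: "Ck 1 v" "Ck 1 u" using Ck_le[OF v_Ck, of 1] Ck_le[OF u_Ck, of 1] by (simp_all del: Ck.simps)
 have Ck_dzbar_uv: "Ck 1 (dzbar j v)" "Ck 1 (dzbar j u)" for j
  using Ck_le[OF Ck_dzbar[of 2 v j], of 1] Ck_le[OF Ck_dzbar[of 2 u j], of 1] assms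
  by (simp_all add: numeral_3_eq_3 numeral_2_eq_2 del: Ck.simps)
 have dzbar_linear: "dzbar j (\<lambda>x. v x + c * u x) = (\<lambda>x. dzbar j v x + c * dzbar j u x)" for j
  by (simp add: fun_eq_iff dzbar_add dzbar_mult Ck_mult Ck_const Ck_uv del: Ck.simps One_nat_def)
 have "D j (\<lambda>x. dzbar j v x + c * dzbar j u x) x = D j (dzbar j v) x + c * D j (dzbar j u) x" for j
  unfolding D_def by (simp add: dz_add dz_mult Ck_mult Ck_const Ck_dzbar_uv algebra_simps del: Ck.simps One_nat_def)
 then show ?thesis unfolding Box_def dzbar_linear by (simp add: sum.distrib sum_distrib_left)
qed

end

lemma integral_by_parts_dzbar:
 assumes f_Ck: "Ck 1 f" and g_test: "Ck 1 g" "compact_supp g"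
 shows "integrable lborel (\<lambda>x. f x * dzbar j g x)" "(\<integral>x. f x * dzbar j g x \<partial>lborel) = - (\<integral>x. dzbar j f x * g x \<partial>lborel)"
proof -
 have cont: "continuous_on UNIV (dzbar j f)" "continuous_on UNIV (dzbar j g)"
  using Ck_dzbar[of 0 f j] Ck_dzbar[of 0 g j] f_Ck g_test by simp_all
 have int: "integrable lborel (\<lambda>x. f x * dzbar j g x)" "integrable lborel (\<lambda>x. dzbar j f x * g x)"
  by (intro integrable_compact_supp continuous_intros Ck_cont[OF f_Ck] Ck_cont[OF g_test(1)] cont compact_supp_mult2 compact_supp_dzbar g_test(2))+
 have "(\<integral>x. dzbar j (\<lambda>x. f x * g x) x \<partial>lborel) = 0"
  by (intro integral_dz_eq_0(2) Ck_mult f_Ck g_test compact_supp_mult2)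
 then have "(\<integral>x. dzbar j f x * g x \<partial>lborel) + (\<integral>x. f x * dzbar j g x \<partial>lborel) = 0"
  unfolding dzbar_mult[OF f_Ck g_test(1)] by (simp only: Bochner_Integration.integral_add[OF int(2,1)])
 then show "(\<integral>x. f x * dzbar j g x \<partial>lborel) = - (\<integral>x. dzbar j f x * g x \<partial>lborel)" by (simp add: eq_neg_iff_add_eq_0 add.commute)
 show "integrable lborel (\<lambda>x. f x * dzbar j g x)" by (rule int(1))
qed

locale twisted_weight = psh_weight E ph + twist m w t
 for E :: "complex^'n::finite \<Rightarrow> real" and ph :: "'n \<Rightarrow> complex^'n \<Rightarrow> complex" and m :: 'n and w :: complex and t :: real
begin

declare Ck.simps [simp del] One_nat_def [simp del]

definition mass :: real where "mass = (\<integral>x. delta_kernel x * E x \<partial>lborel)"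

definition root_weight :: "complex^'n \<Rightarrow> real" where "root_weight x = sqrt (\<Omega> x * E x)"

definition T :: "(complex^'n \<Rightarrow> complex) \<Rightarrow> complex^'n \<Rightarrow> complex" where
 "T v x = Box v x * complex_of_real (root_weight x)"

definition l :: "(complex^'n \<Rightarrow> complex) \<Rightarrow> complex" where
 "l v = (\<integral>x. of_real (delta_kernel x) * cnj (dzbar m v x) * of_real (E x) \<partial>lborel)"

lemma borel_measurable_twist [measurable]:
 "delta_kernel \<in> borel_measurable borel" "\<Omega> \<in> borel_measurable borel" "approx_inverse \<in> borel_measurable borel"
 by (intro borel_measurable_continuous_onI continuous_on_delta_kernel continuous_on_\<Omega> Ck_cont[OF Ck_approx_inverse])+

lemma delta_kernel_E_nonneg: "delta_kernel x * E x \<ge> 0"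
 using delta_kernel_pos[of x] E_pos[of x] by simp

lemma \<Omega>_E_nonneg: "\<Omega> x * E x \<ge> 0"
 using \<Omega>_ge_1[of x] E_pos[of x] by simp

lemma mass_nonneg: "mass \<ge> 0"
 unfolding mass_def using delta_kernel_E_nonneg by simp

lemma integrable_delta_kernel_E: "integrable lborel (\<lambda>x. delta_kernel x * E x)"
proof (rule Bochner_Integration.integrable_bound[OF integrable_mult_right[OF E_int, of "1 / t"]])
 have "norm (delta_kernel x * E x) \<le> norm (1 / t * E x)" for x
  using mult_right_mono[OF delta_kernel_le[of x] less_imp_le[OF E_pos[of x]]] delta_kernel_pos[of x] E_pos[of x] t_bounds by (simp add: abs_mult)
 then show "AE x in lborel. norm (delta_kernel x * E x) \<le> norm (1 / t * E x)" by simp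
qed measurable

lemma continuous_on_T: "Ck 3 v \<Longrightarrow> continuous_on UNIV (T v)"
 unfolding T_def[abs_def] root_weight_def by (intro continuous_intros continuous_on_Box continuous_on_\<Omega> E_cont)

lemma integrable_norm_T_sq:
 assumes "Ck 3 v" "compact_supp v" shows "integrable lborel (\<lambda>x. (norm (T v x))\<^sup>2)"
proof (rule integrable_compact_supp)
 show "continuous_on UNIV (\<lambda>x. (norm (T v x))\<^sup>2)" by (intro continuous_intros continuous_on_T assms)
 have "compact_supp (T v)" unfolding T_def[abs_def] by (intro compact_supp_mult1 compact_supp_Box assms)
 then show "compact_supp (\<lambda>x. (norm (T v x))\<^sup>2)" by (rule compact_supp_comp) simp
qed

lemma norm_T_sq: "(norm (T v x))\<^sup>2 = \<Omega> x * (norm (Box v x))\<^sup>2 * E x"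
 using \<Omega>_E_nonneg[of x] by (simp add: T_def root_weight_def norm_mult power_mult_distrib)

lemma bochner_delta_kernel:
 assumes v_test: "Ck 3 v" "compact_supp v"
 shows "(\<integral>x. delta_kernel x * (norm (dzbar m v x))\<^sup>2 * E x \<partial>lborel) \<le> (\<integral>x. (norm (T v x))\<^sup>2 \<partial>lborel)"
proof -
 interpret twisted_bochner E ph v \<eta> m
 proof
  show "Ck 2 (\<lambda>x. complex_of_real (\<eta> x))" using Ck_\<eta>[of 1] by (simp add: numeral_2_eq_2 One_nat_def)
  show "\<eta> x \<ge> 0" for x using \<eta>_ge_1[of x] by linarith
 qed (simp_all add: v_test dz_\<eta>)
 show ?thesis
  using bochner_inequality[OF continuous_on_delta_kernel] delta_kernel_le_twist
  by (simp add: dz_dzbar_\<eta> dz_\<eta> norm_T_sq \<Omega>_def)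
qed

lemma norm_l_sq_le:
 assumes v_test: "Ck 3 v" "compact_supp v"
 shows "(norm (l v))\<^sup>2 \<le> mass * (\<integral>x. (norm (T v x))\<^sup>2 \<partial>lborel)"
proof -
 have dzbar_cont: "continuous_on UNIV (dzbar m v)" using Ck_cont[OF Ck_dzbar[of 2 v m]] v_test(1) by (simp add: numeral_3_eq_3 numeral_2_eq_2)
 define f where "f x = complex_of_real (sqrt (delta_kernel x * E x))" for x
 define g where "g x = cnj (dzbar m v x) * complex_of_real (sqrt (delta_kernel x * E x))" for x
 have [measurable]: "f \<in> borel_measurable lborel" "g \<in> borel_measurable lborel"
  unfolding f_def[abs_def] g_def[abs_def] using dzbar_cont by (auto intro!: borel_measurable_continuous_onI continuous_intros continuous_on_delta_kernel E_cont)
 have f_sq: "(norm (f x))\<^sup>2 = delta_kernel x * E x" and g_sq: "(norm (g x))\<^sup>2 = delta_kernel x * (norm (dzbar m v x))\<^sup>2 * E x" for x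
  using delta_kernel_E_nonneg[of x] by (simp_all add: f_def g_def norm_mult power_mult_distrib)
 have "f x * g x = of_real (delta_kernel x) * cnj (dzbar m v x) * of_real (E x)" for x
 proof -
  have "complex_of_real (sqrt (delta_kernel x * E x)) * complex_of_real (sqrt (delta_kernel x * E x)) = complex_of_real (delta_kernel x * E x)"
   using delta_kernel_E_nonneg[of x] by (simp only: of_real_mult[symmetric] real_sqrt_mult_self abs_of_nonneg)
  then show ?thesis unfolding f_def g_def by (simp add: mult.left_commute mult.commute)
 qed
 then have l_eq: "l v = (\<integral>x. f x * g x \<partial>lborel)" by (simp add: l_def)
 have "compact_supp (\<lambda>x. delta_kernel x * (norm (dzbar m v x))\<^sup>2 * E x)"
  by (intro compact_supp_mult1 compact_supp_mult2 compact_supp_comp[of "dzbar m v" "\<lambda>z. (norm z)\<^sup>2"] compact_supp_dzbar v_test) simp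
 then have "integrable lborel (\<lambda>x. delta_kernel x * (norm (dzbar m v x))\<^sup>2 * E x)"
  by (intro integrable_compact_supp continuous_intros continuous_on_delta_kernel dzbar_cont E_cont)
 then have "norm (l v) \<le> sqrt mass * sqrt (\<integral>x. delta_kernel x * (norm (dzbar m v x))\<^sup>2 * E x \<partial>lborel)"
  unfolding l_eq mass_def using L2_Cauchy_Schwarz(2)[of f lborel g] integrable_delta_kernel_E by (simp add: f_sq g_sq)
 then have "(norm (l v))\<^sup>2 \<le> (sqrt mass * sqrt (\<integral>x. delta_kernel x * (norm (dzbar m v x))\<^sup>2 * E x \<partial>lborel))\<^sup>2"
  by (rule power_mono) simp
 also have "\<dots> = mass * (\<integral>x. delta_kernel x * (norm (dzbar m v x))\<^sup>2 * E x \<partial>lborel)"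
  using mass_nonneg less_imp_le[OF delta_kernel_pos] less_imp_le[OF E_pos] by (simp add: power_mult_distrib)
 finally show ?thesis by (rule order_trans[OF _ mult_left_mono[OF bochner_delta_kernel[OF v_test] mass_nonneg]])
qed

lemma l_comb:
 assumes v_test: "Ck 3 v" "compact_supp v" and u_test: "Ck 3 u" "compact_supp u"
 shows "l (\<lambda>x. v x + c * u x) = l v + cnj c * l u"
proof -
 let ?g = "\<lambda>a x. of_real (delta_kernel x) * cnj (dzbar m a x) * complex_of_real (E x)"
 have Ck1: "Ck 1 v" "Ck 1 u" using v_test u_test Ck_le[of 3 _ 1] by simp_all
 have int: "integrable lborel (?g a)" if "Ck 1 a" "compact_supp a" for a
 proof (rule integrable_compact_supp)
  have "continuous_on UNIV (dzbar m a)" using Ck_dzbar[of 0 a m] that by (simp add: Ck.simps(1) One_nat_def)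
  then show "continuous_on UNIV (?g a)" by (intro continuous_intros continuous_on_delta_kernel E_cont)
  show "compact_supp (?g a)"
   by (intro compact_supp_mult1 compact_supp_mult2 compact_supp_comp[of "dzbar m a" cnj] compact_supp_dzbar that) simp
 qed
 have "?g (\<lambda>x. v x + c * u x) x = ?g v x + cnj c * ?g u x" for x
  by (simp add: dzbar_add dzbar_mult Ck1 Ck_mult Ck_const algebra_simps)
 then show ?thesis
  unfolding l_def by (simp only: Bochner_Integration.integral_add[OF int[OF Ck1(1) v_test(2)] integrable_mult_right[OF int[OF Ck1(2) u_test(2)]]] integral_mult_right_zero)
qed

lemma twisted_solution:
 obtains U where "U \<in> borel_measurable lborel" "integrable lborel (\<lambda>x. (norm (U x))\<^sup>2)" "(\<integral>x. (norm (U x))\<^sup>2 \<partial>lborel) \<le> mass"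
  "\<And>v. Ck 3 v \<Longrightarrow> compact_supp v \<Longrightarrow> (\<integral>x. U x * cnj (T v x) \<partial>lborel) = l v"
proof -
 interpret L2_bounded_functional lborel "{v. Ck 3 v \<and> compact_supp v}" T l mass
 proof (unfold_locales, goal_cases)
  case 1
  have "(\<lambda>_. 0) \<in> {v. Ck 3 v \<and> compact_supp v}" by (simp add: Ck_const compact_supp_def)
  then show ?case by blast
 next
  case 2
  then show ?case by (auto intro!: Ck_add Ck_mult Ck_const compact_supp_add compact_supp_mult2)
 qed (auto simp: T_def[of "\<lambda>x. _ x + _ * _ x"] Box_linear algebra_simps l_comb integrable_norm_T_sq norm_l_sq_le mass_nonneg T_def[symmetric]
   intro: borel_measurable_continuous_onI continuous_on_T)
 show thesis by (rule representation) (rule that, auto)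
qed

lemma integral_approx_inverse_Box:
 assumes v_test: "Ck 3 v" "compact_supp v"
 shows "integrable lborel (\<lambda>x. approx_inverse x * cnj (Box v x) * of_real (E x))"
  and "(\<integral>x. approx_inverse x * cnj (Box v x) * of_real (E x) \<partial>lborel) = l v"
proof -
 have dzbar_Ck: "Ck 1 (dzbar j v)" for j
  using Ck_le[OF Ck_dzbar[of 2 v j], of 1] v_test(1) by (simp_all add: numeral_3_eq_3 numeral_2_eq_2 One_nat_def)
 define q where "q j x = cnj (dzbar j v x) * complex_of_real (E x)" for j x
 have q_test: "Ck 1 (q j)" "compact_supp (q j)" for j
  unfolding q_def[abs_def] using v_test(2)
  by (auto intro!: Ck_mult Ck_cnj dzbar_Ck E_Ck compact_supp_mult1 compact_supp_comp[of "dzbar j v" cnj] compact_supp_dzbar)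
 have integrand: "approx_inverse x * cnj (Box v x) * of_real (E x) = - (\<Sum>j\<in>UNIV. approx_inverse x * dzbar j (q j) x)" for x
  unfolding Box_def q_def[abs_def] dzbar_mult_E[OF dzbar_Ck] by (simp add: sum_distrib_left sum_distrib_right mult.assoc)
 note parts = integral_by_parts_dzbar[OF Ck_approx_inverse q_test]
 show "integrable lborel (\<lambda>x. approx_inverse x * cnj (Box v x) * of_real (E x))"
  unfolding integrand by (intro Bochner_Integration.integrable_minus Bochner_Integration.integrable_sum parts)
 have "(\<integral>x. approx_inverse x * cnj (Box v x) * of_real (E x) \<partial>lborel) = (\<Sum>j\<in>UNIV. \<integral>x. dzbar j approx_inverse x * q j x \<partial>lborel)"
  unfolding integrand using parts(1) by (simp add: parts(2) sum_negf)
 also have "\<dots> = (\<Sum>j\<in>UNIV. if j = m then (\<integral>x. of_real (delta_kernel x) * q m x \<partial>lborel) else 0)"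
  unfolding dzbar_approx_inverse by (intro sum.cong) auto
 also have "\<dots> = l v" by (simp add: q_def l_def mult.assoc)
 finally show "(\<integral>x. approx_inverse x * cnj (Box v x) * of_real (E x) \<partial>lborel) = l v" .
qed

end

text \<open>\<open>approx_inverse - correction\<close> solves the dual equation, hence is weakly holomorphic; \<open>1 - (z\<^sub>m - w)\<close> times it
 is the wanted extension of \<open>1\<close> from the hyperplane.\<close>

locale twisted_correction = twisted_weight E ph m w t
 for E :: "complex^'n::finite \<Rightarrow> real" and ph :: "'n \<Rightarrow> complex^'n \<Rightarrow> complex" and m :: 'n and w :: complex and t :: real +
 fixes U :: "complex^'n \<Rightarrow> complex"
 assumes U_measurable [measurable]: "U \<in> borel_measurable lborel"
  and U_L2: "integrable lborel (\<lambda>x. (norm (U x))\<^sup>2)" and U_bound: "(\<integral>x. (norm (U x))\<^sup>2 \<partial>lborel) \<le> mass"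
  and U_represents: "\<And>v. Ck 3 v \<Longrightarrow> compact_supp v \<Longrightarrow> (\<integral>x. U x * cnj (T v x) \<partial>lborel) = l v"
begin

definition correction :: "complex^'n \<Rightarrow> complex" where "correction x = U x * of_real (sqrt (\<Omega> x / E x))"

definition solution :: "complex^'n \<Rightarrow> complex" where "solution x = approx_inverse x - correction x"

lemma borel_measurable_correction [measurable]: "correction \<in> borel_measurable borel"
 unfolding correction_def[abs_def] using U_measurable by simp

lemma norm_correction_sq: "(norm (correction x))\<^sup>2 * E x = (norm (U x))\<^sup>2 * \<Omega> x"
 using \<Omega>_ge_1[of x] E_pos[of x] by (simp add: correction_def norm_mult power_mult_distrib)

lemma integrable_norm_solution_sq: "integrable lborel (\<lambda>x. (norm (solution x))\<^sup>2 * E x)"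
proof (rule Bochner_Integration.integrable_bound)
 show "integrable lborel (\<lambda>x. 2 / t * E x + 2 * (1 + 2 / t) * (norm (U x))\<^sup>2)"
  by (intro Bochner_Integration.integrable_add integrable_mult_right E_int U_L2)
 have "norm ((norm (solution x))\<^sup>2 * E x) \<le> norm (2 / t * E x + 2 * (1 + 2 / t) * (norm (U x))\<^sup>2)" for x
 proof -
  have "(norm (solution x))\<^sup>2 * E x \<le> (2 * (norm (approx_inverse x))\<^sup>2 + 2 * (norm (correction x))\<^sup>2) * E x"
   using norm_add_sq_le[of "approx_inverse x" "- correction x"] E_pos[of x] by (intro mult_right_mono) (auto simp: solution_def)
  also have "\<dots> = 2 * (norm (approx_inverse x))\<^sup>2 * E x + 2 * ((norm (U x))\<^sup>2 * \<Omega> x)"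
   unfolding norm_correction_sq[symmetric] by (simp add: algebra_simps)
  also have "\<dots> \<le> 2 * (1 / t) * E x + 2 * ((norm (U x))\<^sup>2 * (1 + 2 / t))"
   using norm_approx_inverse_sq_le[of x] \<Omega>_le[of x] E_pos[of x] by (intro add_mono mult_right_mono mult_left_mono) auto
  finally show ?thesis using E_pos[of x] by (simp add: algebra_simps)
 qed
 then show "AE x in lborel. norm ((norm (solution x))\<^sup>2 * E x) \<le> norm (2 / t * E x + 2 * (1 + 2 / t) * (norm (U x))\<^sup>2)" by simp
qed (simp add: solution_def[abs_def])

lemma integral_solution_Box:
 assumes v_test: "Ck 3 v" "compact_supp v"
 shows "(\<integral>x. solution x * cnj (Box v x) * E x \<partial>lborel) = 0"
proof -
 have "correction x * cnj (Box v x) * of_real (E x) = U x * cnj (T v x)" for x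
 proof -
  have "sqrt (\<Omega> x / E x) * E x = root_weight x"
   using \<Omega>_ge_1[of x] E_pos[of x] by (simp add: root_weight_def real_sqrt_divide real_sqrt_mult field_simps)
  from arg_cong[OF this, of complex_of_real] show ?thesis by (simp add: correction_def T_def mult_ac)
 qed
 then have integrand: "solution x * cnj (Box v x) * E x = approx_inverse x * cnj (Box v x) * of_real (E x) - U x * cnj (T v x)" for x
  by (simp add: solution_def left_diff_distrib)
 have "integrable lborel (\<lambda>x. U x * cnj (T v x))"
 proof (rule L2_Cauchy_Schwarz(1)[OF U_measurable _ U_L2])
  have "(\<lambda>x. cnj (T v x)) \<in> borel_measurable borel"
   by (intro borel_measurable_continuous_onI continuous_intros continuous_on_T v_test)
  then show "(\<lambda>x. cnj (T v x)) \<in> borel_measurable lborel" by simp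
 qed (simp add: integrable_norm_T_sq v_test)
 then show ?thesis
  unfolding integrand using integral_approx_inverse_Box[OF v_test] U_represents[OF v_test] by simp
qed

sublocale weak_solution E ph solution
 by unfold_locales (simp_all add: integrable_norm_solution_sq integral_solution_Box, simp add: solution_def[abs_def])

definition residual :: "complex^'n \<Rightarrow> real" where "residual x = norm (1 - (x $ m - w) * solution x)"

lemma residual_sq_le:
 assumes "norm x \<le> R"
 shows "(residual x)\<^sup>2 * E x \<le> 2 * (delta_kernel x * E x) + 2 * ((R + norm w)\<^sup>2 + 2) * (norm (U x))\<^sup>2"
proof -
 have "norm (x $ m - w) \<le> norm x + norm w"
  using norm_triangle_ineq4[of "x $ m" w] Finite_Cartesian_Product.norm_nth_le[of x m] by linarith
 then have sq_dist: "sq_dist x \<le> (R + norm w)\<^sup>2" unfolding sq_dist_def using assms by (intro power_mono) auto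
 have "1 - (x $ m - w) * solution x = of_real (t / (sq_dist x + t)) + (x $ m - w) * correction x"
  using one_minus_approx_inverse[of x] by (simp add: solution_def algebra_simps)
 then have "(residual x)\<^sup>2 \<le> 2 * (norm (complex_of_real (t / (sq_dist x + t))))\<^sup>2 + 2 * (norm ((x $ m - w) * correction x))\<^sup>2"
  unfolding residual_def by (simp only: norm_add_sq_le)
 also have "(norm (complex_of_real (t / (sq_dist x + t))))\<^sup>2 = t * delta_kernel x"
  unfolding delta_kernel_def norm_of_real by (simp add: power_divide power2_eq_square)
 also have "(norm ((x $ m - w) * correction x))\<^sup>2 = sq_dist x * (norm (correction x))\<^sup>2"
  by (simp add: norm_mult power_mult_distrib sq_dist_def)
 finally have "(residual x)\<^sup>2 * E x \<le> (2 * (t * delta_kernel x) + 2 * (sq_dist x * (norm (correction x))\<^sup>2)) * E x"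
  using E_pos[of x] by (intro mult_right_mono) auto
 also have "\<dots> = 2 * (t * (delta_kernel x * E x)) + 2 * (sq_dist x * \<Omega> x * (norm (U x))\<^sup>2)"
  using norm_correction_sq[of x] by (simp add: algebra_simps)
 also have "\<dots> \<le> 2 * (1 * (delta_kernel x * E x)) + 2 * (((R + norm w)\<^sup>2 + 2) * (norm (U x))\<^sup>2)"
  using t_bounds delta_kernel_E_nonneg[of x] sq_dist_\<Omega>_le[of x] sq_dist by (intro add_mono mult_left_mono mult_right_mono) auto
 finally show ?thesis by (simp only: mult.assoc mult_1)
qed

lemma nn_integral_residual_sq_le:
 "(\<integral>\<^sup>+x. indicator (cball 0 R) x * ennreal ((residual x)\<^sup>2 * E x) \<partial>lborel) \<le> ennreal (2 * ((R + norm w)\<^sup>2 + 3) * mass)"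
proof -
 let ?g = "\<lambda>x. 2 * (delta_kernel x * E x) + 2 * ((R + norm w)\<^sup>2 + 2) * (norm (U x))\<^sup>2"
 have int: "integrable lborel (\<lambda>x. 2 * (delta_kernel x * E x))" "integrable lborel (\<lambda>x. 2 * ((R + norm w)\<^sup>2 + 2) * (norm (U x))\<^sup>2)"
  by (intro integrable_mult_right integrable_delta_kernel_E U_L2)+
 have "(\<integral>\<^sup>+x. indicator (cball 0 R) x * ennreal ((residual x)\<^sup>2 * E x) \<partial>lborel) \<le> (\<integral>\<^sup>+x. ennreal (?g x) \<partial>lborel)"
  using residual_sq_le by (intro nn_integral_mono) (auto simp: indicator_def intro: ennreal_leI)
 also have "\<dots> = ennreal (\<integral>x. ?g x \<partial>lborel)"
  using delta_kernel_E_nonneg by (intro nn_integral_eq_integral Bochner_Integration.integrable_add int) auto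
 also have "(\<integral>x. ?g x \<partial>lborel) = 2 * mass + 2 * ((R + norm w)\<^sup>2 + 2) * (\<integral>x. (norm (U x))\<^sup>2 \<partial>lborel)"
  by (simp only: Bochner_Integration.integral_add[OF int] integral_mult_right_zero mass_def)
 also have "ennreal \<dots> \<le> ennreal (2 * mass + 2 * ((R + norm w)\<^sup>2 + 2) * mass)"
  using U_bound by (intro ennreal_leI add_left_mono mult_left_mono) auto
 finally show ?thesis by (simp add: algebra_simps)
qed

definition extension :: "real \<Rightarrow> complex^'n \<Rightarrow> complex" where
 "extension \<epsilon> y = 1 - (y $ m - w) * convolve solution (\<lambda>x. complex_of_real (mollifier \<epsilon> x)) y"

lemma extension_eq_1: "y $ m = w \<Longrightarrow> extension \<epsilon> y = 1"
 by (simp add: extension_def)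

lemma extension_holomorphic:
 assumes \<epsilon>: "\<epsilon> > 0" shows "Ck 1 (extension \<epsilon>)" "dzbar j (extension \<epsilon>) y = 0"
proof -
 let ?\<rho> = "\<lambda>x :: complex^'n. complex_of_real (mollifier \<epsilon> x)"
 have \<rho>: "Ck 1 ?\<rho>" "compact_supp ?\<rho>"
  using Ck_le[OF Ck_mollifier[OF \<epsilon>], of 1] compact_supp_comp[OF compact_supp_mollifier[OF \<epsilon>], of complex_of_real] by simp_all
 have conv: "Ck 1 (convolve solution ?\<rho>)"
  by (rule Ck_convolve[OF locally_integrable_of_weighted_L2[OF h_meas h_int] \<rho>])
 show "Ck 1 (extension \<epsilon>)"
  unfolding extension_def[abs_def] by (intro Ck_diff Ck_mult Ck_coordinate_diff Ck_const conv)
 show "dzbar j (extension \<epsilon>) y = 0"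
  unfolding extension_def[abs_def]
  by (simp add: dzbar_diff dzbar_mult Ck_mult Ck_coordinate_diff Ck_const conv dzbar_convolve_eq_0[OF \<rho>] dz_coordinate_diff)
qed

lemma norm_extension_le:
 assumes \<epsilon>: "\<epsilon> > 0"
 shows "ennreal (norm (extension \<epsilon> y)) \<le> (\<integral>\<^sup>+x. ennreal (residual x + \<epsilon> * norm (solution x)) * ennreal (mollifier \<epsilon> (y - x)) \<partial>lborel)"
proof -
 let ?\<rho> = "\<lambda>x :: complex^'n. complex_of_real (mollifier \<epsilon> x)"
 have \<rho>: "continuous_on UNIV ?\<rho>" "compact_supp ?\<rho>"
  using continuous_on_mollifier[OF \<epsilon>] compact_supp_comp[OF compact_supp_mollifier[OF \<epsilon>], of complex_of_real]
  by (auto intro: continuous_intros)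
 have int: "integrable lborel (\<lambda>x. ?\<rho> (y - x))" "integrable lborel (\<lambda>x. solution x * ?\<rho> (y - x))"
  by (intro integrable_compact_supp continuous_on_reflect compact_supp_reflect \<rho>
    convolve_integrable locally_integrable_of_weighted_L2 h_meas h_int)+
 have "(\<integral>x. ?\<rho> (y - x) \<partial>lborel) = 1"
  using integral_lborel_reflect[OF borel_measurable_mollifier[OF \<epsilon>], of y] integral_mollifier[OF \<epsilon>, where 'a = "complex^'n"] by simp
 then have "extension \<epsilon> y = (\<integral>x. ?\<rho> (y - x) - (y $ m - w) * (solution x * ?\<rho> (y - x)) \<partial>lborel)"
  unfolding extension_def convolve_def
  by (simp only: Bochner_Integration.integral_diff[OF int(1) integrable_mult_right[OF int(2)]] integral_mult_right_zero)
 also have "ennreal (norm \<dots>) \<le> (\<integral>\<^sup>+x. norm (?\<rho> (y - x) - (y $ m - w) * (solution x * ?\<rho> (y - x))) \<partial>lborel)"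
  by (intro integral_norm_bound_ennreal Bochner_Integration.integrable_diff int(1) integrable_mult_right int(2))
 also have "\<dots> \<le> (\<integral>\<^sup>+x. ennreal (residual x + \<epsilon> * norm (solution x)) * ennreal (mollifier \<epsilon> (y - x)) \<partial>lborel)"
 proof (rule nn_integral_mono)
  fix x
  have nonneg: "mollifier \<epsilon> (y - x) \<ge> 0" by (rule mollifier_nonneg[OF \<epsilon>])
  have "norm (?\<rho> (y - x) - (y $ m - w) * (solution x * ?\<rho> (y - x))) \<le> (residual x + \<epsilon> * norm (solution x)) * mollifier \<epsilon> (y - x)"
  proof (cases "norm (y - x) < \<epsilon>")
   case True
   then have "norm (x $ m - y $ m) \<le> \<epsilon>" using Finite_Cartesian_Product.norm_nth_le[of "x - y" m] by (simp add: norm_minus_commute)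
   then have "norm ((1 - (x $ m - w) * solution x) + (x $ m - y $ m) * solution x) \<le> residual x + \<epsilon> * norm (solution x)"
    unfolding residual_def by (intro norm_triangle_le add_left_mono) (simp add: norm_mult mult_right_mono)
   moreover have "?\<rho> (y - x) - (y $ m - w) * (solution x * ?\<rho> (y - x)) = ((1 - (x $ m - w) * solution x) + (x $ m - y $ m) * solution x) * ?\<rho> (y - x)"
    by (simp add: algebra_simps)
   ultimately show ?thesis using nonneg by (simp add: norm_mult mult_right_mono)
  qed (simp add: mollifier_eq_0[OF \<epsilon>])
  then show "ennreal (norm (?\<rho> (y - x) - (y $ m - w) * (solution x * ?\<rho> (y - x))))
    \<le> ennreal (residual x + \<epsilon> * norm (solution x)) * ennreal (mollifier \<epsilon> (y - x))"
   using \<epsilon> nonneg by (subst ennreal_mult[symmetric]) (auto simp: residual_def intro: ennreal_leI)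
 qed
 finally show ?thesis .
qed

lemma norm_extension_sq_le:
 assumes \<epsilon>: "\<epsilon> > 0"
 shows "ennreal ((norm (extension \<epsilon> y))\<^sup>2 * E y)
  \<le> ennreal (E y) * (\<integral>\<^sup>+x. ennreal (residual x + \<epsilon> * norm (solution x)) * ennreal (mollifier \<epsilon> (y - x)) \<partial>lborel)\<^sup>2"
proof -
 have "ennreal ((norm (extension \<epsilon> y))\<^sup>2 * E y) = ennreal (E y) * (ennreal (norm (extension \<epsilon> y)))\<^sup>2"
  using E_pos[of y] by (subst ennreal_mult) (auto simp: ennreal_power mult.commute)
 also have "\<dots> \<le> ennreal (E y) * (\<integral>\<^sup>+x. ennreal (residual x + \<epsilon> * norm (solution x)) * ennreal (mollifier \<epsilon> (y - x)) \<partial>lborel)\<^sup>2"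
  by (intro mult_left_mono power_mono norm_extension_le \<epsilon>) auto
 finally show ?thesis .
qed

lemma perturbed_residual_sq_le:
 assumes \<epsilon>: "0 < \<epsilon>" "\<epsilon> \<le> 1"
 shows "(ennreal (residual x + \<epsilon> * norm (solution x)))\<^sup>2 * ennreal (2 * E x)
  \<le> ennreal 4 * ennreal ((residual x)\<^sup>2 * E x) + ennreal (4 * \<epsilon>) * ennreal ((norm (solution x))\<^sup>2 * E x)"
proof -
 define f where "f = residual x + \<epsilon> * norm (solution x)"
 have "f \<ge> 0" using \<epsilon> by (simp add: f_def residual_def)
 have "f\<^sup>2 \<le> 2 * (residual x)\<^sup>2 + 2 * (\<epsilon> * norm (solution x))\<^sup>2"
  unfolding f_def using norm_add_sq_le[of "residual x" "\<epsilon> * norm (solution x)"] by simp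
 also have "(\<epsilon> * norm (solution x))\<^sup>2 \<le> \<epsilon> * (norm (solution x))\<^sup>2"
  using \<epsilon> mult_right_mono[of "\<epsilon> * \<epsilon>" "\<epsilon> * 1" "(norm (solution x))\<^sup>2"] by (simp add: power2_eq_square mult_ac)
 finally have "f\<^sup>2 * (2 * E x) \<le> (2 * (residual x)\<^sup>2 + 2 * (\<epsilon> * (norm (solution x))\<^sup>2)) * (2 * E x)"
  using E_pos[of x] by (intro mult_right_mono) auto
 then have "f\<^sup>2 * (2 * E x) \<le> 4 * ((residual x)\<^sup>2 * E x) + 4 * \<epsilon> * ((norm (solution x))\<^sup>2 * E x)"
  by (simp add: algebra_simps)
 from ennreal_leI[OF this] show ?thesis
  using \<open>f \<ge> 0\<close> E_pos[of x] \<epsilon> unfolding f_def[symmetric] by (simp add: ennreal_power ennreal_mult)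
qed

lemma nn_integral_extension_le:
 assumes \<epsilon>: "0 < \<epsilon>" "\<epsilon> \<le> 1"
  and close: "\<And>x y. norm y \<le> R \<Longrightarrow> norm (x - y) < \<epsilon> \<Longrightarrow> E y \<le> 2 * E x"
 shows "(\<integral>\<^sup>+y. indicator (cball 0 R) y * ennreal ((norm (extension \<epsilon> y))\<^sup>2 * E y) \<partial>lborel)
   \<le> ennreal (8 * ((R + 1 + norm w)\<^sup>2 + 3) * mass + 4 * \<epsilon> * energy)"
proof -
 define f where "f x = residual x + \<epsilon> * norm (solution x)" for x
 define a where "a y = (\<integral>\<^sup>+x. ennreal (f x) * ennreal (mollifier \<epsilon> (y - x)) \<partial>lborel)" for y
 define b where "b = 2 * ((R + 1 + norm w)\<^sup>2 + 3) * mass"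
 let ?g = "\<lambda>y. indicator (cball 0 R) y * ennreal (E y)" and ?K = "\<lambda>x. indicator (cball 0 (R + 1)) x * ennreal (2 * E x)"
 have [measurable]: "cball 0 R \<in> sets (borel :: (complex^'n) measure)" "cball 0 (R + 1) \<in> sets (borel :: (complex^'n) measure)"
  "residual \<in> borel_measurable borel" "f \<in> borel_measurable borel"
  unfolding residual_def[abs_def] f_def[abs_def] by simp_all
 have "(\<integral>\<^sup>+y. indicator (cball 0 R) y * ennreal ((norm (extension \<epsilon> y))\<^sup>2 * E y) \<partial>lborel) \<le> (\<integral>\<^sup>+y. ?g y * (a y)\<^sup>2 \<partial>lborel)"
  using norm_extension_sq_le[OF \<epsilon>(1)] unfolding a_def f_def mult.assoc by (intro nn_integral_mono mult_left_mono) auto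
 also have "\<dots> \<le> (\<integral>\<^sup>+x. (ennreal (f x))\<^sup>2 * ?K x \<partial>lborel)"
  unfolding a_def
 proof (rule mollifier_average_bound[OF \<epsilon>(1)])
  fix x y :: "complex^'n" assume xy_close: "norm (y - x) < \<epsilon>"
  have "norm x \<le> R + 1" if "norm y \<le> R" using norm_triangle_ineq2[of x y] xy_close \<epsilon>(2) that by (simp add: norm_minus_commute)
  then show "?g y \<le> ?K x" using close[of y x] xy_close by (auto simp: indicator_def norm_minus_commute intro: ennreal_leI)
 qed simp_all
 also have "\<dots> \<le> (\<integral>\<^sup>+x. ennreal 4 * (indicator (cball 0 (R + 1)) x * ennreal ((residual x)\<^sup>2 * E x)) + ennreal (4 * \<epsilon>) * ennreal ((norm (solution x))\<^sup>2 * E x) \<partial>lborel)"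
  using perturbed_residual_sq_le[OF \<epsilon>] by (intro nn_integral_mono) (simp add: f_def indicator_def)
 also have "\<dots> = ennreal 4 * (\<integral>\<^sup>+x. indicator (cball 0 (R + 1)) x * ennreal ((residual x)\<^sup>2 * E x) \<partial>lborel) + ennreal (4 * \<epsilon>) * ennreal energy"
  unfolding energy_def using less_imp_le[OF E_pos] nn_integral_eq_integral[OF h_int]
  by (subst nn_integral_add) (simp_all add: nn_integral_cmult)
 also have "\<dots> \<le> ennreal 4 * ennreal b + ennreal (4 * \<epsilon>) * ennreal energy"
  unfolding b_def by (intro add_right_mono mult_left_mono nn_integral_residual_sq_le) simp
 also have "\<dots> = ennreal (4 * b + 4 * \<epsilon> * energy)"
  using mass_nonneg energy_nonneg \<epsilon> by (simp add: b_def ennreal_mult)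
 also have "4 * b = 8 * ((R + 1 + norm w)\<^sup>2 + 3) * mass" by (simp add: b_def)
 finally show ?thesis .
qed

end

theorem (in twisted_weight) extension_from_hyperplane:
 assumes "\<theta> > 0"
 obtains F where "Ck 1 F" "\<And>j y. dzbar j F y = 0" "\<And>y. y $ m = w \<Longrightarrow> F y = 1"
  "(\<integral>\<^sup>+y. indicator (cball 0 R) y * ennreal ((norm (F y))\<^sup>2 * E y) \<partial>lborel) \<le> ennreal (8 * ((R + 1 + norm w)\<^sup>2 + 3) * mass + \<theta>)"
proof -
 obtain U where "U \<in> borel_measurable lborel" "integrable lborel (\<lambda>x. (norm (U x))\<^sup>2)" "(\<integral>x. (norm (U x))\<^sup>2 \<partial>lborel) \<le> mass"
  "\<And>v. Ck 3 v \<Longrightarrow> compact_supp v \<Longrightarrow> (\<integral>x. U x * cnj (T v x) \<partial>lborel) = l v"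
  using twisted_solution by blast
 then interpret twisted_correction E ph m w t U by unfold_locales
 define \<epsilon>\<^sub>0 where "\<epsilon>\<^sub>0 = min 1 (\<theta> / (4 * (energy + 1)))"
 have "\<epsilon>\<^sub>0 > 0" using \<open>\<theta> > 0\<close> energy_nonneg by (simp add: \<epsilon>\<^sub>0_def)
 then have "\<forall>\<^sub>F \<epsilon> in at_right 0. \<epsilon> < \<epsilon>\<^sub>0" by (intro order_tendstoD(2)[OF tendsto_ident_at])
 from eventually_happens[OF eventually_conj[OF eventually_conj[OF this eventually_at_right_less] eventually_comparable[OF E_cont E_pos, of R]]]
 obtain \<epsilon> where \<epsilon>: "0 < \<epsilon>" "\<epsilon> < \<epsilon>\<^sub>0" and close: "\<And>x y. norm y \<le> R \<Longrightarrow> norm (x - y) < \<epsilon> \<Longrightarrow> E y \<le> 2 * E x" by auto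
 have "4 * \<epsilon> * energy \<le> \<theta>"
 proof -
  have "4 * \<epsilon> * energy \<le> 4 * \<epsilon> * (energy + 1)" using \<epsilon> by simp
  also have "\<dots> \<le> \<theta>" using \<epsilon>(2) energy_nonneg by (simp add: \<epsilon>\<^sub>0_def field_simps)
  finally show ?thesis .
 qed
 then have "ennreal (8 * ((R + 1 + norm w)\<^sup>2 + 3) * mass + 4 * \<epsilon> * energy) \<le> ennreal (8 * ((R + 1 + norm w)\<^sup>2 + 3) * mass + \<theta>)"
  by (intro ennreal_leI) simp
 moreover have "\<epsilon> \<le> 1" using \<epsilon>(2) by (simp add: \<epsilon>\<^sub>0_def)
 ultimately show thesis
  using that[OF extension_holomorphic[OF \<epsilon>(1)] extension_eq_1] nn_integral_extension_le[OF \<epsilon>(1) _ close] order_trans by blast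
qed

lemma vec_upd_shift_Re: "vec_upd z k (Complex 0 y) + x *\<^sub>R axis k 1 = vec_upd z k (Complex x y)"
 and vec_upd_shift_Im: "vec_upd z k (Complex x 0) + y *\<^sub>R axis k \<i> = vec_upd z k (Complex x y)"
 by (auto simp: vec_eq_iff axis_def complex_eq_iff)

lemma has_derivative_slice:
 fixes F :: "complex^'n::finite \<Rightarrow> complex"
 assumes F_Ck: "Ck 1 F"
 shows "((\<lambda>t. F (vec_upd z k t)) has_derivative
   (\<lambda>h. Re h *\<^sub>R partial (axis k 1) F (vec_upd z k t) + Im h *\<^sub>R partial (axis k \<i>) F (vec_upd z k t))) (at t)"
proof -
 let ?a = "partial (axis k 1) F" and ?b = "partial (axis k \<i>) F" and ?f = "\<lambda>x y. F (vec_upd z k (Complex x y))"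
 have partials: "has_partial F (axis k 1) ?a" "has_partial F (axis k \<i>) ?b" using Ck1_has_partial[OF F_Ck] by auto
 have b_cont: "continuous_on UNIV ?b" using F_Ck by simp
 have deriv_x: "((\<lambda>x. ?f x (Im t)) has_derivative (\<lambda>h. h *\<^sub>R ?a (vec_upd z k t))) (at (Re t))"
  using has_partial_at[OF partials(1), of "vec_upd z k (Complex 0 (Im t))" "Re t"]
  by (simp add: vec_upd_shift_Re has_vector_derivative_def)
 have deriv_y: "((\<lambda>y. ?f x y) has_derivative blinfun_apply (blinfun_scaleR_left (?b (vec_upd z k (Complex x y))))) (at y)" for x y
  using has_partial_at[OF partials(2), of "vec_upd z k (Complex x 0)" y]
  by (simp add: vec_upd_shift_Im has_vector_derivative_def)
 have "continuous_on UNIV (\<lambda>p. blinfun_scaleR_left (?b (vec_upd z k (Complex (fst p) (snd p)))))"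
  by (intro bounded_linear.continuous_on[OF bounded_linear_blinfun_scaleR_left] continuous_on_compose2[OF b_cont]
    continuous_intros) auto
 then have fy_cont: "continuous (at (Re t, Im t) within UNIV \<times> UNIV) (\<lambda>(x, y). blinfun_scaleR_left (?b (vec_upd z k (Complex x y))))"
  by (simp add: continuous_on_eq_continuous_at split_def)
 have "((\<lambda>(x, y). ?f x y) has_derivative
   (\<lambda>(tx, ty). tx *\<^sub>R ?a (vec_upd z k t) + blinfun_apply (blinfun_scaleR_left (?b (vec_upd z k (Complex (Re t) (Im t))))) ty))
   (at (Re t, Im t) within UNIV \<times> UNIV)"
  by (rule has_derivative_partialsI[OF _ _ fy_cont]) (use deriv_x deriv_y in auto)
 then have pair: "((\<lambda>(x, y). ?f x y) has_derivative (\<lambda>(tx, ty). tx *\<^sub>R ?a (vec_upd z k t) + ty *\<^sub>R ?b (vec_upd z k t))) (at (Re t, Im t))"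
  by simp
 have "((\<lambda>t. (Re t, Im t)) has_derivative (\<lambda>h. (Re h, Im h))) (at t)"
  by (auto intro!: derivative_eq_intros)
 from has_derivative_compose[OF this pair] show ?thesis by simp
qed

lemma holomorphic_slice:
 fixes F :: "complex^'n::finite \<Rightarrow> complex"
 assumes F_Ck: "Ck 1 F" and F_CR: "\<And>y. dzbar k F y = 0"
 shows "(\<lambda>t. F (vec_upd z k t)) holomorphic_on S"
proof -
 have "partial (axis k \<i>) F y = \<i> * partial (axis k 1) F y" for y
  using F_CR[of y] by (simp add: dzbar_def complex_eq_iff add_eq_0_iff)
 then have "(\<lambda>h. Re h *\<^sub>R partial (axis k 1) F y + Im h *\<^sub>R partial (axis k \<i>) F y) = (*) (partial (axis k 1) F y)" for y
  by (auto simp: fun_eq_iff complex_eq_iff algebra_simps)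
 then have "((\<lambda>t. F (vec_upd z k t)) has_field_derivative partial (axis k 1) F (vec_upd z k t)) (at t)" for t
  using has_derivative_slice[OF F_Ck, of z k t] by (simp add: has_field_derivative_def)
 then show ?thesis unfolding holomorphic_on_def field_differentiable_def by (blast intro: DERIV_subset)
qed

lemma Cauchy_formula_unit_interval:
 assumes f_hol: "f holomorphic_on cball 0 r" and t_less: "norm t < r"
 shows "((\<lambda>x. f (circlepath 0 r x) * (1 / (1 - t / circlepath 0 r x))) has_integral f t) {0..1}"
proof -
 let ?\<xi> = "circlepath 0 r"
 have r_pos: "r > 0" using t_less norm_ge_zero[of t] by linarith
 have \<xi>: "norm (?\<xi> x) = r" for x using r_pos by (simp add: circlepath norm_mult norm_exp_eq_Re)
 define K where "K = 2 * complex_of_real pi * \<i>"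
 have K_nonzero: "K \<noteq> 0" by (simp add: K_def)
 have "((\<lambda>x. f (?\<xi> x) / (?\<xi> x - t) * (K * ?\<xi> x)) has_integral (K * f t)) {0..1}"
  using Cauchy_integral_circlepath_simple[OF f_hol, of t] t_less
  unfolding has_contour_integral vector_derivative_circlepath K_def unfolding circlepath by (simp add: mult_ac)
 from has_integral_mult_right[OF this, of "inverse K"]
 have "((\<lambda>x. inverse K * (f (?\<xi> x) / (?\<xi> x - t) * (K * ?\<xi> x))) has_integral f t) {0..1}"
  using K_nonzero by (simp add: mult.assoc[symmetric])
 moreover have "inverse K * (f (?\<xi> x) / (?\<xi> x - t) * (K * ?\<xi> x)) = f (?\<xi> x) * (1 / (1 - t / ?\<xi> x))" for x
 proof -
  have "?\<xi> x \<noteq> 0" "?\<xi> x - t \<noteq> 0" using \<xi>[of x] r_pos t_less by auto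
  then have "1 / (1 - t / ?\<xi> x) = ?\<xi> x / (?\<xi> x - t)" by (simp add: divide_simps)
  then show ?thesis using K_nonzero by simp
 qed
 ultimately show ?thesis by (simp only:)
qed

lemma circle_mean_value:
 assumes f_hol: "f holomorphic_on UNIV"
 shows "ennreal (norm (f z)) \<le> (\<integral>\<^sup>+x\<in>{0..1}. ennreal (norm (f (z + u * circlepath 0 1 x))) \<partial>lborel)"
proof -
 let ?h = "\<lambda>v. f (z + u * v)"
 have "?h holomorphic_on UNIV"
  by (intro holomorphic_on_compose_gen[OF _ f_hol, unfolded o_def] holomorphic_intros) auto
 then have "?h holomorphic_on cball 0 1" by (rule holomorphic_on_subset) auto
 then have mean: "((\<lambda>x. ?h (circlepath 0 1 x)) has_integral f z) {0..1}"
  using Cauchy_formula_unit_interval[of ?h 1 0] by simp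
 have "continuous_on {0..1} (\<lambda>x. ?h (circlepath 0 1 x))"
  unfolding circlepath by (intro continuous_on_compose2[OF holomorphic_on_imp_continuous_on[OF f_hol]] continuous_intros) auto
 then have integrable: "set_integrable lborel {0..1} (\<lambda>x. ?h (circlepath 0 1 x))"
  unfolding set_integrable_def by (rule borel_integrable_compact[rotated]) simp
 have "norm (f z) = norm (\<integral>x. indicator {0..1} x *\<^sub>R ?h (circlepath 0 1 x) \<partial>lborel)"
  using set_borel_integral_eq_integral(2)[OF integrable] integral_unique[OF mean] by (simp add: set_lebesgue_integral_def)
 also have "ennreal \<dots> \<le> (\<integral>\<^sup>+x. norm (indicator {0..1} x *\<^sub>R ?h (circlepath 0 1 x)) \<partial>lborel)"
  using integrable unfolding set_integrable_def by (rule integral_norm_bound_ennreal)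
 also have "\<dots> = (\<integral>\<^sup>+x\<in>{0..1}. ennreal (norm (?h (circlepath 0 1 x))) \<partial>lborel)"
  by (intro nn_integral_cong) (auto simp: indicator_def)
 finally show ?thesis .
qed

lemma area_mean_value:
 assumes f_hol: "f holomorphic_on UNIV"
 shows "ennreal (norm (f a)) * emeasure lborel (ball (0::complex) r) \<le> (\<integral>\<^sup>+w\<in>ball a r. ennreal (norm (f w)) \<partial>lborel)"
proof -
 have [measurable]: "f \<in> borel_measurable borel" by (rule borel_measurable_continuous_onI[OF holomorphic_on_imp_continuous_on[OF f_hol]])
 have [measurable]: "ball c r \<in> sets (borel :: complex measure)" for c by simp
 have [measurable]: "circlepath 0 1 \<in> borel_measurable borel"
  unfolding circlepath by (intro borel_measurable_continuous_onI continuous_intros)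
 have circle: "norm (circlepath 0 1 x) = 1" for x by (simp add: circlepath norm_exp_eq_Re)
 define g where "g u = ennreal (norm (f (a + u))) * indicator (ball 0 r) u" for u
 have [measurable]: "g \<in> borel_measurable borel" unfolding g_def by measurable
 have rotate: "(\<integral>\<^sup>+u. g (u * circlepath 0 1 x) \<partial>lborel) = (\<integral>\<^sup>+u. g u \<partial>lborel)" for x
  by (rule nn_integral_lborel_isometry)
   (auto intro!: bounded_linear.linear[OF bounded_linear_mult_left] simp: norm_mult circle)
 have "ennreal (norm (f a)) * indicator (ball 0 r) u \<le> (\<integral>\<^sup>+x. g (u * circlepath 0 1 x) * indicator {0..1} x \<partial>lborel)" for u
 proof (cases "u \<in> ball 0 r")
  case True
  then have "g (u * circlepath 0 1 x) = ennreal (norm (f (a + u * circlepath 0 1 x)))" for x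
   by (simp add: g_def norm_mult circle)
  then show ?thesis using circle_mean_value[OF f_hol, of a u] True by simp
 qed simp
 then have "ennreal (norm (f a)) * emeasure lborel (ball (0::complex) r)
   \<le> (\<integral>\<^sup>+u. \<integral>\<^sup>+x. g (u * circlepath 0 1 x) * indicator {0..1} x \<partial>lborel \<partial>lborel)"
  by (subst nn_integral_cmult_indicator[symmetric]) (auto intro: nn_integral_mono)
 also have "\<dots> = (\<integral>\<^sup>+x. \<integral>\<^sup>+u. g (u * circlepath 0 1 x) * indicator {0..1} x \<partial>lborel \<partial>lborel)"
  by (rule lborel_pair.Fubini'[symmetric]) measurable
 also have "\<dots> = (\<integral>\<^sup>+u. g u \<partial>lborel)" by (simp add: nn_integral_multc nn_integral_cmult rotate)
 also have "\<dots> = (\<integral>\<^sup>+u. ennreal (norm (f (a + u))) * indicator (ball a r) (a + u) \<partial>lborel)"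
  by (intro nn_integral_cong) (simp add: g_def indicator_def dist_norm)
 also have "\<dots> = (\<integral>\<^sup>+w\<in>ball a r. ennreal (norm (f w)) \<partial>lborel)"
  by (rule nn_integral_lborel_shift[of "\<lambda>w. ennreal (norm (f w)) * indicator (ball a r) w"]) measurable
 finally show ?thesis .
qed

definition pdisk :: "complex^'n::finite \<Rightarrow> real \<Rightarrow> (complex^'n) set" where
 "pdisk a r = {x. \<forall>i. norm (x $ i - a $ i) < r}"

definition cpdisk :: "complex^'n::finite \<Rightarrow> real \<Rightarrow> (complex^'n) set" where
 "cpdisk a r = {x. \<forall>i. norm (x $ i - a $ i) \<le> r}"

lemma open_pdisk: "open (pdisk a r)"
proof -
 have "pdisk a r = (\<Inter>i\<in>UNIV. {x. norm (x $ i - a $ i) < r})" by (auto simp: pdisk_def)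
 moreover have "open {x. norm (x $ i - a $ i) < r}" for i
  by (intro open_Collect_less continuous_intros)
 ultimately show ?thesis by (simp add: open_INT)
qed

lemma sets_pdisk [measurable]: "pdisk a r \<in> sets borel"
 using open_pdisk by (rule borel_open)

lemma pdisk_mono: "r \<le> R \<Longrightarrow> pdisk a r \<subseteq> pdisk a R"
 by (auto simp: pdisk_def intro: less_le_trans)

lemma pdisk_subset_cpdisk: "pdisk a r \<subseteq> cpdisk a r"
 by (auto simp: pdisk_def cpdisk_def intro: less_imp_le)

lemma cpdisk_subset_pdisk: "r < R \<Longrightarrow> cpdisk a r \<subseteq> pdisk a R"
 by (auto simp: pdisk_def cpdisk_def intro: le_less_trans)

lemma cpdisk_subset_cball: "cpdisk (a::complex^'n::finite) r \<subseteq> cball a (real CARD('n) * r)"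
proof
 fix x assume x_in: "x \<in> cpdisk a r"
 have "norm (x - a) \<le> (\<Sum>i\<in>UNIV. norm ((x - a) $ i))" by (simp add: norm_vec_def L2_set_le_sum)
 also have "\<dots> \<le> (\<Sum>i\<in>(UNIV::'n set). r)" using x_in by (intro sum_mono) (auto simp: cpdisk_def)
 finally show "x \<in> cball a (real CARD('n) * r)" by (simp add: dist_norm norm_minus_commute)
qed

lemma compact_cpdisk: "compact (cpdisk a r :: (complex^'n::finite) set)"
proof -
 have "cpdisk a r = (\<Inter>i\<in>UNIV. {x. norm (x $ i - a $ i) \<le> r})" by (auto simp: cpdisk_def)
 moreover have "closed {x :: complex^'n. norm (x $ i - a $ i) \<le> r}" for i by (intro closed_Collect_le continuous_intros)
 ultimately have "closed (cpdisk a r)" by (simp add: closed_INT)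
 then show ?thesis using bounded_subset[OF bounded_cball cpdisk_subset_cball] by (simp add: compact_eq_bounded_closed)
qed

lemma emeasure_lborel_open_neq_0:
 fixes S :: "'a::euclidean_space set"
 assumes "open S" "S \<noteq> {}" shows "emeasure lborel S \<noteq> 0"
proof
 assume "emeasure lborel S = 0"
 then have "S \<in> null_sets lborel" using assms by (simp add: null_sets_def)
 then have "S \<in> null_sets lebesgue" by (rule null_sets_completionI)
 then have "negligible S" by (simp add: negligible_iff_null_sets)
 then show False using open_not_negligible[OF assms] by blast
qed

lemma emeasure_pdisk_finite: "emeasure lborel (pdisk a r) < \<infinity>"
proof -
 have "emeasure lborel (pdisk a r) \<le> emeasure lborel (cpdisk a r)"
  using pdisk_subset_cpdisk by (rule emeasure_mono) (simp add: borel_compact compact_cpdisk)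
 also have "\<dots> < \<infinity>" by (rule emeasure_bounded_finite[OF compact_imp_bounded[OF compact_cpdisk]])
 finally show ?thesis .
qed

lemma emeasure_pdisk_pos:
 assumes "r > 0" shows "emeasure lborel (pdisk a r) > 0"
proof -
 have "a \<in> pdisk a r" using assms by (simp add: pdisk_def)
 then show ?thesis using emeasure_lborel_open_neq_0[OF open_pdisk, of a r] by (auto simp: zero_less_iff_neq_zero)
qed

lemma emeasure_pdisk_center:
 "emeasure lborel (pdisk (a::complex^'n::finite) r) = emeasure lborel (pdisk (0::complex^'n) r)"
proof -
 have "indicator (pdisk a r) (a + x) = (indicator (pdisk 0 r) x :: ennreal)" for x
  by (simp add: pdisk_def indicator_def)
 then show ?thesis
  using nn_integral_lborel_shift[of "indicator (pdisk a r)" a] by (simp add: borel_measurable_indicator)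
qed

definition vec_mix :: "'n set \<Rightarrow> complex^'n \<Rightarrow> complex^'n \<Rightarrow> complex^'n" where
 "vec_mix I x a = (\<chi> i. if i \<in> I then x $ i else a $ i)"

lemma vec_mix_empty [simp]: "vec_mix {} x a = a" and vec_mix_UNIV [simp]: "vec_mix UNIV x a = x"
 by (simp_all add: vec_mix_def vec_eq_iff)

lemma vec_mix_insert_vec_upd: "k \<notin> I \<Longrightarrow> vec_mix (insert k I) (vec_upd x k w) a = vec_upd (vec_mix I x a) k w"
 by (auto simp: vec_mix_def vec_eq_iff)

lemma vec_mix_insert: "vec_mix (insert k I) x a = vec_mix I x (vec_upd a k (x $ k))"
 by (auto simp: vec_mix_def vec_eq_iff)

lemma vec_mix_vec_upd: "k \<notin> I \<Longrightarrow> vec_mix I x (vec_upd a k w) = vec_upd (vec_mix I x a) k w"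
 by (auto simp: vec_mix_def vec_eq_iff)

lemma continuous_on_vec_mix [continuous_intros]:
 fixes f h :: "'a::topological_space \<Rightarrow> complex^'n::finite"
 assumes "continuous_on S f" "continuous_on S h"
 shows "continuous_on S (\<lambda>x. vec_mix I (f x) (h x))"
 unfolding vec_mix_def
proof (rule continuous_on_vec_lambda)
 show "continuous_on S (\<lambda>x. if i \<in> I then f x $ i else h x $ i)" for i
  by (cases "i \<in> I") (auto intro!: continuous_intros assms)
qed

lemma polydisk_mean_value_step:
 fixes F :: "complex^'n::finite \<Rightarrow> complex" and a :: "complex^'n"
 assumes F_cont: "continuous_on UNIV F" and hol: "\<And>z. (\<lambda>t. F (vec_upd z k t)) holomorphic_on UNIV" and r_pos: "r > 0" and k_notin: "k \<notin> I"
 defines "J \<equiv> \<lambda>I. \<integral>\<^sup>+x. indicator (pdisk a r) x * ennreal (norm (F (vec_mix I x a))) \<partial>lborel"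
 shows "J I \<le> J (insert k I)"
proof -
 have "continuous_on UNIV (\<lambda>x. F (vec_mix I x a))" for I
  by (intro continuous_on_compose2[OF F_cont] continuous_intros) auto
 then have [measurable]: "(\<lambda>x. F (vec_mix I x a)) \<in> borel_measurable borel" for I by (rule borel_measurable_continuous_onI)
 define f where "f x = indicator (pdisk a r) x * ennreal (norm (F (vec_mix (insert k I) x a)))" for x
 have [measurable]: "f \<in> borel_measurable borel" unfolding f_def by measurable
 define b where "b w = (indicator (ball (a $ k) r) w :: ennreal)" for w
 have [measurable]: "b \<in> borel_measurable borel" unfolding b_def by (rule borel_measurable_indicator) simp
 define v where "v = emeasure lborel (ball (0::complex) r)"
 have integral_b: "(\<integral>\<^sup>+w. b w \<partial>lborel) = v"
 proof -
  have "b (a $ k + u) = indicator (ball 0 r) u" for u by (simp add: b_def indicator_def dist_norm)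
  then show ?thesis using nn_integral_lborel_shift[of b "a $ k"] by (simp add: v_def)
 qed
 have v_finite: "v \<noteq> \<infinity>" "v \<noteq> 0"
  unfolding v_def using r_pos emeasure_bounded_finite[OF bounded_ball, of "0::complex" r] emeasure_lborel_open_neq_0[of "ball (0::complex) r"] by auto
 have "indicator (pdisk a r) z * ennreal (norm (F (vec_mix I z a))) * v \<le> (\<integral>\<^sup>+w. f (vec_upd z k w) * b (z $ k) \<partial>lborel)" for z
 proof (cases "z \<in> pdisk a r")
  case True
  have "indicator (pdisk a r) (vec_upd z k w) = (indicator (ball (a $ k) r) w :: ennreal)" for w
   using True by (auto simp: pdisk_def indicator_def dist_norm norm_minus_commute split: if_splits)
  moreover have "b (z $ k) = 1" using True by (simp add: b_def pdisk_def dist_norm norm_minus_commute)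
  ultimately have "f (vec_upd z k w) * b (z $ k) = ennreal (norm (F (vec_upd (vec_mix I z a) k w))) * indicator (ball (a $ k) r) w" for w
   using k_notin by (simp add: f_def vec_mix_insert_vec_upd mult.commute)
  moreover have "vec_upd (vec_mix I z a) k (a $ k) = vec_mix I z a" using k_notin by (simp add: vec_mix_def vec_eq_iff)
  ultimately show ?thesis using area_mean_value[OF hol, of "vec_mix I z a" "a $ k" r] True by (simp add: v_def)
 qed simp
 then have "J I * v \<le> (\<integral>\<^sup>+z. \<integral>\<^sup>+w. f (vec_upd z k w) * b (z $ k) \<partial>lborel \<partial>lborel)"
  unfolding J_def by (subst nn_integral_multc[symmetric]) (auto intro: nn_integral_mono)
 also have "\<dots> = J (insert k I) * v"
  unfolding integral_b[symmetric] by (subst nn_integral_vec_upd[symmetric]) (auto simp: f_def[abs_def] J_def)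
 finally show ?thesis using v_finite by (simp add: ennreal_mult_le_mult_iff mult.commute[of _ v])
qed

lemma polydisk_mean_value:
 fixes F :: "complex^'n::finite \<Rightarrow> complex"
 assumes "continuous_on UNIV F" "\<And>z k. (\<lambda>t. F (vec_upd z k t)) holomorphic_on UNIV" "r > 0"
 shows "ennreal (norm (F a)) * emeasure lborel (pdisk a r) \<le> (\<integral>\<^sup>+x. indicator (pdisk a r) x * ennreal (norm (F x)) \<partial>lborel)"
proof -
 define J where "J I = (\<integral>\<^sup>+x. indicator (pdisk a r) x * ennreal (norm (F (vec_mix I x a))) \<partial>lborel)" for I
 have "J {} \<le> J I" if "finite I" for I
  using that
 proof induction
  case (insert k I)
  have "J I \<le> J (insert k I)"
   unfolding J_def by (rule polydisk_mean_value_step) (rule assms insert.hyps)+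
  with insert.IH show ?case by (rule order_trans)
 qed simp
 from this[of UNIV] have "J {} \<le> J UNIV" by simp
 moreover have "J {} = ennreal (norm (F a)) * emeasure lborel (pdisk a r)"
  by (simp add: J_def nn_integral_multc) (simp add: mult.commute)
 ultimately show ?thesis by (simp add: J_def)
qed

lemma holomorphic_difference_bound:
 assumes f_hol: "f holomorphic_on UNIV" and r_pos: "r > 0" and B_bound: "\<And>t. norm t \<le> 2 * r \<Longrightarrow> norm (f t) \<le> B"
  and xy_bound: "norm x \<le> r" "norm y \<le> r"
 shows "norm (f x - f y) \<le> B / r * norm (x - y)"
proof (rule field_differentiable_bound[of "cball 0 r" f "deriv f" "B / r"])
 fix t :: complex assume t_in: "t \<in> cball 0 r"
 show "(f has_field_derivative deriv f t) (at t within cball 0 r)"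
  using holomorphic_derivI[OF f_hol open_UNIV, of t] by (auto intro: DERIV_subset)
 have "norm ((deriv ^^ 1) f t) \<le> fact 1 * B / r ^ 1"
 proof (rule Cauchy_inequality)
  show "f holomorphic_on ball t r" by (rule holomorphic_on_subset[OF f_hol]) simp
  show "continuous_on (cball t r) f" by (rule continuous_on_subset[OF holomorphic_on_imp_continuous_on[OF f_hol]]) simp
  fix s assume "norm (t - s) = r"
  then have "norm s \<le> 2 * r" using t_in norm_triangle_ineq2[of s t] by (simp add: norm_minus_commute)
  then show "norm (f s) \<le> B" by (rule B_bound)
 qed (rule r_pos)
 then show "norm (deriv f t) \<le> B / r" by simp
qed (use xy_bound in auto)

lemma nn_integral_inverse_1_plus_square: "(\<integral>\<^sup>+(x::real). ennreal (1 / (1 + x\<^sup>2)) \<partial>lborel) < \<infinity>"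
proof -
 define f where "f = (\<lambda>x::real. 1 / (1 + x\<^sup>2))"
 have fm [measurable]: "f \<in> borel_measurable borel" unfolding f_def by measurable
 have half_pos: "(\<integral>\<^sup>+x. ennreal (f x) * indicator {0..} x \<partial>lborel) = ennreal (pi / 2 - arctan 0)"
 proof (rule nn_integral_FTC_atLeast[OF fm])
  fix x :: real
  show "(arctan has_real_derivative f x) (at x)"
   unfolding f_def using DERIV_arctan[of x] by (simp add: inverse_eq_divide)
 qed (auto simp: f_def tendsto_arctan_at_top)
 have "(\<integral>\<^sup>+x. ennreal (f x) * indicator {..0} x \<partial>lborel) = (\<integral>\<^sup>+x. ennreal (f (0 - x)) * indicator {..0} (0 - x) \<partial>lborel)"
  by (rule nn_integral_lborel_reflect[of "\<lambda>x. ennreal (f x) * indicator {..0} x" 0, symmetric]) simp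
 also have "\<dots> = (\<integral>\<^sup>+x. ennreal (f x) * indicator {0..} x \<partial>lborel)"
  by (intro nn_integral_cong) (auto simp: f_def indicator_def)
 finally have half_neg: "(\<integral>\<^sup>+x. ennreal (f x) * indicator {..0} x \<partial>lborel) = ennreal (pi / 2 - arctan 0)" using half_pos by simp
 have "(\<integral>\<^sup>+x. ennreal (f x) \<partial>lborel) \<le> (\<integral>\<^sup>+x. ennreal (f x) * indicator {0..} x + ennreal (f x) * indicator {..0} x \<partial>lborel)"
  by (intro nn_integral_mono) (auto simp: indicator_def)
 also have "\<dots> = (\<integral>\<^sup>+x. ennreal (f x) * indicator {0..} x \<partial>lborel) + (\<integral>\<^sup>+x. ennreal (f x) * indicator {..0} x \<partial>lborel)"
  by (rule nn_integral_add) measurable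
 also have "\<dots> < \<infinity>" unfolding half_pos half_neg by simp
 finally show ?thesis by (simp add: f_def)
qed

lemma nn_integral_prod_inverse:
 "(\<integral>\<^sup>+(x::'a::euclidean_space). (\<Prod>b\<in>Basis. ennreal (1 / (1 + (x \<bullet> b)\<^sup>2))) \<partial>lborel) < \<infinity>"
proof -
 have "(\<integral>\<^sup>+(x::'a). (\<Prod>b\<in>Basis. ennreal (1 / (1 + (x \<bullet> b)\<^sup>2))) \<partial>lborel) = (\<Prod>b\<in>(Basis::'a set). (\<integral>\<^sup>+(x::real). ennreal (1 / (1 + x\<^sup>2)) \<partial>lborel))"
  by (rule nn_integral_lborel_prod[of "\<lambda>_ x. ennreal (1 / (1 + x\<^sup>2))"]) auto
 also have "\<dots> < \<infinity>" using nn_integral_inverse_1_plus_square by (simp add: power_less_top_ennreal)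
 finally show ?thesis .
qed

lemma nn_integral_gaussian: "(\<integral>\<^sup>+(x::'a::euclidean_space). ennreal (exp (- 2 * (norm x)\<^sup>2)) \<partial>lborel) < \<infinity>"
proof (rule le_less_trans[OF _ nn_integral_prod_inverse], rule nn_integral_mono)
 fix x :: 'a
 have "(norm x)\<^sup>2 = (\<Sum>b\<in>Basis. (x \<bullet> b)\<^sup>2)"
  unfolding power2_norm_eq_inner by (subst euclidean_inner) (simp add: power2_eq_square)
 then have "exp (- 2 * (norm x)\<^sup>2) = (\<Prod>b\<in>Basis. exp (- 2 * (x \<bullet> b)\<^sup>2))"
  by (simp add: exp_sum[symmetric] sum_distrib_left)
 also have "\<dots> \<le> (\<Prod>b\<in>Basis. 1 / (1 + (x \<bullet> b)\<^sup>2))"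
 proof (intro prod_mono conjI)
  fix b
  have "1 + (x \<bullet> b)\<^sup>2 \<le> exp ((x \<bullet> b)\<^sup>2)" by (rule exp_ge_add_one_self)
  also have "\<dots> \<le> exp (2 * (x \<bullet> b)\<^sup>2)" by simp
  finally show "exp (- 2 * (x \<bullet> b)\<^sup>2) \<le> 1 / (1 + (x \<bullet> b)\<^sup>2)"
   by (simp add: exp_minus field_simps add_pos_nonneg)
 qed simp
 finally show "ennreal (exp (- 2 * (norm x)\<^sup>2)) \<le> (\<Prod>b\<in>Basis. ennreal (1 / (1 + (x \<bullet> b)\<^sup>2)))"
  by (subst prod_ennreal) (auto intro: ennreal_leI)
qed

lemma nn_integral_cauchy_kernel: "(\<integral>\<^sup>+(x::complex). ennreal (1 / (1 + (norm x)\<^sup>2)\<^sup>2) \<partial>lborel) < \<infinity>"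
proof (rule le_less_trans[OF _ nn_integral_prod_inverse], rule nn_integral_mono)
 fix x :: complex
 have "(1 + (Re x)\<^sup>2) * (1 + (Im x)\<^sup>2) \<le> (1 + (norm x)\<^sup>2)\<^sup>2"
 proof -
  have "(1 + (p + q))\<^sup>2 - (1 + p) * (1 + q) = p + q + p * p + p * q + q * q" for p q :: real
   by (simp add: power2_eq_square algebra_simps)
  moreover have "0 \<le> p + q + p * p + p * q + q * q" if "p \<ge> 0" "q \<ge> 0" for p q :: real using that by simp
  ultimately show ?thesis unfolding cmod_power2 by (metis diff_ge_0_iff_ge zero_le_power2)
 qed
 then have "1 / (1 + (norm x)\<^sup>2)\<^sup>2 \<le> 1 / ((1 + (Re x)\<^sup>2) * (1 + (Im x)\<^sup>2))"
 proof (intro divide_left_mono mult_pos_pos)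
  have "1 + (norm x)\<^sup>2 > 0" by (simp add: add_pos_nonneg)
  then show "0 < (1 + (norm x)\<^sup>2)\<^sup>2" by simp
 qed (auto simp: add_pos_nonneg)
 also have "\<dots> = (\<Prod>b\<in>Basis. 1 / (1 + (x \<bullet> b)\<^sup>2))" by (simp add: Basis_complex_def)
 finally show "ennreal (1 / (1 + (norm x)\<^sup>2)\<^sup>2) \<le> (\<Prod>b\<in>Basis. ennreal (1 / (1 + (x \<bullet> b)\<^sup>2)))"
  by (subst prod_ennreal) (auto intro: ennreal_leI)
qed

lemma nn_integral_lborel_affine:
 fixes f :: "'a::euclidean_space \<Rightarrow> ennreal"
 assumes [measurable]: "f \<in> borel_measurable borel" and c_pos: "c > 0"
 shows "(\<integral>\<^sup>+x. f x \<partial>lborel) = (\<integral>\<^sup>+x. ennreal (c ^ DIM('a)) * f (a + c *\<^sub>R x) \<partial>lborel)"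
proof -
 have "(\<integral>\<^sup>+x. f x \<partial>lborel) = (\<integral>\<^sup>+x. f x \<partial>density (distr lborel borel (\<lambda>x. a + c *\<^sub>R x)) (\<lambda>_. \<bar>c\<bar>^DIM('a)))"
  using c_pos by (subst lborel_affine[of c a]) auto
 also have "\<dots> = (\<integral>\<^sup>+x. ennreal (c ^ DIM('a)) * f (a + c *\<^sub>R x) \<partial>lborel)"
  using c_pos by (subst nn_integral_density) (auto simp: nn_integral_distr)
 finally show ?thesis .
qed

locale log_sum_weight =
 fixes q :: "'i::finite \<Rightarrow> complex^'n::finite \<Rightarrow> complex" and \<alpha> c :: real
 assumes Ck_q: "Ck 2 (q i)" and q_hol: "dzbar j (q i) x = 0"
  and \<alpha>: "\<alpha> > 0" and c_pos: "c > 0" and q_ge: "c \<le> (\<Sum>i\<in>UNIV. (norm (q i x))\<^sup>2)"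
begin

definition Q :: "complex^'n \<Rightarrow> real" where "Q x = (\<Sum>i\<in>UNIV. (norm (q i x))\<^sup>2)"
definition \<phi> :: "complex^'n \<Rightarrow> real" where "\<phi> x = 2 * (norm x)\<^sup>2 + \<alpha> * ln (Q x)"
definition E :: "complex^'n \<Rightarrow> real" where "E x = exp (- \<phi> x)"
definition dQ :: "'n \<Rightarrow> complex^'n \<Rightarrow> complex" where "dQ k x = (\<Sum>i\<in>UNIV. dz k (q i) x * cnj (q i x))"
definition ph :: "'n \<Rightarrow> complex^'n \<Rightarrow> complex" where
 "ph k x = complex_of_real \<alpha> * (dQ k x * inverse (complex_of_real (Q x))) + 2 * cnj (x $ k)"

lemma Q_pos: "Q x > 0" using c_pos q_ge[of x] by (simp add: Q_def)

lemma of_real_Q: "complex_of_real (Q x) = (\<Sum>i\<in>UNIV. q i x * cnj (q i x))"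
 unfolding Q_def by (simp add: complex_norm_square[symmetric])

lemma of_real_Q_nonzero: "complex_of_real (Q x) \<noteq> 0" using Q_pos[of x] by simp

lemma Ck1_q: "Ck 1 (q i)" using Ck_le[OF Ck_q, of 1] by (simp del: Ck.simps)

lemma Ck_dz_q: "Ck 1 (dz k (q i))" using Ck_dz[of 1 "q i" k] Ck_q by (simp add: numeral_2_eq_2 del: Ck.simps)

lemma Ck_Q: "Ck 2 (\<lambda>x. complex_of_real (Q x))"
 unfolding of_real_Q by (intro Ck_sum Ck_mult Ck_cnj Ck_q)

lemma Ck1_Q: "Ck 1 (\<lambda>x. complex_of_real (Q x))" using Ck_le[OF Ck_Q, of 1] by (simp del: Ck.simps)

lemma dz_Q: "dz k (\<lambda>x. complex_of_real (Q x)) x = dQ k x"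
 "dzbar k (\<lambda>x. complex_of_real (Q x)) x = cnj (dQ k x)"
proof -
 have Ck_summand: "Ck 1 (\<lambda>x. q i x * cnj (q i x))" for i by (intro Ck_mult Ck_cnj Ck1_q)
 show "dz k (\<lambda>x. complex_of_real (Q x)) x = dQ k x"
  unfolding of_real_Q dQ_def dz_sum[OF Ck_summand] dz_mult[OF Ck1_q Ck_cnj[OF Ck1_q]] dz_cnj[OF Ck1_q] q_hol by simp
 show "dzbar k (\<lambda>x. complex_of_real (Q x)) x = cnj (dQ k x)"
  unfolding of_real_Q dQ_def dzbar_sum[OF Ck_summand] dzbar_mult[OF Ck1_q Ck_cnj[OF Ck1_q]] dzbar_cnj[OF Ck1_q] q_hol by (simp add: mult.commute)
qed

lemma continuous_on_Q: "continuous_on UNIV Q" using continuous_on_Re[OF Ck_cont[OF Ck_Q]] by simp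

lemma has_real_derivative_ln_Q: "(ln has_real_derivative 1 / Q x) (at (Q x))"
 using Q_pos[of x] by (auto intro!: derivative_eq_intros)

lemma Ck_ln_Q: "Ck 1 (\<lambda>x. complex_of_real (ln (Q x)))"
proof -
 have "Ck (Suc 0) (\<lambda>x. complex_of_real (ln (Q x)))"
 proof (rule Ck_real_comp[where g' = "\<lambda>y. 1 / y", OF _ has_real_derivative_ln_Q])
  show "Ck (Suc 0) (\<lambda>x. complex_of_real (Q x))" using Ck1_Q by (simp only: One_nat_def)
  have "continuous_on UNIV (\<lambda>x. complex_of_real (1 / Q x))"
   using Q_pos by (intro continuous_intros continuous_on_Q) (auto simp: less_imp_neq[THEN not_sym])
  then show "Ck 0 (\<lambda>x. complex_of_real (1 / Q x))" by simp
 qed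
 then show ?thesis by (simp only: One_nat_def)
qed

lemma dz_ln_Q: "dz k (\<lambda>x. complex_of_real (ln (Q x))) x = complex_of_real (1 / Q x) * dQ k x"
 using dz_real_comp(1)[of Q ln "\<lambda>y. 1 / y", OF Ck1_Q has_real_derivative_ln_Q] by (simp only: dz_Q)

lemma of_real_norm_sq: "complex_of_real ((norm x)\<^sup>2) = (\<Sum>i\<in>UNIV. x $ i * cnj (x $ i))" for x :: "complex^'n"
 unfolding norm_sq_vec by (simp add: complex_norm_square[symmetric])

lemma Ck_norm_sq: "Ck 1 (\<lambda>x::complex^'n. complex_of_real ((norm x)\<^sup>2))"
 unfolding of_real_norm_sq by (intro Ck_sum Ck_mult Ck_cnj Ck_nth)

lemma dz_norm_sq: "dz k (\<lambda>x::complex^'n. complex_of_real ((norm x)\<^sup>2)) x = cnj (x $ k)"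
proof -
 have Ck_summand: "Ck 1 (\<lambda>x::complex^'n. x $ i * cnj (x $ i))" for i by (intro Ck_mult Ck_cnj Ck_nth)
 have "dz k (\<lambda>x::complex^'n. complex_of_real ((norm x)\<^sup>2)) x = (\<Sum>i\<in>UNIV. if i = k then cnj (x $ i) else 0)"
  unfolding of_real_norm_sq dz_sum[OF Ck_summand] dz_mult[OF Ck_nth Ck_cnj[OF Ck_nth]] dz_cnj[OF Ck_nth] dz_nth
  by (intro sum.cong) auto
 then show ?thesis by simp
qed

lemma of_real_\<phi>: "complex_of_real (\<phi> x) = 2 * complex_of_real ((norm x)\<^sup>2) + complex_of_real \<alpha> * complex_of_real (ln (Q x))"
 by (simp add: \<phi>_def)

lemma Ck_\<phi>: "Ck 1 (\<lambda>x. complex_of_real (\<phi> x))"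
 unfolding of_real_\<phi> by (intro Ck_add Ck_mult Ck_const Ck_norm_sq Ck_ln_Q)

lemma dz_\<phi>: "dz k (\<lambda>x. complex_of_real (\<phi> x)) x = ph k x"
 unfolding of_real_\<phi> dz_add[OF Ck_mult[OF Ck_const Ck_norm_sq] Ck_mult[OF Ck_const Ck_ln_Q]]
  dz_mult[OF Ck_const Ck_norm_sq] dz_mult[OF Ck_const Ck_ln_Q] dz_norm_sq dz_ln_Q ph_def
 by (simp add: divide_inverse mult.commute)

lemma has_real_derivative_exp_minus_\<phi>: "((\<lambda>y. exp (- y)) has_real_derivative - exp (- \<phi> x)) (at (\<phi> x))"
 by (auto intro!: derivative_eq_intros)

lemma Ck_E: "Ck 1 (\<lambda>x. complex_of_real (E x))"
proof -
 have \<phi>_cont: "continuous_on UNIV \<phi>" using continuous_on_Re[OF Ck_cont[OF Ck_\<phi>]] by simp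
 have "Ck (Suc 0) (\<lambda>x. complex_of_real (exp (- \<phi> x)))"
 proof (rule Ck_real_comp[where g' = "\<lambda>y. - exp (- y)", OF _ has_real_derivative_exp_minus_\<phi>])
  show "Ck (Suc 0) (\<lambda>x. complex_of_real (\<phi> x))" using Ck_\<phi> by (simp only: One_nat_def)
  have "continuous_on UNIV (\<lambda>x. complex_of_real (- exp (- \<phi> x)))" by (intro continuous_intros \<phi>_cont)
  then show "Ck 0 (\<lambda>x. complex_of_real (- exp (- \<phi> x)))" by simp
 qed
 then show ?thesis by (simp only: One_nat_def E_def)
qed

lemma dz_E: "dz k (\<lambda>x. complex_of_real (E x)) x = - ph k x * complex_of_real (E x)"
 using dz_real_comp(1)[of \<phi> "\<lambda>y. exp (- y)" "\<lambda>y. - exp (- y)", OF Ck_\<phi> has_real_derivative_exp_minus_\<phi>, of k x] unfolding E_def dz_\<phi> by simp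

lemma Ck_dQ: "Ck 1 (dQ k)" unfolding dQ_def[abs_def] by (intro Ck_sum Ck_mult Ck_cnj Ck_dz_q Ck1_q)

lemma Ck_inverse_Q: "Ck 1 (\<lambda>x. inverse (complex_of_real (Q x)))" by (rule Ck_inverse[OF of_real_Q_nonzero Ck1_Q])

lemma Ck_ph: "Ck 1 (ph k)"
 unfolding ph_def[abs_def] by (intro Ck_add Ck_mult Ck_const Ck_cnj Ck_nth Ck_dQ Ck_inverse_Q)

lemma dzbar_dQ: "dzbar j (dQ k) x = (\<Sum>i\<in>UNIV. dz k (q i) x * cnj (dz j (q i) x))"
proof -
 have Ck_summand: "Ck 1 (\<lambda>x. dz k (q i) x * cnj (q i x))" for i by (intro Ck_mult Ck_cnj Ck1_q Ck_dz_q)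
 have "dzbar j (q i) = (\<lambda>_. 0)" for i by (simp add: fun_eq_iff q_hol)
 then have dzbar_dz: "dzbar j (dz k (q i)) x = 0" for i using dzbar_dz_commute[OF Ck_q, of j k i x] by simp
 show ?thesis unfolding dQ_def[abs_def] dzbar_sum[OF Ck_summand] dzbar_mult[OF Ck_dz_q Ck_cnj[OF Ck1_q]] dzbar_cnj[OF Ck1_q] dzbar_dz by simp
qed

lemma dzbar_ph: "dzbar j (ph k) x = complex_of_real \<alpha> * (dzbar j (dQ k) x * inverse (complex_of_real (Q x))
  - dQ k x * cnj (dQ j x) * (inverse (complex_of_real (Q x)) * inverse (complex_of_real (Q x)))) + (if j = k then 2 else 0)"
 unfolding ph_def[abs_def] dzbar_add[OF Ck_mult[OF Ck_const Ck_mult[OF Ck_dQ Ck_inverse_Q]] Ck_mult[OF Ck_const Ck_cnj[OF Ck_nth]]]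
  dzbar_mult[OF Ck_const Ck_mult[OF Ck_dQ Ck_inverse_Q]] dzbar_mult[OF Ck_const Ck_cnj[OF Ck_nth]] dzbar_mult[OF Ck_dQ Ck_inverse_Q]
  dz_inverse(2)[OF Ck1_Q of_real_Q_nonzero] dzbar_cnj[OF Ck_nth] dz_nth dz_Q
 by simp

lemma sum_dzbar_dQ:
 "(\<Sum>j\<in>UNIV. \<Sum>k\<in>UNIV. a j * cnj (dzbar j (dQ k) x * a k)) = of_real (\<Sum>i\<in>UNIV. (norm (\<Sum>j\<in>UNIV. a j * dz j (q i) x))\<^sup>2)"
proof -
 let ?s = "\<lambda>i j k. (a j * dz j (q i) x) * cnj (a k * dz k (q i) x)"
 have "of_real (\<Sum>i\<in>UNIV. (norm (\<Sum>j\<in>UNIV. a j * dz j (q i) x))\<^sup>2) = (\<Sum>i\<in>UNIV. \<Sum>j\<in>UNIV. \<Sum>k\<in>UNIV. ?s i j k)"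
  unfolding of_real_sum complex_norm_square cnj_sum sum_product ..
 also have "\<dots> = (\<Sum>j\<in>UNIV. \<Sum>i\<in>UNIV. \<Sum>k\<in>UNIV. ?s i j k)" by (rule sum.swap)
 also have "\<dots> = (\<Sum>j\<in>UNIV. \<Sum>k\<in>UNIV. \<Sum>i\<in>UNIV. ?s i j k)" by (intro sum.cong refl sum.swap)
 also have "\<dots> = (\<Sum>j\<in>UNIV. \<Sum>k\<in>UNIV. a j * cnj (dzbar j (dQ k) x * a k))"
  unfolding dzbar_dQ by (simp add: sum_distrib_left sum_distrib_right mult_ac)
 finally show ?thesis ..
qed

lemma hessian_eq:
 "(\<Sum>j\<in>UNIV. \<Sum>k\<in>UNIV. a j * cnj (dzbar j (ph k) x * a k))
  = of_real (\<alpha> / Q x * (\<Sum>i\<in>UNIV. (norm (\<Sum>j\<in>UNIV. a j * dz j (q i) x))\<^sup>2)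
    - \<alpha> / (Q x)\<^sup>2 * (norm (\<Sum>j\<in>UNIV. a j * dQ j x))\<^sup>2 + 2 * (\<Sum>j\<in>UNIV. (norm (a j))\<^sup>2))"
proof -
 have cross: "(\<Sum>j\<in>UNIV. \<Sum>k\<in>UNIV. a j * cnj (dQ k x * cnj (dQ j x) * a k)) = of_real ((norm (\<Sum>j\<in>UNIV. a j * dQ j x))\<^sup>2)"
  unfolding complex_norm_square cnj_sum sum_product by (simp add: mult_ac)
 have diagonal: "(\<Sum>j\<in>UNIV. \<Sum>k\<in>UNIV. a j * cnj ((if j = k then 2 else 0) * a k)) = of_real (2 * (\<Sum>j\<in>UNIV. (norm (a j))\<^sup>2))"
 proof -
  have "(\<Sum>k\<in>UNIV. a j * cnj ((if j = k then 2 else 0) * a k)) = (\<Sum>k\<in>UNIV. if j = k then 2 * (a j * cnj (a k)) else 0)" for j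
   by (intro sum.cong) auto
  then show ?thesis by (simp add: sum_distrib_left complex_norm_square del: of_real_power)
 qed
 have "(\<Sum>j\<in>UNIV. \<Sum>k\<in>UNIV. a j * cnj (dzbar j (ph k) x * a k))
  = (\<Sum>j\<in>UNIV. \<Sum>k\<in>UNIV. of_real (\<alpha> / Q x) * (a j * cnj (dzbar j (dQ k) x * a k))
    - of_real (\<alpha> / (Q x)\<^sup>2) * (a j * cnj (dQ k x * cnj (dQ j x) * a k)) + a j * cnj ((if j = k then 2 else 0) * a k))"
  unfolding dzbar_ph by (intro sum.cong refl) (simp add: divide_inverse power2_eq_square algebra_simps)
 also have "\<dots> = of_real (\<alpha> / Q x) * (\<Sum>j\<in>UNIV. \<Sum>k\<in>UNIV. a j * cnj (dzbar j (dQ k) x * a k))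
    - of_real (\<alpha> / (Q x)\<^sup>2) * (\<Sum>j\<in>UNIV. \<Sum>k\<in>UNIV. a j * cnj (dQ k x * cnj (dQ j x) * a k))
    + (\<Sum>j\<in>UNIV. \<Sum>k\<in>UNIV. a j * cnj ((if j = k then 2 else 0) * a k))"
  by (simp only: sum.distrib sum_subtractf sum_distrib_left)
 finally show ?thesis unfolding sum_dzbar_dQ cross diagonal by (simp only: of_real_add of_real_diff of_real_mult)
qed

lemma norm_sum_dQ_sq_le:
 "(norm (\<Sum>j\<in>UNIV. a j * dQ j x))\<^sup>2 \<le> (\<Sum>i\<in>UNIV. (norm (\<Sum>j\<in>UNIV. a j * dz j (q i) x))\<^sup>2) * Q x"
proof -
 have "(\<Sum>j\<in>UNIV. a j * dQ j x) = (\<Sum>i\<in>UNIV. (\<Sum>j\<in>UNIV. a j * dz j (q i) x) * cnj (q i x))"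
  unfolding dQ_def sum_distrib_left sum_distrib_right by (subst sum.swap) (simp add: mult.assoc)
 then have "norm (\<Sum>j\<in>UNIV. a j * dQ j x) \<le> (\<Sum>i\<in>UNIV. norm (\<Sum>j\<in>UNIV. a j * dz j (q i) x) * norm (q i x))"
  using norm_sum[of "\<lambda>i. (\<Sum>j\<in>UNIV. a j * dz j (q i) x) * cnj (q i x)" UNIV] by (simp add: norm_mult)
 then have "(norm (\<Sum>j\<in>UNIV. a j * dQ j x))\<^sup>2 \<le> (\<Sum>i\<in>UNIV. norm (\<Sum>j\<in>UNIV. a j * dz j (q i) x) * norm (q i x))\<^sup>2"
  by (rule power_mono) simp
 also have "\<dots> \<le> (\<Sum>i\<in>UNIV. (norm (\<Sum>j\<in>UNIV. a j * dz j (q i) x))\<^sup>2) * Q x"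
  unfolding Q_def by (rule Cauchy_Schwarz_ineq_sum)
 finally show ?thesis .
qed

lemma hessian_ge: "Re (\<Sum>j\<in>UNIV. \<Sum>k\<in>UNIV. a j * cnj (dzbar j (ph k) x * a k)) \<ge> 2 * (norm (a m))\<^sup>2"
proof -
 define V where "V = (\<Sum>i\<in>UNIV. (norm (\<Sum>j\<in>UNIV. a j * dz j (q i) x))\<^sup>2)"
 have "\<alpha> / (Q x)\<^sup>2 * (norm (\<Sum>j\<in>UNIV. a j * dQ j x))\<^sup>2 \<le> \<alpha> / (Q x)\<^sup>2 * (V * Q x)"
  unfolding V_def using \<alpha> by (intro mult_left_mono norm_sum_dQ_sq_le) simp
 also have "\<dots> = \<alpha> / Q x * V" using Q_pos[of x] by (simp add: power2_eq_square)
 finally have "\<alpha> / (Q x)\<^sup>2 * (norm (\<Sum>j\<in>UNIV. a j * dQ j x))\<^sup>2 \<le> \<alpha> / Q x * V" .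
 moreover have "(norm (a m))\<^sup>2 \<le> (\<Sum>j\<in>UNIV. (norm (a j))\<^sup>2)" by (intro member_le_sum) auto
 ultimately show ?thesis unfolding hessian_eq Re_complex_of_real V_def[symmetric] by linarith
qed

lemma E_powr: "E x = exp (- 2 * (norm x)\<^sup>2) * Q x powr (- \<alpha>)"
 unfolding E_def \<phi>_def using Q_pos[of x] by (simp add: powr_def exp_add[symmetric])

lemma E_le: "E x \<le> c powr (- \<alpha>) * exp (- 2 * (norm x)\<^sup>2)"
proof -
 have "Q x powr (- \<alpha>) \<le> c powr (- \<alpha>)" using c_pos \<alpha> q_ge[of x] by (intro powr_mono2') (auto simp: Q_def)
 then show ?thesis unfolding E_powr by (simp add: mult.commute)
qed

lemma integrable_E: "integrable lborel E"
proof (rule Bochner_Integration.integrable_bound)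
 show "integrable lborel (\<lambda>x::complex^'n. c powr (- \<alpha>) * exp (- 2 * (norm x)\<^sup>2))"
 proof (rule integrable_mult_right, rule integrableI_bounded)
  show "(\<lambda>x::complex^'n. exp (- 2 * (norm x)\<^sup>2)) \<in> borel_measurable lborel" by simp
  show "(\<integral>\<^sup>+(x::complex^'n). ennreal (norm (exp (- 2 * (norm x)\<^sup>2))) \<partial>lborel) < \<infinity>" using nn_integral_gaussian by simp
 qed
 show "E \<in> borel_measurable lborel"
  using borel_measurable_continuous_onI[OF continuous_on_Re[OF Ck_cont[OF Ck_E]]] by simp
 show "AE x in lborel. norm (E x) \<le> norm (c powr (- \<alpha>) * exp (- 2 * (norm x)\<^sup>2))"
  using E_le by (intro AE_I2) (simp add: E_def)
qed

lemma psh_weight_E: "psh_weight E ph"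
 by unfold_locales (rule Ck_E dz_E Ck_ph hessian_ge integrable_E | simp add: E_def)+

end

definition cauchy_kernel :: "complex \<Rightarrow> real" where
 "cauchy_kernel x = 1 / (1 + (norm x)\<^sup>2)\<^sup>2"

lemma cauchy_kernel_nonneg: "cauchy_kernel x \<ge> 0"
 by (simp add: cauchy_kernel_def)

lemma borel_measurable_cauchy_kernel [measurable]: "cauchy_kernel \<in> borel_measurable borel"
 unfolding cauchy_kernel_def[abs_def] by measurable

lemma cauchy_kernel_scale:
 assumes "t > 0"
 shows "t * (t / ((norm (sqrt t *\<^sub>R x))\<^sup>2 + t)\<^sup>2) = cauchy_kernel x"
proof -
 have "(norm (sqrt t *\<^sub>R x))\<^sup>2 + t = t * (1 + (norm x)\<^sup>2)"
  using assms by (simp add: power_mult_distrib algebra_simps)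
 then show ?thesis
  using assms by (simp add: cauchy_kernel_def power_mult_distrib power2_eq_square[of t])
qed

definition slice_integrand ::
 "(complex^'n::finite \<Rightarrow> real) \<Rightarrow> 'n \<Rightarrow> complex \<Rightarrow> real \<Rightarrow> real \<Rightarrow> (complex^'n) \<times> complex \<Rightarrow> ennreal" where
 "slice_integrand E k w r s p =
  ennreal (cauchy_kernel (snd p) * E (vec_upd (fst p) k (w + s *\<^sub>R snd p))) * indicator (ball 0 r) (fst p $ k)"

lemma borel_measurable_indicator_ball_nth [measurable]:
 "(\<lambda>z. indicator (ball 0 r) (z $ k) :: ennreal) \<in> borel_measurable (borel :: (complex^'n::finite) measure)"
 by (rule measurable_compose[OF borel_measurable_vec_nth_complex borel_measurable_indicator]) simp

lemma borel_measurable_slice_integrand: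
 assumes "E \<in> borel_measurable borel"
 shows "slice_integrand E k w r s \<in> borel_measurable (lborel \<Otimes>\<^sub>M lborel)"
proof -
 note [measurable] = assms
 show ?thesis unfolding slice_integrand_def[abs_def] by (simp cong: measurable_cong_sets) measurable
qed

lemma nn_integral_slice_kernel:
 fixes E :: "complex^'n::finite \<Rightarrow> real"
 assumes [measurable]: "E \<in> borel_measurable borel" and E_nonneg: "\<And>x. E x \<ge> 0" and t_pos: "t > 0"
 shows "(\<integral>\<^sup>+x. ennreal (t / ((norm (x $ k - w))\<^sup>2 + t)\<^sup>2 * E x) \<partial>lborel) * emeasure lborel (ball (0::complex) r)
  = (\<integral>\<^sup>+p. slice_integrand E k w r (sqrt t) p \<partial>(lborel \<Otimes>\<^sub>M lborel))"
proof -
 define f where "f z \<zeta> = ennreal (t / ((norm (\<zeta> - w))\<^sup>2 + t)\<^sup>2 * E (vec_upd z k \<zeta>))" for z :: "complex^'n" and \<zeta>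
 have f_meas [measurable]: "f z \<in> borel_measurable borel" for z unfolding f_def by measurable
 have f_scale: "(\<integral>\<^sup>+\<zeta>. f z \<zeta> \<partial>lborel) = (\<integral>\<^sup>+\<xi>. ennreal (cauchy_kernel \<xi> * E (vec_upd z k (w + sqrt t *\<^sub>R \<xi>))) \<partial>lborel)" for z
 proof -
  have "ennreal (sqrt t ^ DIM(complex)) * f z (w + sqrt t *\<^sub>R \<xi>) = ennreal (cauchy_kernel \<xi> * E (vec_upd z k (w + sqrt t *\<^sub>R \<xi>)))" for \<xi>
   unfolding f_def cauchy_kernel_scale[OF t_pos, symmetric] using t_pos E_nonneg
   by (subst ennreal_mult[symmetric]) (auto simp: mult.assoc)
  then show ?thesis using nn_integral_lborel_affine[OF f_meas, of "sqrt t" z w] t_pos by simp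
 qed
 have "(\<integral>\<^sup>+x. ennreal (t / ((norm (x $ k - w))\<^sup>2 + t)\<^sup>2 * E x) \<partial>lborel) * emeasure lborel (ball (0::complex) r)
   = (\<integral>\<^sup>+z. \<integral>\<^sup>+\<zeta>. f z \<zeta> * indicator (ball 0 r) (z $ k) \<partial>lborel \<partial>lborel)"
  using nn_integral_vec_upd[of "\<lambda>x. ennreal (t / ((norm (x $ k - w))\<^sup>2 + t)\<^sup>2 * E x)" "indicator (ball 0 r)" k]
  by (simp add: f_def borel_measurable_indicator)
 also have "\<dots> = (\<integral>\<^sup>+z. \<integral>\<^sup>+\<xi>. slice_integrand E k w r (sqrt t) (z, \<xi>) \<partial>lborel \<partial>lborel)"
  by (simp add: slice_integrand_def nn_integral_multc f_scale)
 also have "\<dots> = (\<integral>\<^sup>+p. slice_integrand E k w r (sqrt t) p \<partial>(lborel \<Otimes>\<^sub>M lborel))"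
  by (rule lborel.nn_integral_fst) (simp add: borel_measurable_slice_integrand)
 finally show ?thesis .
qed

lemma nn_integral_slice_integrand_0:
 fixes E :: "complex^'n::finite \<Rightarrow> real"
 assumes [measurable]: "E \<in> borel_measurable borel" and E_nonneg: "\<And>x. E x \<ge> 0"
 shows "(\<integral>\<^sup>+p. slice_integrand E k w r 0 p \<partial>(lborel \<Otimes>\<^sub>M lborel))
  = (\<integral>\<^sup>+x. ennreal (cauchy_kernel x) \<partial>lborel) * (\<integral>\<^sup>+z. ennreal (E (vec_upd z k w)) * indicator (ball 0 r) (z $ k) \<partial>lborel)"
proof -
 have "(\<integral>\<^sup>+p. slice_integrand E k w r 0 p \<partial>(lborel \<Otimes>\<^sub>M lborel)) = (\<integral>\<^sup>+z. \<integral>\<^sup>+\<xi>. slice_integrand E k w r 0 (z, \<xi>) \<partial>lborel \<partial>lborel)"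
  by (rule lborel.nn_integral_fst[symmetric]) (simp add: borel_measurable_slice_integrand)
 also have "\<dots> = (\<integral>\<^sup>+z. \<integral>\<^sup>+\<xi>. ennreal (cauchy_kernel \<xi>) * (ennreal (E (vec_upd z k w)) * indicator (ball 0 r) (z $ k)) \<partial>lborel \<partial>lborel)"
  by (simp add: slice_integrand_def ennreal_mult cauchy_kernel_nonneg E_nonneg mult.assoc)
 also have "\<dots> = (\<integral>\<^sup>+z. (\<integral>\<^sup>+\<xi>. ennreal (cauchy_kernel \<xi>) \<partial>lborel) * (ennreal (E (vec_upd z k w)) * indicator (ball 0 r) (z $ k)) \<partial>lborel)"
  by (intro nn_integral_cong nn_integral_multc) measurable
 also have "\<dots> = (\<integral>\<^sup>+x. ennreal (cauchy_kernel x) \<partial>lborel) * (\<integral>\<^sup>+z. ennreal (E (vec_upd z k w)) * indicator (ball 0 r) (z $ k) \<partial>lborel)"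
  by (rule nn_integral_cmult) measurable
 finally show ?thesis .
qed

lemma exp_norm_vec_upd_le:
 fixes z :: "complex^'n::finite"
 assumes "norm (z $ k) < r"
 shows "exp (- 2 * (norm (vec_upd z k w))\<^sup>2) \<le> exp (2 * r\<^sup>2) * exp (- 2 * (norm z)\<^sup>2)"
proof -
 have "(norm (z $ k))\<^sup>2 \<le> r\<^sup>2" using assms by (intro power_mono) auto
 then have "(norm z)\<^sup>2 \<le> (norm (vec_upd z k w))\<^sup>2 + r\<^sup>2"
  unfolding norm_sq_vec_upd using zero_le_power2[of "norm w"] by linarith
 then show ?thesis by (simp add: exp_add[symmetric])
qed

lemma slice_integrand_le:
 fixes E :: "complex^'n::finite \<Rightarrow> real"
 assumes E_nonneg: "\<And>x. E x \<ge> 0" and E_decay: "\<And>x. E x \<le> M * exp (- 2 * (norm x)\<^sup>2)"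
 shows "slice_integrand E k w r s p
  \<le> ennreal (M * exp (2 * r\<^sup>2)) * (ennreal (exp (- 2 * (norm (fst p))\<^sup>2)) * ennreal (cauchy_kernel (snd p)))"
proof (cases "norm (fst p $ k) < r")
 case True
 have M_nonneg: "M \<ge> 0" using E_nonneg[of 0] E_decay[of 0] by simp
 let ?y = "vec_upd (fst p) k (w + s *\<^sub>R snd p)"
 have "E ?y \<le> M * (exp (2 * r\<^sup>2) * exp (- 2 * (norm (fst p))\<^sup>2))"
  using E_decay[of ?y] mult_left_mono[OF exp_norm_vec_upd_le[OF True] M_nonneg] by (rule order_trans)
 then have "cauchy_kernel (snd p) * E ?y \<le> cauchy_kernel (snd p) * (M * (exp (2 * r\<^sup>2) * exp (- 2 * (norm (fst p))\<^sup>2)))"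
  by (rule mult_left_mono[OF _ cauchy_kernel_nonneg])
 also have "\<dots> = M * exp (2 * r\<^sup>2) * (exp (- 2 * (norm (fst p))\<^sup>2) * cauchy_kernel (snd p))" by (simp add: mult_ac)
 finally have "ennreal (cauchy_kernel (snd p) * E ?y) \<le> ennreal (M * exp (2 * r\<^sup>2) * (exp (- 2 * (norm (fst p))\<^sup>2) * cauchy_kernel (snd p)))"
  by (rule ennreal_leI)
 then show ?thesis using True M_nonneg cauchy_kernel_nonneg[of "snd p"] by (simp add: slice_integrand_def ennreal_mult)
qed (simp add: slice_integrand_def)

lemma slice_kernel_tendsto:
 fixes E :: "complex^'n::finite \<Rightarrow> real"
 assumes E_cont: "continuous_on UNIV E" and E_nonneg: "\<And>x. E x \<ge> 0" and E_decay: "\<And>x. E x \<le> M * exp (- 2 * (norm x)\<^sup>2)"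
  and t_lim: "\<And>j. t j > 0" "t \<longlonglongrightarrow> 0"
 shows "(\<lambda>j. (\<integral>\<^sup>+x. ennreal (t j / ((norm (x $ k - w))\<^sup>2 + t j)\<^sup>2 * E x) \<partial>lborel) * emeasure lborel (ball (0::complex) r))
  \<longlonglongrightarrow> (\<integral>\<^sup>+x. ennreal (cauchy_kernel x) \<partial>lborel) * (\<integral>\<^sup>+z. ennreal (E (vec_upd z k w)) * indicator (ball 0 r) (z $ k) \<partial>lborel)"
proof -
 have E_meas [measurable]: "E \<in> borel_measurable borel" by (rule borel_measurable_continuous_onI[OF E_cont])
 let ?D = "\<lambda>p :: (complex^'n) \<times> complex. ennreal (M * exp (2 * r\<^sup>2)) * (ennreal (exp (- 2 * (norm (fst p))\<^sup>2)) * ennreal (cauchy_kernel (snd p)))"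
 have D_meas: "?D \<in> borel_measurable (lborel \<Otimes>\<^sub>M lborel)" by (simp cong: measurable_cong_sets)
 have "(\<integral>\<^sup>+p. ?D p \<partial>(lborel \<Otimes>\<^sub>M lborel)) = (\<integral>\<^sup>+z. \<integral>\<^sup>+\<xi>. ?D (z, \<xi>) \<partial>lborel \<partial>lborel)"
  by (rule lborel.nn_integral_fst[symmetric, OF D_meas])
 also have "\<dots> = ennreal (M * exp (2 * r\<^sup>2)) * ((\<integral>\<^sup>+(z::complex^'n). ennreal (exp (- 2 * (norm z)\<^sup>2)) \<partial>lborel) * (\<integral>\<^sup>+\<xi>. ennreal (cauchy_kernel \<xi>) \<partial>lborel))"
  by (simp add: nn_integral_cmult nn_integral_multc)
 also have "\<dots> < \<infinity>"
  using nn_integral_gaussian[where 'a = "complex^'n"] nn_integral_cauchy_kernel by (simp add: cauchy_kernel_def ennreal_mult_less_top)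
 finally have D_finite: "(\<integral>\<^sup>+p. ?D p \<partial>(lborel \<Otimes>\<^sub>M lborel)) < \<infinity>" .
 have pointwise: "(\<lambda>j. slice_integrand E k w r (sqrt (t j)) p) \<longlonglongrightarrow> slice_integrand E k w r 0 p" for p
 proof -
  have "continuous_on UNIV (\<lambda>s. E (vec_upd (fst p) k (w + s *\<^sub>R snd p)))"
   by (intro continuous_on_compose2[OF E_cont] continuous_intros) auto
  then have "(\<lambda>j. E (vec_upd (fst p) k (w + sqrt (t j) *\<^sub>R snd p))) \<longlonglongrightarrow> E (vec_upd (fst p) k (w + 0 *\<^sub>R snd p))"
   by (rule continuous_on_tendsto_compose) (use tendsto_real_sqrt[OF t_lim(2)] in auto)
  then have "(\<lambda>j. ennreal (cauchy_kernel (snd p) * E (vec_upd (fst p) k (w + sqrt (t j) *\<^sub>R snd p))))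
    \<longlonglongrightarrow> ennreal (cauchy_kernel (snd p) * E (vec_upd (fst p) k (w + 0 *\<^sub>R snd p)))"
   by (intro tendsto_ennrealI tendsto_intros)
  then show ?thesis unfolding slice_integrand_def by (cases "fst p $ k \<in> ball 0 r") auto
 qed
 have "(\<lambda>j. \<integral>\<^sup>+p. slice_integrand E k w r (sqrt (t j)) p \<partial>(lborel \<Otimes>\<^sub>M lborel)) \<longlonglongrightarrow> (\<integral>\<^sup>+p. slice_integrand E k w r 0 p \<partial>(lborel \<Otimes>\<^sub>M lborel))"
  by (rule nn_integral_dominated_convergence[OF _ _ D_meas])
   (use D_finite slice_integrand_le[of E M, OF E_nonneg E_decay] pointwise in \<open>auto simp: borel_measurable_slice_integrand\<close>)
 then show ?thesis unfolding nn_integral_slice_kernel[OF E_meas E_nonneg t_lim(1)] nn_integral_slice_integrand_0[OF E_meas E_nonneg] .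
qed

lemma negpow_eq_inverse:
 assumes "t \<ge> 0" "\<delta> > 0" shows "negpow \<delta> t = inverse (ennreal (t powr \<delta>))"
 using assms by (cases "t = 0") (auto simp: negpow_def inverse_ennreal powr_minus)

lemma borel_measurable_negpow [measurable]: "negpow \<delta> \<in> borel_measurable borel"
 unfolding negpow_def[abs_def] by measurable

lemma negpow_antimono:
 assumes "0 \<le> s" "s \<le> t" "\<delta> \<ge> 0" shows "negpow \<delta> t \<le> negpow \<delta> s"
 using assms by (auto simp: negpow_def intro!: ennreal_leI powr_mono2')

lemma tendsto_negpow:
 assumes f_conv: "(f \<longlongrightarrow> s) F" "\<And>x. f x \<ge> 0" and s_nonneg: "s \<ge> 0" and \<delta>: "\<delta> > 0"
 shows "((\<lambda>x. negpow \<delta> (f x)) \<longlongrightarrow> negpow \<delta> s) F"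
proof -
 have "((\<lambda>x. f x powr \<delta>) \<longlongrightarrow> s powr \<delta>) F"
  using f_conv \<delta> by (intro tendsto_powr' tendsto_const) auto
 then have "((\<lambda>x. inverse (ennreal (f x powr \<delta>))) \<longlongrightarrow> inverse (ennreal (s powr \<delta>))) F"
  using continuous_on_inverse_ennreal[OF continuous_on_id, of UNIV]
  by (auto intro: continuous_on_tendsto_compose tendsto_ennrealI)
 then show ?thesis using f_conv s_nonneg \<delta> by (simp add: negpow_eq_inverse)
qed

definition negpow_integral :: "real \<Rightarrow> (complex^'n::finite) set \<Rightarrow> (complex^'n \<Rightarrow> complex^'j::finite) \<Rightarrow> ennreal" where
 "negpow_integral \<delta> S g = (\<integral>\<^sup>+z\<in>S. negpow \<delta> (norm (g z)) \<partial>lborel)"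

lemma negpow_integral_mono: "S \<subseteq> T \<Longrightarrow> negpow_integral \<delta> S g \<le> negpow_integral \<delta> T g"
 unfolding negpow_integral_def by (intro nn_integral_mono) (auto simp: indicator_def)

lemma negpow_integral_cong: "(\<And>z. z \<in> S \<Longrightarrow> g z = h z) \<Longrightarrow> negpow_integral \<delta> S g = negpow_integral \<delta> S h"
 unfolding negpow_integral_def by (intro nn_integral_cong) (auto simp: indicator_def)

lemma negpow_integral_le_of_tendsto:
 fixes g :: "complex^'n::finite \<Rightarrow> complex^'j::finite" and p :: "nat \<Rightarrow> complex^'n \<Rightarrow> complex^'i::finite"
 assumes [measurable]: "\<And>m. p m \<in> borel_measurable borel" "S \<in> sets borel" and \<delta>: "\<delta> > 0"
  and lim: "\<And>z. z \<in> S \<Longrightarrow> (\<lambda>m. norm (p m z)) \<longlonglongrightarrow> norm (g z)"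
  and bound: "\<forall>\<^sub>F m in sequentially. negpow_integral \<delta> S (p m) \<le> C"
 shows "negpow_integral \<delta> S g \<le> C"
proof -
 have "negpow_integral \<delta> S g = (\<integral>\<^sup>+z. liminf (\<lambda>m. negpow \<delta> (norm (p m z)) * indicator S z) \<partial>lborel)"
  unfolding negpow_integral_def
 proof (rule nn_integral_cong)
  fix z
  show "negpow \<delta> (norm (g z)) * indicator S z = liminf (\<lambda>m. negpow \<delta> (norm (p m z)) * indicator S z)"
   using lim_imp_Liminf[OF _ tendsto_negpow[OF lim norm_ge_zero norm_ge_zero \<delta>], of z] by (cases "z \<in> S") (auto simp: Liminf_const)
 qed
 also have "\<dots> \<le> liminf (\<lambda>m. negpow_integral \<delta> S (p m))"
  unfolding negpow_integral_def by (rule nn_integral_liminf) measurable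
 also have "\<dots> \<le> liminf (\<lambda>m::nat. C)" by (rule Liminf_mono[OF bound])
 also have "\<dots> = C" by (simp add: Liminf_const)
 finally show ?thesis .
qed

inductive complex_polynomial :: "(complex^'n::finite \<Rightarrow> complex) \<Rightarrow> bool" where
 complex_polynomial_const: "complex_polynomial (\<lambda>_. c)"
| complex_polynomial_nth: "complex_polynomial (\<lambda>x. x $ i)"
| complex_polynomial_add: "complex_polynomial f \<Longrightarrow> complex_polynomial g \<Longrightarrow> complex_polynomial (\<lambda>x. f x + g x)"
| complex_polynomial_mult: "complex_polynomial f \<Longrightarrow> complex_polynomial g \<Longrightarrow> complex_polynomial (\<lambda>x. f x * g x)"

lemma complex_polynomial_Ck: "complex_polynomial f \<Longrightarrow> Ck n f"
 by (induction rule: complex_polynomial.induct) (auto intro: Ck_const Ck_nth Ck_add Ck_mult simp del: Ck.simps)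

lemma complex_polynomial_dzbar: "complex_polynomial f \<Longrightarrow> dzbar j f x = 0"
 by (induction rule: complex_polynomial.induct)
  (auto simp: dz_nth dzbar_add dzbar_mult complex_polynomial_Ck simp del: Ck.simps One_nat_def)

lemma complex_polynomial_sum: "(\<And>i. i \<in> A \<Longrightarrow> complex_polynomial (f i)) \<Longrightarrow> complex_polynomial (\<lambda>x. \<Sum>i\<in>A. f i x)"
 by (induction A rule: infinite_finite_induct) (auto intro: complex_polynomial.intros)

lemma complex_polynomial_power: "complex_polynomial f \<Longrightarrow> complex_polynomial (\<lambda>x. f x ^ n)"
 by (induction n) (auto intro: complex_polynomial.intros)

lemma complex_polynomial_vec_upd: "complex_polynomial f \<Longrightarrow> complex_polynomial (\<lambda>x. f (vec_upd x k w))"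
proof (induction rule: complex_polynomial.induct)
 case (complex_polynomial_nth i)
 then show ?case by (cases "i = k") (auto intro: complex_polynomial.intros)
qed (auto intro: complex_polynomial.intros)

lemma complex_polynomial_shift: "complex_polynomial f \<Longrightarrow> complex_polynomial (\<lambda>x. f (a + x))"
 by (induction rule: complex_polynomial.induct) (auto intro: complex_polynomial.intros)

lemma continuous_on_polynomial_components:
 fixes p :: "complex^'n::finite \<Rightarrow> complex^'j::finite"
 assumes "\<And>j. complex_polynomial (\<lambda>z. p z $ j)"
 shows "continuous_on S p"
proof -
 have "continuous_on S (\<lambda>z. \<chi> j. p z $ j)"
  using Ck_cont[OF complex_polynomial_Ck[OF assms]] by (intro continuous_on_vec_lambda) (blast intro: continuous_on_subset)
 then show ?thesis by (simp add: vec_lambda_beta[abs_def] vec_nth_inverse)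
qed

lemma sum_UNIV_Plus_option:
 fixes f :: "'a::finite + 'b::finite option \<Rightarrow> real"
 shows "(\<Sum>i\<in>UNIV. f i) = (\<Sum>j\<in>UNIV. f (Inl j)) + (\<Sum>i\<in>UNIV. f (Inr (Some i))) + f (Inr None)"
proof -
 have "(\<Sum>i\<in>UNIV. f i) = (\<Sum>j\<in>UNIV. f (Inl j)) + (\<Sum>i\<in>UNIV. f (Inr i))"
  unfolding UNIV_Plus_UNIV[symmetric] by (subst sum.Plus) auto
 also have "(\<Sum>i\<in>UNIV. f (Inr i)) = (\<Sum>i\<in>UNIV. f (Inr (Some i))) + f (Inr None)"
  unfolding UNIV_option_conv by (subst sum.insert) (auto simp: sum.reindex)
 finally show ?thesis by simp
qed

text \<open>The extra components make the map nowhere zero and large outside the polydisk of radius \<open>R\<close> in the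
 variables other than \<open>z\<^sub>k\<close>, while they tend to \<open>0\<close> inside it as \<open>N \<rightarrow> \<infinity>\<close>.\<close>

definition regularised ::
 "(complex^'n::finite \<Rightarrow> complex^'j::finite) \<Rightarrow> 'n \<Rightarrow> real \<Rightarrow> nat \<Rightarrow> complex^'n \<Rightarrow> complex^('j + 'n option)" where
 "regularised p k R N x = (\<chi> i. case i of Inl j \<Rightarrow> p x $ j
   | Inr None \<Rightarrow> of_real (1 / real (Suc N))
   | Inr (Some i) \<Rightarrow> if i = k then 0 else (of_real (1 / R) * x $ i) ^ Suc N)"

lemma norm_regularised_sq:
 assumes "R > 0"
 shows "(norm (regularised p k R N x))\<^sup>2
  = (norm (p x))\<^sup>2 + (\<Sum>i\<in>UNIV - {k}. (norm (x $ i) / R) ^ (2 * Suc N)) + (1 / real (Suc N))\<^sup>2"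
proof -
 have power: "(norm ((of_real (1 / R) * y) ^ Suc N))\<^sup>2 = (norm y / R) ^ (2 * Suc N)" for y :: complex
  unfolding norm_power norm_mult norm_of_real power_mult[symmetric] using assms by (simp add: mult.commute)
 have "(\<Sum>i\<in>UNIV. (norm (regularised p k R N x $ Inr (Some i)))\<^sup>2) = (\<Sum>i\<in>UNIV. if i = k then 0 else (norm (x $ i) / R) ^ (2 * Suc N))"
  using power by (intro sum.cong) (auto simp: regularised_def simp del: power_Suc)
 also have "\<dots> = (\<Sum>i\<in>UNIV - {k}. (norm (x $ i) / R) ^ (2 * Suc N))"
  by (subst sum.remove[of UNIV k]) (auto intro!: sum.cong)
 finally have powers: "(\<Sum>i\<in>UNIV. (norm (regularised p k R N x $ Inr (Some i)))\<^sup>2) = (\<Sum>i\<in>UNIV - {k}. (norm (x $ i) / R) ^ (2 * Suc N))" .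
 have const_term: "(norm (regularised p k R N x $ Inr None))\<^sup>2 = (1 / real (Suc N))\<^sup>2"
  unfolding regularised_def by (simp only: vec_lambda_beta sum.case option.case norm_of_real power2_abs)
 show ?thesis
  unfolding norm_sq_vec[of "regularised p k R N x"] norm_sq_vec[of "p x"] sum_UNIV_Plus_option powers const_term
  by (simp add: regularised_def)
qed

lemma regularised_polynomial:
 fixes p :: "complex^'n::finite \<Rightarrow> complex^'j::finite"
 assumes "\<And>j. complex_polynomial (\<lambda>z. p z $ j)"
 shows "complex_polynomial (\<lambda>x. regularised p k R N x $ i)"
proof -
 have power: "complex_polynomial (\<lambda>x::complex^'n. (of_real (1 / R) * x $ l) ^ Suc N)" for l
  by (intro complex_polynomial_power complex_polynomial_mult complex_polynomial_const complex_polynomial_nth)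
 consider j where "i = Inl j" | "i = Inr None" | l where "i = Inr (Some l)" by (metis obj_sumE option.exhaust)
 then show ?thesis
 proof cases
  case 3
  then show ?thesis using power[of l] by (cases "l = k") (auto simp: regularised_def complex_polynomial_const)
 qed (auto simp: regularised_def complex_polynomial_const assms)
qed

lemma regularised_weight:
 fixes p :: "complex^'n::finite \<Rightarrow> complex^'j::finite"
 assumes p_poly: "\<And>j. complex_polynomial (\<lambda>z. p z $ j)" and R_pos: "R > 0" and \<delta>: "\<delta> > 0"
 shows "log_sum_weight (\<lambda>i x. regularised p k R N x $ i) (\<delta> / 2) ((1 / real (Suc N))\<^sup>2)"
proof
 show "Ck 2 (\<lambda>x. regularised p k R N x $ i)" "dzbar j (\<lambda>x. regularised p k R N x $ i) x = 0" for i j x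
  using complex_polynomial_Ck[OF regularised_polynomial[OF p_poly]] complex_polynomial_dzbar[OF regularised_polynomial[OF p_poly]] by auto
 show "(1 / real (Suc N))\<^sup>2 \<le> (\<Sum>i\<in>UNIV. (norm (regularised p k R N x $ i))\<^sup>2)" for x
  unfolding norm_sq_vec[symmetric] norm_regularised_sq[OF R_pos] using R_pos by (simp add: sum_nonneg)
qed (use \<delta> in auto)

lemma norm_le_norm_regularised: "R > 0 \<Longrightarrow> norm (p x) \<le> norm (regularised p k R N x)"
 by (rule power2_le_imp_le) (auto simp: norm_regularised_sq sum_nonneg)

lemma norm_regularised_pos: "R > 0 \<Longrightarrow> norm (regularised p k R N x) > 0"
 using norm_regularised_sq[of R p k N x] by (auto simp: sum_nonneg add_nonneg_eq_0_iff)

lemma norm_regularised_ge_1: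
 assumes "R > 0" "i \<noteq> k" "norm (x $ i) \<ge> R"
 shows "1 \<le> norm (regularised p k R N x)"
proof -
 have "1 \<le> (norm (x $ i) / R) ^ (2 * Suc N)" using assms by (intro one_le_power) simp
 also have "\<dots> \<le> (\<Sum>i\<in>UNIV - {k}. (norm (x $ i) / R) ^ (2 * Suc N))" using assms by (intro member_le_sum) auto
 also have "\<dots> \<le> (norm (regularised p k R N x))\<^sup>2" using assms by (simp add: norm_regularised_sq)
 finally have "1\<^sup>2 \<le> (norm (regularised p k R N x))\<^sup>2" by simp
 then show ?thesis by (rule power2_le_imp_le) simp
qed

lemma norm_regularised_sq_le:
 fixes p :: "complex^'n::finite \<Rightarrow> complex^'j::finite"
 assumes "R > 0" "x \<in> pdisk 0 R" "norm (p x) \<le> M"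
 shows "(norm (regularised p k R N x))\<^sup>2 \<le> M\<^sup>2 + real CARD('n) + 1"
proof -
 have "(\<Sum>i\<in>UNIV - {k}. (norm (x $ i) / R) ^ (2 * Suc N)) \<le> (\<Sum>i\<in>UNIV - {k}. 1)"
  using assms by (intro sum_mono power_le_one) (auto simp: pdisk_def divide_le_eq_1 intro: less_imp_le)
 also have "\<dots> \<le> real CARD('n)" by (simp add: card_Diff_singleton)
 moreover have "(norm (p x))\<^sup>2 \<le> M\<^sup>2" using assms by (intro power_mono) auto
 moreover have "(1 / real (Suc N))\<^sup>2 \<le> 1" by (intro power_le_one) auto
 ultimately show ?thesis unfolding norm_regularised_sq[OF assms(1)] by linarith
qed

lemma norm_regularised_tendsto:
 assumes "R > 0" "x \<in> pdisk 0 R"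
 shows "(\<lambda>N. norm (regularised p k R N x)) \<longlonglongrightarrow> norm (p x)"
proof -
 have powers: "(\<lambda>N. (norm (x $ i) / R) ^ (2 * Suc N)) \<longlonglongrightarrow> 0" for i
 proof -
  have "0 \<le> norm (x $ i) / R" "norm (x $ i) / R < 1" using assms by (auto simp: pdisk_def)
  moreover have "filterlim (\<lambda>N. 2 * Suc N) sequentially sequentially"
   by (rule filterlim_subseq) (simp add: strict_mono_def)
  ultimately show ?thesis by (rule filterlim_compose[OF LIMSEQ_realpow_zero])
 qed
 have "(\<lambda>N. 1 / real (Suc N)) \<longlonglongrightarrow> 0" using LIMSEQ_inverse_real_of_nat by (simp add: inverse_eq_divide)
 from tendsto_power[OF this, of 2] have const_term: "(\<lambda>N. (1 / real (Suc N))\<^sup>2) \<longlonglongrightarrow> 0" by simp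
 have "(\<lambda>N. (norm (regularised p k R N x))\<^sup>2) \<longlonglongrightarrow> (norm (p x))\<^sup>2 + (\<Sum>i\<in>UNIV - {k}. 0) + 0"
  unfolding norm_regularised_sq[OF assms(1)] by (intro tendsto_add tendsto_const tendsto_sum powers const_term)
 from tendsto_real_sqrt[OF this] show ?thesis by simp
qed

definition cauchy_mass :: real where
 "cauchy_mass = enn2real (\<integral>\<^sup>+x. ennreal (cauchy_kernel x) \<partial>lborel)"

lemma cauchy_mass: "(\<integral>\<^sup>+x. ennreal (cauchy_kernel x) \<partial>lborel) = ennreal cauchy_mass"
 using nn_integral_cauchy_kernel unfolding cauchy_mass_def cauchy_kernel_def by simp

locale slice_estimate =
 fixes k :: "'n::finite" and R M d :: real
 assumes R_pos: "R > 0"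
begin

definition radius :: real where "radius = real CARD('n) * R"
definition gauss_mass :: real where
 "gauss_mass = exp (2 * R\<^sup>2) * enn2real (\<integral>\<^sup>+(x::complex^'n). ennreal (exp (- 2 * (norm x)\<^sup>2)) \<partial>lborel)"
definition disk_area :: real where "disk_area = measure lborel (ball (0::complex) R)"
definition polydisk_volume :: real where "polydisk_volume = measure lborel (pdisk (0::complex^'n) (R / 2))"
definition kernel_const :: real where "kernel_const = (cauchy_mass + 1) * (gauss_mass + 2) / disk_area"
definition extension_const :: real where "extension_const = 8 * ((radius + 1 + R)\<^sup>2 + 3) * kernel_const + 1"
definition weight_min :: real where "weight_min = exp (- 2 * radius\<^sup>2) * (M\<^sup>2 + real CARD('n) + 1) powr (- (d / 2))"
definition sup_const :: real where "sup_const = extension_const / (weight_min * polydisk_volume)"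
definition slice_const :: real where "slice_const = 256 * sup_const / R\<^sup>2 + 4 * extension_const * exp (2 * radius\<^sup>2)"

lemma cauchy_mass_nonneg: "cauchy_mass \<ge> 0" and gauss_mass_nonneg: "gauss_mass \<ge> 0" and radius_nonneg: "radius \<ge> 0"
 using R_pos by (simp_all add: cauchy_mass_def gauss_mass_def radius_def)

lemma disk_area: "emeasure lborel (ball (0::complex) R) = ennreal disk_area" and disk_area_pos: "disk_area > 0"
proof -
 show "emeasure lborel (ball (0::complex) R) = ennreal disk_area"
  unfolding disk_area_def by (rule emeasure_eq_ennreal_measure) (use emeasure_lborel_ball_finite[of "0::complex" R] in auto)
 show "disk_area > 0" unfolding disk_area_def using content_ball_pos[OF R_pos, of "0::complex"] by simp
qed

lemma polydisk_volume: "emeasure lborel (pdisk (0::complex^'n) (R / 2)) = ennreal polydisk_volume"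
 and polydisk_volume_pos: "polydisk_volume > 0"
 using emeasure_pdisk_finite[of "0::complex^'n" "R / 2"] emeasure_pdisk_pos[of "R / 2" "0::complex^'n"] R_pos unfolding polydisk_volume_def measure_def
 by (auto simp: enn2real_positive_iff)

lemma kernel_const_pos: "kernel_const > 0"
 unfolding kernel_const_def using cauchy_mass_nonneg gauss_mass_nonneg disk_area_pos
 by (intro divide_pos_pos mult_pos_pos) auto

lemma extension_const_pos: "extension_const > 0"
 unfolding extension_const_def using kernel_const_pos by (intro add_nonneg_pos mult_nonneg_nonneg) auto

lemma weight_min_pos: "weight_min > 0"
 unfolding weight_min_def using add_nonneg_pos[of "M\<^sup>2 + real CARD('n)" 1] by auto

lemma sup_const_pos: "sup_const > 0"
 unfolding sup_const_def using extension_const_pos weight_min_pos polydisk_volume_pos by simp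

lemma sup_const_le_slice_const: "256 * sup_const / R\<^sup>2 \<le> slice_const"
 and extension_const_le_slice_const: "4 * extension_const * exp (2 * radius\<^sup>2) \<le> slice_const"
 and slice_const_pos: "slice_const > 0"
 unfolding slice_const_def using extension_const_pos sup_const_pos R_pos by (auto intro!: add_pos_pos)

lemma pdisk_subset_cball_radius: "pdisk (0::complex^'n) R \<subseteq> cball 0 radius"
 unfolding radius_def using pdisk_subset_cpdisk cpdisk_subset_cball by (rule order_trans)

end

locale slice_bounded_map = slice_estimate k R M d
 for k :: "'n::finite" and R M d :: real +
 fixes p :: "complex^'n \<Rightarrow> complex^'j::finite" and \<delta> B :: real and w :: complex
 assumes polynomial: "complex_polynomial (\<lambda>z. p z $ j)"
  and exponent: "0 < \<delta>" "\<delta> \<le> d"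
  and w_bounds: "w \<noteq> 0" "4 * norm w \<le> R"
  and bounded: "z \<in> pdisk 0 R \<Longrightarrow> norm (p z) \<le> M"
  and B_ge_1: "B \<ge> 1"
  and slice: "negpow_integral \<delta> (pdisk 0 R) (\<lambda>z. p (vec_upd z k w)) \<le> ennreal B"
  and small: "slice_const * B * (norm w)\<^sup>2 \<le> 1"
begin

abbreviation reg :: "nat \<Rightarrow> complex^'n \<Rightarrow> complex^('j + 'n option)" where "reg \<equiv> regularised p k R"

definition weight :: "nat \<Rightarrow> complex^'n \<Rightarrow> real" where
 "weight N x = exp (- 2 * (norm x)\<^sup>2) * norm (reg N x) powr (- \<delta>)"

lemma weight_pos: "weight N x > 0"
 using norm_regularised_pos[OF R_pos, of p k N x] by (simp add: weight_def)

lemma psh_weight_weight: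
 obtains dphi C where "psh_weight (weight N) dphi" "\<And>x. weight N x \<le> C * exp (- 2 * (norm x)\<^sup>2)"
proof -
 interpret reg: log_sum_weight "\<lambda>i x. reg N x $ i" "\<delta> / 2" "(1 / real (Suc N))\<^sup>2"
  by (rule regularised_weight[OF polynomial R_pos exponent(1)])
 have "((norm (reg N x))\<^sup>2) powr (- (\<delta> / 2)) = norm (reg N x) powr (- \<delta>)" for x
  using norm_regularised_pos[OF R_pos, of p k N x] by (simp add: powr_powr powr_numeral[symmetric] del: powr_numeral)
 then have "reg.E = weight N"
  by (simp add: fun_eq_iff reg.E_powr reg.Q_def weight_def norm_sq_vec[symmetric])
 then show thesis using that reg.psh_weight_E reg.E_le by metis
qed

lemma continuous_on_p: "continuous_on S p"
 by (rule continuous_on_polynomial_components[OF polynomial])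

lemma continuous_on_reg: "continuous_on S (reg N)"
 by (rule continuous_on_polynomial_components[OF regularised_polynomial[OF polynomial]])

lemma weight_slice_le:
 "ennreal (weight N (vec_upd z k w)) * indicator (ball 0 R) (z $ k)
  \<le> negpow \<delta> (norm (p (vec_upd z k w))) * indicator (pdisk 0 R) z + ennreal (exp (2 * R\<^sup>2)) * ennreal (exp (- 2 * (norm z)\<^sup>2))"
proof (cases "norm (z $ k) < R")
 case zk: True
 define y where "y = vec_upd z k w"
 show ?thesis
 proof (cases "z \<in> pdisk 0 R")
  case True
  have "weight N y \<le> norm (reg N y) powr (- \<delta>)" unfolding weight_def by (rule mult_left_le_one_le) auto
  then have "ennreal (weight N y) \<le> negpow \<delta> (norm (reg N y))"
   using norm_regularised_pos[OF R_pos, of p k N y] by (simp add: negpow_def ennreal_leI)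
  also have "\<dots> \<le> negpow \<delta> (norm (p y))"
   using norm_le_norm_regularised[OF R_pos] exponent by (intro negpow_antimono) auto
  finally show ?thesis using True zk by (simp add: y_def add_increasing2)
 next
  case False
  then obtain i where i_ge: "norm (z $ i) \<ge> R" by (auto simp: pdisk_def not_less)
  then have "i \<noteq> k" using zk by auto
  then have "1 \<le> norm (reg N y)" using R_pos i_ge by (intro norm_regularised_ge_1[of R i]) (auto simp: y_def)
  then have "norm (reg N y) powr (- \<delta>) \<le> 1 powr (- \<delta>)" using exponent by (intro powr_mono2') auto
  then have "weight N y \<le> exp (- 2 * (norm y)\<^sup>2) * 1" unfolding weight_def by (intro mult_left_mono) auto
  also have "\<dots> \<le> exp (2 * R\<^sup>2) * exp (- 2 * (norm z)\<^sup>2)" using exp_norm_vec_upd_le[OF zk] by (simp add: y_def)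
  finally have "ennreal (weight N y) \<le> ennreal (exp (2 * R\<^sup>2) * exp (- 2 * (norm z)\<^sup>2))" by (rule ennreal_leI)
  then show ?thesis using False zk by (simp add: y_def ennreal_mult)
 qed
qed simp

lemma slice_mass_le:
 "(\<integral>\<^sup>+z. ennreal (weight N (vec_upd z k w)) * indicator (ball 0 R) (z $ k) \<partial>lborel) \<le> ennreal (B + gauss_mass)"
proof -
 have [measurable]: "p \<in> borel_measurable borel" by (rule borel_measurable_continuous_onI[OF continuous_on_p])
 have gauss: "(\<integral>\<^sup>+(x::complex^'n). ennreal (exp (- 2 * (norm x)\<^sup>2)) \<partial>lborel)
   = ennreal (enn2real (\<integral>\<^sup>+(x::complex^'n). ennreal (exp (- 2 * (norm x)\<^sup>2)) \<partial>lborel))"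
  using nn_integral_gaussian[where 'a = "complex^'n"] by simp
 have "(\<integral>\<^sup>+z. ennreal (weight N (vec_upd z k w)) * indicator (ball 0 R) (z $ k) \<partial>lborel)
   \<le> (\<integral>\<^sup>+z. negpow \<delta> (norm (p (vec_upd z k w))) * indicator (pdisk 0 R) z + ennreal (exp (2 * R\<^sup>2)) * ennreal (exp (- 2 * (norm z)\<^sup>2)) \<partial>lborel)"
  by (intro nn_integral_mono weight_slice_le)
 also have "\<dots> = negpow_integral \<delta> (pdisk 0 R) (\<lambda>z. p (vec_upd z k w))
   + ennreal (exp (2 * R\<^sup>2)) * (\<integral>\<^sup>+(x::complex^'n). ennreal (exp (- 2 * (norm x)\<^sup>2)) \<partial>lborel)"
  unfolding negpow_integral_def by (subst nn_integral_add) (measurable, simp add: nn_integral_cmult)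
 also have "\<dots> \<le> ennreal B + ennreal gauss_mass"
  unfolding gauss_mass_def by (intro add_mono slice, subst gauss) (simp add: ennreal_mult)
 also have "\<dots> = ennreal (B + gauss_mass)" using B_ge_1 gauss_mass_nonneg by simp
 finally show ?thesis .
qed

lemma slice_kernel_mass_le:
 obtains t where "0 < t" "t \<le> 1"
  "(\<integral>\<^sup>+x. ennreal (t / ((norm (x $ k - w))\<^sup>2 + t)\<^sup>2 * weight N x) \<partial>lborel) \<le> ennreal (kernel_const * B)"
proof -
 obtain dphi C where "psh_weight (weight N) dphi" and weight_le: "\<And>x. weight N x \<le> C * exp (- 2 * (norm x)\<^sup>2)"
  using psh_weight_weight[of N] by blast
 then interpret psh_weight "weight N" dphi by simp
 let ?I = "\<lambda>t. \<integral>\<^sup>+x. ennreal (t / ((norm (x $ k - w))\<^sup>2 + t)\<^sup>2 * weight N x) \<partial>lborel"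
 let ?S = "\<integral>\<^sup>+z. ennreal (weight N (vec_upd z k w)) * indicator (ball 0 R) (z $ k) \<partial>lborel"
 have lim: "(\<lambda>j. ?I (1 / real (Suc j)) * ennreal disk_area) \<longlonglongrightarrow> ennreal cauchy_mass * ?S"
  unfolding disk_area[symmetric] cauchy_mass[symmetric]
  by (rule slice_kernel_tendsto[OF E_cont less_imp_le[OF E_pos] weight_le])
   (use LIMSEQ_inverse_real_of_nat in \<open>auto simp: inverse_eq_divide\<close>)
 let ?b = "(cauchy_mass + 1) * (B + gauss_mass + 1)"
 have "ennreal cauchy_mass * ?S \<le> ennreal (cauchy_mass * (B + gauss_mass))"
  using mult_left_mono[OF slice_mass_le[of N], of "ennreal cauchy_mass"] cauchy_mass_nonneg B_ge_1 gauss_mass_nonneg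
  by (simp add: ennreal_mult)
 also have "\<dots> < ennreal ?b"
 proof (rule ennreal_lessI)
  show "cauchy_mass * (B + gauss_mass) < ?b"
   using cauchy_mass_nonneg B_ge_1 gauss_mass_nonneg by (simp add: algebra_simps)
  show "0 < ?b" using cauchy_mass_nonneg B_ge_1 gauss_mass_nonneg by (intro mult_pos_pos) auto
 qed
 finally obtain j where j_small: "?I (1 / real (Suc j)) * ennreal disk_area < ennreal ?b"
  using order_tendstoD(2)[OF lim] by (meson eventually_happens trivial_limit_sequentially)
 have "gauss_mass * 1 \<le> gauss_mass * B" using gauss_mass_nonneg B_ge_1 by (intro mult_left_mono) auto
 then have "B + gauss_mass + 1 \<le> (gauss_mass + 2) * B" using B_ge_1 by (simp add: algebra_simps)
 from mult_left_mono[OF this, of "cauchy_mass + 1"]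
 have "?b \<le> kernel_const * B * disk_area"
  unfolding kernel_const_def using cauchy_mass_nonneg disk_area_pos by (simp add: mult.assoc)
 then have "?I (1 / real (Suc j)) * ennreal disk_area \<le> ennreal (kernel_const * B) * ennreal disk_area"
  using j_small disk_area_pos kernel_const_pos B_ge_1 by (auto simp: ennreal_mult[symmetric] intro: order_trans[OF less_imp_le] ennreal_leI)
 then have "?I (1 / real (Suc j)) \<le> ennreal (kernel_const * B)"
  using disk_area_pos by (simp add: ennreal_mult_le_mult_iff mult.commute[of _ "ennreal disk_area"])
 then show thesis by (intro that[of "1 / real (Suc j)"]) auto
qed

lemma weighted_extension:
 obtains F where "Ck 1 F" "\<And>j y. dzbar j F y = 0" "\<And>y. y $ k = w \<Longrightarrow> F y = 1"
  "(\<integral>\<^sup>+y. indicator (cball 0 radius) y * ennreal ((norm (F y))\<^sup>2 * weight N y) \<partial>lborel) \<le> ennreal (extension_const * B)"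
proof -
 obtain t where t_bounds: "0 < t" "t \<le> 1"
  and slice_mass: "(\<integral>\<^sup>+x. ennreal (t / ((norm (x $ k - w))\<^sup>2 + t)\<^sup>2 * weight N x) \<partial>lborel) \<le> ennreal (kernel_const * B)"
  by (rule slice_kernel_mass_le)
 obtain dphi C where psh: "psh_weight (weight N) dphi" using psh_weight_weight[of N] by blast
 interpret twisted_weight "weight N" dphi k w t
  using psh t_bounds by (simp add: twisted_weight_def twist_def)
 have "(\<integral>\<^sup>+x. ennreal (delta_kernel x * weight N x) \<partial>lborel) = ennreal mass"
  unfolding mass_def using delta_kernel_E_nonneg by (intro nn_integral_eq_integral integrable_delta_kernel_E) auto
 then have mass_le: "mass \<le> kernel_const * B"
  using slice_mass delta_kernel_E_nonneg kernel_const_pos B_ge_1 by (auto simp: delta_kernel_def sq_dist_def)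
 obtain F where F_extends: "Ck 1 F" "\<And>j y. dzbar j F y = 0" "\<And>y. y $ k = w \<Longrightarrow> F y = 1"
  and F_le: "(\<integral>\<^sup>+y. indicator (cball 0 radius) y * ennreal ((norm (F y))\<^sup>2 * weight N y) \<partial>lborel)
    \<le> ennreal (8 * ((radius + 1 + norm w)\<^sup>2 + 3) * mass + 1)"
  using extension_from_hyperplane[of 1 radius] by auto
 have "norm w \<le> R" using w_bounds(2) norm_ge_zero[of w] by linarith
 then have "(radius + 1 + norm w)\<^sup>2 \<le> (radius + 1 + R)\<^sup>2" using radius_nonneg by (intro power_mono) auto
 then have "8 * ((radius + 1 + norm w)\<^sup>2 + 3) * mass \<le> 8 * ((radius + 1 + R)\<^sup>2 + 3) * (kernel_const * B)"
  using mass_le mass_nonneg by (intro mult_mono) auto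
 then have "8 * ((radius + 1 + norm w)\<^sup>2 + 3) * mass + 1 \<le> extension_const * B"
  unfolding extension_const_def using B_ge_1 by (simp add: distrib_right mult.assoc)
 with F_extends show thesis by (intro that[of F] order_trans[OF F_le ennreal_leI])
qed

end

locale slice_extension = slice_bounded_map k R M d p \<delta> B w
 for k :: "'n::finite" and R M d :: real and p :: "complex^'n \<Rightarrow> complex^'j::finite" and \<delta> B :: real and w :: complex +
 fixes N :: nat and F :: "complex^'n \<Rightarrow> complex"
 assumes F_Ck: "Ck 1 F" and F_hol: "dzbar j F y = 0" and F_slice: "y $ k = w \<Longrightarrow> F y = 1"
  and F_le: "(\<integral>\<^sup>+y. indicator (cball 0 radius) y * ennreal ((norm (F y))\<^sup>2 * weight N y) \<partial>lborel) \<le> ennreal (extension_const * B)"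
begin

lemma continuous_on_F: "continuous_on UNIV F"
 by (rule Ck_cont[OF F_Ck])

lemma borel_measurable_integrand [measurable]:
 "(\<lambda>y. indicator (cball 0 radius) y * ennreal ((norm (F y))\<^sup>2 * weight N y)) \<in> borel_measurable borel"
proof -
 have [measurable]: "F \<in> borel_measurable borel" "reg N \<in> borel_measurable borel" "cball 0 radius \<in> sets (borel :: (complex^'n) measure)"
  by (auto intro: borel_measurable_continuous_onI continuous_on_F continuous_on_reg)
 show ?thesis unfolding weight_def by measurable
qed

lemma F_slice_holomorphic: "(\<lambda>t. F (vec_upd z i t)) holomorphic_on UNIV"
 by (rule holomorphic_slice[OF F_Ck F_hol])

lemma weight_ge:
 assumes x_in: "x \<in> pdisk 0 R" shows "weight_min \<le> weight N x"
proof -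
 let ?Q = "M\<^sup>2 + real CARD('n) + 1"
 have "norm x \<le> radius" using pdisk_subset_cball_radius x_in by auto
 then have "(norm x)\<^sup>2 \<le> radius\<^sup>2" by (intro power_mono) auto
 then have gauss: "exp (- 2 * radius\<^sup>2) \<le> exp (- 2 * (norm x)\<^sup>2)" by simp
 have "?Q powr (- (d / 2)) \<le> ?Q powr (- (\<delta> / 2))" using exponent by (intro powr_mono) auto
 also have "\<dots> \<le> ((norm (reg N x))\<^sup>2) powr (- (\<delta> / 2))"
  using exponent norm_regularised_pos[OF R_pos, of p k N x] norm_regularised_sq_le[where p = p, OF R_pos x_in bounded[OF x_in], of k N]
  by (intro powr_mono2') auto
 also have "\<dots> = norm (reg N x) powr (- \<delta>)"
  using norm_regularised_pos[OF R_pos, of p k N x] by (simp add: powr_powr powr_numeral[symmetric] del: powr_numeral)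
 finally show ?thesis unfolding weight_def weight_min_def using gauss by (intro mult_mono) auto
qed

lemma norm_F_sq_le:
 assumes a_bound: "\<And>i. norm (a $ i) \<le> R / 2"
 shows "(norm (F a))\<^sup>2 \<le> sup_const * B"
proof -
 have "pdisk a (R / 2) \<subseteq> pdisk 0 R"
 proof
  fix x assume x_in: "x \<in> pdisk a (R / 2)"
  then have "norm (x $ i - a $ i) < R / 2" for i by (simp add: pdisk_def)
  then have "norm (x $ i) < R" for i
   using norm_triangle_ineq[of "x $ i - a $ i" "a $ i"] a_bound[of i] by (simp add: less_le_trans) (smt (verit) field_sum_of_halves)
  then show "x \<in> pdisk 0 R" by (simp add: pdisk_def)
 qed
 then have F_sq_le: "indicator (pdisk a (R / 2)) x * ennreal (norm (F x * F x))
   \<le> ennreal (1 / weight_min) * (indicator (cball 0 radius) x * ennreal ((norm (F x))\<^sup>2 * weight N x))" for x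
 proof (cases "x \<in> pdisk a (R / 2)")
  case True
  assume "pdisk a (R / 2) \<subseteq> pdisk 0 R"
  then have x_in: "x \<in> pdisk 0 R" using True by blast
  have "norm (F x * F x) \<le> 1 / weight_min * ((norm (F x))\<^sup>2 * weight N x)"
   using mult_right_mono[OF weight_ge[OF x_in], of "(norm (F x))\<^sup>2"] weight_min_pos
   by (simp add: field_simps norm_mult power2_eq_square)
  then have "ennreal (norm (F x * F x)) \<le> ennreal (1 / weight_min) * ennreal ((norm (F x))\<^sup>2 * weight N x)"
   using weight_min_pos weight_pos[of N x] by (subst ennreal_mult[symmetric]) (auto intro: ennreal_leI)
  then show ?thesis using True x_in pdisk_subset_cball_radius by auto
 qed simp
 have "ennreal (norm (F a * F a)) * ennreal polydisk_volume \<le> (\<integral>\<^sup>+x. indicator (pdisk a (R / 2)) x * ennreal (norm (F x * F x)) \<partial>lborel)"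
  unfolding polydisk_volume[symmetric] emeasure_pdisk_center[of a, symmetric] using R_pos
  by (intro polydisk_mean_value[of "\<lambda>x. F x * F x"] continuous_intros continuous_on_F holomorphic_intros F_slice_holomorphic) auto
 also have "\<dots> \<le> ennreal (1 / weight_min) * (\<integral>\<^sup>+x. indicator (cball 0 radius) x * ennreal ((norm (F x))\<^sup>2 * weight N x) \<partial>lborel)"
  by (subst nn_integral_cmult[symmetric]) (measurable, intro nn_integral_mono F_sq_le)
 also have "\<dots> \<le> ennreal (1 / weight_min) * ennreal (extension_const * B)" by (intro mult_left_mono F_le) auto
 finally have "norm (F a * F a) * polydisk_volume \<le> 1 / weight_min * (extension_const * B)"
  using weight_min_pos extension_const_pos B_ge_1 polydisk_volume_pos by (simp add: ennreal_mult[symmetric])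
 then show ?thesis
  unfolding sup_const_def using weight_min_pos polydisk_volume_pos by (simp add: field_simps norm_mult power2_eq_square)
qed

text \<open>\<open>F = 1\<close> at distance at most \<open>2|w|\<close> from any point of this polydisk.\<close>

lemma norm_F_ge_half:
 assumes z_in: "z \<in> pdisk 0 (norm w)"
 shows "norm (F z) \<ge> 1 / 2"
proof -
 define f where "f t = F (vec_upd z k t)" for t
 have z_i_less: "norm (z $ i) < norm w" for i using z_in by (simp add: pdisk_def)
 have "norm (f (z $ k) - f w) \<le> sqrt (sup_const * B) / (R / 4) * norm (z $ k - w)"
 proof (rule holomorphic_difference_bound)
  show "f holomorphic_on UNIV" unfolding f_def by (rule F_slice_holomorphic)
  fix s :: complex assume s_le: "norm s \<le> 2 * (R / 4)"
  have "norm s \<le> R / 2" "norm (z $ i) \<le> R / 2" for i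
   using s_le z_i_less[of i] w_bounds(2) norm_ge_zero[of w] by linarith+
  then have "norm (vec_upd z k s $ i) \<le> R / 2" for i by simp
  then show "norm (f s) \<le> sqrt (sup_const * B)" unfolding f_def by (intro real_le_rsqrt norm_F_sq_le)
 qed (use R_pos w_bounds z_i_less[of k] in linarith)+
 also have "\<dots> \<le> sqrt (sup_const * B) / (R / 4) * (2 * norm w)"
  using norm_triangle_ineq4[of "z $ k" w] z_i_less[of k] R_pos sup_const_pos B_ge_1 by (intro mult_left_mono) auto
 also have "\<dots> \<le> 1 / 2"
 proof (rule power2_le_imp_le)
  have "256 * sup_const / R\<^sup>2 * B * (norm w)\<^sup>2 \<le> slice_const * B * (norm w)\<^sup>2"
   using sup_const_le_slice_const B_ge_1 by (intro mult_right_mono) auto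
  then have le_1: "256 * sup_const / R\<^sup>2 * B * (norm w)\<^sup>2 \<le> 1" using small by linarith
  have "(sqrt (sup_const * B) / (R / 4) * (2 * norm w))\<^sup>2 = (256 * sup_const / R\<^sup>2 * B * (norm w)\<^sup>2) / 4"
   using sup_const_pos B_ge_1 R_pos by (simp add: power_mult_distrib power_divide)
  also have "\<dots> \<le> 1 / 4" by (rule divide_right_mono[OF le_1]) simp
  finally show "(sqrt (sup_const * B) / (R / 4) * (2 * norm w))\<^sup>2 \<le> (1 / 2)\<^sup>2" by (simp only: power_divide) simp
 qed simp
 finally have "norm (F z - 1) \<le> 1 / 2" unfolding f_def using F_slice[of "vec_upd z k w"] by simp
 then show ?thesis using norm_triangle_ineq2[of 1 "1 - F z"] by (simp add: norm_minus_commute)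
qed

lemma negpow_regularised_le:
 "negpow \<delta> (norm (reg N z)) * indicator (pdisk 0 (norm w)) z
  \<le> ennreal (4 * exp (2 * radius\<^sup>2)) * (indicator (cball 0 radius) z * ennreal ((norm (F z))\<^sup>2 * weight N z))"
proof (cases "z \<in> pdisk 0 (norm w)")
 case True
 have "norm w \<le> R" using w_bounds norm_ge_zero[of w] by linarith
 then have z_in: "z \<in> cball 0 radius" using True pdisk_mono pdisk_subset_cball_radius by blast
 let ?y = "norm (reg N z) powr (- \<delta>)"
 have "(norm z)\<^sup>2 \<le> radius\<^sup>2" using z_in by (intro power_mono) auto
 then have "1 \<le> exp (2 * radius\<^sup>2) * exp (- 2 * (norm z)\<^sup>2)" by (simp add: exp_add[symmetric])
 from mult_right_mono[OF this, of ?y] have "?y \<le> exp (2 * radius\<^sup>2) * weight N z" by (simp add: weight_def mult.assoc)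
 also have "\<dots> \<le> exp (2 * radius\<^sup>2) * (4 * (norm (F z))\<^sup>2 * weight N z)"
 proof (rule mult_left_mono)
  have "(1 / 2)\<^sup>2 \<le> (norm (F z))\<^sup>2" using norm_F_ge_half[OF True] by (intro power_mono) auto
  then have "1 \<le> 4 * (norm (F z))\<^sup>2" by (simp add: power2_eq_square)
  from mult_right_mono[OF this less_imp_le[OF weight_pos]] show "weight N z \<le> 4 * (norm (F z))\<^sup>2 * weight N z" by simp
 qed simp
 finally have "ennreal ?y \<le> ennreal (4 * exp (2 * radius\<^sup>2) * ((norm (F z))\<^sup>2 * weight N z))"
  by (intro ennreal_leI) (simp add: mult_ac)
 moreover have "negpow \<delta> (norm (reg N z)) = ennreal ?y"
  using norm_regularised_pos[OF R_pos, of p k N z] by (simp add: negpow_def)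
 ultimately show ?thesis using True z_in less_imp_le[OF weight_pos, of N z] by (simp add: ennreal_mult)
qed simp

lemma negpow_integral_regularised_le: "negpow_integral \<delta> (pdisk 0 (norm w)) (reg N) \<le> ennreal (slice_const * B)"
proof -
 have "negpow_integral \<delta> (pdisk 0 (norm w)) (reg N)
   \<le> ennreal (4 * exp (2 * radius\<^sup>2)) * (\<integral>\<^sup>+z. indicator (cball 0 radius) z * ennreal ((norm (F z))\<^sup>2 * weight N z) \<partial>lborel)"
  unfolding negpow_integral_def by (subst nn_integral_cmult[symmetric]) (measurable, intro nn_integral_mono negpow_regularised_le)
 also have "\<dots> \<le> ennreal (4 * exp (2 * radius\<^sup>2)) * ennreal (extension_const * B)" by (intro mult_left_mono F_le) auto
 also have "\<dots> = ennreal (4 * extension_const * exp (2 * radius\<^sup>2) * B)"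
  using extension_const_pos B_ge_1 by (subst ennreal_mult[symmetric]) (auto simp: mult_ac)
 also have "\<dots> \<le> ennreal (slice_const * B)"
  using extension_const_le_slice_const B_ge_1 by (intro ennreal_leI mult_right_mono) auto
 finally show ?thesis .
qed

end

context slice_bounded_map
begin

theorem negpow_integral_le: "negpow_integral \<delta> (pdisk 0 (norm w)) p \<le> ennreal (slice_const * B)"
proof (rule negpow_integral_le_of_tendsto[of reg])
 show "reg N \<in> borel_measurable borel" for N by (rule borel_measurable_continuous_onI[OF continuous_on_reg])
 have "norm w \<le> R" using w_bounds norm_ge_zero[of w] by linarith
 then show "(\<lambda>N. norm (reg N z)) \<longlonglongrightarrow> norm (p z)" if "z \<in> pdisk 0 (norm w)" for z
  using that pdisk_mono by (intro norm_regularised_tendsto[OF R_pos]) blast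
 have "negpow_integral \<delta> (pdisk 0 (norm w)) (reg N) \<le> ennreal (slice_const * B)" for N
 proof -
  obtain F where "Ck 1 F" "\<And>j y. dzbar j F y = 0" "\<And>y. y $ k = w \<Longrightarrow> F y = 1"
   "(\<integral>\<^sup>+y. indicator (cball 0 radius) y * ennreal ((norm (F y))\<^sup>2 * weight N y) \<partial>lborel) \<le> ennreal (extension_const * B)"
   using weighted_extension[of N] by blast
  then interpret slice_extension k R M d p \<delta> B w N F by unfold_locales
  show ?thesis by (rule negpow_integral_regularised_le)
 qed
 then show "\<forall>\<^sub>F N in sequentially. negpow_integral \<delta> (pdisk 0 (norm w)) (reg N) \<le> ennreal (slice_const * B)" by simp
qed (use exponent in auto)

end

lemma nn_integral_inverse_square_scale:
 assumes "\<rho> > 0"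
 shows "(\<integral>\<^sup>+w\<in>ball 0 (\<rho> / 2). ennreal (1 / (norm (w::complex))\<^sup>2) \<partial>lborel) = (\<integral>\<^sup>+w\<in>ball 0 \<rho>. ennreal (1 / (norm (w::complex))\<^sup>2) \<partial>lborel)"
proof -
 let ?f = "\<lambda>w::complex. ennreal (1 / (norm w)\<^sup>2) * indicator (ball 0 (\<rho> / 2)) w"
 have [measurable]: "ball 0 (\<rho> / 2) \<in> sets (borel :: complex measure)" by simp
 have "ennreal ((1 / 2) ^ DIM(complex)) * ?f (0 + (1 / 2) *\<^sub>R w) = ennreal (1 / (norm w)\<^sup>2) * indicator (ball 0 \<rho>) w" for w
 proof -
  have "ennreal ((1 / 2) ^ 2) * ennreal (1 / (norm ((1 / 2) *\<^sub>R w))\<^sup>2) = ennreal (1 / (norm w)\<^sup>2)"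
   by (subst ennreal_mult[symmetric]) (auto simp: power_mult_distrib power_divide)
  moreover have "indicator (ball 0 (\<rho> / 2)) ((1 / 2) *\<^sub>R w) = (indicator (ball 0 \<rho>) w :: ennreal)" by (auto simp: indicator_def)
  ultimately show ?thesis by (simp add: mult.assoc[symmetric])
 qed
 moreover have "(\<integral>\<^sup>+w. ?f w \<partial>lborel) = (\<integral>\<^sup>+w. ennreal ((1 / 2) ^ DIM(complex)) * ?f (0 + (1 / 2) *\<^sub>R w) \<partial>lborel)"
  by (rule nn_integral_lborel_affine) auto
 ultimately show ?thesis by simp
qed

lemma inverse_square_not_integrable:
 assumes "\<rho> > 0"
 shows "(\<integral>\<^sup>+w\<in>ball 0 \<rho>. ennreal (1 / (norm (w::complex))\<^sup>2) \<partial>lborel) = \<infinity>"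
proof -
 let ?f = "\<lambda>w::complex. ennreal (1 / (norm w)\<^sup>2)"
 define I where "I r = (\<integral>\<^sup>+w\<in>ball 0 r. ?f w \<partial>lborel)" for r
 define S where "S = ball (0::complex) \<rho> - cball 0 (\<rho> / 2)"
 have S_open: "open S" unfolding S_def by (intro open_Diff) auto
 have [measurable]: "S \<in> sets borel" "ball 0 (\<rho> / 2) \<in> sets (borel :: complex measure)" using S_open by auto
 have "of_real (3 * \<rho> / 4) \<in> S" unfolding S_def using assms by (simp add: norm_of_real abs_mult)
 then have "emeasure lborel S \<noteq> 0" using emeasure_lborel_open_neq_0[OF S_open] by blast
 then have S_mass: "ennreal (1 / \<rho>\<^sup>2) * emeasure lborel S \<noteq> 0" using assms by auto
 have "I \<rho> + ennreal (1 / \<rho>\<^sup>2) * emeasure lborel S = (\<integral>\<^sup>+w. ?f w * indicator (ball 0 (\<rho> / 2)) w + ennreal (1 / \<rho>\<^sup>2) * indicator S w \<partial>lborel)"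
  unfolding I_def nn_integral_inverse_square_scale[OF assms, symmetric] by (subst nn_integral_add) (auto simp: nn_integral_cmult)
 also have "\<dots> \<le> I \<rho>" unfolding I_def
 proof (rule nn_integral_mono)
  fix w :: complex
  show "?f w * indicator (ball 0 (\<rho> / 2)) w + ennreal (1 / \<rho>\<^sup>2) * indicator S w \<le> ?f w * indicator (ball 0 \<rho>) w"
  proof (cases "w \<in> S")
   case True
   then have w_bounds: "norm w < \<rho>" "\<rho> / 2 < norm w" by (auto simp: S_def)
   then have "(norm w)\<^sup>2 \<le> \<rho>\<^sup>2" "(norm w)\<^sup>2 > 0" using assms by (auto intro: power_mono)
   then have "1 / \<rho>\<^sup>2 \<le> 1 / (norm w)\<^sup>2" using assms by (intro divide_left_mono) auto
   then show ?thesis using True w_bounds by (simp add: ennreal_leI)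
  qed (use assms in \<open>auto simp: indicator_def\<close>)
 qed
 finally have "I \<rho> + ennreal (1 / \<rho>\<^sup>2) * emeasure lborel S \<le> I \<rho> + 0" by simp
 then have "I \<rho> = \<infinity>" using S_mass unfolding ennreal_add_left_cancel_le by auto
 then show ?thesis by (simp add: I_def)
qed

lemma negpow_le_add:
 assumes "s \<ge> 0" "0 < a" "a \<le> b" shows "negpow a s \<le> 1 + negpow b s"
proof (cases "s = 0")
 case False
 then have s_pos: "s > 0" using assms by simp
 have "s powr (- a) \<le> 1 + s powr (- b)"
 proof (cases "s \<ge> 1")
  case True
  then have "s powr (- a) \<le> 1 powr (- a)" using assms by (intro powr_mono2') auto
  moreover have "0 \<le> s powr (- b)" by simp
  ultimately show ?thesis unfolding powr_one_eq_one by linarith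
 next
  case False
  then have "s powr (- a) \<le> s powr (- b)" using s_pos assms by (intro powr_mono') auto
  then show ?thesis by simp
 qed
 then have "ennreal (s powr (- a)) \<le> ennreal (1 + s powr (- b))" by (rule ennreal_leI)
 then show ?thesis using False by (simp add: negpow_def)
qed (simp add: negpow_def)

lemma negpow_le_powr_mult_negpow:
 assumes "0 \<le> s" "s \<le> \<eta>" "0 < \<eta>" "a \<le> b"
 shows "negpow a s \<le> ennreal (\<eta> powr (b - a)) * negpow b s"
proof (cases "s = 0")
 case False
 have "s powr (- a) = s powr (b - a) * s powr (- b)" by (simp add: powr_add[symmetric])
 also have "\<dots> \<le> \<eta> powr (b - a) * s powr (- b)" using assms by (intro mult_right_mono powr_mono2) auto
 finally have "ennreal (s powr (- a)) \<le> ennreal (\<eta> powr (b - a) * s powr (- b))" by (rule ennreal_leI)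
 then show ?thesis using False by (simp add: negpow_def ennreal_mult)
qed (use assms in \<open>simp add: negpow_def ennreal_mult_top\<close>)

lemma negpow_le_perturbed:
 assumes \<eta>: "0 < \<eta>" "\<eta> \<le> s" and t_close: "0 \<le> t" "\<bar>s - t\<bar> \<le> \<epsilon>" and \<delta>: "0 < \<delta>" "\<delta> \<le> \<delta>'"
 shows "negpow \<delta>' s \<le> ennreal (\<eta> powr (- (\<delta>' - \<delta>)) * (1 + \<epsilon> / \<eta>) powr \<delta>) * negpow \<delta> t"
proof -
 have \<epsilon>: "\<epsilon> \<ge> 0" using t_close by linarith
 then have factor_pos: "1 + \<epsilon> / \<eta> > 0" using \<eta> by (simp add: add_pos_nonneg)
 consider "t = 0" | "t > 0" using t_close by linarith
 then show ?thesis
 proof cases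
  case 1
  then show ?thesis using \<eta> factor_pos by (simp add: negpow_def ennreal_mult_top)
 next
  case t_pos: 2
  have "\<epsilon> \<le> \<epsilon> / \<eta> * s" using \<eta> \<epsilon> mult_left_mono[of \<eta> s \<epsilon>] by (simp add: field_simps)
  then have "t \<le> (1 + \<epsilon> / \<eta>) * s" using t_close by (simp add: algebra_simps)
  then have "((1 + \<epsilon> / \<eta>) * s) powr (- \<delta>) \<le> t powr (- \<delta>)" using t_pos \<delta> by (intro powr_mono2') auto
  then have "(1 + \<epsilon> / \<eta>) powr \<delta> * ((1 + \<epsilon> / \<eta>) powr (- \<delta>) * s powr (- \<delta>)) \<le> (1 + \<epsilon> / \<eta>) powr \<delta> * t powr (- \<delta>)"
   using factor_pos \<eta> by (simp add: powr_mult mult_left_mono)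
  moreover have "(1 + \<epsilon> / \<eta>) powr \<delta> * (1 + \<epsilon> / \<eta>) powr (- \<delta>) = 1" using factor_pos by (simp add: powr_add[symmetric])
  ultimately have powr_le: "s powr (- \<delta>) \<le> (1 + \<epsilon> / \<eta>) powr \<delta> * t powr (- \<delta>)" by (simp add: mult.assoc[symmetric])
  have "s powr (- \<delta>') = s powr (- (\<delta>' - \<delta>)) * s powr (- \<delta>)" by (simp add: powr_add[symmetric])
  also have "\<dots> \<le> \<eta> powr (- (\<delta>' - \<delta>)) * ((1 + \<epsilon> / \<eta>) powr \<delta> * t powr (- \<delta>))"
   using \<eta> \<delta> by (intro mult_mono powr_le powr_mono2') auto
  finally have "ennreal (s powr (- \<delta>')) \<le> ennreal (\<eta> powr (- (\<delta>' - \<delta>)) * (1 + \<epsilon> / \<eta>) powr \<delta> * t powr (- \<delta>))"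
   by (intro ennreal_leI) (simp add: mult.assoc)
  then show ?thesis using \<eta> t_pos by (simp add: negpow_def ennreal_mult)
 qed
qed

lemma perturbation_parameters:
 fixes \<delta> \<delta>1 d x :: real
 assumes \<delta>: "0 < \<delta>" "\<delta> < \<delta>1" "\<delta> < d" and x_pos: "x > 0"
 obtains \<eta> \<delta>' \<epsilon> where "0 < \<eta>" "\<delta> < \<delta>'" "\<delta>' \<le> d" "\<delta>' \<le> \<delta>1" "\<epsilon> > 0"
  "\<eta> powr (- (\<delta>' - \<delta>)) * (1 + \<epsilon> / \<eta>) powr \<delta> \<le> 3 / 2" "\<eta> powr (\<delta>1 - \<delta>') \<le> x"
proof -
 define a where "a = (\<delta>1 - \<delta>) / 2"
 have a_pos: "a > 0" using \<delta> by (simp add: a_def)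
 define \<eta> where "\<eta> = min 1 (x powr (1 / a))"
 have \<eta>: "0 < \<eta>" "\<eta> \<le> 1" using x_pos by (auto simp: \<eta>_def)
 have "\<eta> powr a \<le> (x powr (1 / a)) powr a" using a_pos \<eta> by (intro powr_mono2) (auto simp: \<eta>_def)
 also have "\<dots> = x" using a_pos x_pos by (simp add: powr_powr)
 finally have \<eta>_a: "\<eta> powr a \<le> x" .
 have "((\<lambda>h. \<eta> powr (- h)) \<longlongrightarrow> \<eta> powr (- 0)) (at_right 0)" using \<eta> by (intro tendsto_intros) auto
 then have "\<forall>\<^sub>F h in at_right 0. \<eta> powr (- h) < 6 / 5" using \<eta> by (intro order_tendstoD(2)) auto
 moreover have "\<forall>\<^sub>F h in at_right 0. h < min a (d - \<delta>)"
  using a_pos \<delta> by (intro order_tendstoD(2)[OF tendsto_ident_at]) auto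
 ultimately have "\<forall>\<^sub>F h in at_right 0. \<eta> powr (- h) < 6 / 5 \<and> h < min a (d - \<delta>) \<and> 0 < h"
  using eventually_at_right_less[of "0::real"] by eventually_elim blast
 then obtain h where h_small: "\<eta> powr (- h) < 6 / 5" "h < a" "h < d - \<delta>" "0 < h"
  using eventually_happens trivial_limit_at_right_real by fastforce
 define \<epsilon> where "\<epsilon> = \<eta> * ((5 / 4) powr (1 / \<delta>) - 1)"
 have "(1::real) < (5 / 4) powr (1 / \<delta>)" using \<delta> by simp
 then have \<epsilon>: "\<epsilon> > 0" using \<eta> by (simp add: \<epsilon>_def)
 have "(1 + \<epsilon> / \<eta>) powr \<delta> = 5 / 4" using \<delta> \<eta> by (simp add: \<epsilon>_def powr_powr)
 then have "\<eta> powr (- h) * (1 + \<epsilon> / \<eta>) powr \<delta> \<le> 6 / 5 * (5 / 4)" using h_small by (intro mult_mono) auto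
 moreover have "\<eta> powr (\<delta>1 - (\<delta> + h)) \<le> \<eta> powr a" using \<eta> h_small by (intro powr_mono') (auto simp: a_def field_simps)
 ultimately show thesis
  using \<eta> h_small \<epsilon> \<eta>_a a_pos by (intro that[of \<eta> "\<delta> + h" \<epsilon>]) (auto simp: a_def)
qed

lemma negpow_perturbation:
 assumes \<delta>: "0 < \<delta>" "\<delta> < \<delta>1" "\<delta> < d" and x_pos: "x > 0"
 obtains \<delta>' \<epsilon> where "\<delta> < \<delta>'" "\<delta>' \<le> d" "\<epsilon> > 0"
  "\<And>s t. 0 \<le> s \<Longrightarrow> 0 \<le> t \<Longrightarrow> \<bar>s - t\<bar> \<le> \<epsilon> \<Longrightarrow> negpow \<delta>' s \<le> ennreal (3 / 2) * negpow \<delta> t + ennreal x * negpow \<delta>1 s"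
proof -
 obtain \<eta> \<delta>' \<epsilon> where \<eta>: "0 < \<eta>" and \<delta>': "\<delta> < \<delta>'" "\<delta>' \<le> d" "\<delta>' \<le> \<delta>1" and \<epsilon>: "\<epsilon> > 0"
  and \<eta>_small: "\<eta> powr (- (\<delta>' - \<delta>)) * (1 + \<epsilon> / \<eta>) powr \<delta> \<le> 3 / 2" "\<eta> powr (\<delta>1 - \<delta>') \<le> x"
  by (rule perturbation_parameters[OF \<delta> x_pos])
 have "negpow \<delta>' s \<le> ennreal (3 / 2) * negpow \<delta> t + ennreal x * negpow \<delta>1 s" if "0 \<le> s" "0 \<le> t" "\<bar>s - t\<bar> \<le> \<epsilon>" for s t
 proof (cases "s < \<eta>")
  case True
  then have "negpow \<delta>' s \<le> ennreal (\<eta> powr (\<delta>1 - \<delta>')) * negpow \<delta>1 s"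
   using that \<eta> \<delta>' by (intro negpow_le_powr_mult_negpow) auto
  also have "\<dots> \<le> ennreal x * negpow \<delta>1 s" by (intro mult_right_mono ennreal_leI \<eta>_small) auto
  finally show ?thesis by (rule add_increasing[OF zero_le])
 next
  case False
  then have "negpow \<delta>' s \<le> ennreal (\<eta> powr (- (\<delta>' - \<delta>)) * (1 + \<epsilon> / \<eta>) powr \<delta>) * negpow \<delta> t"
   using that \<eta> \<delta> \<delta>' by (intro negpow_le_perturbed) auto
  also have "\<dots> \<le> ennreal (3 / 2) * negpow \<delta> t" by (intro mult_right_mono ennreal_leI \<eta>_small) auto
  finally show ?thesis by (rule add_increasing2[OF zero_le])
 qed
 with \<delta>' \<epsilon> show thesis by (intro that)
qed

lemma negpow_integral_le_emeasure_add:
 assumes "0 < a" "a \<le> b" and [measurable]: "S \<in> sets borel" "g \<in> borel_measurable borel"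
 shows "negpow_integral a S g \<le> emeasure lborel S + negpow_integral b S g"
proof -
 have "negpow_integral a S g \<le> (\<integral>\<^sup>+z. indicator S z + negpow b (norm (g z)) * indicator S z \<partial>lborel)"
  unfolding negpow_integral_def using negpow_le_add[OF norm_ge_zero assms(1,2)]
  by (intro nn_integral_mono) (auto simp: indicator_def)
 also have "\<dots> = emeasure lborel S + negpow_integral b S g"
  unfolding negpow_integral_def by (subst nn_integral_add) auto
 finally show ?thesis .
qed

lemma negpow_integral_shift:
 assumes [measurable]: "g \<in> borel_measurable borel"
 shows "negpow_integral \<delta> (pdisk a r) g = negpow_integral \<delta> (pdisk 0 r) (\<lambda>z. g (a + z))"
proof -
 have "indicator (pdisk a r) (a + z) = (indicator (pdisk 0 r) z :: ennreal)" for z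
  by (simp add: pdisk_def indicator_def)
 then show ?thesis
  unfolding negpow_integral_def
  using nn_integral_lborel_shift[of "\<lambda>z. negpow \<delta> (norm (g z)) * indicator (pdisk a r) z" a] by simp
qed

lemma negpow_integral_le_sum_cover:
 assumes A_cover: "finite A" "S \<subseteq> (\<Union>a\<in>A. T a)" and [measurable]: "\<And>a. T a \<in> sets borel" "g \<in> borel_measurable borel"
 shows "negpow_integral \<delta> S g \<le> (\<Sum>a\<in>A. negpow_integral \<delta> (T a) g)"
proof -
 have "negpow_integral \<delta> S g \<le> (\<integral>\<^sup>+z. (\<Sum>a\<in>A. negpow \<delta> (norm (g z)) * indicator (T a) z) \<partial>lborel)"
  unfolding negpow_integral_def
 proof (rule nn_integral_mono)
  fix z
  show "negpow \<delta> (norm (g z)) * indicator S z \<le> (\<Sum>a\<in>A. negpow \<delta> (norm (g z)) * indicator (T a) z)"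
  proof (cases "z \<in> S")
   case True
   then obtain a where a_in: "a \<in> A" "z \<in> T a" using A_cover by auto
   have "negpow \<delta> (norm (g z)) * indicator (T a) z \<le> (\<Sum>a\<in>A. negpow \<delta> (norm (g z)) * indicator (T a) z)"
    using A_cover(1) a_in(1) by (intro member_le_sum) auto
   then show ?thesis using True a_in by simp
  qed simp
 qed
 also have "\<dots> = (\<Sum>a\<in>A. negpow_integral \<delta> (T a) g)"
  unfolding negpow_integral_def by (rule nn_integral_sum) measurable
 finally show ?thesis .
qed

definition depends_on :: "'n set \<Rightarrow> (complex^'n \<Rightarrow> 'a) \<Rightarrow> bool" where
 "depends_on I f \<longleftrightarrow> (\<forall>x y. (\<forall>i\<in>I. x $ i = y $ i) \<longrightarrow> f x = f y)"

definition polynomial_map :: "'n::finite set \<Rightarrow> (complex^'n \<Rightarrow> complex^'j::finite) \<Rightarrow> bool" where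
 "polynomial_map I p \<longleftrightarrow> (\<forall>j. complex_polynomial (\<lambda>z. p z $ j)) \<and> depends_on I p"

definition stable_on :: "'n::finite set \<Rightarrow> (complex^'n \<Rightarrow> complex^'j::finite) \<Rightarrow> real \<Rightarrow> real \<Rightarrow> real \<Rightarrow> bool" where
 "stable_on I g R r \<delta> \<longleftrightarrow> (\<exists>\<epsilon>>0. \<exists>\<delta>'>\<delta>. \<exists>C<\<infinity>. \<forall>p. polynomial_map I p \<longrightarrow>
   (\<forall>z\<in>pdisk 0 R. norm (p z - g z) \<le> \<epsilon>) \<longrightarrow> negpow_integral \<delta>' (pdisk 0 r) p \<le> C)"

lemma borel_measurable_polynomial_map: "polynomial_map I p \<Longrightarrow> p \<in> borel_measurable borel"
 unfolding polynomial_map_def by (intro borel_measurable_continuous_onI continuous_on_polynomial_components) blast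

lemma polynomial_map_vec_upd:
 assumes "polynomial_map (insert k I) p" shows "polynomial_map I (\<lambda>z. p (vec_upd z k w))"
 using assms complex_polynomial_vec_upd[of "\<lambda>z. p z $ _" k w] unfolding polynomial_map_def depends_on_def by auto

lemma polynomial_map_shift:
 assumes "polynomial_map I p" shows "polynomial_map I (\<lambda>z. p (a + z))"
 using assms complex_polynomial_shift[of "\<lambda>z. p z $ _" a] unfolding polynomial_map_def depends_on_def by auto

lemma pdisk_shift:
 assumes a_in: "a \<in> cpdisk 0 r" and z_in: "z \<in> pdisk 0 (R - r)" shows "a + z \<in> pdisk 0 R"
proof -
 have "norm ((a + z) $ i) < R" for i
  using norm_triangle_ineq[of "a $ i" "z $ i"] a_in z_in unfolding cpdisk_def pdisk_def by (simp add: less_diff_eq) (smt (verit))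
 then show ?thesis by (simp add: pdisk_def)
qed

lemma ex_small_slice:
 fixes g :: "complex^'n::finite \<Rightarrow> complex^'j::finite"
 assumes [measurable]: "g \<in> borel_measurable borel" and \<rho>: "0 < \<rho>" "\<rho> \<le> R" and c_pos: "c > 0"
  and finite: "negpow_integral \<delta> (pdisk 0 R) g < \<infinity>"
 shows "\<exists>w. w \<noteq> 0 \<and> norm w < \<rho> \<and> negpow_integral \<delta> (pdisk 0 R) (\<lambda>z. g (vec_upd z k w)) \<le> ennreal (c / (norm w)\<^sup>2)"
proof (rule ccontr)
 assume "\<not> ?thesis"
 then have large: "ennreal (c / (norm w)\<^sup>2) \<le> negpow_integral \<delta> (pdisk 0 R) (\<lambda>z. g (vec_upd z k w))" if "w \<noteq> 0" "norm w < \<rho>" for w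
  using that by (meson linear)
 have [measurable]: "ball 0 \<rho> \<in> sets (borel :: complex measure)" "ball 0 R \<in> sets (borel :: complex measure)" by simp_all
 define f where "f z = negpow \<delta> (norm (g z)) * indicator (pdisk 0 R) z" for z
 have [measurable]: "f \<in> borel_measurable borel" unfolding f_def by measurable
 define b where "b w = (indicator (ball 0 R) w :: ennreal)" for w :: complex
 have [measurable]: "b \<in> borel_measurable borel" unfolding b_def by measurable
 have "\<infinity> = (\<integral>\<^sup>+w. ennreal c * (ennreal (1 / (norm (w::complex))\<^sup>2) * indicator (ball 0 \<rho>) w) \<partial>lborel)"
  using c_pos inverse_square_not_integrable[OF \<rho>(1)] by (subst nn_integral_cmult) (auto simp: ennreal_mult_top)
 also have "\<dots> \<le> (\<integral>\<^sup>+w. \<integral>\<^sup>+z. f (vec_upd z k w) * b (z $ k) \<partial>lborel \<partial>lborel)"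
 proof (rule nn_integral_mono)
  fix w :: complex
  show "ennreal c * (ennreal (1 / (norm w)\<^sup>2) * indicator (ball 0 \<rho>) w) \<le> (\<integral>\<^sup>+z. f (vec_upd z k w) * b (z $ k) \<partial>lborel)"
  proof (cases "w \<noteq> 0 \<and> norm w < \<rho>")
   case True
   have "f (vec_upd z k w) * b (z $ k) = negpow \<delta> (norm (g (vec_upd z k w))) * indicator (pdisk 0 R) z" for z
    using True \<rho> by (auto simp: f_def b_def pdisk_def indicator_def split: if_splits)
   moreover have "ennreal c * ennreal (1 / (norm w)\<^sup>2) = ennreal (c / (norm w)\<^sup>2)"
    using c_pos by (subst ennreal_mult[symmetric]) auto
   ultimately show ?thesis using large[of w] True by (simp add: negpow_integral_def)
  qed (auto simp: indicator_def)
 qed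
 also have "\<dots> = (\<integral>\<^sup>+z. \<integral>\<^sup>+w. f (vec_upd z k w) * b (z $ k) \<partial>lborel \<partial>lborel)"
  by (rule lborel_pair.Fubini') measurable
 also have "\<dots> = negpow_integral \<delta> (pdisk 0 R) g * (\<integral>\<^sup>+w. b w \<partial>lborel)"
  unfolding negpow_integral_def f_def[symmetric] by (rule nn_integral_vec_upd[symmetric]) measurable
 also have "\<dots> < \<infinity>"
  using finite emeasure_bounded_finite[OF bounded_ball, of "0::complex" R] by (simp add: b_def ennreal_mult_less_top)
 finally show False by simp
qed

lemma negpow_integral_le_add:
 assumes [measurable]: "q \<in> borel_measurable borel" "g \<in> borel_measurable borel" "S \<in> sets borel"
  and negpow_le: "\<And>z. z \<in> S \<Longrightarrow> negpow \<delta>' (norm (q z)) \<le> a * negpow \<delta> (norm (g z)) + b * negpow \<delta>1 (norm (q z))"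
 shows "negpow_integral \<delta>' S q \<le> a * negpow_integral \<delta> S g + b * negpow_integral \<delta>1 S q"
proof -
 have "negpow \<delta>' (norm (q z)) * indicator S z
   \<le> a * (negpow \<delta> (norm (g z)) * indicator S z) + b * (negpow \<delta>1 (norm (q z)) * indicator S z)" for z
  using negpow_le[of z] by (cases "z \<in> S") simp_all
 then show ?thesis
  unfolding negpow_integral_def by (subst (1 2) nn_integral_cmult[symmetric], simp_all, subst nn_integral_add[symmetric]) (auto intro: nn_integral_mono)
qed

lemma stable_on_perturbed_slice:
 fixes g :: "complex^'n::finite \<Rightarrow> complex^'j::finite"
 assumes stable: "stable_on I g R (R / 2) \<delta>" and [measurable]: "g \<in> borel_measurable borel"
  and R_pos: "R > 0" and \<delta>: "0 < \<delta>" "\<delta> < d" and B_pos: "B > 0" and g_le: "negpow_integral \<delta> (pdisk 0 R) g \<le> ennreal (B / 2)"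
 obtains \<epsilon> \<delta>' where "\<epsilon> > 0" "\<delta> < \<delta>'" "\<delta>' \<le> d"
  "\<And>q. polynomial_map I q \<Longrightarrow> \<forall>z\<in>pdisk 0 R. norm (q z - g z) \<le> \<epsilon> \<Longrightarrow> negpow_integral \<delta>' (pdisk 0 (R / 2)) q \<le> ennreal B"
proof -
 obtain \<epsilon>1 \<delta>1 C where \<epsilon>1: "\<epsilon>1 > 0" and \<delta>1: "\<delta>1 > \<delta>" and C_finite: "C < \<infinity>"
  and bound: "\<And>q. polynomial_map I q \<Longrightarrow> \<forall>z\<in>pdisk 0 R. norm (q z - g z) \<le> \<epsilon>1 \<Longrightarrow> negpow_integral \<delta>1 (pdisk 0 (R / 2)) q \<le> C"
  using stable unfolding stable_on_def by metis
 define x where "x = B / (4 * (enn2real C + 1))"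
 have x_pos: "x > 0" using B_pos by (simp add: x_def add_nonneg_pos)
 have "x * enn2real C \<le> B / 4"
  using mult_left_mono[of "enn2real C" "enn2real C + 1" "B / 4"] B_pos by (simp add: x_def divide_le_eq add_nonneg_pos)
 then have x_C_le: "ennreal x * C \<le> ennreal (B / 4)"
  using C_finite x_pos by (metis ennreal_enn2real ennreal_leI ennreal_mult enn2real_nonneg infinity_ennreal_def less_imp_le)
 obtain \<delta>' \<epsilon>2 where \<delta>': "\<delta> < \<delta>'" "\<delta>' \<le> d" and \<epsilon>2: "\<epsilon>2 > 0"
  and perturb: "\<And>s t. 0 \<le> s \<Longrightarrow> 0 \<le> t \<Longrightarrow> \<bar>s - t\<bar> \<le> \<epsilon>2 \<Longrightarrow> negpow \<delta>' s \<le> ennreal (3 / 2) * negpow \<delta> t + ennreal x * negpow \<delta>1 s"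
  using negpow_perturbation[OF \<delta>(1) \<delta>1 \<delta>(2) x_pos] by blast
 have sub: "pdisk 0 (R / 2) \<subseteq> (pdisk 0 R :: (complex^'n) set)" using R_pos by (intro pdisk_mono) simp
 have "negpow_integral \<delta>' (pdisk 0 (R / 2)) q \<le> ennreal B"
  if q_poly: "polynomial_map I q" and close: "\<forall>z\<in>pdisk 0 R. norm (q z - g z) \<le> min \<epsilon>1 \<epsilon>2" for q
 proof -
  have [measurable]: "q \<in> borel_measurable borel" by (rule borel_measurable_polynomial_map[OF q_poly])
  have "\<bar>norm (q z) - norm (g z)\<bar> \<le> \<epsilon>2" if "z \<in> pdisk 0 (R / 2)" for z
   using order_trans[OF norm_triangle_ineq3[of "q z" "g z"]] close sub that by auto
  then have "negpow_integral \<delta>' (pdisk 0 (R / 2)) q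
    \<le> ennreal (3 / 2) * negpow_integral \<delta> (pdisk 0 (R / 2)) g + ennreal x * negpow_integral \<delta>1 (pdisk 0 (R / 2)) q"
   by (intro negpow_integral_le_add perturb) simp_all
  also have "\<dots> \<le> ennreal (3 / 2) * ennreal (B / 2) + ennreal (B / 4)"
   using close by (intro add_mono mult_left_mono order_trans[OF negpow_integral_mono[OF sub] g_le] order_trans[OF mult_left_mono[OF bound[OF q_poly]] x_C_le]) auto
  also have "\<dots> = ennreal B" using B_pos by (simp add: ennreal_mult[symmetric] ennreal_plus[symmetric] del: ennreal_plus)
  finally show ?thesis .
 qed
 then show thesis using that[of "min \<epsilon>1 \<epsilon>2" \<delta>'] \<epsilon>1 \<epsilon>2 \<delta>' by auto
qed

lemma (in slice_estimate) ex_good_slice: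
 fixes g :: "complex^'n \<Rightarrow> complex^'j::finite"
 assumes g_meas: "g \<in> borel_measurable borel" and finite: "negpow_integral \<delta> (pdisk 0 r) g < \<infinity>" and R_le_r: "R \<le> r"
 obtains w B where "w \<noteq> 0" "4 * norm w \<le> R" "B \<ge> 1" "slice_const * B * (norm w)\<^sup>2 \<le> 1"
  "negpow_integral \<delta> (pdisk 0 r) (\<lambda>z. g (vec_upd z k w)) \<le> ennreal (B / 2)"
proof -
 define \<kappa> where "\<kappa> = 1 / slice_const"
 have \<kappa>: "\<kappa> > 0" using slice_const_pos by (simp add: \<kappa>_def)
 define \<rho> where "\<rho> = min (R / 4) (min 1 \<kappa>)"
 have \<rho>: "0 < \<rho>" "\<rho> \<le> r" "\<rho> \<le> R / 4" "\<rho> \<le> 1" "\<rho> \<le> \<kappa>" using R_pos R_le_r \<kappa> by (auto simp: \<rho>_def)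
 obtain w where w_bounds: "w \<noteq> 0" "norm w < \<rho>"
  and slice_le: "negpow_integral \<delta> (pdisk 0 r) (\<lambda>z. g (vec_upd z k w)) \<le> ennreal (\<kappa> / 2 / (norm w)\<^sup>2)"
  using ex_small_slice[OF g_meas \<rho>(1,2) _ finite, of "\<kappa> / 2" k] \<kappa> by auto
 define B where "B = \<kappa> / (norm w)\<^sup>2"
 have w_sq: "(norm w)\<^sup>2 > 0" using w_bounds by simp
 have "(norm w)\<^sup>2 \<le> norm w * 1" unfolding power2_eq_square using w_bounds \<rho> by (intro mult_left_mono) auto
 then have "B \<ge> 1" unfolding B_def using w_sq w_bounds \<rho> by simp
 moreover have "slice_const * B * (norm w)\<^sup>2 \<le> 1" using w_sq slice_const_pos by (simp add: B_def \<kappa>_def)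
 moreover have "negpow_integral \<delta> (pdisk 0 r) (\<lambda>z. g (vec_upd z k w)) \<le> ennreal (B / 2)"
  using slice_le by (simp add: B_def mult.commute)
 moreover have "4 * norm w \<le> R" using w_bounds(2) \<rho>(3) by simp
 ultimately show thesis using w_bounds(1) that by blast
qed

lemma stable_on_neighbourhood:
 fixes g :: "complex^'n::finite \<Rightarrow> complex^'j::finite"
 assumes slice_stable: "\<And>w. norm w < R \<Longrightarrow> negpow_integral \<delta> (pdisk 0 R) (\<lambda>z. g (vec_upd z k w)) < \<infinity>
    \<Longrightarrow> stable_on I (\<lambda>z. g (vec_upd z k w)) R (R / 2) \<delta>"
  and g [measurable]: "g \<in> borel_measurable borel" and bounded: "\<And>z. z \<in> pdisk 0 R \<Longrightarrow> norm (g z) \<le> M"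
  and R_pos: "R > 0" and \<delta>: "\<delta> > 0" and finite: "negpow_integral \<delta> (pdisk 0 R) g < \<infinity>"
 shows "\<exists>s>0. stable_on (insert k I) g R s \<delta>"
proof -
 interpret slice_estimate k "R / 2" "M + 1" "\<delta> + 1" by unfold_locales (use R_pos in simp)
 obtain w B where w_bounds: "w \<noteq> 0" "4 * norm w \<le> R / 2" and B_bounds: "B \<ge> 1" "slice_const * B * (norm w)\<^sup>2 \<le> 1"
  and slice_le: "negpow_integral \<delta> (pdisk 0 R) (\<lambda>z. g (vec_upd z k w)) \<le> ennreal (B / 2)"
  using ex_good_slice[OF g finite] R_pos by auto
 have w_R: "norm w < R" using w_bounds(2) R_pos by linarith
 have in_pdisk: "vec_upd z k w \<in> pdisk 0 R" if "z \<in> pdisk 0 R" for z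
  using that w_R by (auto simp: pdisk_def)
 have "stable_on I (\<lambda>z. g (vec_upd z k w)) R (R / 2) \<delta>"
  using w_R by (intro slice_stable le_less_trans[OF slice_le]) auto
 then obtain \<epsilon> \<delta>' where \<epsilon>: "\<epsilon> > 0" and \<delta>': "\<delta> < \<delta>'" "\<delta>' \<le> \<delta> + 1" and slice_bound:
  "\<And>q. polynomial_map I q \<Longrightarrow> \<forall>z\<in>pdisk 0 R. norm (q z - g (vec_upd z k w)) \<le> \<epsilon> \<Longrightarrow> negpow_integral \<delta>' (pdisk 0 (R / 2)) q \<le> ennreal B"
  by (rule stable_on_perturbed_slice[where d = "\<delta> + 1" and B = B])
   (use R_pos \<delta> B_bounds slice_le in auto)
 have "negpow_integral \<delta>' (pdisk 0 (norm w)) p \<le> ennreal (slice_const * B)"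
  if p_poly: "polynomial_map (insert k I) p" and close: "\<forall>z\<in>pdisk 0 R. norm (p z - g z) \<le> min \<epsilon> 1" for p
 proof -
  have "norm (p z) \<le> M + 1" if "z \<in> pdisk 0 (R / 2)" for z
  proof -
   have "z \<in> pdisk 0 R" using that pdisk_mono[of "R / 2" R] R_pos by auto
   then show ?thesis using norm_triangle_ineq[of "p z - g z" "g z"] close bounded[of z] by force
  qed
  moreover have "negpow_integral \<delta>' (pdisk 0 (R / 2)) (\<lambda>z. p (vec_upd z k w)) \<le> ennreal B"
   using close in_pdisk by (intro slice_bound polynomial_map_vec_upd[OF p_poly]) auto
  ultimately interpret slice_bounded_map k "R / 2" "M + 1" "\<delta> + 1" p \<delta>' B w
   using p_poly \<delta> \<delta>' w_bounds B_bounds by unfold_locales (auto simp: polynomial_map_def)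
  show ?thesis by (rule negpow_integral_le)
 qed
 then have "stable_on (insert k I) g R (norm w) \<delta>"
  unfolding stable_on_def using \<epsilon> \<delta>'
  by (intro exI[of _ "min \<epsilon> 1"] exI[of _ \<delta>'] exI[of _ "ennreal (slice_const * B)"] conjI allI impI) auto
 then show ?thesis using w_bounds by (intro exI[of _ "norm w"]) simp
qed

lemma negpow_integral_pdisk_le_of_shift:
 fixes g p :: "complex^'n::finite \<Rightarrow> complex^'j::finite"
 assumes bound: "\<And>q. polynomial_map I q \<Longrightarrow> \<forall>z\<in>pdisk 0 (R - r). norm (q z - g (a + z)) \<le> \<epsilon> \<Longrightarrow> negpow_integral \<delta>' (pdisk 0 s) q \<le> C"
  and a_in: "a \<in> cpdisk 0 r" and p_poly: "polynomial_map I p" and close: "\<forall>z\<in>pdisk 0 R. norm (p z - g z) \<le> \<epsilon>" and \<delta>: "0 < \<delta>" "\<delta> \<le> \<delta>'"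
 shows "negpow_integral \<delta> (pdisk a s) p \<le> emeasure lborel (pdisk a s) + C"
proof -
 have [measurable]: "p \<in> borel_measurable borel" by (rule borel_measurable_polynomial_map[OF p_poly])
 have "\<forall>z\<in>pdisk 0 (R - r). norm (p (a + z) - g (a + z)) \<le> \<epsilon>" using close pdisk_shift[OF a_in] by blast
 then have "negpow_integral \<delta>' (pdisk 0 s) (\<lambda>z. p (a + z)) \<le> C" by (intro bound polynomial_map_shift[OF p_poly])
 then have "negpow_integral \<delta>' (pdisk a s) p \<le> C" by (subst negpow_integral_shift) auto
 then show ?thesis
  using \<delta> by (intro order_trans[OF negpow_integral_le_emeasure_add[of \<delta> \<delta>']] add_left_mono) auto
qed

lemma stable_on_finite_cover:
 fixes g :: "complex^'n::finite \<Rightarrow> complex^'j::finite"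
 assumes A_cover: "finite A" "A \<subseteq> cpdisk 0 r" "A \<noteq> {}" "cpdisk 0 r \<subseteq> (\<Union>a\<in>A. pdisk a (s a))" and \<delta>: "\<delta> > 0"
  and \<epsilon>: "\<And>a. a \<in> A \<Longrightarrow> \<epsilon> a > 0" and \<delta>': "\<And>a. a \<in> A \<Longrightarrow> \<delta>' a > \<delta>" and C_finite: "\<And>a. a \<in> A \<Longrightarrow> C a < \<infinity>"
  and bound: "\<And>a p. a \<in> A \<Longrightarrow> polynomial_map I p \<Longrightarrow> \<forall>z\<in>pdisk 0 (R - r). norm (p z - g (a + z)) \<le> \<epsilon> a
   \<Longrightarrow> negpow_integral (\<delta>' a) (pdisk 0 (s a)) p \<le> C a"
 shows "stable_on I g R r \<delta>"
proof -
 define \<epsilon>0 where "\<epsilon>0 = Min (\<epsilon> ` A)"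
 define \<delta>0 where "\<delta>0 = Min (\<delta>' ` A)"
 have \<epsilon>0: "\<epsilon>0 > 0" "\<And>a. a \<in> A \<Longrightarrow> \<epsilon>0 \<le> \<epsilon> a" unfolding \<epsilon>0_def using A_cover \<epsilon> by (auto simp: Min_gr_iff)
 have \<delta>0: "\<delta>0 > \<delta>" "\<And>a. a \<in> A \<Longrightarrow> \<delta>0 \<le> \<delta>' a" unfolding \<delta>0_def using A_cover \<delta>' by (auto simp: Min_gr_iff)
 define C0 where "C0 = (\<Sum>a\<in>A. emeasure lborel (pdisk a (s a)) + C a)"
 have "emeasure lborel (pdisk a (s a)) + C a < \<infinity>" if "a \<in> A" for a
  using C_finite[OF that] emeasure_pdisk_finite[of a "s a"] by auto
 then have "C0 < \<infinity>" unfolding C0_def using A_cover(1) by (auto simp: less_top)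
 moreover have "negpow_integral \<delta>0 (pdisk 0 r) p \<le> C0"
  if p_poly: "polynomial_map I p" and close: "\<forall>z\<in>pdisk 0 R. norm (p z - g z) \<le> \<epsilon>0" for p
 proof -
  have [measurable]: "p \<in> borel_measurable borel" by (rule borel_measurable_polynomial_map[OF p_poly])
  have "negpow_integral \<delta>0 (pdisk a (s a)) p \<le> emeasure lborel (pdisk a (s a)) + C a" if a_in: "a \<in> A" for a
  proof (rule negpow_integral_pdisk_le_of_shift[OF bound[OF a_in] _ p_poly])
   show "\<forall>z\<in>pdisk 0 R. norm (p z - g z) \<le> \<epsilon> a" using close \<epsilon>0(2)[OF a_in] by (meson order_trans)
  qed (use A_cover(2) a_in \<delta> \<delta>0 in auto)
  then have "(\<Sum>a\<in>A. negpow_integral \<delta>0 (pdisk a (s a)) p) \<le> C0" unfolding C0_def by (rule sum_mono)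
  moreover have "pdisk 0 r \<subseteq> (\<Union>a\<in>A. pdisk a (s a))" using pdisk_subset_cpdisk A_cover(4) by (rule order_trans)
  ultimately show ?thesis using A_cover(1) by (intro order_trans[OF negpow_integral_le_sum_cover]) auto
 qed
 ultimately show ?thesis
  unfolding stable_on_def using \<epsilon>0(1) \<delta>0(1)
  by (intro exI[of _ \<epsilon>0] exI[of _ \<delta>0] exI[of _ C0] conjI allI impI)
qed

lemma stable_on_cover:
 fixes g :: "complex^'n::finite \<Rightarrow> complex^'j::finite"
 assumes r_bounds: "0 < r" "r < R" and \<delta>: "\<delta> > 0"
  and local: "\<And>a. a \<in> cpdisk 0 r \<Longrightarrow> \<exists>s>0. stable_on I (\<lambda>z. g (a + z)) (R - r) s \<delta>"
 shows "stable_on I g R r \<delta>"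
proof -
 let ?K = "cpdisk 0 r :: (complex^'n) set"
 define stable where "stable a s \<epsilon> \<delta>' C \<longleftrightarrow> s > 0 \<and> \<epsilon> > 0 \<and> \<delta>' > \<delta> \<and> C < \<infinity> \<and> (\<forall>p. polynomial_map I p \<longrightarrow>
   (\<forall>z\<in>pdisk 0 (R - r). norm (p z - g (a + z)) \<le> \<epsilon>) \<longrightarrow> negpow_integral \<delta>' (pdisk 0 s) p \<le> C)" for a s \<epsilon> \<delta>' C
 have "\<exists>s \<epsilon> \<delta>' C. stable a s \<epsilon> \<delta>' C" if "a \<in> ?K" for a
  using local[OF that] unfolding stable_on_def stable_def by metis
 then obtain s \<epsilon> \<delta>' C where "\<And>a. a \<in> ?K \<Longrightarrow> stable a (s a) (\<epsilon> a) (\<delta>' a) (C a)" by metis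
 then have s_pos: "\<And>a. a \<in> ?K \<Longrightarrow> s a > 0" and \<epsilon>: "\<And>a. a \<in> ?K \<Longrightarrow> \<epsilon> a > 0"
  and \<delta>': "\<And>a. a \<in> ?K \<Longrightarrow> \<delta>' a > \<delta>" and C_finite: "\<And>a. a \<in> ?K \<Longrightarrow> C a < \<infinity>"
  and bound: "\<And>a p. a \<in> ?K \<Longrightarrow> polynomial_map I p \<Longrightarrow> \<forall>z\<in>pdisk 0 (R - r). norm (p z - g (a + z)) \<le> \<epsilon> a
   \<Longrightarrow> negpow_integral (\<delta>' a) (pdisk 0 (s a)) p \<le> C a"
  unfolding stable_def by blast+
 have "?K \<subseteq> (\<Union>a\<in>?K. pdisk a (s a))" using s_pos by (force simp: pdisk_def)
 then obtain A where A_cover: "A \<subseteq> ?K" "finite A" "?K \<subseteq> (\<Union>a\<in>A. pdisk a (s a))"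
  by (rule compactE_image[OF compact_cpdisk open_pdisk])
 have "0 \<in> ?K" using r_bounds by (simp add: cpdisk_def)
 then have "A \<noteq> {}" using A_cover by auto
 with A_cover \<epsilon> \<delta>' C_finite bound show ?thesis by (intro stable_on_finite_cover[OF A_cover(2,1) _ A_cover(3) \<delta>, of \<epsilon> \<delta>' C]) auto
qed

lemma negpow_integral_0:
 assumes "r > 0" shows "negpow_integral \<delta> (pdisk 0 r) (\<lambda>z :: complex^'n::finite. 0 :: complex^'j::finite) = \<infinity>"
proof -
 have "negpow_integral \<delta> (pdisk 0 r) (\<lambda>z :: complex^'n. 0 :: complex^'j) = (\<integral>\<^sup>+z. \<infinity> * indicator (pdisk (0::complex^'n) r) z \<partial>lborel)"
  unfolding negpow_integral_def by (intro nn_integral_cong) (simp add: negpow_def)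
 also have "\<dots> = \<infinity>"
  using emeasure_pdisk_pos[of r "0::complex^'n"] assms by (subst nn_integral_cmult_indicator) (auto simp: ennreal_top_mult)
 finally show ?thesis .
qed

lemma stable_on_constant:
 fixes g :: "complex^'n::finite \<Rightarrow> complex^'j::finite"
 assumes "depends_on {} g" and r_bounds: "0 < r" "r < R" and finite: "negpow_integral \<delta> (pdisk 0 R) g < \<infinity>"
 shows "stable_on {} g R r \<delta>"
proof -
 have g_const: "g z = g 0" for z using assms(1) by (simp add: depends_on_def)
 have "g 0 \<noteq> 0"
 proof
  assume "g 0 = 0"
  then have "negpow_integral \<delta> (pdisk 0 R) g = negpow_integral \<delta> (pdisk 0 R) (\<lambda>z :: complex^'n. 0 :: complex^'j)"
   by (intro negpow_integral_cong) (subst g_const, simp)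
  then show False using finite negpow_integral_0[where 'n = 'n and 'j = 'j, of R \<delta>] r_bounds by simp
 qed
 define c where "c = norm (g 0) / 2"
 define \<delta>' where "\<delta>' = \<bar>\<delta>\<bar> + 1"
 define C where "C = negpow \<delta>' c * emeasure lborel (pdisk (0::complex^'n) r)"
 have c_pos: "c > 0" using \<open>g 0 \<noteq> 0\<close> by (simp add: c_def)
 have "negpow_integral \<delta>' (pdisk 0 r) p \<le> C" if close: "\<forall>z\<in>pdisk 0 R. norm (p z - g z) \<le> c" for p :: "complex^'n \<Rightarrow> complex^'j"
 proof -
  have "negpow \<delta>' (norm (p z)) * indicator (pdisk 0 r) z \<le> negpow \<delta>' c * indicator (pdisk 0 r) z" for z
  proof (cases "z \<in> pdisk 0 r")
   case True
   then have "z \<in> pdisk 0 R" using pdisk_mono[of r R] r_bounds by auto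
   then have "norm (p z - g 0) \<le> c" using close g_const[of z] by metis
   then have "c \<le> norm (p z)" using norm_triangle_ineq2[of "g 0" "g 0 - p z"] by (simp add: c_def norm_minus_commute)
   then show ?thesis using c_pos True by (simp add: negpow_antimono \<delta>'_def)
  qed simp
  then have "negpow_integral \<delta>' (pdisk 0 r) p \<le> (\<integral>\<^sup>+z. negpow \<delta>' c * indicator (pdisk (0::complex^'n) r) z \<partial>lborel)"
   unfolding negpow_integral_def by (rule nn_integral_mono)
  also have "\<dots> = C" unfolding C_def by (rule nn_integral_cmult_indicator) simp
  finally show ?thesis .
 qed
 moreover have "C < \<infinity>"
  using emeasure_pdisk_finite[of "0::complex^'n" r] c_pos by (simp add: C_def negpow_def ennreal_mult_less_top)
 moreover have "\<delta>' > \<delta>" by (simp add: \<delta>'_def)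
 ultimately show ?thesis
  unfolding stable_on_def using c_pos by (intro exI[of _ c] exI[of _ \<delta>'] exI[of _ C] conjI allI impI)
qed

theorem stable_on_pdisk:
 fixes g :: "complex^'n::finite \<Rightarrow> complex^'j::finite"
 assumes "finite I" "g \<in> borel_measurable borel" "depends_on I g" "\<And>z. z \<in> pdisk 0 R \<Longrightarrow> norm (g z) \<le> M"
  "0 < r" "r < R" "\<delta> > 0" "negpow_integral \<delta> (pdisk 0 R) g < \<infinity>"
 shows "stable_on I g R r \<delta>"
 using assms
proof (induction I arbitrary: g R r rule: finite_induct)
 case empty
 then show ?case by (intro stable_on_constant) auto
next
 case (insert k I)
 note [measurable] = insert.prems(1)
 show ?case
 proof (rule stable_on_cover[OF insert.prems(4-6)])
  fix a :: "complex^'n" assume a_in: "a \<in> cpdisk 0 r"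
  let ?g = "\<lambda>z. g (a + z)"
  show "\<exists>s>0. stable_on (insert k I) ?g (R - r) s \<delta>"
  proof (rule stable_on_neighbourhood)
   show "norm (?g z) \<le> M" if "z \<in> pdisk 0 (R - r)" for z by (rule insert.prems(3)[OF pdisk_shift[OF a_in that]])
   have "pdisk a (R - r) \<subseteq> pdisk 0 R"
    using pdisk_shift[OF a_in, of "_ - a" R] by (force simp: pdisk_def)
   then show "negpow_integral \<delta> (pdisk 0 (R - r)) ?g < \<infinity>"
    using insert.prems(7) by (subst negpow_integral_shift[symmetric]) (auto intro: le_less_trans[OF negpow_integral_mono])
   fix w :: complex assume w_less: "norm w < R - r"
   show "stable_on I (\<lambda>z. ?g (vec_upd z k w)) (R - r) ((R - r) / 2) \<delta>"
    if "negpow_integral \<delta> (pdisk 0 (R - r)) (\<lambda>z. ?g (vec_upd z k w)) < \<infinity>"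
   proof (rule insert.IH)
    show "depends_on I (\<lambda>z. ?g (vec_upd z k w))" using insert.prems(2) by (simp add: depends_on_def)
    show "norm (?g (vec_upd z k w)) \<le> M" if "z \<in> pdisk 0 (R - r)" for z
     using that w_less by (intro insert.prems(3) pdisk_shift[OF a_in]) (auto simp: pdisk_def)
   qed (use insert.prems that in auto)
  qed (use insert.prems in auto)
 qed
qed

definition poly_approximable :: "(complex^'n::finite) set \<Rightarrow> (complex^'n \<Rightarrow> complex) \<Rightarrow> bool" where
 "poly_approximable K u \<longleftrightarrow> (\<forall>\<epsilon>>0. \<exists>p. complex_polynomial p \<and> (\<forall>z\<in>K. dist (p z) (u z) < \<epsilon>))"

lemma poly_approximable_polynomial: "complex_polynomial p \<Longrightarrow> poly_approximable K p"
 unfolding poly_approximable_def by (metis dist_self)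

lemma poly_approximable_uniform_limit:
 assumes v_poly: "\<And>m::nat. poly_approximable K (v m)" and lim: "uniform_limit K v u sequentially"
 shows "poly_approximable K u"
 unfolding poly_approximable_def
proof (intro allI impI)
 fix \<epsilon> :: real assume "\<epsilon> > 0"
 then have half: "\<epsilon> / 2 > 0" by simp
 obtain m where m_close: "\<forall>z\<in>K. dist (v m z) (u z) < \<epsilon> / 2"
  using lim half unfolding uniform_limit_sequentially_iff by blast
 obtain p where p_approx: "complex_polynomial p" "\<forall>z\<in>K. dist (p z) (v m z) < \<epsilon> / 2"
  using v_poly[of m] half unfolding poly_approximable_def by blast
 have "\<forall>z\<in>K. dist (p z) (u z) < \<epsilon>" using m_close p_approx(2) dist_triangle_half_l[of "p _" "v m _" \<epsilon>] by (metis dist_commute)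
 with p_approx(1) show "\<exists>p. complex_polynomial p \<and> (\<forall>z\<in>K. dist (p z) (u z) < \<epsilon>)" by blast
qed

lemma poly_approximable_obtains_uniform_limit:
 assumes "poly_approximable K u"
 obtains p :: "nat \<Rightarrow> _" where "\<And>m. complex_polynomial (p m)" "uniform_limit K p u sequentially"
proof -
 have "\<forall>m::nat. \<exists>p. complex_polynomial p \<and> (\<forall>z\<in>K. dist (p z) (u z) < inverse (Suc m))"
  using assms unfolding poly_approximable_def by simp
 then obtain p where p_poly: "\<And>m. complex_polynomial (p m)" and dist: "\<And>m z. z \<in> K \<Longrightarrow> dist (p m z) (u z) < inverse (Suc m)"
  by metis
 have "uniform_limit K p u sequentially"
 proof (rule uniform_limitI)
  fix \<epsilon> :: real assume "\<epsilon> > 0"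
  then have "\<forall>\<^sub>F m in sequentially. inverse (real (Suc m)) < \<epsilon>"
   by (rule order_tendstoD(2)[OF LIMSEQ_inverse_real_of_nat])
  then show "\<forall>\<^sub>F m in sequentially. \<forall>z\<in>K. dist (p m z) (u z) < \<epsilon>"
   by eventually_elim (use dist in \<open>force intro: less_trans\<close>)
 qed
 with p_poly show thesis by (rule that)
qed

lemma bounded_poly_approximable_image:
 assumes "poly_approximable K u" "compact K" shows "bounded (u ` K)"
proof -
 obtain p where p_approx: "\<And>m. complex_polynomial (p m)" "uniform_limit K p u sequentially"
  using poly_approximable_obtains_uniform_limit[OF assms(1)] by blast
 have "continuous_on K u"
  by (rule uniform_limit_theorem[OF always_eventually p_approx(2)]) (auto intro!: continuous_on_subset[OF Ck_cont[OF complex_polynomial_Ck[OF p_approx(1)]]])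
 then show ?thesis using assms(2) by (intro compact_imp_bounded compact_continuous_image)
qed

lemma poly_approximable_add:
 assumes "poly_approximable K u" "poly_approximable K v" shows "poly_approximable K (\<lambda>z. u z + v z)"
proof -
 obtain p q where p_approx: "\<And>m. complex_polynomial (p m)" "uniform_limit K p u sequentially"
  and q_approx: "\<And>m. complex_polynomial (q m)" "uniform_limit K q v sequentially"
  using assms by (meson poly_approximable_obtains_uniform_limit)
 show ?thesis
  by (rule poly_approximable_uniform_limit[OF poly_approximable_polynomial[OF complex_polynomial_add[OF p_approx(1) q_approx(1)]]
    uniform_limit_add[OF p_approx(2) q_approx(2)]])
qed

lemma poly_approximable_mult:
 assumes u_poly: "poly_approximable K u" and v_poly: "poly_approximable K v" and K_compact: "compact K"
 shows "poly_approximable K (\<lambda>z. u z * v z)"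
proof -
 obtain p q where p_approx: "\<And>m. complex_polynomial (p m)" "uniform_limit K p u sequentially"
  and q_approx: "\<And>m. complex_polynomial (q m)" "uniform_limit K q v sequentially"
  using u_poly v_poly by (meson poly_approximable_obtains_uniform_limit)
 show ?thesis
  by (rule poly_approximable_uniform_limit[OF poly_approximable_polynomial[OF complex_polynomial_mult[OF p_approx(1) q_approx(1)]]
    uniform_lim_mult[OF p_approx(2) q_approx(2) bounded_poly_approximable_image[OF u_poly K_compact] bounded_poly_approximable_image[OF v_poly K_compact]]])
qed

lemma poly_approximable_sum:
 "(\<And>i. i \<in> A \<Longrightarrow> poly_approximable K (f i)) \<Longrightarrow> poly_approximable K (\<lambda>z. \<Sum>i\<in>A. f i z)"
 by (induction A rule: infinite_finite_induct)
  (auto intro: poly_approximable_add poly_approximable_polynomial complex_polynomial_const)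

lemma poly_approximable_geometric:
 fixes k :: "'n::finite"
 assumes R_bounds: "0 < R" "R < norm \<xi>"
 shows "poly_approximable (cpdisk 0 R) (\<lambda>z::complex^'n. 1 / (1 - z $ k / \<xi>))"
proof (rule poly_approximable_uniform_limit)
 let ?f = "\<lambda>l (z::complex^'n). ((1 / \<xi>) * z $ k) ^ l"
 show "poly_approximable (cpdisk 0 R) (\<lambda>z. \<Sum>l<m. ?f l z)" for m
  by (intro poly_approximable_polynomial complex_polynomial_sum complex_polynomial_power complex_polynomial_mult
    complex_polynomial_const complex_polynomial_nth)
 define q where "q = R / norm \<xi>"
 have "norm \<xi> > 0" using R_bounds by linarith
 then have q_bounds: "0 < q" "q < 1" using R_bounds by (simp_all add: q_def)
 have ratio: "norm ((1 / \<xi>) * z $ k) \<le> q" if "z \<in> cpdisk 0 R" for z :: "complex^'n"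
  using that R_bounds by (auto simp: q_def norm_divide cpdisk_def intro: divide_right_mono)
 have "uniform_limit (cpdisk 0 R) (\<lambda>m z. \<Sum>l<m. ?f l z) (\<lambda>z. \<Sum>l. ?f l z) sequentially"
 proof (rule Weierstrass_m_test)
  show "summable (\<lambda>l. q ^ l)" using q_bounds by (simp add: summable_geometric)
  show "norm (?f l z) \<le> q ^ l" if "z \<in> cpdisk 0 R" for l z
   using power_mono[OF ratio[OF that] norm_ge_zero, of l] by (simp add: norm_power)
 qed
 moreover have "(\<Sum>l. ?f l z) = 1 / (1 - z $ k / \<xi>)" if "z \<in> cpdisk 0 R" for z
  using suminf_geometric[of "(1 / \<xi>) * z $ k"] ratio[OF that] q_bounds by simp
 ultimately show "uniform_limit (cpdisk 0 R) (\<lambda>m z. \<Sum>l<m. ?f l z) (\<lambda>z. 1 / (1 - z $ k / \<xi>)) sequentially"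
  unfolding uniform_limit_iff by simp
qed

lemma riemann_sum_bound:
 fixes f :: "real \<Rightarrow> complex"
 assumes f_cont: "continuous_on {0..1} f" and N_pos: "N > 0" and n_le: "n \<le> N"
  and close: "\<And>x y. x \<in> {0..1} \<Longrightarrow> y \<in> {0..1} \<Longrightarrow> \<bar>x - y\<bar> \<le> 1 / real N \<Longrightarrow> norm (f x - f y) \<le> \<epsilon>"
 shows "norm (integral {0..real n / real N} f - (\<Sum>l<n. of_real (1 / real N) * f (real l / real N))) \<le> \<epsilon> * (real n / real N)"
 using n_le
proof (induction n)
 case (Suc n)
 define a b where "a = real n / real N" and "b = real (Suc n) / real N"
 have width: "b - a = 1 / real N" using N_pos by (simp add: a_def b_def diff_divide_distrib[symmetric])
 have a_b_bounds: "a \<le> b" "0 \<le> a" "b \<le> 1"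
  using Suc.prems N_pos by (simp_all add: a_def b_def divide_le_eq_1 divide_right_mono)
 then have cont: "continuous_on {a..b} f" "continuous_on {0..b} f" by (auto intro: continuous_on_subset[OF f_cont])
 have "norm (integral {a..b} (\<lambda>x. f x - f a)) \<le> \<epsilon> * (b - a)"
  using a_b_bounds width by (intro integral_bound continuous_on_diff continuous_on_const cont close) auto
 moreover have "integral {a..b} (\<lambda>x. f x - f a) = integral {a..b} f - of_real (b - a) * f a"
  using a_b_bounds by (subst Henstock_Kurzweil_Integration.integral_diff) (auto intro!: integrable_continuous_real cont simp: scaleR_conv_of_real)
 moreover have "integral {0..a} f + integral {a..b} f = integral {0..b} f"
  using a_b_bounds by (intro Henstock_Kurzweil_Integration.integral_combine integrable_continuous_real cont) auto
  ultimately have step: "norm ((integral {0..b} f - integral {0..a} f) - of_real (1 / real N) * f a) \<le> \<epsilon> * (1 / real N)"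
  by (simp only: width[symmetric]) (metis add_diff_cancel_left')
 have "integral {0..b} f - (\<Sum>l<Suc n. of_real (1 / real N) * f (real l / real N)) =
   (integral {0..a} f - (\<Sum>l<n. of_real (1 / real N) * f (real l / real N))) + ((integral {0..b} f - integral {0..a} f) - of_real (1 / real N) * f a)"
  by (simp add: a_def)
 moreover have "norm (integral {0..a} f - (\<Sum>l<n. of_real (1 / real N) * f (real l / real N))) \<le> \<epsilon> * a"
  unfolding a_def using Suc.prems by (intro Suc.IH) simp
 moreover have "\<epsilon> * a + \<epsilon> * (1 / real N) = \<epsilon> * b" using width by (simp only: distrib_left[symmetric]) simp
 ultimately show ?case using norm_triangle_mono[OF _ step] unfolding b_def by metis
qed simp

lemma poly_approximable_integral:
 fixes \<Psi> :: "complex^'n::finite \<Rightarrow> real \<Rightarrow> complex"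
 assumes cont: "continuous_on (K \<times> {0..1}) (\<lambda>p. \<Psi> (fst p) (snd p))" and K_compact: "compact K"
  and approx: "\<And>x. poly_approximable K (\<lambda>z. \<Psi> z x)"
 shows "poly_approximable K (\<lambda>z. integral {0..1} (\<Psi> z))"
proof (rule poly_approximable_uniform_limit)
 let ?S = "\<lambda>m z. \<Sum>l<Suc m. of_real (1 / real (Suc m)) * \<Psi> z (real l / real (Suc m))"
 show "poly_approximable K (?S m)" for m
  by (intro poly_approximable_sum poly_approximable_mult K_compact approx poly_approximable_polynomial[OF complex_polynomial_const])
 show "uniform_limit K ?S (\<lambda>z. integral {0..1} (\<Psi> z)) sequentially"
 proof (rule uniform_limitI)
  fix \<epsilon> :: real assume \<epsilon>: "\<epsilon> > 0"
  have "uniformly_continuous_on (K \<times> {0..1}) (\<lambda>p. \<Psi> (fst p) (snd p))"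
   by (intro compact_uniformly_continuous cont compact_Times K_compact compact_Icc)
  moreover have "\<epsilon> / 2 > 0" using \<epsilon> by simp
  ultimately obtain d where d_pos: "d > 0"
   and close: "\<And>p q. p \<in> K \<times> {0..1} \<Longrightarrow> q \<in> K \<times> {0..1} \<Longrightarrow> dist q p < d \<Longrightarrow> dist (\<Psi> (fst q) (snd q)) (\<Psi> (fst p) (snd p)) < \<epsilon> / 2"
   unfolding uniformly_continuous_on_def by meson
  have "\<forall>\<^sub>F m in sequentially. 1 / real (Suc m) < d"
   using order_tendstoD(2)[OF LIMSEQ_inverse_real_of_nat d_pos] by (simp add: inverse_eq_divide)
  then show "\<forall>\<^sub>F m in sequentially. \<forall>z\<in>K. dist (?S m z) (integral {0..1} (\<Psi> z)) < \<epsilon>"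
  proof (eventually_elim, intro ballI)
   fix m z assume m_large: "1 / real (Suc m) < d" and z_in: "z \<in> K"
   have "norm (integral {0..real (Suc m) / real (Suc m)} (\<Psi> z) - ?S m z) \<le> \<epsilon> / 2 * (real (Suc m) / real (Suc m))"
   proof (rule riemann_sum_bound)
    have "continuous_on {0..1} (\<lambda>x. \<Psi> (fst (z, x)) (snd (z, x)))"
     by (rule continuous_on_compose2[OF cont, of _ "\<lambda>x. (z, x)"]) (use z_in in \<open>auto intro!: continuous_intros\<close>)
    then show "continuous_on {0..1} (\<Psi> z)" by simp
    fix x y :: real assume x_y_close: "x \<in> {0..1}" "y \<in> {0..1}" "\<bar>x - y\<bar> \<le> 1 / real (Suc m)"
    then have "dist (z, x) (z, y) < d" using m_large by (simp add: dist_Pair_Pair dist_real_def)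
    from close[OF _ _ this] z_in x_y_close show "norm (\<Psi> z x - \<Psi> z y) \<le> \<epsilon> / 2" by (simp add: dist_norm less_imp_le)
   qed auto
   then show "dist (?S m z) (integral {0..1} (\<Psi> z)) < \<epsilon>" using \<epsilon> by (simp add: dist_norm norm_minus_commute)
  qed
 qed
qed

text \<open>Cauchy's formula in one variable at a time; \<open>vec_mix I z a\<close> carries the variables already treated.\<close>

lemma poly_approximable_vec_mix:
 fixes h :: "complex^'n::finite \<Rightarrow> complex"
 assumes h_cont: "continuous_on (pdisk 0 R0) h"
  and hol: "\<And>z k. z \<in> pdisk 0 R0 \<Longrightarrow> (\<lambda>t. h (vec_upd z k t)) holomorphic_on ball 0 R0"
  and R_bounds: "0 < R" "R < R1" "R1 < R0" and "finite I" and a_in: "a \<in> cpdisk 0 R1"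
 shows "poly_approximable (cpdisk 0 R) (\<lambda>z. h (vec_mix I z a))"
 using \<open>finite I\<close> a_in
proof (induction I arbitrary: a rule: finite_induct)
 case empty
 then show ?case by (simp add: poly_approximable_polynomial complex_polynomial_const)
next
 case (insert k I)
 let ?\<xi> = "circlepath 0 R1"
 have \<xi>: "norm (?\<xi> x) = R1" "?\<xi> x \<noteq> 0" for x using R_bounds by (auto simp: circlepath norm_mult norm_exp_eq_Re)
 have \<xi>_cont: "continuous_on S (\<lambda>p. ?\<xi> (snd p))" for S :: "((complex^'n) \<times> real) set"
  unfolding circlepath by (intro continuous_intros)
 have a_upd: "vec_upd a k (?\<xi> x) \<in> cpdisk 0 R1" for x using insert.prems \<xi> by (auto simp: cpdisk_def)
 have in_pdisk: "vec_mix I z b \<in> pdisk 0 R0" if "z \<in> cpdisk 0 R" "b \<in> cpdisk 0 R1" for z b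
  using that R_bounds by (auto simp: vec_mix_def cpdisk_def pdisk_def intro: le_less_trans) 
 have z_k_less: "norm (z $ k) < R1" if "z \<in> cpdisk 0 R" for z :: "complex^'n"
  using that R_bounds by (auto simp: cpdisk_def intro: le_less_trans)
 define \<Psi> where "\<Psi> z x = h (vec_mix I z (vec_upd a k (?\<xi> x))) * (1 / (1 - z $ k / ?\<xi> x))" for z x
 have "continuous_on (cpdisk 0 R \<times> {0..1}) (\<lambda>p. h (vec_mix I (fst p) (vec_upd a k (?\<xi> (snd p)))))"
  using in_pdisk a_upd by (intro continuous_on_compose2[OF h_cont] continuous_intros \<xi>_cont) auto
 moreover have "1 - z $ k / ?\<xi> x \<noteq> 0" if "z \<in> cpdisk 0 R" for z x using \<xi>[of x] z_k_less[OF that] by auto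
 ultimately have \<Psi>_cont: "continuous_on (cpdisk 0 R \<times> {0..1}) (\<lambda>p. \<Psi> (fst p) (snd p))"
  unfolding \<Psi>_def using \<xi>(2) by (intro continuous_on_mult continuous_on_divide continuous_intros \<xi>_cont) auto
 have formula: "integral {0..1} (\<Psi> z) = h (vec_mix (insert k I) z a)" if z_in: "z \<in> cpdisk 0 R" for z
 proof -
  have "(\<lambda>t. h (vec_upd (vec_mix I z a) k t)) holomorphic_on cball 0 R1"
   by (rule holomorphic_on_subset[OF hol[OF in_pdisk[OF z_in insert.prems]]]) (use R_bounds in auto)
  from Cauchy_formula_unit_interval[OF this z_k_less[OF z_in]] show ?thesis
   using insert.hyps by (simp add: \<Psi>_def[abs_def] vec_mix_vec_upd vec_mix_insert integral_unique)
 qed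
 have "poly_approximable (cpdisk 0 R) (\<lambda>z. \<Psi> z x)" for x
  unfolding \<Psi>_def using R_bounds \<xi> by (intro poly_approximable_mult compact_cpdisk insert.IH a_upd poly_approximable_geometric) auto
 from poly_approximable_integral[OF \<Psi>_cont compact_cpdisk this]
 show ?case by (rule poly_approximable_uniform_limit[of _ "\<lambda>_. _"]) (simp add: formula uniform_limit_iff)
qed

lemma poly_approximable_holomorphic:
 fixes h :: "complex^'n::finite \<Rightarrow> complex"
 assumes "continuous_on (pdisk 0 R0) h" "\<And>z k. z \<in> pdisk 0 R0 \<Longrightarrow> (\<lambda>t. h (vec_upd z k t)) holomorphic_on ball 0 R0"
  and R_bounds: "0 < R" "R < R0"
 shows "poly_approximable (cpdisk 0 R) h"
proof -
 obtain R1 where R1_bounds: "R < R1" "R1 < R0" using dense[OF R_bounds(2)] by blast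
 have "(0::complex^'n) \<in> cpdisk 0 R1" using R_bounds(1) R1_bounds(1) by (simp add: cpdisk_def)
 from poly_approximable_vec_mix[where I = UNIV, OF assms(1,2) R_bounds(1) R1_bounds finite this] show ?thesis by simp
qed

lemma polynomial_map_uniform_limit:
 fixes h :: "complex^'n::finite \<Rightarrow> complex^'j::finite"
 assumes "\<And>j. poly_approximable K (\<lambda>z. h z $ j)"
 obtains p :: "nat \<Rightarrow> _" where "\<And>m. polynomial_map UNIV (p m)" "uniform_limit K p h sequentially"
proof -
 have "\<exists>q. (\<forall>m::nat. complex_polynomial (q m)) \<and> uniform_limit K q (\<lambda>z. h z $ j) sequentially" for j
  using poly_approximable_obtains_uniform_limit[OF assms[of j]] by blast
 then obtain q where q_approx: "\<And>j m. complex_polynomial (q j (m::nat))" "\<And>j. uniform_limit K (q j) (\<lambda>z. h z $ j) sequentially" by metis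
 define p where "p m z = (\<chi> j. q j m z)" for m z
 have "polynomial_map UNIV (p m)" for m
  using q_approx(1) by (auto simp: polynomial_map_def p_def depends_on_def vec_eq_iff[symmetric])
 moreover have "uniform_limit K p h sequentially"
 proof (rule uniform_limitI)
  fix \<epsilon> :: real assume "\<epsilon> > 0"
  then have "\<epsilon> / real CARD('j) > 0" by simp
  then have "\<forall>\<^sub>F m in sequentially. \<forall>j. \<forall>z\<in>K. dist (q j m z) (h z $ j) < \<epsilon> / real CARD('j)"
   using q_approx(2) unfolding uniform_limit_iff by (intro eventually_all_finite) blast
  then show "\<forall>\<^sub>F m in sequentially. \<forall>z\<in>K. dist (p m z) (h z) < \<epsilon>"
  proof (eventually_elim, intro ballI)
   fix m z assume close: "\<forall>j. \<forall>z\<in>K. dist (q j m z) (h z $ j) < \<epsilon> / real CARD('j)" and z_in: "z \<in> K"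
   have "norm (p m z - h z) \<le> (\<Sum>j\<in>UNIV. norm ((p m z - h z) $ j))" by (simp add: norm_vec_def L2_set_le_sum)
   also have "\<dots> < (\<Sum>j\<in>(UNIV::'j set). \<epsilon> / real CARD('j))"
    using close z_in by (intro sum_strict_mono) (auto simp: p_def dist_norm)
   finally show "dist (p m z) (h z) < \<epsilon>" by (simp add: dist_norm)
  qed
 qed
 ultimately show thesis by (rule that)
qed

lemma continuous_on_Times_slice:
 assumes "continuous_on (S \<times> T) (\<lambda>p. f (fst p) (snd p))"
 shows "y \<in> T \<Longrightarrow> continuous_on S (\<lambda>x. f x y)" and "x \<in> S \<Longrightarrow> continuous_on T (f x)"
proof -
 assume y_in: "y \<in> T"
 have "continuous_on S (\<lambda>x. f (fst (x, y)) (snd (x, y)))"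
  by (rule continuous_on_compose2[OF assms]) (use y_in in \<open>auto intro!: continuous_intros\<close>)
 then show "continuous_on S (\<lambda>x. f x y)" by simp
next
 assume x_in: "x \<in> S"
 have "continuous_on T (\<lambda>y. f (fst (x, y)) (snd (x, y)))"
  by (rule continuous_on_compose2[OF assms]) (use x_in in \<open>auto intro!: continuous_intros\<close>)
 then show "continuous_on T (f x)" by simp
qed

locale bounded_family =
 fixes g :: "complex^'n::finite \<Rightarrow> 'c::metric_space \<Rightarrow> complex^'j::finite" and S :: "(complex^'n) set" and T :: "'c set"
  and \<delta> \<delta>' C :: real
 assumes continuous: "continuous_on (S \<times> T) (\<lambda>p. g (fst p) (snd p))"
  and S_sets: "S \<in> sets borel" and S_finite: "emeasure lborel S < \<infinity>"
  and exponents: "0 < \<delta>" "\<delta> < \<delta>'"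
  and bounded: "c \<in> T \<Longrightarrow> negpow_integral \<delta>' S (\<lambda>z. g z c) \<le> ennreal C" and C_nonneg: "C \<ge> 0"
begin

definition truncated :: "real \<Rightarrow> 'c \<Rightarrow> complex^'n \<Rightarrow> real" where
 "truncated \<eta> c z = indicator S z * (max (norm (g z c)) \<eta>) powr (- \<delta>)"

lemma continuous_on_g: "c \<in> T \<Longrightarrow> continuous_on S (\<lambda>z. g z c)" "z \<in> S \<Longrightarrow> continuous_on T (g z)"
 using continuous_on_Times_slice[OF continuous] by auto

lemma borel_measurable_extended_g:
 assumes "c \<in> T" shows "(\<lambda>z. if z \<in> S then g z c else 0) \<in> borel_measurable borel"
 by (rule borel_measurable_continuous_on_if[OF S_sets continuous_on_g(1)[OF assms]]) simp

lemma borel_measurable_truncated: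
 assumes c_in: "c \<in> T" shows "truncated \<eta> c \<in> borel_measurable borel"
proof -
 note [measurable] = borel_measurable_extended_g[OF c_in] S_sets
 have "truncated \<eta> c = (\<lambda>z. indicator S z * (max (norm (if z \<in> S then g z c else 0)) \<eta>) powr (- \<delta>))"
  by (auto simp: truncated_def fun_eq_iff)
 then show ?thesis by simp
qed

lemma norm_truncated_le: "\<eta> > 0 \<Longrightarrow> norm (truncated \<eta> c z) \<le> \<eta> powr (- \<delta>) * indicator S z"
 using exponents by (auto simp: truncated_def indicator_def intro!: powr_mono2')

lemma integrable_bound_truncated: "integrable lborel (\<lambda>z. \<eta> powr (- \<delta>) * indicator S z)"
 using S_sets S_finite by (intro integrable_mult_right integrable_real_indicator) auto

lemma integrable_truncated: "c \<in> T \<Longrightarrow> \<eta> > 0 \<Longrightarrow> integrable lborel (truncated \<eta> c)"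
 using norm_truncated_le borel_measurable_truncated
 by (intro Bochner_Integration.integrable_bound[OF integrable_bound_truncated[of \<eta>]])
  (auto intro: order_trans[OF _ abs_ge_self])

lemma continuous_on_integral_truncated:
 assumes \<eta>: "\<eta> > 0" shows "continuous_on T (\<lambda>c. \<integral>z. truncated \<eta> c z \<partial>lborel)"
 unfolding continuous_on_sequentially comp_def
proof (intro allI ballI impI, elim conjE)
 fix x a assume a_in: "a \<in> T" and x_seq: "\<forall>n. x n \<in> T" "x \<longlonglongrightarrow> a"
 show "(\<lambda>n. \<integral>z. truncated \<eta> (x n) z \<partial>lborel) \<longlonglongrightarrow> (\<integral>z. truncated \<eta> a z \<partial>lborel)"
 proof (rule integral_dominated_convergence[OF _ _ integrable_bound_truncated[of \<eta>]])
  have "(\<lambda>n. truncated \<eta> (x n) z) \<longlonglongrightarrow> truncated \<eta> a z" for z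
  proof (cases "z \<in> S")
   case True
   have "(\<lambda>n. g z (x n)) \<longlonglongrightarrow> g z a"
    using continuous_on_g(2)[OF True] a_in x_seq unfolding continuous_on_sequentially comp_def by blast
   then show ?thesis unfolding truncated_def using \<eta> by (intro tendsto_intros) auto
  qed (simp add: truncated_def)
  then show "AE z in lborel. (\<lambda>n. truncated \<eta> (x n) z) \<longlonglongrightarrow> truncated \<eta> a z" by simp
 qed (use a_in x_seq borel_measurable_truncated norm_truncated_le[OF \<eta>] in auto)
qed

lemma truncated_le_negpow:
 assumes "\<eta> > 0" shows "ennreal (truncated \<eta> c z) \<le> negpow \<delta> (norm (g z c)) * indicator S z"
proof -
 have "negpow \<delta> (max (norm (g z c)) \<eta>) \<le> negpow \<delta> (norm (g z c))" using exponents by (intro negpow_antimono) auto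
 then show ?thesis using assms by (auto simp: truncated_def negpow_def indicator_def max_def split: if_splits)
qed

lemma negpow_le_truncated:
 assumes \<eta>: "\<eta> > 0"
 shows "negpow \<delta> (norm (g z c)) * indicator S z
  \<le> ennreal (truncated \<eta> c z) + ennreal (\<eta> powr (\<delta>' - \<delta>)) * (negpow \<delta>' (norm (g z c)) * indicator S z)"
proof (cases "norm (g z c) < \<eta>")
 case True
 then have "negpow \<delta> (norm (g z c)) \<le> ennreal (\<eta> powr (\<delta>' - \<delta>)) * negpow \<delta>' (norm (g z c))"
  using \<eta> exponents by (intro negpow_le_powr_mult_negpow) auto
 then have "negpow \<delta> (norm (g z c)) * indicator S z \<le> ennreal (\<eta> powr (\<delta>' - \<delta>)) * (negpow \<delta>' (norm (g z c)) * indicator S z)"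
  by (simp add: mult.assoc[symmetric] mult_right_mono)
 then show ?thesis by (rule add_increasing[OF zero_le])
next
 case False
 then have "negpow \<delta> (norm (g z c)) * indicator S z = ennreal (truncated \<eta> c z)"
  using \<eta> by (auto simp: truncated_def negpow_def max_def indicator_def)
 then show ?thesis by (simp add: add_increasing2)
qed

lemma integral_truncated_le_negpow_integral:
 assumes c_in: "c \<in> T" and \<eta>: "\<eta> > 0"
 shows "ennreal (\<integral>z. truncated \<eta> c z \<partial>lborel) \<le> negpow_integral \<delta> S (\<lambda>z. g z c)"
  and "negpow_integral \<delta> S (\<lambda>z. g z c) \<le> ennreal ((\<integral>z. truncated \<eta> c z \<partial>lborel) + \<eta> powr (\<delta>' - \<delta>) * C)"
proof -
 let ?g = "\<lambda>z. if z \<in> S then g z c else 0"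
 have nonneg: "truncated \<eta> c z \<ge> 0" for z by (simp add: truncated_def)
 have nn_integral_eq: "(\<integral>\<^sup>+z. ennreal (truncated \<eta> c z) \<partial>lborel) = ennreal (\<integral>z. truncated \<eta> c z \<partial>lborel)"
  by (rule nn_integral_eq_integral[OF integrable_truncated[OF c_in \<eta>]]) (simp add: nonneg)
 show "ennreal (\<integral>z. truncated \<eta> c z \<partial>lborel) \<le> negpow_integral \<delta> S (\<lambda>z. g z c)"
  unfolding nn_integral_eq[symmetric] negpow_integral_def by (intro nn_integral_mono truncated_le_negpow \<eta>)
 note [measurable] = borel_measurable_extended_g[OF c_in] borel_measurable_truncated[OF c_in] S_sets
 have "negpow \<delta>' (norm (g z c)) * indicator S z = negpow \<delta>' (norm (?g z)) * indicator S z" for z by (simp add: indicator_def)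
 then have "negpow_integral \<delta> S (\<lambda>z. g z c)
   \<le> (\<integral>\<^sup>+z. ennreal (truncated \<eta> c z) + ennreal (\<eta> powr (\<delta>' - \<delta>)) * (negpow \<delta>' (norm (?g z)) * indicator S z) \<partial>lborel)"
  unfolding negpow_integral_def using negpow_le_truncated[OF \<eta>, of _ c] by (intro nn_integral_mono) simp
 also have "\<dots> = ennreal (\<integral>z. truncated \<eta> c z \<partial>lborel) + ennreal (\<eta> powr (\<delta>' - \<delta>)) * negpow_integral \<delta>' S ?g"
  unfolding negpow_integral_def by (subst nn_integral_add) (auto simp: nn_integral_cmult nn_integral_eq)
 also have "negpow_integral \<delta>' S ?g = negpow_integral \<delta>' S (\<lambda>z. g z c)" by (rule negpow_integral_cong) simp
 also have "ennreal (\<integral>z. truncated \<eta> c z \<partial>lborel) + ennreal (\<eta> powr (\<delta>' - \<delta>)) * \<dots>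
   \<le> ennreal (\<integral>z. truncated \<eta> c z \<partial>lborel) + ennreal (\<eta> powr (\<delta>' - \<delta>)) * ennreal C"
  by (intro add_left_mono mult_left_mono bounded c_in) auto
 also have "\<dots> = ennreal ((\<integral>z. truncated \<eta> c z \<partial>lborel) + \<eta> powr (\<delta>' - \<delta>) * C)"
  using C_nonneg nonneg by (simp add: ennreal_mult ennreal_plus)
 finally show "negpow_integral \<delta> S (\<lambda>z. g z c) \<le> ennreal ((\<integral>z. truncated \<eta> c z \<partial>lborel) + \<eta> powr (\<delta>' - \<delta>) * C)" .
qed

lemma negpow_integral_finite: "c \<in> T \<Longrightarrow> negpow_integral \<delta> S (\<lambda>z. g z c) < \<infinity>"
 using integral_truncated_le_negpow_integral(2)[OF _ zero_less_one] by (rule le_less_trans) simp_all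

lemma uniform_limit_integral_truncated:
 "uniform_limit T (\<lambda>\<eta> c. \<integral>z. truncated \<eta> c z \<partial>lborel) (\<lambda>c. enn2real (negpow_integral \<delta> S (\<lambda>z. g z c))) (at_right 0)"
proof (rule uniform_limitI)
 fix \<epsilon> :: real assume \<epsilon>: "\<epsilon> > 0"
 have "((\<lambda>\<eta>. \<eta> powr (\<delta>' - \<delta>) * C) \<longlongrightarrow> 0 powr (\<delta>' - \<delta>) * C) (at_right 0)"
  using exponents by (intro tendsto_mult tendsto_const tendsto_powr' tendsto_ident_at) (auto simp: eventually_at_right_less less_imp_le eventually_mono[OF eventually_at_right_less])
 then have "\<forall>\<^sub>F \<eta> in at_right 0. \<eta> powr (\<delta>' - \<delta>) * C < \<epsilon>" using \<epsilon> by (intro order_tendstoD(2)) auto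
 then show "\<forall>\<^sub>F \<eta> in at_right 0. \<forall>c\<in>T. dist (\<integral>z. truncated \<eta> c z \<partial>lborel) (enn2real (negpow_integral \<delta> S (\<lambda>z. g z c))) < \<epsilon>"
  using eventually_at_right_less
 proof (eventually_elim, intro ballI)
  fix \<eta> :: real and c assume small: "\<eta> powr (\<delta>' - \<delta>) * C < \<epsilon>" and \<eta>: "0 < \<eta>" and c_in: "c \<in> T"
  define I J where "I = (\<integral>z. truncated \<eta> c z \<partial>lborel)" and "J = enn2real (negpow_integral \<delta> S (\<lambda>z. g z c))"
  have "negpow_integral \<delta> S (\<lambda>z. g z c) = ennreal J" using negpow_integral_finite[OF c_in] by (simp add: J_def)
  moreover have "0 \<le> I" "0 \<le> J" "0 \<le> \<eta> powr (\<delta>' - \<delta>) * C" using C_nonneg by (auto simp: I_def J_def truncated_def)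
  ultimately have "I \<le> J" "J \<le> I + \<eta> powr (\<delta>' - \<delta>) * C"
   using integral_truncated_le_negpow_integral[OF c_in \<eta>] by (simp_all add: I_def[symmetric] ennreal_le_iff del: ennreal_plus)
  then show "dist (\<integral>z. truncated \<eta> c z \<partial>lborel) (enn2real (negpow_integral \<delta> S (\<lambda>z. g z c))) < \<epsilon>"
   using small unfolding I_def[symmetric] J_def[symmetric] by (simp add: dist_real_def)
 qed
qed

lemma continuous_on_negpow_integral: "continuous_on T (\<lambda>c. enn2real (negpow_integral \<delta> S (\<lambda>z. g z c)))"
proof (rule uniform_limit_theorem[OF _ uniform_limit_integral_truncated])
 show "\<forall>\<^sub>F \<eta> in at_right 0. continuous_on T (\<lambda>c. \<integral>z. truncated \<eta> c z \<partial>lborel)"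
  by (rule eventually_mono[OF eventually_at_right_less continuous_on_integral_truncated])
qed simp

end

lemma bounded_linear_axis: "bounded_linear (\<lambda>v::complex. axis k v :: complex^'n::finite)"
 unfolding linear_conv_bounded_linear[symmetric] by (rule linearI) (auto simp: vec_eq_iff axis_def)

lemma holomorphic_several_slice:
 fixes F :: "(complex^'n::finite) \<times> complex \<Rightarrow> complex"
 assumes F_hol: "holomorphic_several F (polydisk r \<times> ball 0 s)" and c_in: "c \<in> ball 0 s"
  and R0_le: "\<And>i. R0 \<le> r i" and z_in: "z \<in> pdisk 0 R0"
 shows "(\<lambda>t. F (vec_upd z k t, c)) holomorphic_on ball 0 R0"
 unfolding holomorphic_on_def field_differentiable_def
proof
 fix t :: complex assume t_in: "t \<in> ball 0 R0"
 have "norm (vec_upd z k t $ i) < r i" for i using z_in t_in R0_le[of i] by (auto simp: pdisk_def intro: less_le_trans)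
 then have "(vec_upd z k t, c) \<in> polydisk r \<times> ball 0 s" using c_in by (simp add: polydisk_def)
 then obtain L where L_cmul: "(F has_derivative L) (at (vec_upd z k t, c))" "\<And>a v. L (cmul a v) = a * L v"
  using F_hol unfolding holomorphic_several_def by blast
 have "((\<lambda>t. vec_upd z k 0 + axis k t) has_derivative (\<lambda>v. axis k v)) (at t)"
  by (auto intro!: derivative_eq_intros bounded_linear.has_derivative[OF bounded_linear_axis])
 moreover have "vec_upd z k 0 + axis k t = vec_upd z k t" for t by (auto simp: vec_eq_iff axis_def)
 ultimately have curve: "((\<lambda>t. (vec_upd z k t, c)) has_derivative (\<lambda>v. (axis k v, 0))) (at t)"
  by (intro has_derivative_Pair has_derivative_const) simp
 have "L (axis k v, 0) = L (axis k 1, 0) * v" for v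
 proof -
  have "(axis k v, 0) = cmul v (axis k 1, 0 :: complex)" by (auto simp: cmul_def vec_eq_iff axis_def)
  then show ?thesis using L_cmul(2)[of v "(axis k 1, 0)"] by (simp add: mult.commute)
 qed
 then have linear: "(\<lambda>v. L (axis k v, 0)) = (*) (L (axis k 1, 0))" by (rule ext)
 have "((\<lambda>t. F (vec_upd z k t, c)) has_field_derivative L (axis k 1, 0)) (at t)"
  using has_derivative_compose[OF curve L_cmul(1)] unfolding has_field_derivative_def linear .
 then show "\<exists>f'. ((\<lambda>t. F (vec_upd z k t, c)) has_field_derivative f') (at t within ball 0 R0)"
  by (intro exI) (rule has_field_derivative_at_within)
qed

lemma continuous_on_holomorphic_several:
 assumes "\<forall>j. holomorphic_several (\<lambda>p. G p $ j) D" shows "continuous_on D (G :: _ \<Rightarrow> complex^'j::finite)"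
proof -
 have "isCont (\<lambda>p. G p $ j) p" if p_in: "p \<in> D" for j p
 proof -
  obtain L where "((\<lambda>p. G p $ j) has_derivative L) (at p)"
   using assms p_in unfolding holomorphic_several_def by blast
  then show ?thesis by (rule has_derivative_continuous)
 qed
 then have "continuous_on D (\<lambda>p. \<chi> j. G p $ j)"
  by (intro continuous_on_vec_lambda continuous_at_imp_continuous_on) blast
 then show ?thesis by (simp add: vec_nth_inverse)
qed

lemma stable_on_continuous:
 fixes h :: "complex^'n::finite \<Rightarrow> complex^'j::finite"
 assumes R_bounds: "0 < R" "R < R0" and \<delta>: "\<delta> > 0" and cont: "continuous_on (pdisk 0 R0) h"
  and finite: "negpow_integral \<delta> (pdisk 0 R0) h < \<infinity>"
 shows "stable_on UNIV h R (R / 2) \<delta>"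
proof -
 define G where "G z = (if z \<in> pdisk 0 R then h z else 0)" for z
 have "continuous_on (pdisk 0 R) h" using R_bounds pdisk_mono[of R R0] by (intro continuous_on_subset[OF cont]) auto
 then have "G \<in> borel_measurable borel"
  unfolding G_def by (intro borel_measurable_continuous_on_if sets_pdisk continuous_on_const)
 moreover have "bounded (h ` cpdisk 0 R)"
  by (intro compact_imp_bounded compact_continuous_image continuous_on_subset[OF cont cpdisk_subset_pdisk[OF R_bounds(2)]] compact_cpdisk)
 then obtain M where "\<And>z. z \<in> cpdisk 0 R \<Longrightarrow> norm (h z) \<le> M" unfolding bounded_iff by blast
 then have "\<And>z. z \<in> pdisk 0 R \<Longrightarrow> norm (G z) \<le> M"
  using pdisk_subset_cpdisk[of 0 R] by (auto simp: G_def)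
 moreover have "negpow_integral \<delta> (pdisk 0 R) G < \<infinity>"
 proof -
  have "negpow_integral \<delta> (pdisk 0 R) G = negpow_integral \<delta> (pdisk 0 R) h"
   by (rule negpow_integral_cong) (simp add: G_def)
  also have "\<dots> \<le> negpow_integral \<delta> (pdisk 0 R0) h" using R_bounds by (intro negpow_integral_mono pdisk_mono) simp
  finally show ?thesis using finite by (rule le_less_trans)
 qed
 moreover have "depends_on UNIV G" by (auto simp: depends_on_def vec_eq_iff[symmetric])
 ultimately have "stable_on UNIV G R (R / 2) \<delta>" using R_bounds \<delta> by (intro stable_on_pdisk[where M = M]) auto
 then show ?thesis by (simp add: stable_on_def G_def cong: ball_cong)
qed

lemma ex_uniformly_close_slices:
 fixes g :: "complex^'n::finite \<Rightarrow> complex \<Rightarrow> complex^'j::finite"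
 assumes cont: "continuous_on (pdisk 0 R0 \<times> ball 0 s) (\<lambda>p. g (fst p) (snd p))" and R_less: "R < R0" and s_pos: "s > 0" and \<epsilon>: "\<epsilon> > 0"
 obtains s' where "0 < s'" "s' \<le> s" "\<And>c z. c \<in> ball 0 s' \<Longrightarrow> z \<in> cpdisk 0 R \<Longrightarrow> dist (g z c) (g z 0) < \<epsilon>"
proof -
 have "cpdisk 0 R \<times> cball 0 (s / 2) \<subseteq> (pdisk 0 R0 \<times> ball 0 s :: ((complex^'n) \<times> complex) set)"
  using cpdisk_subset_pdisk[OF R_less] s_pos by auto
 then have "uniformly_continuous_on (cpdisk 0 R \<times> cball 0 (s / 2)) (\<lambda>p. g (fst p) (snd p))"
  by (intro compact_uniformly_continuous continuous_on_subset[OF cont] compact_Times compact_cpdisk compact_cball)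
 then obtain d where d_pos: "d > 0" and close: "\<And>p q. p \<in> cpdisk 0 R \<times> cball 0 (s / 2) \<Longrightarrow> q \<in> cpdisk 0 R \<times> cball 0 (s / 2)
   \<Longrightarrow> dist q p < d \<Longrightarrow> dist (g (fst q) (snd q)) (g (fst p) (snd p)) < \<epsilon>"
  using \<epsilon> unfolding uniformly_continuous_on_def by meson
 have "dist (g z c) (g z 0) < \<epsilon>" if "c \<in> ball 0 (min d (s / 2))" "z \<in> cpdisk 0 R" for c z
  using close[of "(z, 0)" "(z, c)"] that s_pos by (simp add: dist_Pair_Pair dist_commute)
 then show thesis using that[of "min d (s / 2)"] d_pos s_pos by auto
qed

lemma negpow_integral_le_of_polynomial_bound:
 fixes G h :: "complex^'n::finite \<Rightarrow> complex^'j::finite"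
 assumes approx: "\<And>j. poly_approximable (cpdisk 0 R) (\<lambda>z. h z $ j)" and R_pos: "R > 0" and \<delta>: "\<delta> > 0"
  and close: "\<And>z. z \<in> cpdisk 0 R \<Longrightarrow> dist (h z) (G z) < \<epsilon> / 2"
  and bound: "\<And>p. polynomial_map UNIV p \<Longrightarrow> \<forall>z\<in>pdisk 0 R. norm (p z - G z) \<le> \<epsilon> \<Longrightarrow> negpow_integral \<delta> (pdisk 0 (R / 2)) p \<le> C"
 shows "negpow_integral \<delta> (pdisk 0 (R / 2)) h \<le> C"
proof -
 obtain p :: "nat \<Rightarrow> _" where p_poly: "\<And>m. polynomial_map UNIV (p m)" and lim: "uniform_limit (cpdisk 0 R) p h sequentially"
  using polynomial_map_uniform_limit[of "cpdisk 0 R" h, OF approx] by blast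
 show ?thesis
 proof (rule negpow_integral_le_of_tendsto)
  show "p m \<in> borel_measurable borel" for m by (rule borel_measurable_polynomial_map[OF p_poly])
  show "(\<lambda>m. norm (p m z)) \<longlonglongrightarrow> norm (h z)" if "z \<in> pdisk 0 (R / 2)" for z
  proof (intro tendsto_norm tendsto_uniform_limitI[OF lim])
   show "z \<in> cpdisk 0 R" using that R_pos pdisk_mono[of "R / 2" R "0 :: complex^'n"] pdisk_subset_cpdisk[of "0 :: complex^'n" R] by auto
  qed
  have "0 \<in> cpdisk 0 R" using R_pos by (simp add: cpdisk_def)
  then have "\<epsilon> / 2 > 0" using close[of 0] zero_le_dist le_less_trans by blast
  then have "\<forall>\<^sub>F m in sequentially. \<forall>z\<in>cpdisk 0 R. dist (p m z) (h z) < \<epsilon> / 2" by (rule uniform_limitD[OF lim])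
  then show "\<forall>\<^sub>F m in sequentially. negpow_integral \<delta> (pdisk 0 (R / 2)) (p m) \<le> C"
  proof eventually_elim
   case (elim m)
   have "dist (p m z) (G z) \<le> \<epsilon>" if "z \<in> pdisk 0 R" for z
   proof -
    have "z \<in> cpdisk 0 R" using that pdisk_subset_cpdisk by blast
    then have "dist (p m z) (h z) < \<epsilon> / 2" "dist (h z) (G z) < \<epsilon> / 2" using elim close by blast+
    then show ?thesis using dist_triangle[of "p m z" "G z" "h z"] by linarith
   qed
   then show ?case by (intro bound p_poly) (simp add: dist_norm)
  qed
 qed (use \<delta> in auto)
qed

lemma negpow_integral_bounded_nearby:
 fixes g :: "complex^'n::finite \<Rightarrow> complex \<Rightarrow> complex^'j::finite"
 assumes R_bounds: "0 < R" "R < R0" and s_pos: "s > 0" and \<delta>: "\<delta> > 0"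
  and cont: "continuous_on (pdisk 0 R0 \<times> ball 0 s) (\<lambda>p. g (fst p) (snd p))"
  and hol: "\<And>c z k j. c \<in> ball 0 s \<Longrightarrow> z \<in> pdisk 0 R0 \<Longrightarrow> (\<lambda>t. g (vec_upd z k t) c $ j) holomorphic_on ball 0 R0"
  and finite: "negpow_integral \<delta> (pdisk 0 R0) (\<lambda>z. g z 0) < \<infinity>"
 obtains s' \<delta>' C where "0 < s'" "s' \<le> s" "\<delta> < \<delta>'" "C < \<infinity>"
  "\<And>c. c \<in> ball 0 s' \<Longrightarrow> negpow_integral \<delta>' (pdisk 0 (R / 2)) (\<lambda>z. g z c) \<le> C"
proof -
 have g_cont: "continuous_on (pdisk 0 R0) (\<lambda>z. g z c)" if "c \<in> ball 0 s" for c
  by (rule continuous_on_Times_slice(1)[OF cont that])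
 have "stable_on UNIV (\<lambda>z. g z 0) R (R / 2) \<delta>" using s_pos by (intro stable_on_continuous[OF R_bounds \<delta> g_cont finite]) simp
 then obtain \<epsilon> \<delta>' C where \<epsilon>: "\<epsilon> > 0" and \<delta>': "\<delta>' > \<delta>" and C_finite: "C < \<infinity>"
  and stable: "\<And>p. polynomial_map UNIV p \<Longrightarrow> \<forall>z\<in>pdisk 0 R. norm (p z - g z 0) \<le> \<epsilon> \<Longrightarrow> negpow_integral \<delta>' (pdisk 0 (R / 2)) p \<le> C"
  unfolding stable_on_def by metis
 have "\<epsilon> / 2 > 0" using \<epsilon> by simp
 then obtain s' where s'_bounds: "0 < s'" "s' \<le> s" and close: "\<And>c z. c \<in> ball 0 s' \<Longrightarrow> z \<in> cpdisk 0 R \<Longrightarrow> dist (g z c) (g z 0) < \<epsilon> / 2"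
  using ex_uniformly_close_slices[OF cont R_bounds(2) s_pos] by blast
 have "negpow_integral \<delta>' (pdisk 0 (R / 2)) (\<lambda>z. g z c) \<le> C" if c_in: "c \<in> ball 0 s'" for c
 proof (rule negpow_integral_le_of_polynomial_bound[OF _ R_bounds(1) _ close[OF c_in] stable])
  have c_s: "c \<in> ball 0 s" using c_in s'_bounds by auto
  show "poly_approximable (cpdisk 0 R) (\<lambda>z. g z c $ j)" for j
   using g_cont[OF c_s] hol[OF c_s] R_bounds by (intro poly_approximable_holomorphic[of R0] continuous_intros)
 qed (use \<delta> \<delta>' in auto)
 then show thesis using that[OF s'_bounds \<delta>' C_finite] by blast
qed

theorem mainTheorem1:
  fixes g :: "complex^'n::finite \<Rightarrow> complex \<Rightarrow> complex^'j::finite"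
    and r :: "'n \<Rightarrow> real" and s :: real and \<delta> :: real
  assumes r_pos: "\<forall>i. r i > 0" and s_pos: "s > 0" and delta_pos: "\<delta> > 0"
    and holo: "\<forall>j. holomorphic_several (\<lambda>p. g (fst p) (snd p) $ j) (polydisk r \<times> ball 0 s)"
    and fin: "(\<integral>\<^sup>+ z \<in> polydisk r. negpow \<delta> (norm (g z 0)) \<partial>lborel) < \<infinity>"
  shows "\<exists>r' s'. (\<forall>i. 0 < r' i \<and> r' i \<le> r i) \<and> 0 < s' \<and> s' \<le> s \<and>
           (\<forall>c\<in>ball 0 s'. (\<integral>\<^sup>+ z \<in> polydisk r'. negpow \<delta> (norm (g z c)) \<partial>lborel) < \<infinity>) \<and>
           continuous_on (ball 0 s')
             (\<lambda>c. enn2real (\<integral>\<^sup>+ z \<in> polydisk r'. negpow \<delta> (norm (g z c)) \<partial>lborel))"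
proof -
 define R0 where "R0 = Min (range r)"
 have R0_bounds: "R0 > 0" "\<And>i. R0 \<le> r i" unfolding R0_def using r_pos by auto
 have sub: "pdisk 0 R0 \<subseteq> polydisk r" using R0_bounds(2) by (auto simp: pdisk_def polydisk_def intro: less_le_trans)
 have cont: "continuous_on (pdisk 0 R0 \<times> ball 0 s) (\<lambda>p. g (fst p) (snd p))"
  using sub by (intro continuous_on_subset[OF continuous_on_holomorphic_several[OF holo]]) auto
 have finite: "negpow_integral \<delta> (pdisk 0 R0) (\<lambda>z. g z 0) < \<infinity>"
  using negpow_integral_mono[OF sub] fin unfolding negpow_integral_def by (rule le_less_trans)
 have hol: "(\<lambda>t. g (vec_upd z k t) c $ j) holomorphic_on ball 0 R0" if "c \<in> ball 0 s" "z \<in> pdisk 0 R0" for c z k j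
  using holomorphic_several_slice[OF holo[rule_format, of j] that(1) R0_bounds(2) that(2), of k] by simp
 obtain s' \<delta>' C where s'_bounds: "0 < s'" "s' \<le> s" and \<delta>': "\<delta> < \<delta>'" and C_finite: "C < \<infinity>"
  and bound: "\<And>c. c \<in> ball 0 s' \<Longrightarrow> negpow_integral \<delta>' (pdisk 0 (R0 / 2 / 2)) (\<lambda>z. g z c) \<le> C"
  by (rule negpow_integral_bounded_nearby[of "R0 / 2", OF _ _ s_pos delta_pos cont hol finite]) (use R0_bounds(1) in auto)
 interpret bounded_family g "pdisk 0 (R0 / 4)" "ball 0 s'" \<delta> \<delta>' "enn2real C"
 proof
  show "continuous_on (pdisk 0 (R0 / 4) \<times> ball 0 s') (\<lambda>p. g (fst p) (snd p))"
   using s'_bounds R0_bounds(1) pdisk_mono[of "R0 / 4" R0] by (intro continuous_on_subset[OF cont]) auto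
 qed (use delta_pos \<delta>' C_finite bound emeasure_pdisk_finite in auto)
 have "(\<integral>\<^sup>+ z \<in> polydisk (\<lambda>_. R0 / 4). negpow \<delta> (norm (g z c)) \<partial>lborel) = negpow_integral \<delta> (pdisk 0 (R0 / 4)) (\<lambda>z. g z c)" for c
  by (simp add: negpow_integral_def polydisk_def pdisk_def)
 then show ?thesis
  using R0_bounds(1) order_trans[OF _ R0_bounds(2), of "R0 / 4"] s'_bounds negpow_integral_finite continuous_on_negpow_integral
  by (intro exI[of _ "\<lambda>_. R0 / 4"] exI[of _ s']) auto
qed

end
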